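(* Let $D=\sum_{i=1}^n\beta_ip_i$ be a divisor on $S^2$ with $-1<\beta_1\le\cdots\le\beta_n\le0$, and suppose that $D$ is either critical with $n\ge3$, or supercritical. Set $\beta:=\min_i\beta_i$ and $\alpha:=|D|-\min_i\beta_i$, where $|D|=\sum_i\beta_i$. Then $$\mathrm{MinVol}(S^2,D)=2\pi\left(\alpha-\beta+\sqrt{2(1+\alpha)^2+2(1+\beta)^2}\right).$$
   Context: A metric $g$ on a closed Riemann surface has a conic singularity of order $\beta>-1$ at $p$ if, in a local holomorphic coordinate $z$ centered at $p$, $g=e^{2u}|z|^{2\beta}|dz|^2$ with $u$ continuous and $C^2$ away from $p$. A metric represents the divisor $D=\sum\beta_ip_i$ if it has conic singularities of order $\beta_i$ at $p_i$ and is smooth elsewhere. $D$ is critical if $|D|=2\min_i\beta_i$ and supercritical if $|D|>2\min_i\beta_i$. The minimal volume of $(M,D)$ is $$\mathrm{MinVol}(M,D)=\inf\{\mathrm{Vol}(M,g)\ :\ g\text{ represents }D\text{ with }|K_g|\le1\},$$ where $K_g$ is the Gaussian curvature away from the conic points and $\mathrm{Vol}$ is the total area. *)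

theory Defs
  imports "HOL-Complex_Analysis.Complex_Analysis"
begin

text \<open>Meant for open \<open>S\<close>: all partial derivatives up to order \<open>k\<close> exist and are continuous on \<open>S\<close>.\<close>

fun Ck_on :: "nat \<Rightarrow> 'a::euclidean_space set \<Rightarrow> ('a \<Rightarrow> real) \<Rightarrow> bool" where
  "Ck_on 0 S f \<longleftrightarrow> continuous_on S f"
| "Ck_on (Suc k) S f \<longleftrightarrow>
     (\<forall>x\<in>S. f differentiable (at x)) \<and>
     (\<forall>b\<in>Basis. Ck_on k S (\<lambda>x. frechet_derivative f (at x) b))"

definition smooth_on :: "'a::euclidean_space set \<Rightarrow> ('a \<Rightarrow> real) \<Rightarrow> bool" where
  "smooth_on S f \<longleftrightarrow> (\<forall>k. Ck_on k S f)"

definition laplacian :: "('a::euclidean_space \<Rightarrow> real) \<Rightarrow> 'a \<Rightarrow> real" where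
  "laplacian f x =
     (\<Sum>b\<in>Basis. frechet_derivative (\<lambda>y. frechet_derivative f (at y) b) (at x) b)"

text \<open>
  The Riemann surface \<open>S\<^sup>2\<close> is the Riemann sphere, with its complex structure given by the two
  affine charts, here written as parametrizations \<open>z \<mapsto> z\<close> and \<open>w \<mapsto> 1 / w\<close>.
\<close>

datatype rsphere = Fin complex | Infty

definition chart_infty :: "complex \<Rightarrow> rsphere" where
  "chart_infty w = (if w = 0 then Infty else Fin (1 / w))"

definition affine_charts :: "(complex \<Rightarrow> rsphere) set" where
  "affine_charts = {Fin, chart_infty}"

text \<open>
  Metrics on a Riemann surface are conformal. On the Riemann sphere, every conformal metric
  (with singularities) is \<open>G \<cdot> g\<^sub>0\<close> for a unique function \<open>G\<close>, positive off the singular points, where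
  \<open>g\<^sub>0\<close> is the round metric. In each of the two affine charts \<open>g\<^sub>0\<close> is
  \<open>4 |dz|\<^sup>2 / (1 + |z|\<^sup>2)\<^sup>2\<close>. The function \<open>G\<close> encodes the metric; its values at singular points are
  irrelevant. \<open>metric_coeff G \<phi> z\<close> is the coefficient of \<open>|dz|\<^sup>2\<close> in the affine chart \<open>\<phi>\<close>.
\<close>

type_synonym conformal_metric = "rsphere \<Rightarrow> real"

definition metric_coeff ::
    "conformal_metric \<Rightarrow> (complex \<Rightarrow> rsphere) \<Rightarrow> complex \<Rightarrow> real" where
  "metric_coeff G \<phi> z = G (\<phi> z) * 4 / (1 + (cmod z)\<^sup>2)\<^sup>2"

definition smooth_metric_off :: "rsphere set \<Rightarrow> conformal_metric \<Rightarrow> bool" where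
  "smooth_metric_off P G \<longleftrightarrow>
     (\<forall>q. q \<notin> P \<longrightarrow> G q > 0) \<and>
     (\<forall>\<phi>\<in>affine_charts. smooth_on {z. \<phi> z \<notin> P} (metric_coeff G \<phi>))"

text \<open>
  A local holomorphic coordinate \<open>z\<close> centred at \<open>p\<close> is given by its inverse \<open>\<phi> \<circ> h\<close>, where \<open>\<phi>\<close> is
  an affine chart and \<open>h\<close> is holomorphic and injective on a disc about \<open>0\<close> with \<open>\<phi> (h 0) = p\<close>.
  In that coordinate the metric is \<open>metric_coeff G \<phi> (h z) |h' z|\<^sup>2 |dz|\<^sup>2\<close>.
\<close>

definition conic_singularity :: "conformal_metric \<Rightarrow> rsphere \<Rightarrow> real \<Rightarrow> bool" where
  "conic_singularity G p b \<longleftrightarrow>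
     b > -1 \<and>
     (\<exists>\<phi>\<in>affine_charts. \<exists>h r u.
        r > 0 \<and> h holomorphic_on ball 0 r \<and> inj_on h (ball 0 r) \<and> \<phi> (h 0) = p \<and>
        continuous_on (ball 0 r) u \<and> Ck_on 2 (ball 0 r - {0}) u \<and>
        (\<forall>z\<in>ball 0 r - {0}.
           metric_coeff G \<phi> (h z) * (cmod (deriv h z))\<^sup>2
             = exp (2 * u z) * cmod z powr (2 * b)))"

text \<open>
  A divisor \<open>\<Sum>i=1..n. \<beta>\<^sub>i p\<^sub>i\<close> is given by \<open>n\<close> and the functions \<open>p\<close> and \<open>\<beta>\<close> on \<open>{1..n}\<close>.
\<close>

definition div_degree :: "nat \<Rightarrow> (nat \<Rightarrow> real) \<Rightarrow> real" where
  "div_degree n \<beta> = (\<Sum>i=1..n. \<beta> i)"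

definition min_order :: "nat \<Rightarrow> (nat \<Rightarrow> real) \<Rightarrow> real" where
  "min_order n \<beta> = Min (\<beta> ` {1..n})"

definition critical :: "nat \<Rightarrow> (nat \<Rightarrow> real) \<Rightarrow> bool" where
  "critical n \<beta> \<longleftrightarrow> div_degree n \<beta> = 2 * min_order n \<beta>"

definition supercritical :: "nat \<Rightarrow> (nat \<Rightarrow> real) \<Rightarrow> bool" where
  "supercritical n \<beta> \<longleftrightarrow> div_degree n \<beta> > 2 * min_order n \<beta>"

definition represents ::
    "conformal_metric \<Rightarrow> nat \<Rightarrow> (nat \<Rightarrow> rsphere) \<Rightarrow> (nat \<Rightarrow> real) \<Rightarrow> bool" where
  "represents G n p \<beta> \<longleftrightarrow>
     smooth_metric_off (p ` {1..n}) G \<and> (\<forall>i\<in>{1..n}. conic_singularity G (p i) (\<beta> i))"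

text \<open>The metric \<open>\<rho> |dz|\<^sup>2 = e\<^sup>2\<^sup>v |dz|\<^sup>2\<close> has Gaussian curvature \<open>- e\<^sup>-\<^sup>2\<^sup>v \<Delta>v\<close> with \<open>v = ln \<rho> / 2\<close>.\<close>

definition planar_curvature :: "(complex \<Rightarrow> real) \<Rightarrow> complex \<Rightarrow> real" where
  "planar_curvature \<rho> z = - laplacian (\<lambda>w. ln (\<rho> w) / 2) z / \<rho> z"

fun gauss_curvature :: "conformal_metric \<Rightarrow> rsphere \<Rightarrow> real" where
  "gauss_curvature G (Fin z) = planar_curvature (metric_coeff G Fin) z"
| "gauss_curvature G Infty = planar_curvature (metric_coeff G chart_infty) 0"

text \<open>The chart \<open>Fin\<close> misses only the point \<open>Infty\<close>, which carries no area.\<close>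

definition metric_area :: "conformal_metric \<Rightarrow> ennreal" where
  "metric_area G = (\<integral>\<^sup>+z. ennreal (metric_coeff G Fin z) \<partial>lborel)"

definition MinVol :: "nat \<Rightarrow> (nat \<Rightarrow> rsphere) \<Rightarrow> (nat \<Rightarrow> real) \<Rightarrow> ennreal" where
  "MinVol n p \<beta> =
     Inf {metric_area G | G.
            represents G n p \<beta> \<and> (\<forall>q. q \<notin> p ` {1..n} \<longrightarrow> \<bar>gauss_curvature G q\<bar> \<le> 1)}"

end

theory Submission
  imports Defs "HOL-Real_Asymp.Real_Asymp"
begin

text \<open>
  A Moebius transformation moves the point of least order \<open>\<beta>\<close> to \<open>\<infinity>\<close>, where the metric becomes
  \<open>\<rho> |dz|\<^sup>2\<close> on the plane.
  For the lower bound, let \<open>u = ln \<rho> / 2\<close> and let \<open>a(s)\<close> be the area of the metric on \<open>{u > s}\<close>. Coarea and the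
  planar isoperimetric inequality bound \<open>- a'(s)\<close> from below by means of the total curvature of \<open>{u > s}\<close>, which
  by \<open>|K| \<le> 1\<close> and Gauss-Bonnet is at most \<open>min (a(s)) (2\<pi>(2 + \<alpha> + \<beta>) + A - a(s))\<close>, \<open>A\<close> being the total area.
  Integration in \<open>s\<close> gives a quadratic inequality for \<open>A\<close>. Smooth cutoffs of \<open>u\<close> and the sharp Sobolev
  inequality replace level sets and isoperimetry throughout.
  For the upper bound, \<open>\<rho>\<close> is \<open>e\<^sup>2\<^sup>V\<close> times \<open>\<Prod> |z - z\<^sub>i|\<close> to the powers \<open>2 \<beta>\<^sub>i\<close>, where \<open>V\<close> is radial and constant on
  a huge disc containing all \<open>z\<^sub>i\<close>; its profile is that of a football with two cone points, glued from
  pieces of curvature \<open>1\<close> and \<open>-1\<close> and smoothed. By the weighted AM-GM inequality the area is nearly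
  that of the football, in which all finite cone points are merged into one of order \<open>\<alpha>\<close>.
\<close>

section \<open>Calculus of \<open>C\<^sup>k\<close> functions\<close>

text \<open>The two bounds meet because the lower bound names its own extremal. The minimum of the
  two curvature bounds switches at area (A + k) / 2, where k = 2\<pi>(2 + \<alpha> + \<beta>);
  equality therefore wants curvature 1 on the higher superlevel set, -1 on the rest, and round level
  sets. This is a football whose area is the larger root of the quadratic. (Super)criticality means
  \<alpha> \<ge> \<beta> and puts the cone of order \<beta> on the side of curvature -1. The
  football is only C^(1,1) and has a single finite cone point, so it must be approximated with |K|
  \<le> 1 kept near the separate points. Flatness achieves this: where V is constant the potential
  is a sum of harmonic logarithms, so curvature lives only outside a disc so large that the points
  look merged. The remaining error is absorbed by a constant factor close to 1 on the metric. In the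
  lower bound the obstacle is the cone points, where the gradient of u is not controlled. All tests
  use logarithmic cutoffs: in the limit their gradients and the bounded remainders of u contribute
  nothing, and the logarithms contribute 2\<pi> times the orders.\<close>

lemma Ck_on_imp_continuous_on: "Ck_on k S f \<Longrightarrow> continuous_on S f"
proof (cases k)
  case (Suc m)
  assume "Ck_on k S f"
  then show ?thesis
    unfolding Suc by (auto intro!: continuous_at_imp_continuous_on differentiable_imp_continuous_within)
qed simp

lemma Ck_on_SucD: "Ck_on (Suc k) S f \<Longrightarrow> Ck_on k S f"
proof (induction k arbitrary: f)
  case 0
  then show ?case using Ck_on_imp_continuous_on[OF 0] by (simp only: Ck_on.simps(1))
next
  case (Suc k)
  then show ?case by (subst Ck_on.simps(2), subst (asm) (2) Ck_on.simps(2)) blast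
qed

lemma Ck_on_subset: "Ck_on k S f \<Longrightarrow> T \<subseteq> S \<Longrightarrow> Ck_on k T f"
  by (induction k arbitrary: f) (auto intro: continuous_on_subset)

lemma Ck_on_cong:
  assumes "open S" "\<And>x. x \<in> S \<Longrightarrow> f x = g x" "Ck_on k S f"
  shows "Ck_on k S g"
  using assms(2,3)
proof (induction k arbitrary: f g)
  case 0
  then show ?case by (simp cong: continuous_on_cong)
next
  case (Suc k)
  have D: "(g has_derivative frechet_derivative f (at x)) (at x)" if "x \<in> S" for x
  proof (rule has_derivative_transform_within_open[OF _ \<open>open S\<close> that])
    show "(f has_derivative frechet_derivative f (at x)) (at x)"
      using Suc.prems(2) that frechet_derivative_works by fastforce
  qed (use Suc.prems(1) in auto)
  have eq: "frechet_derivative g (at x) = frechet_derivative f (at x)" if "x \<in> S" for x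
    using frechet_derivative_at[OF D[OF that]] by simp
  have "Ck_on k S (\<lambda>x. frechet_derivative g (at x) b)" if "b \<in> Basis" for b
    by (rule Suc.IH[where f="\<lambda>x. frechet_derivative f (at x) b"]) (use eq Suc.prems that in auto)
  moreover have "\<forall>x\<in>S. g differentiable (at x)" using D unfolding differentiable_def by blast
  ultimately show ?case by simp
qed

lemma Ck_on_localI:
  assumes "\<And>x. x \<in> S \<Longrightarrow> \<exists>U. open U \<and> x \<in> U \<and> Ck_on k U f"
  shows "Ck_on k S f"
  using assms
proof (induction k arbitrary: f)
  case 0
  show ?case unfolding Ck_on.simps
  proof (rule continuous_at_imp_continuous_on, rule ballI)
    fix x assume "x \<in> S"
    then obtain U where "open U" "x \<in> U" "continuous_on U f" using 0 by (meson Ck_on.simps(1))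
    then show "isCont f x" by (simp add: continuous_on_eq_continuous_at)
  qed
next
  case (Suc k)
  have "f differentiable (at x)" if x: "x \<in> S" for x
    using Suc.prems[OF that] by (meson Ck_on.simps(2))
  moreover have "Ck_on k S (\<lambda>x. frechet_derivative f (at x) b)" if b: "b \<in> Basis" for b
  proof (rule Suc.IH)
    fix x assume "x \<in> S"
    from Suc.prems[OF this] obtain U where "open U" "x \<in> U" "Ck_on (Suc k) U f" by blast
    with b show "\<exists>U. open U \<and> x \<in> U \<and> Ck_on k U (\<lambda>x. frechet_derivative f (at x) b)"
      unfolding Ck_on.simps(2) by blast
  qed
  ultimately show ?case by simp
qed

text \<open>Uniqueness of derivatives on an open set lets any explicit derivative stand in for the
  choice operator behind \<open>frechet_derivative\<close>. The closure rules below rest on this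
  rule and its converse \<open>Ck_on_SucE\<close>.\<close>

lemma Ck_on_SucI:
  assumes "open S" "\<And>x. x \<in> S \<Longrightarrow> (f has_derivative f' x) (at x)"
    and "\<And>b. b \<in> Basis \<Longrightarrow> Ck_on k S (\<lambda>x. f' x b)"
  shows "Ck_on (Suc k) S f"
proof -
  have eq: "f' x b = frechet_derivative f (at x) b" if "x \<in> S" for x b
    using frechet_derivative_at[OF assms(2)[OF that]] by simp
  have "Ck_on k S (\<lambda>x. frechet_derivative f (at x) b)" if "b \<in> Basis" for b
    by (rule Ck_on_cong[OF \<open>open S\<close> eq assms(3)[OF that]])
  moreover have "\<forall>x\<in>S. f differentiable (at x)" using assms(2) unfolding differentiable_def by blast
  ultimately show ?thesis by simp
qed

lemma Ck_on_SucE: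
  assumes "Ck_on (Suc k) S f"
  obtains f' where "\<And>x. x \<in> S \<Longrightarrow> (f has_derivative f' x) (at x)"
    "\<And>b. b \<in> Basis \<Longrightarrow> Ck_on k S (\<lambda>x. f' x b)"
proof (rule that[of "\<lambda>x. frechet_derivative f (at x)"])
  show "(f has_derivative frechet_derivative f (at x)) (at x)" if "x \<in> S" for x
    using assms that by (simp add: frechet_derivative_works[symmetric])
  show "Ck_on k S (\<lambda>x. frechet_derivative f (at x) b)" if "b \<in> Basis" for b
    using assms that by simp
qed

lemma Ck_on_const [simp]: "Ck_on k S (\<lambda>_. c)"
proof (induction k arbitrary: c)
  case (Suc k)
  have "frechet_derivative (\<lambda>_. c) (at x) = (\<lambda>_. 0)" for x :: 'a
    by (simp add: frechet_derivative_const)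
  then show ?case using Suc by simp
qed simp

lemma Ck_on_add:
  assumes "open S" "Ck_on k S f" "Ck_on k S g"
  shows "Ck_on k S (\<lambda>x. f x + g x)"
  using assms(2,3)
proof (induction k arbitrary: f g)
  case (Suc k)
  from Ck_on_SucE[OF Suc.prems(1)] obtain f' where f': "\<And>x. x \<in> S \<Longrightarrow> (f has_derivative f' x) (at x)"
    "\<And>b. b \<in> Basis \<Longrightarrow> Ck_on k S (\<lambda>x. f' x b)" by metis
  from Ck_on_SucE[OF Suc.prems(2)] obtain g' where g': "\<And>x. x \<in> S \<Longrightarrow> (g has_derivative g' x) (at x)"
    "\<And>b. b \<in> Basis \<Longrightarrow> Ck_on k S (\<lambda>x. g' x b)" by metis
  show ?case
    by (rule Ck_on_SucI[OF \<open>open S\<close> has_derivative_add[OF f'(1) g'(1)]]; (assumption | intro Suc.IH f'(2) g'(2))?)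
qed (auto intro: continuous_intros)

lemma Ck_on_mult:
  assumes "open S" "Ck_on k S f" "Ck_on k S g"
  shows "Ck_on k S (\<lambda>x. f x * g x)"
  using assms(2,3)
proof (induction k arbitrary: f g)
  case (Suc k)
  from Ck_on_SucE[OF Suc.prems(1)] obtain f' where f': "\<And>x. x \<in> S \<Longrightarrow> (f has_derivative f' x) (at x)"
    "\<And>b. b \<in> Basis \<Longrightarrow> Ck_on k S (\<lambda>x. f' x b)" by metis
  from Ck_on_SucE[OF Suc.prems(2)] obtain g' where g': "\<And>x. x \<in> S \<Longrightarrow> (g has_derivative g' x) (at x)"
    "\<And>b. b \<in> Basis \<Longrightarrow> Ck_on k S (\<lambda>x. g' x b)" by metis
  show ?case
    by (rule Ck_on_SucI[OF \<open>open S\<close> has_derivative_mult[OF f'(1) g'(1)]];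
       (assumption | intro Suc.IH f'(2) g'(2) Ck_on_add[OF \<open>open S\<close>] Ck_on_SucD[OF Suc.prems(1)] Ck_on_SucD[OF Suc.prems(2)])?)
qed (auto intro: continuous_intros)

lemma Ck_on_minus: "open S \<Longrightarrow> Ck_on k S f \<Longrightarrow> Ck_on k S (\<lambda>x. - f x)"
  using Ck_on_mult[of S k "\<lambda>_. -1" f] by simp

lemma Ck_on_diff: "open S \<Longrightarrow> Ck_on k S f \<Longrightarrow> Ck_on k S g \<Longrightarrow> Ck_on k S (\<lambda>x. f x - g x)"
  using Ck_on_add[of S k f "\<lambda>x. - g x"] Ck_on_minus[of S k g] by simp

lemma Ck_on_sum:
  "open S \<Longrightarrow> (\<And>i. i \<in> I \<Longrightarrow> Ck_on k S (f i)) \<Longrightarrow> Ck_on k S (\<lambda>x. \<Sum>i\<in>I. f i x)"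
proof (induction I rule: infinite_finite_induct)
  case (insert i F)
  then show ?case using Ck_on_add[OF \<open>open S\<close>, of k "f i" "\<lambda>x. \<Sum>i\<in>F. f i x"] by auto
qed auto

text \<open>Induction on \<open>k\<close> with \<open>F\<close> generalized: the derivative of the
  composite is a product of \<open>f'\<close> with \<open>F'\<close> after the same
  \<open>f\<close>, so \<open>f\<close> stays fixed and merely loses one order.\<close>

lemma Ck_on_compose:
  fixes F :: "real \<Rightarrow> real"
  assumes "open S" "Ck_on k S f" "Ck_on k T F" "f ` S \<subseteq> T"
  shows "Ck_on k S (\<lambda>x. F (f x))"
  using assms(2,3)
proof (induction k arbitrary: F)
  case 0
  then show ?case using assms(4) continuous_on_compose2[of T F S f] by simp
next
  case (Suc k)
  from Ck_on_SucE[OF Suc.prems(1)] obtain f' where f': "\<And>x. x \<in> S \<Longrightarrow> (f has_derivative f' x) (at x)"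
    "\<And>b. b \<in> Basis \<Longrightarrow> Ck_on k S (\<lambda>x. f' x b)" by metis
  from Ck_on_SucE[OF Suc.prems(2)] obtain F' where F': "\<And>x. x \<in> T \<Longrightarrow> (F has_derivative F' x) (at x)"
    "\<And>b. b \<in> Basis \<Longrightarrow> Ck_on k T (\<lambda>x. F' x b)" by metis
  have lin: "F' y h = h * F' y 1" if "y \<in> T" for y h
  proof -
    have "linear (F' y)" using F'(1)[OF that] has_derivative_linear by blast
    from linear_scale[OF this, of h 1] show ?thesis by simp
  qed
  have D: "((\<lambda>x. F (f x)) has_derivative (\<lambda>h. f' x h * F' (f x) 1)) (at x)" if "x \<in> S" for x
  proof -
    have "f x \<in> T" using that assms(4) by auto
    then have "F' (f x) = (\<lambda>h. h * F' (f x) 1)" using lin by blast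
    with F'(1)[OF \<open>f x \<in> T\<close>] have "(F has_derivative (\<lambda>h. h * F' (f x) 1)) (at (f x))" by metis
    from has_derivative_compose[OF f'(1)[OF that] this] show ?thesis .
  qed
  have *: "Ck_on k S (\<lambda>x. F' (f x) 1)" by (rule Suc.IH[OF Ck_on_SucD[OF Suc.prems(1)] F'(2)]) simp
  show ?case
    by (rule Ck_on_SucI[OF \<open>open S\<close> D]) (simp_all add: Ck_on_mult[OF \<open>open S\<close> f'(2) *])
qed

lemma Ck_on_real_SucI:
  fixes F :: "real \<Rightarrow> real"
  assumes "open T" "\<And>x. x \<in> T \<Longrightarrow> (F has_real_derivative F' x) (at x)" "Ck_on k T F'"
  shows "Ck_on (Suc k) T F"
  by (rule Ck_on_SucI[OF \<open>open T\<close> assms(2)[THEN has_field_derivative_imp_has_derivative]])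
     (use assms(3) in \<open>auto simp: mult.commute\<close>)

lemma Ck_on_id: "Ck_on k UNIV (\<lambda>x::real. x)"
proof (cases k)
  case (Suc j)
  show ?thesis unfolding Suc
    by (rule Ck_on_real_SucI[OF open_UNIV DERIV_ident Ck_on_const])
qed simp

lemma Ck_on_exp: "Ck_on k UNIV (exp :: real \<Rightarrow> real)"
proof (induction k)
  case (Suc k)
  show ?case by (rule Ck_on_real_SucI[OF open_UNIV DERIV_exp Suc])
qed (auto intro!: continuous_intros)

lemma Ck_on_inverse: "Ck_on k (-{0}) (inverse :: real \<Rightarrow> real)"
proof (induction k)
  case (Suc k)
  show ?case
  proof (rule Ck_on_real_SucI)
    show "Ck_on k (-{0}) (\<lambda>x::real. - (inverse x * inverse x))"
      by (intro Ck_on_minus Ck_on_mult Suc open_Compl closed_singleton)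
  qed (auto intro!: derivative_eq_intros)
qed (auto intro!: continuous_intros)

lemma Ck_on_ln: "Ck_on k {0<..} (ln :: real \<Rightarrow> real)"
proof (cases k)
  case (Suc k)
  show ?thesis unfolding Suc
  proof (rule Ck_on_real_SucI)
    show "Ck_on k {0<..} (inverse :: real \<Rightarrow> real)"
      by (rule Ck_on_subset[OF Ck_on_inverse]) auto
  qed (auto intro!: derivative_eq_intros simp: divide_simps)
qed (auto intro!: continuous_intros)

lemma Ck_on_exp': "open S \<Longrightarrow> Ck_on k S f \<Longrightarrow> Ck_on k S (\<lambda>x. exp (f x))"
  by (rule Ck_on_compose[OF _ _ Ck_on_exp]) auto

lemma Ck_on_ln': "open S \<Longrightarrow> Ck_on k S f \<Longrightarrow> (\<And>x. x \<in> S \<Longrightarrow> f x > 0) \<Longrightarrow> Ck_on k S (\<lambda>x. ln (f x))"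
  by (rule Ck_on_compose[OF _ _ Ck_on_ln]) auto

section \<open>Composition with holomorphic maps\<close>

lemma complex_linear_expand:
  fixes L :: "complex \<Rightarrow> real"
  assumes "linear L"
  shows "L w = Re w * L 1 + Im w * L \<i>"
proof -
  have "w = Re w *\<^sub>R 1 + Im w *\<^sub>R \<i>" by (simp add: complex_eq_iff)
  then have "L w = L (Re w *\<^sub>R 1 + Im w *\<^sub>R \<i>)" by simp
  also have "\<dots> = Re w * L 1 + Im w * L \<i>"
    by (simp add: linear_add[OF assms] linear_scale[OF assms])
  finally show ?thesis .
qed

lemma has_derivative_holomorphic:
  assumes "h holomorphic_on S" "open S" "z \<in> S"
  shows "(h has_derivative (\<lambda>b. deriv h z * b)) (at z)"
  using holomorphic_derivI[OF assms] has_field_derivative_imp_has_derivative by blast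

text \<open>Real and imaginary parts go through one induction, because differentiating in direction
  \<i> exchanges them up to sign.\<close>

lemma Ck_on_Re_Im_holomorphic:
  assumes "open S" "f holomorphic_on S"
  shows "Ck_on k S (\<lambda>z. Re (f z))" "Ck_on k S (\<lambda>z. Im (f z))"
proof -
  have "Ck_on k S (\<lambda>z. Re (f z)) \<and> Ck_on k S (\<lambda>z. Im (f z))"
    using assms(2)
  proof (induction k arbitrary: f)
    case 0
    then have "continuous_on S f" by (rule holomorphic_on_imp_continuous_on)
    then show ?case by (auto intro: continuous_on_Re continuous_on_Im)
  next
    case (Suc k)
    note IH = Suc.IH[OF holomorphic_deriv[OF Suc.prems \<open>open S\<close>]]
    note D = has_derivative_holomorphic[OF Suc.prems \<open>open S\<close>]
    have "Ck_on k S (\<lambda>z. Re (deriv f z * b)) \<and> Ck_on k S (\<lambda>z. Im (deriv f z * b))" if "b \<in> Basis" for b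
    proof -
      have "Re (w * \<i>) = - Im w" "Im (w * \<i>) = Re w" for w by simp_all
      with IH Ck_on_minus[OF \<open>open S\<close>, of k "\<lambda>z. Im (deriv f z)"] that show ?thesis
        unfolding Basis_complex_def insert_iff empty_iff by (elim disjE) (simp_all only: mult_1_right simp_thms)
    qed
    note * = conjunct1[OF this] conjunct2[OF this]
    show ?case
      by (rule conjI; (rule Ck_on_SucI[OF \<open>open S\<close> has_derivative_Re[OF D] *(1)]
          Ck_on_SucI[OF \<open>open S\<close> has_derivative_Im[OF D] *(2)]); assumption)
  qed
  then show "Ck_on k S (\<lambda>z. Re (f z))" "Ck_on k S (\<lambda>z. Im (f z))" by auto
qed

text \<open>The chain rule multiplies the partial derivatives of \<open>f\<close> by
  \<open>Re (deriv h z * b)\<close> and \<open>Im (deriv h z * b)\<close>, which are smooth of every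
  order; so the induction only consumes orders of \<open>f\<close>.\<close>

lemma Ck_on_compose_holomorphic:
  assumes "open U" "h holomorphic_on U" "Ck_on k S f" "h ` U \<subseteq> S"
  shows "Ck_on k U (\<lambda>z. f (h z))"
  using assms(3)
proof (induction k arbitrary: f)
  case 0
  then show ?case
    using assms(4) continuous_on_compose2[of S f U h] holomorphic_on_imp_continuous_on[OF assms(2)] by simp
next
  case (Suc k)
  from Ck_on_SucE[OF Suc.prems(1)] obtain f' where f': "\<And>x. x \<in> S \<Longrightarrow> (f has_derivative f' x) (at x)"
    "\<And>b. b \<in> Basis \<Longrightarrow> Ck_on k S (\<lambda>x. f' x b)" by metis
  have D: "((\<lambda>z. f (h z)) has_derivative
      (\<lambda>b. Re (deriv h z * b) * f' (h z) 1 + Im (deriv h z * b) * f' (h z) \<i>)) (at z)" if "z \<in> U" for z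
  proof -
    have "h z \<in> S" using that assms(4) by auto
    then have "linear (f' (h z))" using f'(1) has_derivative_linear by blast
    then have eq: "(\<lambda>b. f' (h z) (deriv h z * b)) =
        (\<lambda>b. Re (deriv h z * b) * f' (h z) 1 + Im (deriv h z * b) * f' (h z) \<i>)"
      by (intro ext complex_linear_expand)
    show ?thesis
      using has_derivative_compose[OF has_derivative_holomorphic[OF assms(2,1) that] f'(1)[OF \<open>h z \<in> S\<close>]]
      unfolding eq .
  qed
  have hb: "(\<lambda>z. deriv h z * b) holomorphic_on U" for b
    by (intro holomorphic_intros holomorphic_deriv[OF assms(2,1)])
  have *: "Ck_on k U (\<lambda>z. f' (h z) 1)" "Ck_on k U (\<lambda>z. f' (h z) \<i>)"
    by (rule Suc.IH, rule f'(2), simp add: Basis_complex_def)+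
  have **: "Ck_on k U (\<lambda>z. Re (deriv h z * b) * f' (h z) 1 + Im (deriv h z * b) * f' (h z) \<i>)" for b
    by (rule Ck_on_add[OF \<open>open U\<close> Ck_on_mult[OF \<open>open U\<close> _ *(1)] Ck_on_mult[OF \<open>open U\<close> _ *(2)]];
        rule Ck_on_Re_Im_holomorphic[OF \<open>open U\<close> hb])
  show ?case
    by (rule Ck_on_SucI[OF \<open>open U\<close> D]; (assumption | rule **)?)
qed

lemma Ck_on_cmod_power2:
  assumes "open S" "f holomorphic_on S"
  shows "Ck_on k S (\<lambda>z. (cmod (f z))\<^sup>2)"
  unfolding cmod_power2 unfolding power2_eq_square
  by (intro Ck_on_add Ck_on_mult Ck_on_Re_Im_holomorphic assms)

lemma Ck_on_ln_cmod:
  assumes "open S" "f holomorphic_on S" "\<And>z. z \<in> S \<Longrightarrow> f z \<noteq> 0"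
  shows "Ck_on k S (\<lambda>z. ln (cmod (f z)))"
proof (rule Ck_on_cong[OF assms(1)])
  \<comment> \<open>The modulus is a square root; half the logarithm of its square, a sum of two
    squares, falls under the closure rules.\<close>
  show "Ck_on k S (\<lambda>z. ln ((cmod (f z))\<^sup>2) * (1/2))"
    by (intro Ck_on_mult[OF \<open>open S\<close>] Ck_on_ln'[OF \<open>open S\<close>] Ck_on_cmod_power2 assms Ck_on_const) (use assms(3) in auto)
  show "ln ((cmod (f z))\<^sup>2) * (1/2) = ln (cmod (f z))" if "z \<in> S" for z
    using assms(3)[OF that] by (simp add: ln_realpow)
qed

section \<open>The Laplacian and conformal changes of variable\<close>

lemma laplacian_eqI:
  assumes "open S" "z \<in> S" "\<And>y. y \<in> S \<Longrightarrow> (f has_derivative f' y) (at y)"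
    and "\<And>b. b \<in> Basis \<Longrightarrow> ((\<lambda>y. f' y b) has_derivative f'' b) (at z)"
  shows "laplacian f z = (\<Sum>b\<in>Basis. f'' b b)"
  unfolding laplacian_def
proof (rule sum.cong)
  fix b :: 'a assume b: "b \<in> Basis"
  have "((\<lambda>y. frechet_derivative f (at y) b) has_derivative f'' b) (at z)"
  proof (rule has_derivative_transform_within_open[OF assms(4)[OF b] assms(1,2)])
    show "f' y b = frechet_derivative f (at y) b" if "y \<in> S" for y
      using frechet_derivative_at[OF assms(3)[OF that]] by simp
  qed
  then show "frechet_derivative (\<lambda>y. frechet_derivative f (at y) b) (at z) b = f'' b b"
    using frechet_derivative_at by metis
qed simp

lemma laplacian_cong:
  fixes f g :: "'a::euclidean_space \<Rightarrow> real"
  assumes "open S" "z \<in> S" "\<And>y. y \<in> S \<Longrightarrow> f y = g y"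
  shows "laplacian f z = laplacian g z"
proof -
  have fd: "frechet_derivative u (at y) = frechet_derivative v (at y)"
    if "y \<in> S" "\<And>y. y \<in> S \<Longrightarrow> u y = v y" for u v :: "'a \<Rightarrow> real" and y
  proof -
    have "(u has_derivative D) (at y) \<longleftrightarrow> (v has_derivative D) (at y)" for D
      using has_derivative_transform_within_open[OF _ assms(1) that(1), of u D UNIV v]
        has_derivative_transform_within_open[OF _ assms(1) that(1), of v D UNIV u] that(2) by metis
    then show ?thesis unfolding frechet_derivative_def by simp
  qed
  have "frechet_derivative (\<lambda>y. frechet_derivative f (at y) b) (at z) =
        frechet_derivative (\<lambda>y. frechet_derivative g (at y) b) (at z)" for b
    by (rule fd[OF assms(2)]) (use fd[OF _ assms(3)] in auto)
  then show ?thesis unfolding laplacian_def by simp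
qed

lemma Ck_on_2E:
  assumes "Ck_on 2 S f"
  obtains f' f'' where "\<And>x. x \<in> S \<Longrightarrow> (f has_derivative f' x) (at x)"
    "\<And>x b. x \<in> S \<Longrightarrow> b \<in> Basis \<Longrightarrow> ((\<lambda>x. f' x b) has_derivative f'' x b) (at x)"
    "\<And>b c. b \<in> Basis \<Longrightarrow> c \<in> Basis \<Longrightarrow> continuous_on S (\<lambda>x. f'' x b c)"
    "\<And>b. b \<in> Basis \<Longrightarrow> continuous_on S (\<lambda>x. f' x b)"
    "\<And>x. f' x = frechet_derivative f (at x)"
proof (rule that[of "\<lambda>x. frechet_derivative f (at x)"
      "\<lambda>x b. frechet_derivative (\<lambda>y. frechet_derivative f (at y) b) (at x)"])
  have *: "(\<forall>x\<in>S. f differentiable (at x))"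
    "\<And>b. b \<in> Basis \<Longrightarrow> Ck_on (Suc 0) S (\<lambda>x. frechet_derivative f (at x) b)"
    using assms by (auto simp: numeral_2_eq_2)
  show "(f has_derivative frechet_derivative f (at x)) (at x)" if "x \<in> S" for x
    using * that by (simp add: frechet_derivative_works[symmetric])
  show "((\<lambda>x. frechet_derivative f (at x) b) has_derivative
      frechet_derivative (\<lambda>y. frechet_derivative f (at y) b) (at x)) (at x)" if "x \<in> S" "b \<in> Basis" for x b
    using *(2)[OF that(2)] that(1) by (simp add: frechet_derivative_works[symmetric])
  show "continuous_on S (\<lambda>x. frechet_derivative (\<lambda>y. frechet_derivative f (at y) b) (at x) c)"
    if "b \<in> Basis" "c \<in> Basis" for b c
    using *(2)[OF that(1)] that(2) by simp
  show "continuous_on S (\<lambda>x. frechet_derivative f (at x) b)" if "b \<in> Basis" for b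
    using *(2)[OF that(1)] Ck_on_imp_continuous_on by blast
qed simp

lemma laplacian_add:
  assumes "open S" "z \<in> S" "Ck_on 2 S f" "Ck_on 2 S g"
  shows "laplacian (\<lambda>x. f x + g x) z = laplacian f z + laplacian g z"
proof -
  from Ck_on_2E[OF assms(3)] obtain f' f'' where f:
    "\<And>x. x \<in> S \<Longrightarrow> (f has_derivative f' x) (at x)"
    "\<And>x b. x \<in> S \<Longrightarrow> b \<in> Basis \<Longrightarrow> ((\<lambda>x. f' x b) has_derivative f'' x b) (at x)" by metis
  from Ck_on_2E[OF assms(4)] obtain g' g'' where g:
    "\<And>x. x \<in> S \<Longrightarrow> (g has_derivative g' x) (at x)"
    "\<And>x b. x \<in> S \<Longrightarrow> b \<in> Basis \<Longrightarrow> ((\<lambda>x. g' x b) has_derivative g'' x b) (at x)" by metis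
  have "laplacian (\<lambda>x. f x + g x) z = (\<Sum>b\<in>Basis. f'' z b b + g'' z b b)"
    by (rule laplacian_eqI[OF assms(1,2) has_derivative_add[OF f(1) g(1)]];
        (assumption | rule has_derivative_add[OF f(2) g(2)] assms(2))+)
  moreover have "laplacian f z = (\<Sum>b\<in>Basis. f'' z b b)"
    by (rule laplacian_eqI[OF assms(1,2) f(1)]) (auto intro: f(2) assms(2))
  moreover have "laplacian g z = (\<Sum>b\<in>Basis. g'' z b b)"
    by (rule laplacian_eqI[OF assms(1,2) g(1)]) (auto intro: g(2) assms(2))
  ultimately show ?thesis by (simp add: sum.distrib)
qed

lemma laplacian_const [simp]: "laplacian (\<lambda>_. c) z = 0"
  by (subst laplacian_eqI[OF open_UNIV, where f'="\<lambda>_ _. 0" and f''="\<lambda>_ _. 0"]) auto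

lemma laplacian_cmult:
  assumes "open S" "z \<in> S" "Ck_on 2 S f"
  shows "laplacian (\<lambda>x. c * f x) z = c * laplacian f z"
proof -
  from Ck_on_2E[OF assms(3)] obtain f' f'' where f:
    "\<And>x. x \<in> S \<Longrightarrow> (f has_derivative f' x) (at x)"
    "\<And>x b. x \<in> S \<Longrightarrow> b \<in> Basis \<Longrightarrow> ((\<lambda>x. f' x b) has_derivative f'' x b) (at x)" by metis
  have "laplacian (\<lambda>x. c * f x) z = (\<Sum>b\<in>Basis. c * f'' z b b)"
    by (rule laplacian_eqI[OF assms(1,2) has_derivative_mult_right[OF f(1)]];
        (assumption | rule has_derivative_mult_right[OF f(2)] assms(2))+)
  moreover have "laplacian f z = (\<Sum>b\<in>Basis. f'' z b b)"
    by (rule laplacian_eqI[OF assms(1,2) f(1)]) (auto intro: f(2) assms(2))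
  ultimately show ?thesis by (simp add: sum_distrib_left)
qed

lemma laplacian_sum:
  assumes "open S" "z \<in> S" "\<And>i. i \<in> I \<Longrightarrow> Ck_on 2 S (f i)"
  shows "laplacian (\<lambda>x. \<Sum>i\<in>I. f i x) z = (\<Sum>i\<in>I. laplacian (f i) z)"
  using assms(3)
proof (induction I rule: infinite_finite_induct)
  case (insert i F)
  have "laplacian (\<lambda>x. f i x + (\<Sum>i\<in>F. f i x)) z = laplacian (f i) z + laplacian (\<lambda>x. \<Sum>i\<in>F. f i x) z"
    by (rule laplacian_add[OF assms(1,2)]) (use insert.prems in \<open>auto intro!: Ck_on_sum assms(1)\<close>)
  with insert show ?case by simp
qed auto

lemma laplacian_compose:
  assumes "open S" "z \<in> S" "Ck_on 2 S f" "open T" "f ` S \<subseteq> T"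
    and "\<And>t. t \<in> T \<Longrightarrow> (F has_real_derivative F' t) (at t)"
    and "(F' has_real_derivative F2) (at (f z))"
  shows "laplacian (\<lambda>x. F (f x)) z =
    F2 * (\<Sum>b\<in>Basis. (frechet_derivative f (at z) b)\<^sup>2) + F' (f z) * laplacian f z"
proof -
  from Ck_on_2E[OF assms(3)] obtain f' f'' where f:
    "\<And>x. x \<in> S \<Longrightarrow> (f has_derivative f' x) (at x)"
    "\<And>x b. x \<in> S \<Longrightarrow> b \<in> Basis \<Longrightarrow> ((\<lambda>x. f' x b) has_derivative f'' x b) (at x)"
    "\<And>x. f' x = frechet_derivative f (at x)" by metis
  have D1: "((\<lambda>x. F (f x)) has_derivative (\<lambda>h. F' (f x) * f' x h)) (at x)" if "x \<in> S" for x
    by (rule has_derivative_compose[OF f(1)[OF that]])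
       (use assms(5,6) that in \<open>auto simp: has_field_derivative_def\<close>)
  have D2: "((\<lambda>x. F' (f x) * f' x b) has_derivative (\<lambda>h. F' (f z) * f'' z b h + F2 * f' z h * f' z b)) (at z)"
    if "b \<in> Basis" for b
    by (rule has_derivative_mult[OF has_derivative_compose[OF f(1)[OF assms(2)]] f(2)[OF assms(2) that]])
       (use assms(7) in \<open>auto simp: has_field_derivative_def\<close>)
  have "laplacian (\<lambda>x. F (f x)) z = (\<Sum>b\<in>Basis. F' (f z) * f'' z b b + F2 * f' z b * f' z b)"
    by (rule laplacian_eqI[OF assms(1,2) D1 D2])
  moreover have "laplacian f z = (\<Sum>b\<in>Basis. f'' z b b)"
    by (rule laplacian_eqI[OF assms(1,2) f(1)]) (auto intro: f(2) assms(2))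
  ultimately show ?thesis by (simp add: f(3) sum.distrib sum_distrib_left power2_eq_square mult.assoc)
qed

lemma has_derivative_ln_cmod:
  assumes "(g has_field_derivative g') (at z)" "g z \<noteq> 0"
  shows "((\<lambda>z. ln (cmod (g z))) has_derivative (\<lambda>b. Re (g' / g z * b))) (at z)"
proof -
  have 1: "((\<lambda>z. cmod (g z)) has_derivative (\<lambda>b. inner (g' * b) (sgn (g z)))) (at z)"
    by (rule has_derivative_compose[OF has_field_derivative_imp_has_derivative[OF assms(1)] has_derivative_norm])
       (use assms in auto)
  have 2: "((\<lambda>z. ln (cmod (g z))) has_derivative (\<lambda>b. inverse (cmod (g z)) * inner (g' * b) (sgn (g z)))) (at z)"
    by (rule has_derivative_compose[OF 1]) (use DERIV_ln[of "cmod (g z)"] assms(2) in \<open>auto simp: has_field_derivative_def\<close>)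
  have "inverse (cmod (g z)) * inner (g' * b) (sgn (g z)) = Re (g' / g z * b)" for b
  proof -
    have "g' / g z * b = (g' * b) * cnj (g z) / of_real ((cmod (g z))\<^sup>2)"
      unfolding complex_norm_square using assms(2) by (simp add: field_simps)
    then have "Re (g' / g z * b) = Re ((g' * b) * cnj (g z)) / (cmod (g z))\<^sup>2"
      by (simp only: Re_divide_of_real)
    also have "Re ((g' * b) * cnj (g z)) = inner (g' * b) (g z)" by (simp add: inner_complex_def)
    finally show ?thesis by (simp add: sgn_div_norm power2_eq_square divide_simps inner_scaleR_right)
  qed
  with 2 show ?thesis by simp
qed

text \<open>The differential of ln |g| sends b to Re (b g'/g), so the pure second derivative in
  direction b is the real part of b^2 times the derivative of g'/g. The directions 1 and \<i> cancel
  because 1 + \<i>^2 = 0.\<close>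

lemma laplacian_ln_cmod:
  assumes "open S" "g holomorphic_on S" "\<And>z. z \<in> S \<Longrightarrow> g z \<noteq> 0" "z \<in> S"
  shows "laplacian (\<lambda>z. ln (cmod (g z))) z = 0"
    and "(\<Sum>b\<in>Basis. (frechet_derivative (\<lambda>z. ln (cmod (g z))) (at z) b)\<^sup>2) = (cmod (deriv g z / g z))\<^sup>2"
proof -
  let ?L = "\<lambda>y. deriv g y / g y"
  have L: "?L holomorphic_on S"
    by (intro holomorphic_intros holomorphic_deriv assms) (use assms(3) in auto)
  have D: "((\<lambda>z. ln (cmod (g z))) has_derivative (\<lambda>b. Re (?L y * b))) (at y)" if "y \<in> S" for y
    by (rule has_derivative_ln_cmod[OF holomorphic_derivI[OF assms(2,1) that] assms(3)[OF that]])
  have D2: "((\<lambda>y. Re (?L y * b)) has_derivative (\<lambda>h. Re (deriv ?L z * h * b))) (at z)" for b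
    by (intro has_derivative_Re has_derivative_mult_left has_derivative_holomorphic[OF L assms(1,4)])
  have "laplacian (\<lambda>z. ln (cmod (g z))) z = (\<Sum>b\<in>Basis. Re (deriv ?L z * b * b))"
    by (rule laplacian_eqI[OF assms(1,4) D D2])
  also have "\<dots> = 0" by (simp add: Basis_complex_def)
  finally show "laplacian (\<lambda>z. ln (cmod (g z))) z = 0" .
  show "(\<Sum>b\<in>Basis. (frechet_derivative (\<lambda>z. ln (cmod (g z))) (at z) b)\<^sup>2) = (cmod (?L z))\<^sup>2"
  proof -
    have "Re (w * \<i>) = - Im w" for w by simp
    then show ?thesis unfolding frechet_derivative_at[OF D[OF assms(4)], symmetric] cmod_power2
      by (simp add: Basis_complex_def del: times_divide_eq_left)
  qed
qed

text \<open>ln |z - c| is harmonic with gradient of length 1 / |z - c|, so only the second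
  derivative of \<open>F\<close> survives in the chain rule. In the variable ln |z - c| the
  Laplacian of radial functions is the one of the line.\<close>

lemma laplacian_radial:
  assumes "z \<noteq> c" "\<And>t. (F has_real_derivative F' t) (at t)" "(F' has_real_derivative F2) (at (ln (cmod (z - c))))"
  shows "laplacian (\<lambda>z. F (ln (cmod (z - c)))) z = F2 / (cmod (z - c))\<^sup>2"
proof -
  have S: "open (- {c})" "z \<in> - {c}" "(\<lambda>z. z - c) holomorphic_on (- {c})" using assms(1) by (auto intro!: holomorphic_intros)
  have nz: "\<And>z. z \<in> - {c} \<Longrightarrow> z - c \<noteq> 0" by auto
  have d: "deriv (\<lambda>z. z - c) z = 1" by (auto intro!: DERIV_imp_deriv derivative_eq_intros)
  from laplacian_compose[OF S(1,2) Ck_on_ln_cmod[OF S(1,3) nz] open_UNIV subset_UNIV assms(2,3)]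
  show ?thesis
    using laplacian_ln_cmod[OF S(1,3) nz S(2)] d by (simp add: norm_divide power_divide)
qed

text \<open>Summed over the directions 1 and \<i>, the terms with the second derivative of
  \<open>h\<close> cancel, and so do the terms with mixed second derivatives of \<open>f\<close>,
  even before their symmetry is known.\<close>

lemma laplacian_compose_holomorphic:
  assumes "open U" "z \<in> U" "h holomorphic_on U" "Ck_on 2 S f" "h ` U \<subseteq> S"
  shows "laplacian (\<lambda>z. f (h z)) z = (cmod (deriv h z))\<^sup>2 * laplacian f (h z)"
proof -
  from Ck_on_2E[OF assms(4)] obtain f' f'' where f:
    "\<And>x. x \<in> S \<Longrightarrow> (f has_derivative f' x) (at x)"
    "\<And>x b. x \<in> S \<Longrightarrow> b \<in> Basis \<Longrightarrow> ((\<lambda>x. f' x b) has_derivative f'' x b) (at x)"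
    "\<And>x. f' x = frechet_derivative f (at x)" by metis
  have hS: "h x \<in> S" if "x \<in> U" for x using that assms(5) by auto
  have B: "1 \<in> (Basis :: complex set)" "\<i> \<in> (Basis :: complex set)" by (auto simp: Basis_complex_def)
  have lin': "f' (h x) k = Re k * f' (h x) 1 + Im k * f' (h x) \<i>" if "x \<in> U" for x k
    by (rule complex_linear_expand[OF has_derivative_linear[OF f(1)[OF hS[OF that]]]])
  have lin'': "f'' (h z) b k = Re k * f'' (h z) b 1 + Im k * f'' (h z) b \<i>" if "b \<in> Basis" for b k
    by (rule complex_linear_expand[OF has_derivative_linear[OF f(2)[OF hS[OF assms(2)] that]]])
  have D1: "((\<lambda>z. f (h z)) has_derivative
      (\<lambda>b. Re (deriv h x * b) * f' (h x) 1 + Im (deriv h x * b) * f' (h x) \<i>)) (at x)" if "x \<in> U" for x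
    using has_derivative_compose[OF has_derivative_holomorphic[OF assms(3,1) that] f(1)[OF hS[OF that]]]
    unfolding lin'[OF that, of "deriv h x * _"] .
  note h2 = has_derivative_holomorphic[OF holomorphic_deriv[OF assms(3,1)] assms(1,2)]
  note hz = hS[OF assms(2)]
  have D2: "((\<lambda>x. Re (deriv h x * b) * f' (h x) 1 + Im (deriv h x * b) * f' (h x) \<i>) has_derivative
     (\<lambda>k. (Re (deriv h z * b) * f'' (h z) 1 (deriv h z * k) + Re (deriv (deriv h) z * k * b) * f' (h z) 1) +
          (Im (deriv h z * b) * f'' (h z) \<i> (deriv h z * k) + Im (deriv (deriv h) z * k * b) * f' (h z) \<i>))) (at z)" for b
  proof -
    note hd = has_derivative_holomorphic[OF assms(3,1,2)]
    have h2b: "((\<lambda>x. deriv h x * b) has_derivative (\<lambda>k. deriv (deriv h) z * k * b)) (at z)"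
      by (rule has_derivative_mult_left[OF h2])
    show ?thesis
      by (rule has_derivative_add[OF
          has_derivative_mult[OF has_derivative_Re[OF h2b] has_derivative_compose[OF hd f(2)[OF hz B(1)]]]
          has_derivative_mult[OF has_derivative_Im[OF h2b] has_derivative_compose[OF hd f(2)[OF hz B(2)]]]])
  qed
  have "laplacian (\<lambda>z. f (h z)) z = 
     (\<Sum>b\<in>Basis. (Re (deriv h z * b) * f'' (h z) 1 (deriv h z * b) + Re (deriv (deriv h) z * b * b) * f' (h z) 1) +
          (Im (deriv h z * b) * f'' (h z) \<i> (deriv h z * b) + Im (deriv (deriv h) z * b * b) * f' (h z) \<i>))"
    by (rule laplacian_eqI[OF assms(1,2) D1 D2])
  also have "\<dots> = (cmod (deriv h z))\<^sup>2 * (f'' (h z) 1 1 + f'' (h z) \<i> \<i>)"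
    unfolding lin''[OF B(1), of "deriv h z * _"] lin''[OF B(2), of "deriv h z * _"]
    unfolding cmod_power2 by (simp add: Basis_complex_def power2_eq_square algebra_simps)
  also have "f'' (h z) 1 1 + f'' (h z) \<i> \<i> = laplacian f (h z)"
    unfolding laplacian_def f(3)[symmetric]
    using frechet_derivative_at[OF f(2)[OF hz B(1)]] frechet_derivative_at[OF f(2)[OF hz B(2)]]
    by (simp add: Basis_complex_def)
  finally show ?thesis .
qed

lemma planar_curvature_cong:
  assumes "open S" "z \<in> S" "\<And>y. y \<in> S \<Longrightarrow> f y = g y"
  shows "planar_curvature f z = planar_curvature g z"
  unfolding planar_curvature_def
  using laplacian_cong[OF assms(1,2), of "\<lambda>w. ln (f w) / 2" "\<lambda>w. ln (g w) / 2"] assms by simp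

text \<open>ln |h'| is harmonic, so the Laplacian of the pulled back potential gains the factor
  |h'|^2, the same one as the density by which it is divided.\<close>

lemma planar_curvature_pullback:
  assumes "open U" "z \<in> U" "h holomorphic_on U" "\<And>z. z \<in> U \<Longrightarrow> deriv h z \<noteq> 0"
    and "open S" "h ` U \<subseteq> S" "Ck_on 2 S \<rho>" "\<And>z. z \<in> S \<Longrightarrow> \<rho> z > 0"
  shows "planar_curvature (\<lambda>z. \<rho> (h z) * (cmod (deriv h z))\<^sup>2) z = planar_curvature \<rho> (h z)"
proof -
  let ?v = "\<lambda>w. 1/2 * ln (\<rho> w)"
  have v: "Ck_on 2 S ?v" by (intro Ck_on_mult Ck_on_const Ck_on_ln' assms)
  note h' = holomorphic_deriv[OF assms(3,1)]
  have pos: "\<rho> (h y) > 0" "cmod (deriv h y) > 0" if "y \<in> U" for y using assms(4,6,8) that by auto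
  have "laplacian (\<lambda>w. ln (\<rho> (h w) * (cmod (deriv h w))\<^sup>2) / 2) z =
     laplacian (\<lambda>w. ?v (h w) + ln (cmod (deriv h w))) z"
    by (rule laplacian_cong[OF assms(1,2)]) (use pos assms(4) in \<open>simp add: ln_mult ln_realpow field_simps less_imp_neq[symmetric]\<close>)
  also have "\<dots> = laplacian (\<lambda>w. ?v (h w)) z + laplacian (\<lambda>w. ln (cmod (deriv h w))) z"
    by (rule laplacian_add[OF assms(1,2) Ck_on_compose_holomorphic[OF assms(1,3) v assms(6)]
          Ck_on_ln_cmod[OF assms(1) h' assms(4)]])
  also have "\<dots> = (cmod (deriv h z))\<^sup>2 * laplacian ?v (h z)"
    using laplacian_compose_holomorphic[OF assms(1,2,3) v assms(6)] laplacian_ln_cmod(1)[OF assms(1) h' assms(4) assms(2)]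
    by simp
  finally show ?thesis using pos[OF assms(2)] unfolding planar_curvature_def
    by simp
qed

section \<open>Integration in the plane\<close>

lemma lborel_integral_shift:
  fixes f :: "'a::euclidean_space \<Rightarrow> real"
  shows "(\<integral>x. f (c + x) \<partial>lborel) = (\<integral>x. f x \<partial>lborel)" 
    and "integrable lborel (\<lambda>x. f (c + x)) \<longleftrightarrow> integrable lborel f"
proof -
  let ?T = "(+) c"
  have *: "(\<integral>x. f (c + x) \<partial>lborel) = (\<integral>x. f x \<partial>lborel) \<and> (integrable lborel (\<lambda>x. f (c + x)) \<longleftrightarrow> integrable lborel f)"
  proof (cases "f \<in> borel_measurable borel")
    case True
    have "(\<integral>x. f x \<partial>distr lborel borel ?T) = (\<integral>x. f (c + x) \<partial>lborel)"
      by (rule integral_distr) (use True in auto)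
    moreover have "integrable (distr lborel borel ?T) f = integrable lborel (\<lambda>x. f (c + x))"
      by (rule integrable_distr_eq) (use True in auto)
    ultimately show ?thesis by (simp add: lborel_distr_plus)
  next
    \<comment> \<open>A non-measurable function has integral 0 by convention, and its translate is
      not measurable either.\<close>
    case False
    have "(\<lambda>x. f (c + x)) \<notin> borel_measurable borel"
    proof
      assume A: "(\<lambda>x. f (c + x)) \<in> borel_measurable borel"
      have "(\<lambda>x. (\<lambda>x. f (c + x)) (x - c)) \<in> borel_measurable borel"
        by (rule measurable_compose[OF _ A]) simp
      with False show False by simp
    qed
    then have "\<not> integrable lborel f" "\<not> integrable lborel (\<lambda>x. f (c + x))"
      using False borel_measurable_integrable[of lborel f] borel_measurable_integrable[of lborel "\<lambda>x. f (c + x)"]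
      by auto
    then show ?thesis by (simp add: not_integrable_integral_eq)
  qed
  then show "(\<integral>x. f (c + x) \<partial>lborel) = (\<integral>x. f x \<partial>lborel)"
    "integrable lborel (\<lambda>x. f (c + x)) \<longleftrightarrow> integrable lborel f" by auto
qed

lemma integrable_compact_support:
  fixes f :: "'a::euclidean_space \<Rightarrow> real"
  assumes "continuous_on UNIV f" "\<And>x. R < norm x \<Longrightarrow> f x = 0"
  shows "integrable lborel f"
proof -
  have "integrable lborel (\<lambda>x. indicator (cball 0 R) x *\<^sub>R f x)"
    by (rule borel_integrable_compact) (auto intro: continuous_on_subset[OF assms(1)])
  moreover have "(\<lambda>x. indicator (cball 0 R) x *\<^sub>R f x) = f"
    using assms(2) by (fastforce simp: indicator_def fun_eq_iff)
  ultimately show ?thesis by simp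
qed

lemma bounded_compact_support:
  fixes f :: "'a::euclidean_space \<Rightarrow> real"
  assumes "continuous_on UNIV f" "\<And>x. R < norm x \<Longrightarrow> f x = 0"
  obtains B where "B \<ge> 0" "\<And>x. \<bar>f x\<bar> \<le> B"
proof -
  have "compact (f ` cball 0 R)"
    by (rule compact_continuous_image) (auto intro: continuous_on_subset[OF assms(1)])
  then obtain B where B: "\<And>x. x \<in> cball 0 R \<Longrightarrow> norm (f x) \<le> B"
    using compact_imp_bounded bounded_iff by (metis imageI)
  show ?thesis
  proof (rule that[of "max B 0"])
    show "\<bar>f x\<bar> \<le> max B 0" for x
      using B[of x] assms(2)[of x] by (cases "norm x \<le> R") auto
  qed simp
qed

text \<open>The integral of a difference quotient vanishes by translation invariance.\<close>

lemma integral_partial_derivative_eq_0: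
  fixes F :: "'a::euclidean_space \<Rightarrow> real"
  assumes D: "\<And>x. (F has_derivative F' x) (at x)"
    and cont: "continuous_on UNIV (\<lambda>x. F' x b)" and supp: "\<And>x. R < norm x \<Longrightarrow> F x = 0"
  shows "(\<integral>x. F' x b \<partial>lborel) = 0"
proof -
  have contF: "continuous_on UNIV F"
    by (intro continuous_at_imp_continuous_on ballI has_derivative_continuous[OF D])
  have supp': "F' x b = 0" if "R < norm x" for x
  proof -
    have "((\<lambda>_. 0) has_derivative F' x) (at x)"
      by (rule has_derivative_transform_within_open[OF D, where s="{x. R < norm x}"])
         (use that supp in \<open>auto intro!: open_Collect_less continuous_intros\<close>)
    then have "F' x = (\<lambda>_. 0)" using has_derivative_unique has_derivative_const by blast
    then show ?thesis by simp
  qed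
  obtain B where B: "B \<ge> 0" "\<And>x. \<bar>F' x b\<bar> \<le> B" using bounded_compact_support[OF cont supp'] by blast
  define s where "s n x = (F (x + (1 / real (Suc n)) *\<^sub>R b) - F x) * real (Suc n)" for n x
  have intF: "integrable lborel F" by (rule integrable_compact_support[OF contF supp])
  have der: "((\<lambda>t. F (x + t *\<^sub>R b)) has_real_derivative F' (x + t *\<^sub>R b) b) (at t)" for x t
  proof -
    have "((\<lambda>t. F (x + t *\<^sub>R b)) has_derivative (\<lambda>h. F' (x + t *\<^sub>R b) (h *\<^sub>R b))) (at t)"
      by (rule has_derivative_compose[OF _ D]) (auto intro!: derivative_eq_intros)
    moreover have "F' (x + t *\<^sub>R b) (h *\<^sub>R b) = F' (x + t *\<^sub>R b) b * h" for h
      using linear_scale[OF has_derivative_linear[OF D[of "x + t *\<^sub>R b"]], of h b] by simp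
    ultimately show ?thesis unfolding has_field_derivative_def by simp
  qed
  have zero: "(\<integral>x. s n x \<partial>lborel) = 0" for n
  proof -
    have "(\<integral>x. F (x + (1 / real (Suc n)) *\<^sub>R b) \<partial>lborel) = (\<integral>x. F x \<partial>lborel)"
      using lborel_integral_shift(1)[of F "(1 / real (Suc n)) *\<^sub>R b"] by (simp add: add.commute)
    moreover have "integrable lborel (\<lambda>x. F (x + (1 / real (Suc n)) *\<^sub>R b))"
      using lborel_integral_shift(2)[of F "(1 / real (Suc n)) *\<^sub>R b"] intF by (simp add: add.commute)
    ultimately show ?thesis unfolding s_def using intF by simp
  qed
  have lim: "(\<lambda>n. s n x) \<longlonglongrightarrow> F' x b" for x
  proof -
    have "((\<lambda>h. (F (x + (0 + h) *\<^sub>R b) - F (x + 0 *\<^sub>R b)) / h) \<longlongrightarrow> F' x b) (at 0)"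
      using der[of x 0] unfolding DERIV_def by simp
    moreover have "filterlim (\<lambda>n. 1 / real (Suc n)) (at 0) sequentially"
      unfolding filterlim_at using LIMSEQ_inverse_real_of_nat
      by (auto simp: inverse_eq_divide)
    ultimately have "(\<lambda>n. (F (x + (0 + 1 / real (Suc n)) *\<^sub>R b) - F (x + 0 *\<^sub>R b)) / (1 / real (Suc n))) \<longlonglongrightarrow> F' x b"
      by (rule filterlim_compose)
    then show ?thesis unfolding s_def by simp
  qed
  \<comment> \<open>The mean value theorem bounds the quotient by the supremum of the derivative.
    The shift has length at most \<open>norm b\<close>, so the quotient vanishes off the ball
    enlarged by \<open>norm b\<close>.\<close>
  have dom: "norm (s n x) \<le> B * indicator (cball 0 (R + norm b)) x" for n x
  proof (cases "x \<in> cball 0 (R + norm b)")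
    case False
    then have 1: "R + norm b < norm x" by simp
    then have "R < norm x" using norm_ge_zero[of b] by linarith
    moreover have "R < norm (x + (1 / real (Suc n)) *\<^sub>R b)"
    proof -
      have "norm ((1 / real (Suc n)) *\<^sub>R b) \<le> norm b" using mult_left_mono[of 1 "1 + real n" "norm b"] by (simp add: divide_simps)
      then show ?thesis using 1 norm_triangle_ineq2[of x "- ((1 / real (Suc n)) *\<^sub>R b)"] by simp
    qed
    ultimately show ?thesis using supp False by (simp add: s_def)
  next
    case True
    have "\<exists>t>0. t < 1 / real (Suc n) \<and> F (x + (1 / real (Suc n)) *\<^sub>R b) - F (x + 0 *\<^sub>R b) = (1 / real (Suc n) - 0) * F' (x + t *\<^sub>R b) b"
      using MVT2[of 0 "1 / real (Suc n)" "\<lambda>t. F (x + t *\<^sub>R b)" "\<lambda>t. F' (x + t *\<^sub>R b) b"] der by auto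
    then obtain t where "F (x + (1 / real (Suc n)) *\<^sub>R b) - F x = (1 / real (Suc n)) * F' (x + t *\<^sub>R b) b" by auto
    then have "s n x = F' (x + t *\<^sub>R b) b" by (simp add: s_def)
    then show ?thesis using B True by simp
  qed
  have "(\<lambda>n. \<integral>x. s n x \<partial>lborel) \<longlonglongrightarrow> (\<integral>x. F' x b \<partial>lborel)"
  proof (rule integral_dominated_convergence)
    show "(\<lambda>x. F' x b) \<in> borel_measurable lborel"
      using borel_measurable_continuous_onI[OF cont] by simp
    show "s n \<in> borel_measurable lborel" for n
      unfolding s_def using borel_measurable_continuous_onI[OF contF] by simp
    show "integrable lborel (\<lambda>x::'a. B * indicator (cball 0 (R + norm b)) x :: real)"
      by (rule integrable_mult_right, rule integrable_real_indicator)
         (use emeasure_bounded_finite[OF bounded_cball, of "0::'a" "R + norm b"] in \<open>simp_all add: less_top\<close>)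
  qed (use lim dom in auto)
  then have "(\<lambda>n. 0) \<longlonglongrightarrow> (\<integral>x. F' x b \<partial>lborel)" unfolding zero .
  from LIMSEQ_unique[OF this tendsto_const] show ?thesis .
qed

lemma integral_by_parts:
  fixes F H :: "'a::euclidean_space \<Rightarrow> real"
  assumes F: "\<And>x. (F has_derivative F' x) (at x)" "continuous_on UNIV (\<lambda>x. F' x b)"
    and H: "\<And>x. (H has_derivative H' x) (at x)" "continuous_on UNIV (\<lambda>x. H' x b)"
    and supp: "\<And>x. R < norm x \<Longrightarrow> F x = 0"
  shows "(\<integral>x. F' x b * H x \<partial>lborel) = - (\<integral>x. F x * H' x b \<partial>lborel)"
proof -
  have contF: "continuous_on UNIV F" and contH: "continuous_on UNIV H"
    by (intro continuous_at_imp_continuous_on ballI has_derivative_continuous[OF F(1)]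
        has_derivative_continuous[OF H(1)])+
  have supp': "F' x b = 0" if "R < norm x" for x
  proof -
    have "((\<lambda>_. 0) has_derivative F' x) (at x)"
      by (rule has_derivative_transform_within_open[OF F(1), where s="{x. R < norm x}"])
         (use that supp in \<open>auto intro!: open_Collect_less continuous_intros\<close>)
    then have "F' x = (\<lambda>_. 0)" using has_derivative_unique has_derivative_const by blast
    then show ?thesis by simp
  qed
  have c1: "continuous_on UNIV (\<lambda>x. F x * H' x b)" and c2: "continuous_on UNIV (\<lambda>x. F' x b * H x)"
    by (rule continuous_on_mult[OF contF H(2)] continuous_on_mult[OF F(2) contH])+
  have "(\<integral>x. F x * H' x b + F' x b * H x \<partial>lborel) = 0"
  proof (rule integral_partial_derivative_eq_0)
    show "((\<lambda>x. F x * H x) has_derivative (\<lambda>h. F x * H' x h + F' x h * H x)) (at x)" for x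
      by (rule has_derivative_mult[OF F(1) H(1)])
    show "F x * H x = 0" if "R < norm x" for x using supp[OF that] by simp
  qed (rule continuous_on_add[OF c1 c2])
  moreover have "integrable lborel (\<lambda>x. F x * H' x b)"
    by (rule integrable_compact_support[OF c1]) (use supp in auto)
  moreover have "integrable lborel (\<lambda>x. F' x b * H x)"
    by (rule integrable_compact_support[OF c2]) (use supp' in auto)
  ultimately show ?thesis by simp
qed

section \<open>Area in radial coordinates\<close>

lemma emeasure_lborel_complex_cball:
  "r \<ge> 0 \<Longrightarrow> emeasure lborel (cball (c::complex) r) = ennreal (pi * r\<^sup>2)"
  by (simp add: emeasure_cball unit_ball_vol_2)

text \<open>The disc of squared radius a has area \<pi> a, linear in a; hence the squared distance,
  rather than the distance, carries area to a constant multiple of length.\<close>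

lemma distr_cmod_power2:
  "distr lborel borel (\<lambda>z. (cmod (z - c))\<^sup>2) = density lborel (\<lambda>x. ennreal (pi * indicator {0..} x))"
proof (rule measure_eqI_generator_eq)
  let ?E = "range (\<lambda>a::real. {..a})"
  show "Int_stable ?E" by (auto simp: Int_stable_def)
  show "?E \<subseteq> Pow UNIV" by auto
  show "sets (distr lborel borel (\<lambda>z. (cmod (z - c))\<^sup>2)) = sigma_sets UNIV ?E"
    "sets (density lborel (\<lambda>x. ennreal (pi * indicator {0..} x))) = sigma_sets UNIV ?E"
    by (simp_all add: borel_eq_atMost)
  show "range (\<lambda>n::nat. {..real n}) \<subseteq> ?E" "(\<Union>n. {..real n}) = UNIV"
    using real_arch_simple by auto
  have L: "emeasure (distr lborel borel (\<lambda>z. (cmod (z - c))\<^sup>2)) {..a} = ennreal (pi * max 0 a)" for a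
  proof -
    have *: "(\<lambda>z. (cmod (z - c))\<^sup>2) -` {..a} = (if a \<ge> 0 then cball c (sqrt a) else {})"
    proof (cases "a \<ge> 0")
      case True
      have "((cmod (z - c))\<^sup>2 \<le> a) = (cmod (z - c) \<le> sqrt a)" for z
        using True by (metis norm_ge_zero real_le_rsqrt real_sqrt_ge_zero real_sqrt_le_iff real_sqrt_pow2 real_sqrt_power power_mono)
      then show ?thesis using True by (auto simp: dist_norm norm_minus_commute)
    next
      case False
      have "\<not> (cmod (z - c))\<^sup>2 \<le> a" for z using False zero_le_power2[of "cmod (z - c)"] by linarith
      then show ?thesis using False by auto
    qed
    show ?thesis
      by (subst emeasure_distr) (auto simp: * emeasure_lborel_complex_cball max_def)
  qed
  show "emeasure (distr lborel borel (\<lambda>z. (cmod (z - c))\<^sup>2)) {..real n} \<noteq> \<infinity>" for n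
    using L by simp
  show "emeasure (distr lborel borel (\<lambda>z. (cmod (z - c))\<^sup>2)) X =
      emeasure (density lborel (\<lambda>x. ennreal (pi * indicator {0..} x))) X" if "X \<in> ?E" for X
  proof -
    from that obtain a where X: "X = {..a}" by (rule rangeE)
    have "emeasure (density lborel (\<lambda>x. ennreal (pi * indicator {0..} x))) {..a} =
        (\<integral>\<^sup>+x. ennreal pi * indicator {0..a} x \<partial>lborel)"
      by (subst emeasure_density) (auto intro!: nn_integral_cong simp: indicator_def)
    also have "\<dots> = ennreal pi * emeasure lborel {0..a}"
      by (simp add: nn_integral_cmult_indicator)
    also have "\<dots> = ennreal (pi * max 0 a)"
      by (auto simp: emeasure_lborel_Icc_eq max_def ennreal_mult)
    finally show ?thesis using L X by simp
  qed
qed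

lemma nn_integral_radial:
  assumes [measurable]: "H \<in> borel_measurable borel"
  shows "(\<integral>\<^sup>+z. H ((cmod (z - c))\<^sup>2) \<partial>lborel) = ennreal pi * (\<integral>\<^sup>+x. H x * indicator {0..} x \<partial>lborel)"
proof -
  have "(\<integral>\<^sup>+z. H ((cmod (z - c))\<^sup>2) \<partial>lborel) = (\<integral>\<^sup>+x. H x \<partial>distr lborel borel (\<lambda>z. (cmod (z - c))\<^sup>2))"
    by (subst nn_integral_distr) auto
  also have "\<dots> = (\<integral>\<^sup>+x. ennreal pi * (H x * indicator {0..} x) \<partial>lborel)"
    unfolding distr_cmod_power2
    by (subst nn_integral_density) (auto intro!: nn_integral_cong simp: indicator_def)
  also have "\<dots> = ennreal pi * (\<integral>\<^sup>+x. H x * indicator {0..} x \<partial>lborel)"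
    by (rule nn_integral_cmult) auto
  finally show ?thesis .
qed

text \<open>Polar coordinates \<open>z = c + e\<^sup>t\<^sup>+\<^sup>i\<^sup>\<theta>\<close>, in which \<open>|z - c|\<^sup>-\<^sup>2 |dz|\<^sup>2 = dt d\<theta>\<close>.\<close>

lemma distr_ln_cmod:
  "lborel = distr (density lborel (\<lambda>z. ennreal (1 / (2 * pi * (cmod (z - c))\<^sup>2)))) borel (\<lambda>z. ln (cmod (z - c)))"
proof (rule lborel_eqI)
  fix l u :: real assume "\<And>b. b \<in> Basis \<Longrightarrow> l \<bullet> b \<le> u \<bullet> b"
  then have lu: "l \<le> u" by simp
  let ?D = "distr (density lborel (\<lambda>z. ennreal (1 / (2 * pi * (cmod (z - c))\<^sup>2)))) borel (\<lambda>z. ln (cmod (z - c)))"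
  let ?H = "\<lambda>x. ennreal (1 / (2 * pi * x)) * indicator {exp (2*l)<..<exp (2*u)} x"
  have "emeasure ?D (box l u) = (\<integral>\<^sup>+z. ennreal (1 / (2 * pi * (cmod (z - c))\<^sup>2)) * 
      indicator ((\<lambda>z. ln (cmod (z - c))) -` {l<..<u}) z \<partial>lborel)"
  proof -
    have "(\<lambda>z. ln (cmod (z - c))) \<in> borel_measurable borel" by measurable
    from measurable_sets[OF this, of "{l<..<u}"] show ?thesis
      by (subst emeasure_distr) (auto simp: emeasure_density)
  qed
  also have "\<dots> = (\<integral>\<^sup>+z. ?H ((cmod (z - c))\<^sup>2) \<partial>lborel)"
  proof (rule nn_integral_cong_AE)
    have "AE z in lborel. z \<noteq> c" by (rule AE_lborel_singleton)
    then show "AE z in lborel. ennreal (1 / (2 * pi * (cmod (z - c))\<^sup>2)) * 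
      indicator ((\<lambda>z. ln (cmod (z - c))) -` {l<..<u}) z = ?H ((cmod (z - c))\<^sup>2)"
    proof eventually_elim
      case (elim z)
      then have p: "cmod (z - c) > 0" by simp
      have "exp (2*l) < (cmod (z - c))\<^sup>2 \<longleftrightarrow> l < ln (cmod (z - c))"
      proof -
        have "l < ln (cmod (z - c)) \<longleftrightarrow> 2 * l < ln ((cmod (z - c))\<^sup>2)" using p by (simp add: ln_realpow)
        also have "\<dots> \<longleftrightarrow> exp (2*l) < (cmod (z - c))\<^sup>2" using p by (subst exp_less_cancel_iff[symmetric]) simp
        finally show ?thesis by simp
      qed
      moreover have "(cmod (z - c))\<^sup>2 < exp (2*u) \<longleftrightarrow> ln (cmod (z - c)) < u"
      proof -
        have "ln (cmod (z - c)) < u \<longleftrightarrow> ln ((cmod (z - c))\<^sup>2) < 2 * u" using p by (simp add: ln_realpow)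
        also have "\<dots> \<longleftrightarrow> (cmod (z - c))\<^sup>2 < exp (2*u)" using p by (subst exp_less_cancel_iff[symmetric]) simp
        finally show ?thesis by simp
      qed
      ultimately show ?case by (simp add: indicator_def)
    qed
  qed
  also have "\<dots> = ennreal pi * (\<integral>\<^sup>+x. ?H x * indicator {0..} x \<partial>lborel)"
    by (rule nn_integral_radial) simp
  also have "(\<integral>\<^sup>+x. ?H x * indicator {0..} x \<partial>lborel) = 
      (\<integral>\<^sup>+x. ennreal (1 / (2 * pi * x)) * indicator {exp (2*l)..exp (2*u)} x \<partial>lborel)"
  proof (rule nn_integral_cong_AE)
    have "AE x in lborel. x \<noteq> exp (2*l)" "AE x in lborel. x \<noteq> exp (2*u)" by (rule AE_lborel_singleton)+
    then show "AE x in lborel. ?H x * indicator {0..} x = ennreal (1 / (2 * pi * x)) * indicator {exp (2*l)..exp (2*u)} x"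
    proof eventually_elim
      case (elim x)
      have "0 \<le> x" if "exp (2*l) < x" using that exp_gt_zero[of "2*l"] by linarith
      then show ?case using elim by (auto simp: indicator_def)
    qed
  qed
  also have "\<dots> = ennreal (ln (exp (2*u)) / (2*pi) - ln (exp (2*l)) / (2*pi))"
  proof (rule nn_integral_FTC_Icc)
    fix x assume "x \<in> {exp (2*l)..exp (2*u)}"
    then have "0 < x" using exp_gt_zero[of "2*l"] by (metis atLeastAtMost_iff less_le_trans)
    then show "((\<lambda>x. ln x / (2*pi)) has_real_derivative 1 / (2 * pi * x)) (at x)" "0 \<le> 1 / (2 * pi * x)"
      by (auto intro!: derivative_eq_intros simp: divide_simps)
  qed (use lu in auto)
  also have "ennreal pi * \<dots> = ennreal (u - l)"
    using lu by (simp add: ennreal_mult[symmetric] field_simps)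
  finally show "emeasure ?D (box l u) = (\<Prod>b\<in>Basis. (u - l) \<bullet> b)" using lu by simp
qed simp

lemma nn_integral_ln_cmod:
  assumes [measurable]: "H \<in> borel_measurable borel"
  shows "(\<integral>\<^sup>+z. H (ln (cmod (z - c))) * ennreal (1 / (cmod (z - c))\<^sup>2) \<partial>lborel) =
    ennreal (2 * pi) * (\<integral>\<^sup>+t. H t \<partial>lborel)"
proof -
  have "(\<integral>\<^sup>+t. H t \<partial>lborel) = (\<integral>\<^sup>+z. ennreal (1 / (2 * pi * (cmod (z - c))\<^sup>2)) * H (ln (cmod (z - c))) \<partial>lborel)"
    by (subst distr_ln_cmod[of c], subst nn_integral_distr, measurable, subst nn_integral_density) auto
  then have "ennreal (2 * pi) * (\<integral>\<^sup>+t. H t \<partial>lborel) = 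
     (\<integral>\<^sup>+z. ennreal (2 * pi) * (ennreal (1 / (2 * pi * (cmod (z - c))\<^sup>2)) * H (ln (cmod (z - c)))) \<partial>lborel)"
    by (simp add: nn_integral_cmult)
  also have "\<dots> = (\<integral>\<^sup>+z. H (ln (cmod (z - c))) * ennreal (1 / (cmod (z - c))\<^sup>2) \<partial>lborel)"
  proof (rule nn_integral_cong)
    fix z
    have "ennreal (1 / (cmod (z - c))\<^sup>2) = ennreal (2 * pi) * ennreal (1 / (2 * pi * (cmod (z - c))\<^sup>2))"
      by (simp add: ennreal_mult[symmetric])
    then show "ennreal (2 * pi) * (ennreal (1 / (2 * pi * (cmod (z - c))\<^sup>2)) * H (ln (cmod (z - c)))) =
      H (ln (cmod (z - c))) * ennreal (1 / (cmod (z - c))\<^sup>2)" by (simp only: mult_ac)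
  qed
  finally show ?thesis by simp
qed

lemma integral_ln_cmod:
  fixes H :: "real \<Rightarrow> real"
  assumes [measurable]: "H \<in> borel_measurable borel"
  shows "(\<integral>z. H (ln (cmod (z - c))) / (cmod (z - c))\<^sup>2 \<partial>lborel) = 2 * pi * (\<integral>t. H t \<partial>lborel)"
    and "integrable lborel (\<lambda>z. H (ln (cmod (z - c))) / (cmod (z - c))\<^sup>2) \<longleftrightarrow> integrable lborel H"
proof -
  let ?D = "density lborel (\<lambda>z. ennreal (1 / (2 * pi * (cmod (z - c))\<^sup>2)))"
  have eq: "(\<lambda>z. (1 / (2 * pi * (cmod (z - c))\<^sup>2)) *\<^sub>R H (ln (cmod (z - c)))) =
     (\<lambda>z. (1 / (2*pi)) * (H (ln (cmod (z - c))) / (cmod (z - c))\<^sup>2))" by auto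
  have "(\<integral>t. H t \<partial>lborel) = (\<integral>z. H (ln (cmod (z - c))) \<partial>?D)"
    by (subst distr_ln_cmod[of c], subst integral_distr) auto
  also have "\<dots> = (\<integral>z. (1 / (2 * pi * (cmod (z - c))\<^sup>2)) *\<^sub>R H (ln (cmod (z - c))) \<partial>lborel)"
    by (rule integral_density) auto
  also have "\<dots> = (1 / (2*pi)) * (\<integral>z. H (ln (cmod (z - c))) / (cmod (z - c))\<^sup>2 \<partial>lborel)"
    unfolding eq by (rule integral_mult_right_zero)
  finally show "(\<integral>z. H (ln (cmod (z - c))) / (cmod (z - c))\<^sup>2 \<partial>lborel) = 2 * pi * (\<integral>t. H t \<partial>lborel)"
    by (simp add: field_simps)
  have "integrable lborel H \<longleftrightarrow> integrable ?D (\<lambda>z. H (ln (cmod (z - c))))"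
    by (subst distr_ln_cmod[of c], subst integrable_distr_eq) auto
  also have "\<dots> \<longleftrightarrow> integrable lborel (\<lambda>z. (1 / (2 * pi * (cmod (z - c))\<^sup>2)) *\<^sub>R H (ln (cmod (z - c))))"
    by (rule integrable_density) auto
  also have "\<dots> \<longleftrightarrow> integrable lborel (\<lambda>z. H (ln (cmod (z - c))) / (cmod (z - c))\<^sup>2)"
    unfolding eq integrable_mult_left_iff by simp
  finally show "integrable lborel (\<lambda>z. H (ln (cmod (z - c))) / (cmod (z - c))\<^sup>2) \<longleftrightarrow> integrable lborel H" by simp
qed

section \<open>The sharp Sobolev inequality in the plane\<close>

lemma Fubini_compact_support:
  fixes g :: "'a::euclidean_space \<Rightarrow> 'b::euclidean_space \<Rightarrow> real"
  assumes cont: "continuous_on UNIV (\<lambda>p. g (fst p) (snd p))"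
    and supp: "\<And>x y. R < norm x \<Longrightarrow> g x y = 0" "\<And>x y. R < norm y \<Longrightarrow> g x y = 0"
  shows "(\<integral>x. (\<integral>y. g x y \<partial>lborel) \<partial>lborel) = (\<integral>y. (\<integral>x. g x y \<partial>lborel) \<partial>lborel)"
    and "integrable lborel (\<lambda>x. \<integral>y. g x y \<partial>lborel)"
proof -
  have "integrable lborel (\<lambda>p. g (fst p) (snd p))"
  proof (rule integrable_compact_support[OF cont])
    fix p :: "'a \<times> 'b" assume p: "2 * \<bar>R\<bar> < norm p"
    have "norm p \<le> norm (fst p) + norm (snd p)"
      by (metis norm_Pair_le prod.collapse)
    with p have "R < norm (fst p) \<or> R < norm (snd p)" by linarith
    with supp show "g (fst p) (snd p) = 0" by auto
  qed
  then have int: "integrable (lborel \<Otimes>\<^sub>M lborel) (\<lambda>(x, y). g x y)"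
    by (simp add: lborel_prod case_prod_beta')
  show "(\<integral>x. (\<integral>y. g x y \<partial>lborel) \<partial>lborel) = (\<integral>y. (\<integral>x. g x y \<partial>lborel) \<partial>lborel)"
    by (rule lborel_pair.Fubini_integral[OF int, symmetric])
  show "integrable lborel (\<lambda>x. \<integral>y. g x y \<partial>lborel)"
    using lborel_pair.integrable_fst'[OF int] by simp
qed

text \<open>A smooth version of 1 / |r|^2 at scale \<open>d\<close>, spelled out in
  \<open>Re\<close> and \<open>Im\<close> because the integrations by parts differentiate it in
  these two directions.\<close>

definition ker :: "real \<Rightarrow> complex \<Rightarrow> real" where
  "ker d r = 1 / ((Re r)\<^sup>2 + (Im r)\<^sup>2 + d\<^sup>2)"

lemma ker_denominator_pos: "d \<noteq> 0 \<Longrightarrow> (Re r)\<^sup>2 + (Im r)\<^sup>2 + d\<^sup>2 > 0"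
  by (meson add_nonneg_pos sum_power2_ge_zero zero_less_power2)

lemma ker_pos: "d \<noteq> 0 \<Longrightarrow> ker d r > 0"
  using ker_denominator_pos[of d r] by (simp add: ker_def)

lemma ker_times: "d \<noteq> 0 \<Longrightarrow> ker d r * ((Re r)\<^sup>2 + (Im r)\<^sup>2 + d\<^sup>2) = 1"
  using ker_denominator_pos[of d r] by (simp add: ker_def)

lemma has_derivative_ker:
  assumes "d \<noteq> 0"
  shows "(ker d has_derivative (\<lambda>h. - 2 * (ker d r)\<^sup>2 * (Re r * Re h + Im r * Im h))) (at r)"
proof -
  have "((\<lambda>r. 1 / ((Re r)\<^sup>2 + (Im r)\<^sup>2 + d\<^sup>2)) has_derivative
    (\<lambda>h. - 2 * (1 / ((Re r)\<^sup>2 + (Im r)\<^sup>2 + d\<^sup>2))\<^sup>2 * (Re r * Re h + Im r * Im h))) (at r)"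
    using ker_denominator_pos[OF assms, of r]
    by (auto intro!: derivative_eq_intros simp: power2_eq_square divide_simps fun_eq_iff)
  then show ?thesis unfolding ker_def .
qed

lemma continuous_on_ker: "d \<noteq> 0 \<Longrightarrow> continuous_on S f \<Longrightarrow> continuous_on S (\<lambda>x. ker d (f x))"
  unfolding ker_def using ker_denominator_pos by (intro continuous_intros) (auto simp: less_imp_neq[symmetric])

text \<open>
  The kernel \<open>2 r r\<^sup>T / (|r|\<^sup>2 + d\<^sup>2) - 1\<close> is a contraction, and as \<open>d \<rightarrow> 0\<close> its double divergence
  tends to \<open>4\<pi>\<close> times the point mass at \<open>0\<close>. Contracting it with two gradients therefore bounds
  \<open>4\<pi> \<integral> F\<^sup>2\<close> by the square of the total variation.
\<close>

lemma contraction_kernel_bound: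
  assumes "d \<noteq> 0"
  shows "- (u1 * v1 * (2 * (Re r)\<^sup>2 * ker d r - 1) + (u1 * v2 + u2 * v1) * (2 * Re r * Im r * ker d r) +
      u2 * v2 * (2 * (Im r)\<^sup>2 * ker d r - 1)) \<le> sqrt (u1\<^sup>2 + u2\<^sup>2) * sqrt (v1\<^sup>2 + v2\<^sup>2)"
proof -
  define k a b where kab: "k = ker d r" "a = Re r" "b = Im r"
  have k: "k > 0" "k * (a\<^sup>2 + b\<^sup>2) \<le> 1"
  proof -
    show "k > 0" using ker_pos[OF assms] by (simp add: kab)
    then have "0 \<le> k * d\<^sup>2" by simp
    then show "k * (a\<^sup>2 + b\<^sup>2) \<le> 1"
      using ker_times[OF assms, of r] unfolding kab by (simp only: distrib_left)
  qed
  \<comment> \<open>w = v - 2 k r (r . v) is minus the kernel applied to v. It is a reflection of v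
    when k |r|^2 = 1, and never longer than v because k |r|^2 \<le> 1.\<close>
  define w1 w2 where w: "w1 = v1 - 2 * k * a * (a * v1 + b * v2)" "w2 = v2 - 2 * k * b * (a * v1 + b * v2)"
  have "w1\<^sup>2 + w2\<^sup>2 = v1\<^sup>2 + v2\<^sup>2 - 4 * k * (a * v1 + b * v2)\<^sup>2 * (1 - k * (a\<^sup>2 + b\<^sup>2))"
    unfolding w by (simp add: power2_eq_square algebra_simps)
  also have "\<dots> \<le> v1\<^sup>2 + v2\<^sup>2" using k by simp
  finally have w_le: "sqrt (w1\<^sup>2 + w2\<^sup>2) \<le> sqrt (v1\<^sup>2 + v2\<^sup>2)" by simp
  have "- (u1 * v1 * (2 * a\<^sup>2 * k - 1) + (u1 * v2 + u2 * v1) * (2 * a * b * k) + u2 * v2 * (2 * b\<^sup>2 * k - 1)) =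
     u1 * w1 + u2 * w2"
    unfolding w by (simp add: power2_eq_square algebra_simps)
  also have "\<dots> = inner (Complex u1 u2) (Complex w1 w2)" by (simp add: inner_complex_def)
  also have "\<dots> \<le> norm (Complex u1 u2) * norm (Complex w1 w2)" by (rule norm_cauchy_schwarz)
  also have "\<dots> = sqrt (u1\<^sup>2 + u2\<^sup>2) * sqrt (w1\<^sup>2 + w2\<^sup>2)" by (simp add: cmod_def)
  also have "\<dots> \<le> sqrt (u1\<^sup>2 + u2\<^sup>2) * sqrt (v1\<^sup>2 + v2\<^sup>2)" by (rule mult_left_mono[OF w_le]) simp
  finally show ?thesis unfolding kab .
qed

text \<open>The divergence of the matrix kernel 2 r r^T \<open>ker d r\<close> - 1 is the radial
  field r * \<open>div_kernel d r\<close>; the divergence of that field is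
  \<open>ddiv_kernel d r\<close>.\<close>

definition div_kernel :: "real \<Rightarrow> complex \<Rightarrow> real" where
  "div_kernel d r = 2 * (3 * ker d r - 2 * ((Re r)\<^sup>2 + (Im r)\<^sup>2) * (ker d r)\<^sup>2)"

definition ddiv_kernel :: "real \<Rightarrow> complex \<Rightarrow> real" where
  "ddiv_kernel d r = 4 * d\<^sup>2 * (3 * d\<^sup>2 - (cmod r)\<^sup>2) / ((cmod r)\<^sup>2 + d\<^sup>2) ^ 3"

lemma has_derivative_shift_flip:
  assumes "\<And>r. (k has_derivative k' r) (at r)"
  shows "((\<lambda>y. k (x - y)) has_derivative (\<lambda>h. k' (x - y) (- h))) (at y)"
  by (rule has_derivative_compose[OF _ assms]) (auto intro!: derivative_eq_intros)

lemma has_derivative_shift: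
  assumes "\<And>r. (k has_derivative k' r) (at r)"
  shows "((\<lambda>x. k (x - y)) has_derivative (\<lambda>h. k' (x - y) h)) (at x)"
  by (rule has_derivative_compose[OF _ assms]) (auto intro!: derivative_eq_intros)

text \<open>In the first two identities the kernel is differentiated in y, and the sign from x - y
  cancels the sign of integration by parts; in the third it is differentiated in x and the sign
  stays. Together they move both derivatives of F(x) F(y) onto the kernel.\<close>

lemma integral_kernel_by_parts:
  fixes F :: "complex \<Rightarrow> real"
  assumes F: "\<And>x. (F has_derivative F' x) (at x)" "\<And>b. b \<in> Basis \<Longrightarrow> continuous_on UNIV (\<lambda>x. F' x b)"
    and supp: "\<And>x. R < norm x \<Longrightarrow> F x = 0" and d: "d \<noteq> 0"
  shows "(\<integral>y. F' y 1 * (2 * (Re (x - y))\<^sup>2 * ker d (x - y) - 1) + F' y \<i> * (2 * Re (x - y) * Im (x - y) * ker d (x - y)) \<partial>lborel)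
      = (\<integral>y. F y * (Re (x - y) * div_kernel d (x - y)) \<partial>lborel)" (is ?A)
    and "(\<integral>y. F' y 1 * (2 * Re (x - y) * Im (x - y) * ker d (x - y)) + F' y \<i> * (2 * (Im (x - y))\<^sup>2 * ker d (x - y) - 1) \<partial>lborel)
      = (\<integral>y. F y * (Im (x - y) * div_kernel d (x - y)) \<partial>lborel)" (is ?B)
    and "(\<integral>x. F' x 1 * (Re (x - y) * div_kernel d (x - y)) + F' x \<i> * (Im (x - y) * div_kernel d (x - y)) \<partial>lborel)
      = - (\<integral>x. F x * ddiv_kernel d (x - y) \<partial>lborel)" (is ?C)
proof -
  have B: "(1::complex) \<in> Basis" "\<i> \<in> Basis" by (auto simp: Basis_complex_def)
  have contF: "continuous_on UNIV F"
    by (intro continuous_at_imp_continuous_on ballI has_derivative_continuous[OF F(1)])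
  have supp': "F' x b = 0" if "R < norm x" for x b
  proof -
    have "((\<lambda>_. 0) has_derivative F' x) (at x)"
      by (rule has_derivative_transform_within_open[OF F(1), where s="{x. R < norm x}"])
         (use that supp in \<open>auto intro!: open_Collect_less continuous_intros\<close>)
    then have "F' x = (\<lambda>_. 0)" using has_derivative_unique has_derivative_const by blast
    then show ?thesis by simp
  qed
  note dk = has_derivative_ker[OF d]
  let ?k = "ker d"
  define k11' where "k11' r h = 4 * Re r * Re h * ?k r - 4 * (Re r)\<^sup>2 * (?k r)\<^sup>2 * (Re r * Re h + Im r * Im h)" for r h
  define k12' where "k12' r h = 2 * (Re h * Im r + Re r * Im h) * ?k r - 4 * (Re r * Im r) * (?k r)\<^sup>2 * (Re r * Re h + Im r * Im h)" for r h
  define k22' where "k22' r h = 4 * Im r * Im h * ?k r - 4 * (Im r)\<^sup>2 * (?k r)\<^sup>2 * (Re r * Re h + Im r * Im h)" for r h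
  define e where "e r h = 4 * (Re r * Re h + Im r * Im h) * (- 5 * (?k r)\<^sup>2 + 4 * ((Re r)\<^sup>2 + (Im r)\<^sup>2) * (?k r)^3)" for r h
  have D11: "((\<lambda>r. 2 * (Re r)\<^sup>2 * ?k r - 1) has_derivative k11' r) (at r)" for r
    unfolding k11'_def by (auto intro!: derivative_eq_intros dk simp: fun_eq_iff power2_eq_square algebra_simps)
  have D12: "((\<lambda>r. 2 * Re r * Im r * ?k r) has_derivative k12' r) (at r)" for r
    unfolding k12'_def by (auto intro!: derivative_eq_intros dk simp: fun_eq_iff power2_eq_square algebra_simps)
  have D22: "((\<lambda>r. 2 * (Im r)\<^sup>2 * ?k r - 1) has_derivative k22' r) (at r)" for r
    unfolding k22'_def by (auto intro!: derivative_eq_intros dk simp: fun_eq_iff power2_eq_square algebra_simps)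
  have De: "(div_kernel d has_derivative e r) (at r)" for r
    unfolding div_kernel_def[abs_def] e_def 
    by (auto intro!: derivative_eq_intros dk simp: fun_eq_iff power2_eq_square power3_eq_cube algebra_simps)
  have Dn1: "((\<lambda>r. Re r * div_kernel d r) has_derivative (\<lambda>h. Re r * e r h + Re h * div_kernel d r)) (at r)" for r
    by (rule has_derivative_mult[OF _ De]) (auto intro!: derivative_eq_intros)
  have Dn2: "((\<lambda>r. Im r * div_kernel d r) has_derivative (\<lambda>h. Im r * e r h + Im h * div_kernel d r)) (at r)" for r
    by (rule has_derivative_mult[OF _ De]) (auto intro!: derivative_eq_intros)
  have cdiv: "continuous_on S (\<lambda>x. div_kernel d (f x))" if "continuous_on S f" for S and f :: "complex \<Rightarrow> complex"
    unfolding div_kernel_def by (intro continuous_intros continuous_on_ker d that)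
  note ci = continuous_intros continuous_on_ker[OF d] cdiv F(2) B contF
  have c': "continuous_on UNIV (\<lambda>y. k11' (x - y) (- b))" "continuous_on UNIV (\<lambda>y. k12' (x - y) (- b))"
    "continuous_on UNIV (\<lambda>y. k22' (x - y) (- b))" for x b
    unfolding k11'_def k12'_def k22'_def by (intro ci)+
  have ce: "continuous_on UNIV (\<lambda>x. Re (x - y) * e (x - y) b + Re b * div_kernel d (x - y))"
    "continuous_on UNIV (\<lambda>x. Im (x - y) * e (x - y) b + Im b * div_kernel d (x - y))" for y b
    unfolding e_def by (intro ci)+
  have int: "integrable lborel (\<lambda>x. F' x b * G x)" "integrable lborel (\<lambda>x. F x * G x)"
    if "b \<in> Basis" "continuous_on UNIV G" for b and G :: "complex \<Rightarrow> real"
    by (rule integrable_compact_support[where R=R]; use that supp supp' in \<open>auto intro!: continuous_on_mult F(2) contF\<close>)+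
  note ibp = integral_by_parts[where F=F and F'=F' and R=R, OF F(1) F(2) _ _ supp]
  have *: "4 * Re r * ?k r - 4 * (Re r)\<^sup>2 * (?k r)\<^sup>2 * Re r + 2 * Re r * ?k r - 4 * (Re r * Im r) * (?k r)\<^sup>2 * Im r = Re r * div_kernel d r"
    "4 * Im r * ?k r - 4 * (Im r)\<^sup>2 * (?k r)\<^sup>2 * Im r + 2 * Im r * ?k r - 4 * (Re r * Im r) * (?k r)\<^sup>2 * Re r = Im r * div_kernel d r" for r
    unfolding div_kernel_def by (simp_all add: power2_eq_square algebra_simps)
  show ?A
  proof -
    have "(\<integral>y. F' y 1 * (2 * (Re (x - y))\<^sup>2 * ?k (x - y) - 1) \<partial>lborel) = - (\<integral>y. F y * k11' (x - y) (- 1) \<partial>lborel)"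
      by (rule ibp[OF B(1) has_derivative_shift_flip[OF D11] c'(1)])
    moreover have "(\<integral>y. F' y \<i> * (2 * Re (x - y) * Im (x - y) * ?k (x - y)) \<partial>lborel) = - (\<integral>y. F y * k12' (x - y) (- \<i>) \<partial>lborel)"
      by (rule ibp[OF B(2) has_derivative_shift_flip[OF D12] c'(2)])
    ultimately have "(\<integral>y. F' y 1 * (2 * (Re (x - y))\<^sup>2 * ?k (x - y) - 1) + F' y \<i> * (2 * Re (x - y) * Im (x - y) * ?k (x - y)) \<partial>lborel)
       = - (\<integral>y. F y * k11' (x - y) (- 1) \<partial>lborel) - (\<integral>y. F y * k12' (x - y) (- \<i>) \<partial>lborel)"
      by (subst Bochner_Integration.integral_add) (auto intro!: int B ci)
    also have "\<dots> = - (\<integral>y. F y * k11' (x - y) (- 1) + F y * k12' (x - y) (- \<i>) \<partial>lborel)"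
      by (subst Bochner_Integration.integral_add) (auto intro!: int B c')
    also have "\<dots> = (\<integral>y. - (F y * k11' (x - y) (- 1) + F y * k12' (x - y) (- \<i>)) \<partial>lborel)"
      by (rule Bochner_Integration.integral_minus[symmetric])
    also have "\<dots> = (\<integral>y. F y * (Re (x - y) * div_kernel d (x - y)) \<partial>lborel)"
      by (intro Bochner_Integration.integral_cong refl, subst *(1)[symmetric]) (simp add: k11'_def k12'_def algebra_simps)
    finally show ?thesis .
  qed
  show ?B
  proof -
    have "(\<integral>y. F' y 1 * (2 * Re (x - y) * Im (x - y) * ?k (x - y)) \<partial>lborel) = - (\<integral>y. F y * k12' (x - y) (- 1) \<partial>lborel)"
      by (rule ibp[OF B(1) has_derivative_shift_flip[OF D12] c'(2)])
    moreover have "(\<integral>y. F' y \<i> * (2 * (Im (x - y))\<^sup>2 * ?k (x - y) - 1) \<partial>lborel) = - (\<integral>y. F y * k22' (x - y) (- \<i>) \<partial>lborel)"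
      by (rule ibp[OF B(2) has_derivative_shift_flip[OF D22] c'(3)])
    ultimately have "(\<integral>y. F' y 1 * (2 * Re (x - y) * Im (x - y) * ?k (x - y)) + F' y \<i> * (2 * (Im (x - y))\<^sup>2 * ?k (x - y) - 1) \<partial>lborel)
       = - (\<integral>y. F y * k12' (x - y) (- 1) \<partial>lborel) - (\<integral>y. F y * k22' (x - y) (- \<i>) \<partial>lborel)"
      by (subst Bochner_Integration.integral_add) (auto intro!: int B ci)
    also have "\<dots> = - (\<integral>y. F y * k12' (x - y) (- 1) + F y * k22' (x - y) (- \<i>) \<partial>lborel)"
      by (subst Bochner_Integration.integral_add) (auto intro!: int B c')
    also have "\<dots> = (\<integral>y. - (F y * k12' (x - y) (- 1) + F y * k22' (x - y) (- \<i>)) \<partial>lborel)"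
      by (rule Bochner_Integration.integral_minus[symmetric])
    also have "\<dots> = (\<integral>y. F y * (Im (x - y) * div_kernel d (x - y)) \<partial>lborel)"
      by (intro Bochner_Integration.integral_cong refl, subst *(2)[symmetric]) (simp add: k12'_def k22'_def algebra_simps)
    finally show ?thesis .
  qed
  have **: "Re r * e r 1 + div_kernel d r + (Im r * e r \<i> + div_kernel d r) = ddiv_kernel d r" for r
  proof -
    define \<rho> where "\<rho> = (Re r)\<^sup>2 + (Im r)\<^sup>2"
    have pos: "\<rho> + d\<^sup>2 \<noteq> 0" using ker_denominator_pos[OF d, of r] by (simp add: \<rho>_def)
    have k: "?k r = 1 / (\<rho> + d\<^sup>2)" by (simp add: ker_def \<rho>_def)
    have "Re r * e r 1 + div_kernel d r + (Im r * e r \<i> + div_kernel d r) =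
      4 * \<rho> * (- 5 * (?k r)\<^sup>2 + 4 * \<rho> * (?k r)^3) + 4 * (3 * ?k r - 2 * \<rho> * (?k r)\<^sup>2)"
      unfolding e_def div_kernel_def by (simp add: \<rho>_def power2_eq_square algebra_simps)
    also have "\<dots> = 4 * ?k r * (1 - ?k r * \<rho>) * (3 * (1 - ?k r * \<rho>) - ?k r * \<rho>)"
      by (simp add: power2_eq_square power3_eq_cube algebra_simps)
    \<comment> \<open>This identity brings out the factor d^2 by which the double divergence
      concentrates at 0 as d shrinks.\<close>
    also have "1 - ?k r * \<rho> = ?k r * d\<^sup>2"
      unfolding k using pos by (simp add: field_simps)
    also have "4 * ?k r * (?k r * d\<^sup>2) * (3 * (?k r * d\<^sup>2) - ?k r * \<rho>) = 4 * d\<^sup>2 * (3 * d\<^sup>2 - \<rho>) * (?k r)^3"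
      by (simp add: power2_eq_square power3_eq_cube algebra_simps)
    also have "\<dots> = 4 * d\<^sup>2 * (3 * d\<^sup>2 - \<rho>) / (\<rho> + d\<^sup>2) ^ 3"
      unfolding k by (simp add: power_one_over)
    finally show ?thesis by (simp add: ddiv_kernel_def \<rho>_def cmod_power2)
  qed
  show ?C
  proof -
    have "(\<integral>x. F' x 1 * (Re (x - y) * div_kernel d (x - y)) \<partial>lborel) = 
       - (\<integral>x. F x * (Re (x - y) * e (x - y) 1 + Re 1 * div_kernel d (x - y)) \<partial>lborel)"
      by (rule ibp[OF B(1) has_derivative_shift[OF Dn1] ce(1)])
    moreover have "(\<integral>x. F' x \<i> * (Im (x - y) * div_kernel d (x - y)) \<partial>lborel) = 
       - (\<integral>x. F x * (Im (x - y) * e (x - y) \<i> + Im \<i> * div_kernel d (x - y)) \<partial>lborel)"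
      by (rule ibp[OF B(2) has_derivative_shift[OF Dn2] ce(2)])
    ultimately have "(\<integral>x. F' x 1 * (Re (x - y) * div_kernel d (x - y)) + F' x \<i> * (Im (x - y) * div_kernel d (x - y)) \<partial>lborel)
       = - (\<integral>x. F x * (Re (x - y) * e (x - y) 1 + Re 1 * div_kernel d (x - y)) \<partial>lborel) 
         - (\<integral>x. F x * (Im (x - y) * e (x - y) \<i> + Im \<i> * div_kernel d (x - y)) \<partial>lborel)"
      by (subst Bochner_Integration.integral_add) (auto intro!: int B ci)
    also have "\<dots> = - (\<integral>x. F x * (Re (x - y) * e (x - y) 1 + Re 1 * div_kernel d (x - y)) + 
          F x * (Im (x - y) * e (x - y) \<i> + Im \<i> * div_kernel d (x - y)) \<partial>lborel)"
      unfolding Bochner_Integration.integral_add[OF int(2)[OF B(1) ce(1)] int(2)[OF B(1) ce(2)]] by linarith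
    also have "\<dots> = - (\<integral>x. F x * ddiv_kernel d (x - y) \<partial>lborel)"
      by (intro arg_cong[where f=uminus] Bochner_Integration.integral_cong refl, subst **[symmetric]) (simp add: algebra_simps)
    finally show ?thesis .
  qed
qed

text \<open>With x = |r|^2 the kernel is 4 (4 / (1 + x)^3 - 1 / (1 + x)^2), and the two terms in the
  bracket have plane integrals 2\<pi> and \<pi>. The kernel changes sign, so the terms are first
  integrated separately as nonnegative functions.\<close>

lemma integral_ddiv_kernel:
  "integrable lborel (ddiv_kernel 1)" "(\<integral>r. ddiv_kernel 1 r \<partial>lborel) = 4 * pi"
proof -
  define p1 p2 :: "real \<Rightarrow> real" where "p1 x = 4 / (1 + \<bar>x\<bar>) ^ 3" and "p2 x = 1 / (1 + \<bar>x\<bar>)\<^sup>2" for x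
  have m[measurable]: "p1 \<in> borel_measurable borel" "p2 \<in> borel_measurable borel"
    unfolding p1_def p2_def by measurable
  have i1: "(\<integral>\<^sup>+x. ennreal (p1 x) * indicator {0..} x \<partial>lborel) = ennreal (0 - (- 2 / (1 + 0)\<^sup>2))"
  proof (rule nn_integral_FTC_atLeast)
    show "((\<lambda>x. - 2 / (1 + x)\<^sup>2) has_real_derivative p1 x) (at x)" if "0 \<le> x" for x
      using that by (auto intro!: derivative_eq_intros simp: p1_def power2_eq_square power3_eq_cube divide_simps)
    show "((\<lambda>x::real. - 2 / (1 + x)\<^sup>2) \<longlongrightarrow> 0) at_top" by real_asymp
  qed (auto simp: p1_def)
  have i2: "(\<integral>\<^sup>+x. ennreal (p2 x) * indicator {0..} x \<partial>lborel) = ennreal (0 - (- 1 / (1 + 0)))"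
  proof (rule nn_integral_FTC_atLeast)
    show "((\<lambda>x. - 1 / (1 + x)) has_real_derivative p2 x) (at x)" if "0 \<le> x" for x
      using that by (auto intro!: derivative_eq_intros simp: p2_def power2_eq_square divide_simps)
    show "((\<lambda>x::real. - 1 / (1 + x)) \<longlongrightarrow> 0) at_top" by real_asymp
  qed (auto simp: p2_def)
  have n1: "(\<integral>\<^sup>+z. ennreal (p1 ((cmod z)\<^sup>2)) \<partial>lborel) = ennreal (2 * pi)"
    using nn_integral_radial[of "\<lambda>x. ennreal (p1 x)" 0] i1 by (simp add: ennreal_mult mult.commute)
  have n2: "(\<integral>\<^sup>+z. ennreal (p2 ((cmod z)\<^sup>2)) \<partial>lborel) = ennreal pi"
    using nn_integral_radial[of "\<lambda>x. ennreal (p2 x)" 0] i2 by (simp add: ennreal_mult mult.commute)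
  have h1: "has_bochner_integral lborel (\<lambda>z::complex. p1 ((cmod z)\<^sup>2)) (2 * pi)"
    by (rule has_bochner_integral_nn_integral) (use n1 in \<open>auto simp: p1_def\<close>)
  have h2: "has_bochner_integral lborel (\<lambda>z::complex. p2 ((cmod z)\<^sup>2)) pi"
    by (rule has_bochner_integral_nn_integral) (use n2 in \<open>auto simp: p2_def\<close>)
  have eq: "ddiv_kernel 1 z = 4 * (p1 ((cmod z)\<^sup>2) - p2 ((cmod z)\<^sup>2))" for z
  proof -
    have "4 * (3 - x) / (x + 1) ^ 3 = 4 * (4 / (1 + x) ^ 3 - 1 / (1 + x)\<^sup>2)" if "x \<ge> 0" for x :: real
      using that by (simp add: divide_simps power2_eq_square power3_eq_cube) (simp add: algebra_simps)
    from this[of "(cmod z)\<^sup>2"] show ?thesis by (simp add: ddiv_kernel_def p1_def p2_def)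
  qed
  have "has_bochner_integral lborel (\<lambda>z. 4 * (p1 ((cmod z)\<^sup>2) - p2 ((cmod z)\<^sup>2))) (4 * (2 * pi - pi))"
    by (intro has_bochner_integral_mult_right has_bochner_integral_diff h1 h2)
  then have "has_bochner_integral lborel (ddiv_kernel 1) (4 * pi)"
    unfolding eq[abs_def, symmetric] by (simp add: eq[symmetric])
  then show "integrable lborel (ddiv_kernel 1)" "(\<integral>r. ddiv_kernel 1 r \<partial>lborel) = 4 * pi"
    by (auto simp: has_bochner_integral_iff)
qed

lemma integral_ddiv_kernel_scale:
  fixes F :: "complex \<Rightarrow> real"
  assumes "d > 0" and [measurable]: "F \<in> borel_measurable borel"
  shows "(\<integral>x. F x * ddiv_kernel d (x - y) \<partial>lborel) = (\<integral>r. F (y + d *\<^sub>R r) * ddiv_kernel 1 r \<partial>lborel)"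
proof -
  have m[measurable]: "ddiv_kernel d \<in> borel_measurable borel" for d
    unfolding ddiv_kernel_def by measurable
  \<comment> \<open>Homogeneity of degree -2: rescaling preserves the total mass, which makes
    \<open>ddiv_kernel d\<close> an approximate identity up to that mass.\<close>
  have scale: "d\<^sup>2 * ddiv_kernel d (d *\<^sub>R r) = ddiv_kernel 1 r" for r
  proof -
    define x where "x = (cmod r)\<^sup>2"
    have x: "x \<ge> 0" by (simp add: x_def)
    have "d\<^sup>2 * x + d\<^sup>2 > 0" using assms(1) x by (intro add_nonneg_pos) auto
    moreover have "(d\<^sup>2 * x + d\<^sup>2)^3 = d^6 * (x + 1)^3" by (simp add: power3_eq_cube power_numeral_reduce algebra_simps)
    ultimately have "d\<^sup>2 * (4 * d\<^sup>2 * (3 * d\<^sup>2 - d\<^sup>2 * x) / (d\<^sup>2 * x + d\<^sup>2) ^ 3) = 4 * (3 - x) / (x + 1) ^ 3"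
      using assms(1) x by (simp add: divide_simps) (simp add: power_numeral_reduce algebra_simps)
    then show ?thesis by (simp add: ddiv_kernel_def x_def power_mult_distrib)
  qed
  have "(\<integral>x. F x * ddiv_kernel d (x - y) \<partial>lborel) = 
      (\<integral>x. F x * ddiv_kernel d (x - y) \<partial>density (distr lborel borel (\<lambda>r. y + d *\<^sub>R r)) (\<lambda>_. ennreal (d\<^sup>2)))"
    using lborel_affine[of d y] assms(1) by (simp add: ennreal_power[symmetric])
  also have "\<dots> = (\<integral>r. d\<^sup>2 *\<^sub>R (F (y + d *\<^sub>R r) * ddiv_kernel d ((y + d *\<^sub>R r) - y)) \<partial>lborel)"
    by (subst integral_density, measurable, simp, subst integral_distr) auto
  also have "\<dots> = (\<integral>r. F (y + d *\<^sub>R r) * ddiv_kernel 1 r \<partial>lborel)"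
    by (intro Bochner_Integration.integral_cong refl, subst scale[symmetric]) simp
  finally show ?thesis .
qed

text \<open>The constant 4\<pi> is the isoperimetric one: on smoothed indicators of a disc the two
  sides agree in the limit. The exact value of the minimal volume depends on this sharpness.\<close>

theorem planar_sobolev:
  fixes F :: "complex \<Rightarrow> real"
  assumes F: "\<And>x. (F has_derivative F' x) (at x)" "\<And>b. b \<in> Basis \<Longrightarrow> continuous_on UNIV (\<lambda>x. F' x b)"
    and supp: "\<And>x. R < norm x \<Longrightarrow> F x = 0"
  shows "4 * pi * (\<integral>x. (F x)\<^sup>2 \<partial>lborel) \<le> (\<integral>x. sqrt ((F' x 1)\<^sup>2 + (F' x \<i>)\<^sup>2) \<partial>lborel)\<^sup>2"
proof -
  define s where "s x = sqrt ((F' x 1)\<^sup>2 + (F' x \<i>)\<^sup>2)" for x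
  have B: "(1::complex) \<in> Basis" "\<i> \<in> Basis" by (auto simp: Basis_complex_def)
  have contF: "continuous_on UNIV F"
    by (intro continuous_at_imp_continuous_on ballI has_derivative_continuous[OF F(1)])
  have [measurable]: "F \<in> borel_measurable borel" by (rule borel_measurable_continuous_onI[OF contF])
  have supp': "F' x b = 0" if "R < norm x" for x b
  proof -
    have "((\<lambda>_. 0) has_derivative F' x) (at x)"
      by (rule has_derivative_transform_within_open[OF F(1), where s="{x. R < norm x}"])
         (use that supp in \<open>auto intro!: open_Collect_less continuous_intros\<close>)
    then have "F' x = (\<lambda>_. 0)" using has_derivative_unique has_derivative_const by blast
    then show ?thesis by simp
  qed
  have cs: "continuous_on UNIV s" unfolding s_def by (intro continuous_intros F(2) B)
  have supps: "s x = 0" if "R < norm x" for x using supp'[OF that] by (simp add: s_def)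
  have ints: "integrable lborel s" by (rule integrable_compact_support[OF cs supps])
  have c2: "continuous_on UNIV (\<lambda>p. F' (fst p) b)" "continuous_on UNIV (\<lambda>p. F' (snd p) b)" if "b \<in> Basis" for b
    by (rule continuous_on_compose2[OF F(2)[OF that]]; auto intro!: continuous_intros)+
  have cF: "continuous_on UNIV (\<lambda>p. F (fst p))" "continuous_on UNIV (\<lambda>p. F (snd p))"
    by (rule continuous_on_compose2[OF contF]; auto intro!: continuous_intros)+
  \<comment> \<open>For fixed d, the double integral of the kernel against the gradients at x and y
    is bounded through the contraction property by the squared total variation; by parts it equals,
    up to sign, the pairing of F with its convolution.\<close>
  have key: "(\<integral>y. F y * (\<integral>x. F x * ddiv_kernel d (x - y) \<partial>lborel) \<partial>lborel) \<le> (\<integral>x. s x \<partial>lborel)\<^sup>2" if d: "d > 0" for d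
  proof -
    have d0: "d \<noteq> 0" using d by simp
    note ci = continuous_intros continuous_on_ker[OF d0] c2[OF B(1)] c2[OF B(2)] F(2)[OF B(1)] F(2)[OF B(2)] cF contF
    define g where "g x y = F' x 1 * (F' y 1 * (2 * (Re (x - y))\<^sup>2 * ker d (x - y) - 1) + F' y \<i> * (2 * Re (x - y) * Im (x - y) * ker d (x - y))) +
       F' x \<i> * (F' y 1 * (2 * Re (x - y) * Im (x - y) * ker d (x - y)) + F' y \<i> * (2 * (Im (x - y))\<^sup>2 * ker d (x - y) - 1))" for x y
    define k where "k x y = F' x 1 * (F y * (Re (x - y) * div_kernel d (x - y))) + F' x \<i> * (F y * (Im (x - y) * div_kernel d (x - y)))" for x y
    have cg: "continuous_on UNIV (\<lambda>p. g (fst p) (snd p))" unfolding g_def by (intro ci)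
    have ck: "continuous_on UNIV (\<lambda>p. k (fst p) (snd p))" unfolding k_def div_kernel_def by (intro ci)
    have sg: "g x y = 0" if "R < norm x \<or> R < norm y" for x y using that supp' by (auto simp: g_def)
    have sk: "k x y = 0" if "R < norm x \<or> R < norm y" for x y using that supp' supp by (auto simp: k_def)
    have inty: "integrable lborel (\<lambda>y. g x y)" for x
      by (rule integrable_compact_support[of _ R]) (use sg in \<open>auto simp: g_def intro!: ci\<close>)
    have gk: "(\<integral>y. g x y \<partial>lborel) = (\<integral>y. k x y \<partial>lborel)" for x
    proof -
      have "(\<integral>y. g x y \<partial>lborel) =
          F' x 1 * (\<integral>y. F' y 1 * (2 * (Re (x - y))\<^sup>2 * ker d (x - y) - 1) + F' y \<i> * (2 * Re (x - y) * Im (x - y) * ker d (x - y)) \<partial>lborel) +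
          F' x \<i> * (\<integral>y. F' y 1 * (2 * Re (x - y) * Im (x - y) * ker d (x - y)) + F' y \<i> * (2 * (Im (x - y))\<^sup>2 * ker d (x - y) - 1) \<partial>lborel)"
        unfolding g_def
        by (subst Bochner_Integration.integral_add)
           (auto intro!: integrable_mult_right integrable_compact_support[of _ R] ci simp: supp')
      also have "\<dots> = F' x 1 * (\<integral>y. F y * (Re (x - y) * div_kernel d (x - y)) \<partial>lborel) +
           F' x \<i> * (\<integral>y. F y * (Im (x - y) * div_kernel d (x - y)) \<partial>lborel)"
        by (simp only: integral_kernel_by_parts(1,2)[OF F supp d0])
      also have "\<dots> = (\<integral>y. k x y \<partial>lborel)"
        unfolding k_def
        by (subst Bochner_Integration.integral_add)
           (auto intro!: integrable_mult_right integrable_compact_support[of _ R] ci simp: supp supp' div_kernel_def)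
      finally show ?thesis .
    qed
    have "(\<integral>x. \<integral>y. g x y \<partial>lborel \<partial>lborel) = (\<integral>x. \<integral>y. k x y \<partial>lborel \<partial>lborel)" by (simp add: gk)
    also have "\<dots> = (\<integral>y. \<integral>x. k x y \<partial>lborel \<partial>lborel)"
      by (rule Fubini_compact_support(1)[OF ck, of R]) (use sk in auto)
    also have "\<dots> = (\<integral>y. - (F y * (\<integral>x. F x * ddiv_kernel d (x - y) \<partial>lborel)) \<partial>lborel)"
    proof (intro Bochner_Integration.integral_cong refl)
      fix y
      have "(\<integral>x. k x y \<partial>lborel) = (\<integral>x. F y * (F' x 1 * (Re (x - y) * div_kernel d (x - y)) + F' x \<i> * (Im (x - y) * div_kernel d (x - y))) \<partial>lborel)"
        by (intro Bochner_Integration.integral_cong refl) (simp add: k_def algebra_simps)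
      also have "\<dots> = F y * (\<integral>x. F' x 1 * (Re (x - y) * div_kernel d (x - y)) + F' x \<i> * (Im (x - y) * div_kernel d (x - y)) \<partial>lborel)"
        by (rule integral_mult_right_zero)
      finally show "(\<integral>x. k x y \<partial>lborel) = - (F y * (\<integral>x. F x * ddiv_kernel d (x - y) \<partial>lborel))"
        by (simp only: integral_kernel_by_parts(3)[OF F supp d0] mult_minus_right)
    qed
    finally have "(\<integral>y. F y * (\<integral>x. F x * ddiv_kernel d (x - y) \<partial>lborel) \<partial>lborel) = (\<integral>x. - (\<integral>y. g x y \<partial>lborel) \<partial>lborel)"
      by simp
    also have "\<dots> \<le> (\<integral>x. s x * (\<integral>y. s y \<partial>lborel) \<partial>lborel)"
    proof (rule integral_mono)
      show "integrable lborel (\<lambda>x. - (\<integral>y. g x y \<partial>lborel))"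
        by (intro integrable_minus Fubini_compact_support(2)[OF cg, of R]) (use sg in auto)
      show "integrable lborel (\<lambda>x. s x * (\<integral>y. s y \<partial>lborel))" using ints by simp
      fix x
      have "- (\<integral>y. g x y \<partial>lborel) = (\<integral>y. - g x y \<partial>lborel)" by simp
      also have "\<dots> \<le> (\<integral>y. s x * s y \<partial>lborel)"
      proof (rule integral_mono)
        fix y
        show "- g x y \<le> s x * s y"
          using contraction_kernel_bound[OF d0, of "F' x 1" "F' y 1" "x - y" "F' y \<i>" "F' x \<i>"]
          by (simp add: g_def s_def algebra_simps)
      qed (use inty ints in auto)
      finally show "- (\<integral>y. g x y \<partial>lborel) \<le> s x * (\<integral>y. s y \<partial>lborel)" by simp
    qed
    also have "\<dots> = (\<integral>x. s x \<partial>lborel)\<^sup>2" by (simp add: power2_eq_square)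
    finally show ?thesis .
  qed
  \<comment> \<open>The limit of small d is dominated twice: inside the convolution by a multiple of
    |\<open>ddiv_kernel 1\<close>|, outside by a multiple of |F|.\<close>
  obtain M where M: "M \<ge> 0" "\<And>x. \<bar>F x\<bar> \<le> M" using bounded_compact_support[OF contF supp] by blast
  define d where "d n = 1 / real (Suc n)" for n
  have d: "d n > 0" "d \<longlonglongrightarrow> 0" for n
    using LIMSEQ_inverse_real_of_nat by (auto simp: d_def[abs_def] inverse_eq_divide)
  note q = integral_ddiv_kernel
  have mq[measurable]: "ddiv_kernel 1 \<in> borel_measurable borel" using q(1) by auto
  define G where "G n y = (\<integral>r. F (y + d n *\<^sub>R r) * ddiv_kernel 1 r \<partial>lborel)" for n y
  have limG: "(\<lambda>n. G n y) \<longlonglongrightarrow> F y * (4 * pi)" for y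
  proof -
    have "(\<lambda>n. G n y) \<longlonglongrightarrow> (\<integral>r. F y * ddiv_kernel 1 r \<partial>lborel)"
      unfolding G_def
    proof (rule integral_dominated_convergence)
      show "integrable lborel (\<lambda>r. M * \<bar>ddiv_kernel 1 r\<bar>)" using q(1) by simp
      show "AE r in lborel. (\<lambda>n. F (y + d n *\<^sub>R r) * ddiv_kernel 1 r) \<longlonglongrightarrow> F y * ddiv_kernel 1 r"
      proof (intro AE_I2 tendsto_mult tendsto_const)
        fix r
        have "(\<lambda>n. y + d n *\<^sub>R r) \<longlonglongrightarrow> y + 0 *\<^sub>R r" by (intro tendsto_intros d)
        then have "(\<lambda>n. y + d n *\<^sub>R r) \<longlonglongrightarrow> y" by simp
        moreover have "isCont F y" using contF by (simp add: continuous_on_eq_continuous_at)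
        ultimately show "(\<lambda>n. F (y + d n *\<^sub>R r)) \<longlonglongrightarrow> F y" by (rule isCont_tendsto_compose[rotated])
      qed
      show "AE r in lborel. norm (F (y + d n *\<^sub>R r) * ddiv_kernel 1 r) \<le> M * \<bar>ddiv_kernel 1 r\<bar>" for n
        using M by (auto simp: abs_mult intro!: mult_right_mono)
    qed auto
    then show ?thesis using q(2) by simp
  qed
  have boundG: "\<bar>G n y\<bar> \<le> M * (\<integral>r. \<bar>ddiv_kernel 1 r\<bar> \<partial>lborel)" for n y
  proof -
    have "\<bar>G n y\<bar> \<le> (\<integral>r. \<bar>F (y + d n *\<^sub>R r) * ddiv_kernel 1 r\<bar> \<partial>lborel)"
      unfolding G_def by (rule integral_abs_bound)
    also have "\<dots> \<le> (\<integral>r. M * \<bar>ddiv_kernel 1 r\<bar> \<partial>lborel)"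
    proof (rule integral_mono)
      show "integrable lborel (\<lambda>r. M * \<bar>ddiv_kernel 1 r\<bar>)" using q(1) by simp
      show "\<bar>F (y + d n *\<^sub>R r) * ddiv_kernel 1 r\<bar> \<le> M * \<bar>ddiv_kernel 1 r\<bar>" for r
        using M by (auto simp: abs_mult intro!: mult_right_mono)
      then show "integrable lborel (\<lambda>r. \<bar>F (y + d n *\<^sub>R r) * ddiv_kernel 1 r\<bar>)"
        by (intro Bochner_Integration.integrable_bound[OF \<open>integrable lborel (\<lambda>r. M * \<bar>ddiv_kernel 1 r\<bar>)\<close>]) (auto intro!: AE_I2 simp: M)
    qed
    finally show ?thesis by simp
  qed
  have mG: "(\<lambda>y. G n y) \<in> borel_measurable borel" for n
    unfolding G_def by measurable
  have intF: "integrable lborel F" by (rule integrable_compact_support[OF contF supp])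
  have "(\<lambda>n. \<integral>y. F y * G n y \<partial>lborel) \<longlonglongrightarrow> (\<integral>y. F y * (F y * (4 * pi)) \<partial>lborel)"
  proof (rule integral_dominated_convergence)
    show "integrable lborel (\<lambda>y. \<bar>F y\<bar> * (M * (\<integral>r. \<bar>ddiv_kernel 1 r\<bar> \<partial>lborel)))" using intF by simp
    show "AE y in lborel. (\<lambda>n. F y * G n y) \<longlonglongrightarrow> F y * (F y * (4 * pi))"
      by (intro AE_I2 tendsto_mult tendsto_const limG)
    show "AE y in lborel. norm (F y * G n y) \<le> \<bar>F y\<bar> * (M * (\<integral>r. \<bar>ddiv_kernel 1 r\<bar> \<partial>lborel))" for n
      using boundG by (auto simp: abs_mult intro!: mult_left_mono)
  qed (use mG in auto)
  moreover have "(\<integral>y. F y * G n y \<partial>lborel) \<le> (\<integral>x. s x \<partial>lborel)\<^sup>2" for n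
    using key[OF d(1)[of n]] unfolding integral_ddiv_kernel_scale[OF d(1) \<open>F \<in> borel_measurable borel\<close>] G_def .
  ultimately have "(\<integral>y. F y * (F y * (4 * pi)) \<partial>lborel) \<le> (\<integral>x. s x \<partial>lborel)\<^sup>2"
    by (intro LIMSEQ_le_const2) auto
  moreover have "(\<integral>y. F y * (F y * (4 * pi)) \<partial>lborel) = 4 * pi * (\<integral>y. (F y)\<^sup>2 \<partial>lborel)"
  proof -
    have "(\<lambda>y. F y * (F y * (4 * pi))) = (\<lambda>y. 4 * pi * (F y)\<^sup>2)" by (auto simp: power2_eq_square)
    then show ?thesis by simp
  qed
  ultimately show ?thesis unfolding s_def by simp
qed

section \<open>Cutoff functions and Green's identity\<close>

definition ppow :: "nat \<Rightarrow> real \<Rightarrow> real" where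
  "ppow n t = max 0 t ^ n"

lemma DERIV_ppow: "(ppow (Suc (Suc n)) has_real_derivative real (Suc (Suc n)) * ppow (Suc n) x) (at x)"
proof -
  consider "x < 0" | "x > 0" | "x = 0" by linarith
  then show ?thesis
  proof cases
    case 1
    have "((\<lambda>_. 0) has_real_derivative 0) (at x)" by simp
    then have "(ppow (Suc (Suc n)) has_real_derivative 0) (at x)"
      by (rule has_field_derivative_transform_within_open[where S="{..<0}"]) (use 1 in \<open>auto simp: ppow_def\<close>)
    then show ?thesis using 1 by (simp add: ppow_def)
  next
    case 2
    have "((\<lambda>t. t ^ Suc (Suc n)) has_real_derivative real (Suc (Suc n)) * x ^ Suc n) (at x)"
      using DERIV_pow[of "Suc (Suc n)" x] by simp
    then have "(ppow (Suc (Suc n)) has_real_derivative real (Suc (Suc n)) * x ^ Suc n) (at x)"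
      by (rule has_field_derivative_transform_within_open[where S="{0<..}"]) (use 2 in \<open>auto simp: ppow_def max_def\<close>)
    then show ?thesis using 2 by (simp add: ppow_def)
  next
    case 3
    have "((\<lambda>h. (ppow (Suc (Suc n)) (0 + h) - ppow (Suc (Suc n)) 0) / h) \<longlongrightarrow> 0) (at 0)"
    proof (rule tendsto_0_le[where K=1])
      show "((\<lambda>h::real. h ^ Suc n) \<longlongrightarrow> 0) (at 0)" by (auto intro!: tendsto_eq_intros)
      show "\<forall>\<^sub>F h in at 0. norm ((ppow (Suc (Suc n)) (0 + h) - ppow (Suc (Suc n)) 0) / h) \<le> norm (h ^ Suc n) * 1"
        unfolding eventually_at_filter by (rule always_eventually) (auto simp: ppow_def max_def)
    qed
    then show ?thesis unfolding 3 DERIV_def by (simp add: ppow_def)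
  qed
qed

lemma continuous_on_ppow [continuous_intros]: "continuous_on S f \<Longrightarrow> continuous_on S (\<lambda>x. ppow n (f x))"
  unfolding ppow_def by (intro continuous_intros)

text \<open>The cubic B-spline and its antiderivatives: \<open>step\<close> is a \<open>C\<^sup>2\<close> step function.\<close>

definition step2 :: "real \<Rightarrow> real" where
  "step2 t = ppow 1 t - 3 * ppow 1 (t - 1) + 3 * ppow 1 (t - 2) - ppow 1 (t - 3)"
definition step1 :: "real \<Rightarrow> real" where
  "step1 t = (ppow 2 t - 3 * ppow 2 (t - 1) + 3 * ppow 2 (t - 2) - ppow 2 (t - 3)) / 2"
definition step :: "real \<Rightarrow> real" where
  "step t = (ppow 3 t - 3 * ppow 3 (t - 1) + 3 * ppow 3 (t - 2) - ppow 3 (t - 3)) / 6"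
definition ramp :: "real \<Rightarrow> real" where
  "ramp t = (ppow 4 t - 3 * ppow 4 (t - 1) + 3 * ppow 4 (t - 2) - ppow 4 (t - 3)) / 24"

lemma DERIV_ppow_shift: "((\<lambda>t. ppow (Suc (Suc n)) (t - c)) has_real_derivative real (Suc (Suc n)) * ppow (Suc n) (x - c)) (at x)"
  using DERIV_shift[of "ppow (Suc (Suc n))" "real (Suc (Suc n)) * ppow (Suc n) (x - c)" x "- c"] DERIV_ppow[of n "x - c"]
  by simp

lemma DERIV_step1: "(step1 has_real_derivative step2 x) (at x)"
proof -
  have "(step1 has_real_derivative (2 * ppow 1 x - 3 * (2 * ppow 1 (x - 1)) + 3 * (2 * ppow 1 (x - 2)) - 2 * ppow 1 (x - 3)) / 2) (at x)"
    unfolding step1_def[abs_def] using DERIV_ppow[of 0 x] DERIV_ppow_shift[of 0 _ x]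
    by (intro DERIV_cdivide DERIV_add DERIV_diff DERIV_cmult) (simp_all add: numeral_2_eq_2)
  also have "(2 * ppow 1 x - 3 * (2 * ppow 1 (x - 1)) + 3 * (2 * ppow 1 (x - 2)) - 2 * ppow 1 (x - 3)) / 2 = step2 x"
    by (simp add: step2_def field_simps)
  finally show ?thesis .
qed

lemma DERIV_step: "(step has_real_derivative step1 x) (at x)"
proof -
  have "(step has_real_derivative (3 * ppow 2 x - 3 * (3 * ppow 2 (x - 1)) + 3 * (3 * ppow 2 (x - 2)) - 3 * ppow 2 (x - 3)) / 6) (at x)"
    unfolding step_def[abs_def] using DERIV_ppow[of 1 x] DERIV_ppow_shift[of 1 _ x]
    by (intro DERIV_cdivide DERIV_add DERIV_diff DERIV_cmult) (simp_all add: eval_nat_numeral)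
  also have "(3 * ppow 2 x - 3 * (3 * ppow 2 (x - 1)) + 3 * (3 * ppow 2 (x - 2)) - 3 * ppow 2 (x - 3)) / 6 = step1 x"
    by (simp add: step1_def field_simps)
  finally show ?thesis .
qed

lemma DERIV_ramp: "(ramp has_real_derivative step x) (at x)"
proof -
  have "(ramp has_real_derivative (4 * ppow 3 x - 3 * (4 * ppow 3 (x - 1)) + 3 * (4 * ppow 3 (x - 2)) - 4 * ppow 3 (x - 3)) / 24) (at x)"
    unfolding ramp_def[abs_def] using DERIV_ppow[of 2 x] DERIV_ppow_shift[of 2 _ x]
    by (intro DERIV_cdivide DERIV_add DERIV_diff DERIV_cmult) (simp_all add: eval_nat_numeral)
  also have "(4 * ppow 3 x - 3 * (4 * ppow 3 (x - 1)) + 3 * (4 * ppow 3 (x - 2)) - 4 * ppow 3 (x - 3)) / 24 = step x"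
    by (simp add: step_def field_simps)
  finally show ?thesis .
qed

lemma step_le_0: "t \<le> 0 \<Longrightarrow> step t = 0" "t \<le> 0 \<Longrightarrow> step1 t = 0" "t \<le> 0 \<Longrightarrow> step2 t = 0" "t \<le> 0 \<Longrightarrow> ramp t = 0"
  by (auto simp: step_def step1_def step2_def ramp_def ppow_def max_def)

lemma step_ge_3:
  assumes "t \<ge> 3" shows "step t = 1" "step1 t = 0" "step2 t = 0" "ramp t = t - 3/2"
  using assms by (auto simp: step_def step1_def step2_def ramp_def ppow_def max_def eval_nat_numeral field_simps)

lemma step1_bounds: "0 \<le> step1 t" "step1 t \<le> 1"
proof -
  consider "t \<le> 0" | "0 < t" "t \<le> 1" | "1 < t" "t \<le> 2" | "2 < t" "t < 3" | "t \<ge> 3" by linarith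
  then have "0 \<le> step1 t \<and> step1 t \<le> 1"
  proof cases
    case 2
    then have "step1 t = t\<^sup>2 / 2" by (simp add: step1_def ppow_def max_def)
    then show ?thesis using 2 power_le_one[of t 2] zero_le_power2[of t] by linarith
  next
    case 3
    then have "step1 t = (t\<^sup>2 - 3 * (t - 1)\<^sup>2) / 2" by (simp add: step1_def ppow_def max_def)
    also have "\<dots> = 3/4 - (t - 3/2)\<^sup>2" by (simp add: power2_eq_square field_simps)
    finally have *: "step1 t = 3/4 - (t - 3/2)\<^sup>2" .
    have "(t - 3/2)\<^sup>2 \<le> (1/2)\<^sup>2"
      using mult_nonneg_nonneg[of "t - 1" "2 - t"] 3 by (simp add: power2_eq_square algebra_simps)
    with * show ?thesis by (simp add: power2_eq_square) (use zero_le_square[of "t - 3/2"] in linarith)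
  next
    case 4
    then have "step1 t = (t\<^sup>2 - 3 * (t - 1)\<^sup>2 + 3 * (t - 2)\<^sup>2) / 2" by (simp add: step1_def ppow_def max_def)
    also have "\<dots> = (3 - t)\<^sup>2 / 2" by (simp add: power2_eq_square field_simps)
    finally show ?thesis using 4 power_le_one[of "3 - t" 2] zero_le_power2[of "3 - t"] by linarith
  qed (auto simp: step_le_0 step_ge_3)
  then show "0 \<le> step1 t" "step1 t \<le> 1" by auto
qed

lemma mono_step: "s \<le> t \<Longrightarrow> step s \<le> step t"
  by (rule DERIV_nonneg_imp_nondecreasing) (use DERIV_step step1_bounds in blast)+

lemma step_bounds: "0 \<le> step t" "step t \<le> 1"
proof -
  show "0 \<le> step t" using mono_step[of "min 0 t" t] step_le_0(1)[of "min 0 t"] by simp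
  show "step t \<le> 1" using mono_step[of t "max 3 t"] step_ge_3(1)[of "max 3 t"] by simp
qed

text \<open>\<open>ramp t\<close> lies between 0 and t on [0, 3] and equals t - 3/2 from there on.
  Hence the smoothed positive part of a function has the same logarithmic singularities as the
  function where it is large.\<close>

lemma ramp_bound: "\<bar>ramp t - t\<bar> \<le> 3" if "t \<ge> 0" for t
proof (cases "t \<ge> 3")
  case False
  have "\<exists>z. z > 0 \<and> z < t \<and> ramp t - ramp 0 = (t - 0) * step z" if "t > 0"
    using MVT2[of 0 t ramp step] that DERIV_ramp by blast
  then have "0 \<le> ramp t \<and> ramp t \<le> t"
    using \<open>t \<ge> 0\<close> step_le_0(4)[of 0] step_bounds by (cases "t > 0") (auto simp: mult_left_le)
  then show ?thesis using False by auto
qed (simp add: step_ge_3)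

lemma continuous_step: "continuous_on S step2" "continuous_on S step1" "continuous_on S step" "continuous_on S ramp"
  unfolding step_def step1_def step2_def ramp_def by (intro continuous_intros; simp)+

lemma Ck_on_step: "Ck_on 2 UNIV step" "Ck_on 2 UNIV ramp"
proof -
  have 1: "Ck_on (Suc 0) UNIV step1"
    by (rule Ck_on_real_SucI[OF open_UNIV DERIV_step1]) (simp add: continuous_step)
  have 2: "Ck_on (Suc (Suc 0)) UNIV step"
    by (rule Ck_on_real_SucI[OF open_UNIV DERIV_step 1])
  then show "Ck_on 2 UNIV step" by (simp only: numeral_2_eq_2)
  show "Ck_on 2 UNIV ramp" unfolding numeral_2_eq_2
    by (rule Ck_on_real_SucI[OF open_UNIV DERIV_ramp Ck_on_SucD[OF 2]])
qed

text \<open>In the variable l = ln |z - c| this is, up to 2\<pi>, the pairing of a logarithm with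
  the Laplacian of the cutoff \<open>cut\<close> below. The value -1 for every position m and width
  n is how the orders of cone points are read off.\<close>

lemma integral_step2:
  assumes "n > 0"
  shows "has_bochner_integral lborel (\<lambda>l. l * step2 ((l - m) / n) / n\<^sup>2) (- 1)"
proof -
  define P where "P l = l * step1 ((l - m) / n) / n - step ((l - m) / n)" for l
  have D: "(P has_real_derivative l * step2 ((l - m) / n) / n\<^sup>2) (at l)" for l
  proof -
    have d: "((\<lambda>l. (l - m) / n) has_real_derivative 1 / n) (at l)" using assms by (auto intro!: derivative_eq_intros)
    show ?thesis unfolding P_def
      using assms DERIV_chain2[OF DERIV_step1 d] DERIV_chain2[OF DERIV_step d]
      by (auto intro!: derivative_eq_intros simp: field_simps power2_eq_square)
  qed
  have "has_bochner_integral lborel (\<lambda>l. l * step2 ((l - m) / n) / n\<^sup>2 * indicator {m..m + 3 * n} l) (P (m + 3 * n) - P m)"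
  proof (rule has_bochner_integral_FTC_Icc_real)
    show "isCont (\<lambda>l. l * step2 ((l - m) / n) / n\<^sup>2) x" for x
      using continuous_on_compose2[OF continuous_step(1)[of UNIV], of UNIV "\<lambda>l. (l - m) / n"] assms
      by (intro continuous_intros) (auto simp: continuous_on_eq_continuous_at intro!: continuous_intros)
  qed (use assms D in auto)
  moreover have "l * step2 ((l - m) / n) / n\<^sup>2 * indicator {m..m + 3 * n} l = l * step2 ((l - m) / n) / n\<^sup>2" for l
  proof (cases "l \<in> {m..m + 3 * n}")
    case False
    then have "(l - m) / n \<le> 0 \<or> (l - m) / n \<ge> 3" using assms by (auto simp: field_simps)
    then show ?thesis using step_le_0(3) step_ge_3(3) by auto
  qed simp
  moreover have "P (m + 3 * n) - P m = - 1" using assms by (simp add: P_def step_le_0 step_ge_3)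
  ultimately show ?thesis by (simp only:)
qed

text \<open>The L1 norm of the cutoff's Laplacian decays like 1 / n, so bounded remainders of a
  logarithm disappear in the limit. The constant 18 is 6, a crude bound for |\<open>step2\<close>|,
  times the length 3 of its support.\<close>

lemma integral_abs_step2:
  assumes "n > 0"
  shows "integrable lborel (\<lambda>l. \<bar>step2 ((l - m) / n)\<bar> / n\<^sup>2)" "(\<integral>l. \<bar>step2 ((l - m) / n)\<bar> / n\<^sup>2 \<partial>lborel) \<le> 18 / n"
proof -
  have m[measurable]: "step2 \<in> borel_measurable borel"
    by (rule borel_measurable_continuous_onI[OF continuous_step(1)])
  have b: "\<bar>step2 t\<bar> \<le> 6 * indicator {0..3} t" for t
  proof (cases "t \<in> {0..3}")
    case True
    then show ?thesis by (auto simp: step2_def ppow_def max_def)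
  next
    case False
    then show ?thesis using step_le_0(3)[of t] step_ge_3(3)[of t] by auto
  qed
  have le: "\<bar>step2 ((l - m) / n)\<bar> / n\<^sup>2 \<le> 6 / n\<^sup>2 * indicator {m..m + 3 * n} l" for l
  proof -
    have "indicator {0..3} ((l - m) / n) = (indicator {m..m + 3 * n} l :: real)"
      using assms by (auto simp: indicator_def field_simps)
    with b[of "(l - m) / n"] have "\<bar>step2 ((l - m) / n)\<bar> \<le> 6 * indicator {m..m + 3 * n} l" by simp
    from divide_right_mono[OF this, of "n\<^sup>2"] show ?thesis by simp
  qed
  have i: "integrable lborel (\<lambda>l. 6 / n\<^sup>2 * indicator {m..m + 3 * n} l :: real)"
    by (rule integrable_mult_right, rule integrable_real_indicator) (auto simp: emeasure_lborel_Icc_eq)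
  show i2: "integrable lborel (\<lambda>l. \<bar>step2 ((l - m) / n)\<bar> / n\<^sup>2)"
    by (rule Bochner_Integration.integrable_bound[OF i]) (use le in \<open>auto intro!: AE_I2 simp: abs_divide\<close>)
  have "(\<integral>l. \<bar>step2 ((l - m) / n)\<bar> / n\<^sup>2 \<partial>lborel) \<le> (\<integral>l. 6 / n\<^sup>2 * indicator {m..m + 3 * n} l \<partial>lborel)"
    by (rule integral_mono[OF i2 i le])
  also have "\<dots> = 18 / n" using assms by (simp add: power2_eq_square)
  finally show "(\<integral>l. \<bar>step2 ((l - m) / n)\<bar> / n\<^sup>2 \<partial>lborel) \<le> 18 / n" .
qed

text \<open>The field \<xi> grad w - w grad \<xi>, extended by 0 over the singular set, is C1
  because \<xi> vanishes near \<open>Z\<close>, and it has compact support. Its divergence is the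
  integrand. \<open>X b\<close> is its component in direction b and \<open>Y b\<close> the
  derivative of that component.\<close>

lemma green_identity:
  fixes w \<xi> :: "'a::euclidean_space \<Rightarrow> real"
  assumes Z: "closed Z" and w: "Ck_on 2 (- Z) w" and \<xi>: "Ck_on 2 UNIV \<xi>"
    and U: "open U" "Z \<subseteq> U" "\<And>x. x \<in> U \<Longrightarrow> \<xi> x = 0"
    and supp: "(\<forall>x. R < norm x \<longrightarrow> w x = 0) \<or> (\<forall>x. R < norm x \<longrightarrow> \<xi> x = 0)"
  shows "(\<integral>x. \<xi> x * laplacian w x - w x * laplacian \<xi> x \<partial>lborel) = 0"
proof -
  have oZ: "open (- Z)" using Z by (simp add: open_Compl)
  from Ck_on_2E[OF w] obtain w' w'' where w':
    "\<And>x. x \<in> - Z \<Longrightarrow> (w has_derivative w' x) (at x)"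
    "\<And>x b. x \<in> - Z \<Longrightarrow> b \<in> Basis \<Longrightarrow> ((\<lambda>x. w' x b) has_derivative w'' x b) (at x)"
    "\<And>b c. b \<in> Basis \<Longrightarrow> c \<in> Basis \<Longrightarrow> continuous_on (- Z) (\<lambda>x. w'' x b c)"
    "\<And>b. b \<in> Basis \<Longrightarrow> continuous_on (- Z) (\<lambda>x. w' x b)" by metis
  from Ck_on_2E[OF \<xi>] obtain c' c'' where c':
    "\<And>x. x \<in> UNIV \<Longrightarrow> (\<xi> has_derivative c' x) (at x)"
    "\<And>x b. x \<in> UNIV \<Longrightarrow> b \<in> Basis \<Longrightarrow> ((\<lambda>x. c' x b) has_derivative c'' x b) (at x)"
    "\<And>b c. b \<in> Basis \<Longrightarrow> c \<in> Basis \<Longrightarrow> continuous_on UNIV (\<lambda>x. c'' x b c)"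
    "\<And>b. b \<in> Basis \<Longrightarrow> continuous_on UNIV (\<lambda>x. c' x b)" by metis
  have c0: "c' x = (\<lambda>_. 0)" if "x \<in> U" for x
  proof -
    have "((\<lambda>_. 0) has_derivative c' x) (at x)"
      by (rule has_derivative_transform_within_open[OF c'(1) U(1) that]) (use U(3) in auto)
    then show ?thesis using has_derivative_unique has_derivative_const by blast
  qed
  have c00: "c'' x b = (\<lambda>_. 0)" if "x \<in> U" "b \<in> Basis" for x b
  proof -
    have "((\<lambda>_. 0) has_derivative c'' x b) (at x)"
      by (rule has_derivative_transform_within_open[OF c'(2)[OF _ that(2)] U(1) that(1)]) (use c0 in auto)
    then show ?thesis using has_derivative_unique has_derivative_const by blast
  qed
  define X where "X b x = (if x \<in> Z then 0 else \<xi> x * w' x b - w x * c' x b)" for b x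
  define Y where "Y b x h = (if x \<in> Z then 0 else (\<xi> x * w'' x b h + c' x h * w' x b) - (w x * c'' x b h + w' x h * c' x b))" for b x h
  have X0: "X b x = 0" if "x \<in> U" for b x using that U(3) c0 by (simp add: X_def)
  have Y0: "Y b x h = 0" if "x \<in> U" "b \<in> Basis" for b x h using that U(3) c0 c00 by (simp add: Y_def)
  have D: "(X b has_derivative Y b x) (at x)" if b: "b \<in> Basis" for b x
  proof (cases "x \<in> U")
    case True
    have "Y b x = (\<lambda>_. 0)" using Y0[OF True b] by blast
    then have "((\<lambda>_. 0) has_derivative Y b x) (at x)" by simp
    then show ?thesis by (rule has_derivative_transform_within_open[OF _ U(1) True]) (simp add: X0)
  next
    case False
    then have x: "x \<in> - Z" using U(2) by auto
    have "((\<lambda>x. \<xi> x * w' x b - w x * c' x b) has_derivative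
      (\<lambda>h. (\<xi> x * w'' x b h + c' x h * w' x b) - (w x * c'' x b h + w' x h * c' x b))) (at x)"
      by (rule has_derivative_diff[OF has_derivative_mult[OF c'(1)[OF UNIV_I] w'(2)[OF x b]]
            has_derivative_mult[OF w'(1)[OF x] c'(2)[OF UNIV_I b]]])
    moreover have "(\<lambda>h. (\<xi> x * w'' x b h + c' x h * w' x b) - (w x * c'' x b h + w' x h * c' x b)) = Y b x"
      using x by (auto simp: Y_def)
    ultimately have "((\<lambda>x. \<xi> x * w' x b - w x * c' x b) has_derivative Y b x) (at x)" by simp
    then show ?thesis by (rule has_derivative_transform_within_open[OF _ oZ x]) (simp add: X_def)
  qed
  have contY: "continuous_on UNIV (\<lambda>x. Y b x b)" if b: "b \<in> Basis" for b
  proof -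
    have "continuous_on U (\<lambda>x. Y b x b)"
      by (rule continuous_on_eq[of _ "\<lambda>_. 0"]) (auto simp: Y0 b)
    moreover have "continuous_on (- Z) (\<lambda>x. Y b x b)"
    proof (rule continuous_on_eq)
      show "continuous_on (- Z) (\<lambda>x. (\<xi> x * w'' x b b + c' x b * w' x b) - (w x * c'' x b b + w' x b * c' x b))"
        by (intro continuous_intros w'(3,4) b continuous_on_subset[OF c'(3)] continuous_on_subset[OF c'(4)]
            continuous_on_subset[OF Ck_on_imp_continuous_on[OF \<xi>]] Ck_on_imp_continuous_on[OF w] subset_UNIV)
    qed (auto simp: Y_def)
    moreover have "U \<union> - Z = UNIV" using U(2) by auto
    ultimately show ?thesis using continuous_on_open_Un[OF U(1) oZ, of "\<lambda>x. Y b x b"] by simp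
  qed
  have XR: "X b x = 0" if "R < norm x" for b x
  proof (cases "x \<in> Z")
    case False
    have op: "open (- Z \<inter> {x. R < norm x})" "open {x. R < norm x}" by (intro open_Int oZ open_Collect_less continuous_intros)+
    have z: "f' = (\<lambda>_. 0)" if "(f has_derivative f') (at x)" "\<And>y. y \<in> - Z \<inter> {x. R < norm x} \<Longrightarrow> f y = 0" for f :: "'a \<Rightarrow> real" and f'
    proof -
      have "((\<lambda>_. 0) has_derivative f') (at x)"
        by (rule has_derivative_transform_within_open[OF that(1) op(1)]) (use that(2) \<open>R < norm x\<close> False in auto)
      then show ?thesis using has_derivative_unique has_derivative_const by blast
    qed
    from supp show ?thesis
    proof
      assume s: "\<forall>x. R < norm x \<longrightarrow> w x = 0"
      then have "w' x = (\<lambda>_. 0)" by (intro z[OF w'(1)]) (use False in auto)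
      with s that show ?thesis by (simp add: X_def)
    next
      assume s: "\<forall>x. R < norm x \<longrightarrow> \<xi> x = 0"
      then have "c' x = (\<lambda>_. 0)" by (intro z[OF c'(1)]) auto
      with s that show ?thesis by (simp add: X_def)
    qed
  qed (simp add: X_def)
  have YR: "Y b x b = 0" if b: "b \<in> Basis" "R < norm x" for b x
  proof -
    have "((\<lambda>_. 0) has_derivative Y b x) (at x)"
      by (rule has_derivative_transform_within_open[OF D[OF b(1)], where s="{x. R < norm x}"])
         (use XR that in \<open>auto intro!: open_Collect_less continuous_intros\<close>)
    then have "Y b x = (\<lambda>_. 0)" using has_derivative_unique has_derivative_const by blast
    then show ?thesis by simp
  qed
  have int: "integrable lborel (\<lambda>x. Y b x b)" if "b \<in> Basis" for b
    by (rule integrable_compact_support[OF contY[OF that] YR[OF that]])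
  have "(\<integral>x. Y b x b \<partial>lborel) = 0" if "b \<in> Basis" for b
    by (rule integral_partial_derivative_eq_0[OF D[OF that] contY[OF that] XR])
  then have "(\<integral>x. (\<Sum>b\<in>Basis. Y b x b) \<partial>lborel) = 0"
    by (subst Bochner_Integration.integral_sum) (auto intro: int)
  moreover have "(\<Sum>b\<in>Basis. Y b x b) = \<xi> x * laplacian w x - w x * laplacian \<xi> x" for x
  proof -
    have lc: "laplacian \<xi> x = (\<Sum>b\<in>Basis. c'' x b b)"
      by (rule laplacian_eqI[OF open_UNIV UNIV_I c'(1) c'(2)]) auto
    show ?thesis
    proof (cases "x \<in> U")
      case True
      then show ?thesis using Y0[OF True] U(3) c00 lc by simp
    next
      case False
      then have x: "x \<in> - Z" using U(2) by auto
      have lw: "laplacian w x = (\<Sum>b\<in>Basis. w'' x b b)"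
        by (rule laplacian_eqI[OF oZ x w'(1) w'(2)[OF x]])
      show ?thesis unfolding lc lw using x
        by (simp add: Y_def sum_distrib_left sum_subtractf[symmetric] sum.distrib[symmetric] algebra_simps)
    qed
  qed
  ultimately show ?thesis by simp
qed

lemma frechet_derivative_compose_real:
  assumes "(f has_derivative f') (at x)" "(F has_real_derivative F') (at (f x))"
  shows "((\<lambda>x. F (f x)) has_derivative (\<lambda>h. F' * f' h)) (at x)"
    "frechet_derivative (\<lambda>x. F (f x)) (at x) = (\<lambda>h. F' * f' h)"
proof -
  show D: "((\<lambda>x. F (f x)) has_derivative (\<lambda>h. F' * f' h)) (at x)"
    by (rule has_derivative_compose[OF assms(1)]) (use assms(2) in \<open>simp add: has_field_derivative_def\<close>)
  show "frechet_derivative (\<lambda>x. F (f x)) (at x) = (\<lambda>h. F' * f' h)"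
    using frechet_derivative_at[OF D] by simp
qed

lemma frechet_derivative_cong:
  fixes f g :: "'a::euclidean_space \<Rightarrow> real"
  assumes "open S" "z \<in> S" "\<And>y. y \<in> S \<Longrightarrow> f y = g y"
  shows "frechet_derivative f (at z) = frechet_derivative g (at z)"
proof -
  have "(f has_derivative D) (at z) \<longleftrightarrow> (g has_derivative D) (at z)" for D
    using has_derivative_transform_within_open[OF _ assms(1,2), of f D UNIV g]
      has_derivative_transform_within_open[OF _ assms(1,2), of g D UNIV f] assms(3) by metis
  then show ?thesis unfolding frechet_derivative_def by simp
qed

text \<open>A logarithmic cutoff: it rises from 0 to 1 while |z - c| goes from r exp (-3 n) to r, so
  the transition takes length 3 n in ln |z - c|. The value at \<open>c\<close> is fixed separately
  because \<open>ln 0\<close> has the default value 0.\<close>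

definition cut :: "complex \<Rightarrow> real \<Rightarrow> real \<Rightarrow> complex \<Rightarrow> real" where
  "cut c r n z = (if z = c then 0 else step ((ln (cmod (z - c)) - (ln r - 3 * n)) / n))"

lemma cut_eq:
  assumes "n > 0" "r > 0"
  shows "cmod (z - c) \<le> r * exp (- 3 * n) \<Longrightarrow> cut c r n z = 0" "cmod (z - c) \<ge> r \<Longrightarrow> cut c r n z = 1"
proof -
  show "cut c r n z = 0" if "cmod (z - c) \<le> r * exp (- 3 * n)"
  proof (cases "z = c")
    case False
    then have "ln (cmod (z - c)) \<le> ln (r * exp (- 3 * n))" using that assms by (subst ln_le_cancel_iff) auto
    also have "\<dots> = ln r - 3 * n" using assms by (subst ln_mult) auto
    finally show ?thesis using assms by (auto simp: cut_def intro!: step_le_0 divide_nonpos_pos)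
  qed (simp add: cut_def)
  show "cut c r n z = 1" if "cmod (z - c) \<ge> r"
  proof -
    have "z \<noteq> c" using that assms by auto
    moreover have "ln r \<le> ln (cmod (z - c))" using that assms by (subst ln_le_cancel_iff) auto
    ultimately show ?thesis using assms by (auto simp: cut_def field_simps intro!: step_ge_3)
  qed
qed

lemma cut_bounds: "0 \<le> cut c r n z" "cut c r n z \<le> 1"
  using step_bounds by (auto simp: cut_def)

lemma cut_derivatives:
  assumes "n > 0" "z \<noteq> c"
  shows "laplacian (cut c r n) z = step2 ((ln (cmod (z - c)) - (ln r - 3 * n)) / n) / n\<^sup>2 / (cmod (z - c))\<^sup>2"
    and "(\<Sum>b\<in>Basis. (frechet_derivative (cut c r n) (at z) b)\<^sup>2) = (step1 ((ln (cmod (z - c)) - (ln r - 3 * n)) / n) / (n * cmod (z - c)))\<^sup>2"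
proof -
  define m where "m = ln r - 3 * n"
  let ?F = "\<lambda>t. step ((t - m) / n)"
  have d: "((\<lambda>t. (t - m) / n) has_real_derivative 1 / n) (at t)" for t
    using assms by (auto intro!: derivative_eq_intros)
  have F1: "(?F has_real_derivative step1 ((t - m) / n) / n) (at t)" for t
    using DERIV_chain2[OF DERIV_step d] by simp
  have "((\<lambda>t. step1 ((t - m) / n) * (1 / n)) has_real_derivative step2 ((t - m) / n) * (1 / n) * (1 / n)) (at t)" for t
    by (rule DERIV_cmult_right[OF DERIV_chain2[OF DERIV_step1 d]])
  then have F2: "((\<lambda>t. step1 ((t - m) / n) / n) has_real_derivative step2 ((t - m) / n) / n\<^sup>2) (at t)" for t
    by (simp add: power2_eq_square)
  have eq: "cut c r n y = ?F (ln (cmod (y - c)))" if "y \<in> - {c}" for y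
    using that by (simp add: cut_def m_def)
  have oc: "open (- {c})" "z \<in> - {c}" using assms by auto
  have "laplacian (cut c r n) z = laplacian (\<lambda>y. ?F (ln (cmod (y - c)))) z"
    by (rule laplacian_cong[OF oc eq])
  also have "\<dots> = step2 ((ln (cmod (z - c)) - m) / n) / n\<^sup>2 / (cmod (z - c))\<^sup>2"
    by (rule laplacian_radial[OF assms(2) F1 F2])
  finally show "laplacian (cut c r n) z = step2 ((ln (cmod (z - c)) - (ln r - 3 * n)) / n) / n\<^sup>2 / (cmod (z - c))\<^sup>2"
    by (simp add: m_def)
  have nz: "\<And>z. z \<in> - {c} \<Longrightarrow> z - c \<noteq> 0" by auto
  have hol: "(\<lambda>z. z - c) holomorphic_on - {c}" by (auto intro!: holomorphic_intros)
  have dz: "deriv (\<lambda>z. z - c) z = 1" by (auto intro!: DERIV_imp_deriv derivative_eq_intros)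
  have lnd: "((\<lambda>y. ln (cmod (y - c))) has_derivative (\<lambda>b. Re (1 / (z - c) * b))) (at z)"
    by (rule has_derivative_ln_cmod) (use assms in \<open>auto intro!: derivative_eq_intros\<close>)
  have "frechet_derivative (cut c r n) (at z) = frechet_derivative (\<lambda>y. ?F (ln (cmod (y - c)))) (at z)"
    by (rule frechet_derivative_cong[OF oc eq])
  also have "\<dots> = (\<lambda>h. step1 ((ln (cmod (z - c)) - m) / n) / n * Re (1 / (z - c) * h))"
    by (rule frechet_derivative_compose_real(2)[OF lnd F1])
  finally have "(\<Sum>b\<in>Basis. (frechet_derivative (cut c r n) (at z) b)\<^sup>2) =
      (step1 ((ln (cmod (z - c)) - m) / n) / n)\<^sup>2 * (\<Sum>b\<in>Basis. (Re (1 / (z - c) * b))\<^sup>2)"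
    by (simp only: power_mult_distrib sum_distrib_left)
  also have "(\<Sum>b\<in>Basis. (Re (1 / (z - c) * b))\<^sup>2) = (\<Sum>b\<in>Basis. (frechet_derivative (\<lambda>y. ln (cmod (y - c))) (at z) b)\<^sup>2)"
    unfolding frechet_derivative_at[OF lnd, symmetric] ..
  also have "\<dots> = 1 / (cmod (z - c))\<^sup>2"
    using laplacian_ln_cmod(2)[OF oc(1) hol nz oc(2)] dz by (simp add: norm_divide power_divide)
  finally show "(\<Sum>b\<in>Basis. (frechet_derivative (cut c r n) (at z) b)\<^sup>2) = (step1 ((ln (cmod (z - c)) - (ln r - 3 * n)) / n) / (n * cmod (z - c)))\<^sup>2"
    by (simp add: m_def power_divide power_mult_distrib)
qed

lemma Ck_on_cut:
  assumes "n > 0" "r > 0"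
  shows "Ck_on 2 UNIV (cut c r n)"
proof (rule Ck_on_localI)
  fix z
  show "\<exists>U. open U \<and> z \<in> U \<and> Ck_on 2 U (cut c r n)"
  proof (cases "z = c")
    case True
    have "Ck_on 2 (ball c (r * exp (- 3 * n))) (cut c r n)"
      by (rule Ck_on_cong[OF open_ball _ Ck_on_const[of _ _ 0]])
         (use cut_eq(1)[OF assms] in \<open>auto simp: dist_norm norm_minus_commute less_imp_le\<close>)
    then show ?thesis using True assms by (intro exI[of _ "ball c (r * exp (- 3 * n))"]) auto
  next
    case False
    have oc: "open (- {c})" by auto
    have L: "Ck_on 2 (- {c}) (\<lambda>z. ln (cmod (z - c)))"
      by (rule Ck_on_ln_cmod) (auto intro!: holomorphic_intros)
    have "Ck_on 2 (- {c}) (\<lambda>z. (ln (cmod (z - c)) - (ln r - 3 * n)) * (1 / n))"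
      by (intro Ck_on_mult Ck_on_diff L oc Ck_on_const)
    then have "Ck_on 2 (- {c}) (\<lambda>z. step ((ln (cmod (z - c)) - (ln r - 3 * n)) * (1 / n)))"
      by (rule Ck_on_compose[OF oc _ Ck_on_step(1)]) simp
    then have "Ck_on 2 (- {c}) (cut c r n)"
      by (rule Ck_on_cong[OF oc, rotated]) (auto simp: cut_def)
    then show ?thesis using False oc by blast
  qed
qed

section \<open>Superlevel sets of conic metrics on the plane\<close>

text \<open>In logarithmic polar coordinates the Laplacian of the cutoff becomes a weight on the
  line. The logarithm contributes exactly -2\<pi> a, the remainder at most C times the L1 norm, that
  is C times 2\<pi> * 18 / n.\<close>

lemma cut_laplacian_integral:
  assumes n: "n > 0" and r: "r > 0" and [measurable]: "w \<in> borel_measurable borel"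
    and w: "\<And>z. r * exp (- 3 * n) \<le> cmod (z - c) \<Longrightarrow> cmod (z - c) \<le> r \<Longrightarrow> \<bar>w z - a * ln (cmod (z - c))\<bar> \<le> C"
    and C: "C \<ge> 0"
  shows "integrable lborel (\<lambda>z. w z * laplacian (cut c r n) z)"
    and "\<bar>(\<integral>z. w z * laplacian (cut c r n) z \<partial>lborel) + 2 * pi * a\<bar> \<le> 36 * pi * C / n"
proof -
  define m where "m = ln r - 3 * n"
  define H where "H l = step2 ((l - m) / n) / n\<^sup>2" for l
  let ?L = "\<lambda>z. ln (cmod (z - c))"
  have [measurable]: "step2 \<in> borel_measurable borel"
    by (rule borel_measurable_continuous_onI[OF continuous_step(1)])
  have mH[measurable]: "H \<in> borel_measurable borel" unfolding H_def by measurable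
  note I1 = integral_step2[OF n, of m]
  note I2 = integral_abs_step2[OF n, of m]
  have absH: "\<bar>H l\<bar> = \<bar>step2 ((l - m) / n)\<bar> / n\<^sup>2" for l by (simp add: H_def)
  have i1: "integrable lborel (\<lambda>z. (?L z * H (?L z)) / (cmod (z - c))\<^sup>2)"
    "(\<integral>z. (?L z * H (?L z)) / (cmod (z - c))\<^sup>2 \<partial>lborel) = - 2 * pi"
  proof -
    have "integrable lborel (\<lambda>l. l * H l)" "(\<integral>l. l * H l \<partial>lborel) = - 1"
      using I1 by (simp_all add: has_bochner_integral_iff H_def)
    then show "integrable lborel (\<lambda>z. (?L z * H (?L z)) / (cmod (z - c))\<^sup>2)"
      "(\<integral>z. (?L z * H (?L z)) / (cmod (z - c))\<^sup>2 \<partial>lborel) = - 2 * pi"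
      using integral_ln_cmod[of "\<lambda>l. l * H l" c] by simp_all
  qed
  have i2: "integrable lborel (\<lambda>z. \<bar>H (?L z)\<bar> / (cmod (z - c))\<^sup>2)"
    "(\<integral>z. \<bar>H (?L z)\<bar> / (cmod (z - c))\<^sup>2 \<partial>lborel) \<le> 2 * pi * (18 / n)"
  proof -
    have i: "integrable lborel (\<lambda>l. \<bar>H l\<bar>)" "(\<integral>l. \<bar>H l\<bar> \<partial>lborel) \<le> 18 / n"
      unfolding absH by (rule I2)+
    have "(\<integral>z. \<bar>H (?L z)\<bar> / (cmod (z - c))\<^sup>2 \<partial>lborel) = 2 * pi * (\<integral>l. \<bar>H l\<bar> \<partial>lborel)"
      by (rule integral_ln_cmod(1)) simp
    also have "\<dots> \<le> 2 * pi * (18 / n)" by (rule mult_left_mono[OF i(2)]) simp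
    finally show "(\<integral>z. \<bar>H (?L z)\<bar> / (cmod (z - c))\<^sup>2 \<partial>lborel) \<le> 2 * pi * (18 / n)" .
    show "integrable lborel (\<lambda>z. \<bar>H (?L z)\<bar> / (cmod (z - c))\<^sup>2)"
      using integral_ln_cmod(2)[of "\<lambda>l. \<bar>H l\<bar>" c] i(1) by simp
  qed
  define E where "E z = (w z - a * ?L z) * H (?L z) / (cmod (z - c))\<^sup>2" for z
  have Eb: "norm (E z) \<le> norm (C * (\<bar>H (?L z)\<bar> / (cmod (z - c))\<^sup>2))" if zc: "z \<noteq> c" for z
  proof (cases "r * exp (- 3 * n) \<le> cmod (z - c) \<and> cmod (z - c) \<le> r")
    case True
    then have "\<bar>w z - a * ?L z\<bar> \<le> C" using w by blast
    then have "\<bar>w z - a * ?L z\<bar> * (\<bar>H (?L z)\<bar> / (cmod (z - c))\<^sup>2) \<le> C * (\<bar>H (?L z)\<bar> / (cmod (z - c))\<^sup>2)"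
      by (rule mult_right_mono) simp
    then show ?thesis using C by (simp add: E_def abs_mult)
  next
    case False
    have "H (?L z) = 0"
    proof (cases "cmod (z - c) \<le> r")
      case True
      with False have "cmod (z - c) < r * exp (- 3 * n)" by simp
      then have "?L z < ln (r * exp (- 3 * n))" using zc r by (subst ln_less_cancel_iff) auto
      also have "\<dots> = m" using r by (subst ln_mult) (auto simp: m_def)
      finally show ?thesis using n by (auto simp: H_def intro!: step_le_0 divide_nonpos_pos)
    next
      case False
      then have "ln r < ?L z" using zc r by (subst ln_less_cancel_iff) auto
      then have "(?L z - m) / n \<ge> 3" using n by (simp add: m_def field_simps)
      then show ?thesis by (simp add: H_def step_ge_3)
    qed
    then show ?thesis by (simp add: E_def)
  qed
  have [measurable]: "E \<in> borel_measurable borel" unfolding E_def[abs_def] by measurable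
  have aec: "AE z in lborel. z \<noteq> c" by (rule AE_lborel_singleton)
  have iE: "integrable lborel E"
  proof (rule Bochner_Integration.integrable_bound[OF integrable_mult_right[OF i2(1), of C]])
    show "AE z in lborel. norm (E z) \<le> norm (C * (\<bar>H (?L z)\<bar> / (cmod (z - c))\<^sup>2))"
      using aec by eventually_elim (rule Eb)
  qed (auto simp: E_def)
  have "\<bar>\<integral>z. E z \<partial>lborel\<bar> \<le> (\<integral>z. \<bar>E z\<bar> \<partial>lborel)" by (rule integral_abs_bound)
  also have "\<dots> \<le> (\<integral>z. C * (\<bar>H (?L z)\<bar> / (cmod (z - c))\<^sup>2) \<partial>lborel)"
  proof (rule integral_mono_AE)
    show "AE z in lborel. \<bar>E z\<bar> \<le> C * (\<bar>H (?L z)\<bar> / (cmod (z - c))\<^sup>2)"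
      using aec
    proof eventually_elim
      case (elim z)
      show ?case using Eb[OF elim] C by simp
    qed
    show "integrable lborel (\<lambda>z. C * (\<bar>H (?L z)\<bar> / (cmod (z - c))\<^sup>2))" by (rule integrable_mult_right[OF i2(1)])
  qed (use iE in auto)
  also have "\<dots> \<le> C * (2 * pi * (18 / n))" using i2(2) C by (simp only: integral_mult_right_zero mult_left_mono)
  finally have Ei: "\<bar>\<integral>z. E z \<partial>lborel\<bar> \<le> 36 * pi * C / n" by (simp add: mult_ac)
  have eq: "AE z in lborel. a * ((?L z * H (?L z)) / (cmod (z - c))\<^sup>2) + E z = w z * laplacian (cut c r n) z"
    using aec
  proof eventually_elim
    case (elim z)
    have "laplacian (cut c r n) z = H (?L z) / (cmod (z - c))\<^sup>2"
      using cut_derivatives(1)[OF n elim, of r] by (simp add: H_def m_def)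
    then show ?case by (simp add: E_def left_diff_distrib diff_divide_distrib mult.assoc)
  qed
  have meas: "(\<lambda>z. w z * laplacian (cut c r n) z) \<in> borel_measurable borel"
  proof -
    \<comment> \<open>Naming the value at the single point \<open>c\<close> exhibits the Laplacian
      as a piecewise measurable function.\<close>
    define K where "K = laplacian (cut c r n) c"
    have "laplacian (cut c r n) z = (if z = c then K else H (?L z) / (cmod (z - c))\<^sup>2)" for z
      using cut_derivatives(1)[OF n, of z c r] by (simp add: H_def m_def K_def)
    then show ?thesis by simp
  qed
  have int: "integrable lborel (\<lambda>z. a * ((?L z * H (?L z)) / (cmod (z - c))\<^sup>2) + E z)"
    by (intro Bochner_Integration.integrable_add integrable_mult_right i1 iE)
  show "integrable lborel (\<lambda>z. w z * laplacian (cut c r n) z)"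
    using integrable_cong_AE_imp[OF int _ eq] meas by simp
  have "(\<integral>z. w z * laplacian (cut c r n) z \<partial>lborel) = (\<integral>z. a * ((?L z * H (?L z)) / (cmod (z - c))\<^sup>2) + E z \<partial>lborel)"
    by (rule integral_cong_AE) (use meas eq int in \<open>auto elim!: eventually_mono\<close>)
  also have "\<dots> = a * (- 2 * pi) + (\<integral>z. E z \<partial>lborel)"
    unfolding Bochner_Integration.integral_add[OF integrable_mult_right[OF i1(1), of a] iE]
      integral_mult_right_zero i1(2) ..
  finally show "\<bar>(\<integral>z. w z * laplacian (cut c r n) z \<partial>lborel) + 2 * pi * a\<bar> \<le> 36 * pi * C / n"
    using Ei by simp
qed

text \<open>The choice t = sqrt (E / D) makes the bound sqrt (D E). The form linear in D and E is
  the one that passes to the limit in the cutoffs for fixed t, so Cauchy-Schwarz is reached this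
  way.\<close>

lemma AM_GM_to_CS:
  fixes X D E :: real
  assumes "\<And>t. t > 0 \<Longrightarrow> X \<le> (t * D + E / t) / 2" "0 \<le> X" "0 \<le> D" "0 \<le> E"
  shows "X\<^sup>2 \<le> D * E"
proof (cases "D = 0 \<or> E = 0")
  case True
  have "X \<le> e" if "e > 0" for e
  proof (cases "D = 0")
    case True
    \<comment> \<open>For D = 0 the parameter is sent to infinity as e shrinks; E + 1 in place of E
      keeps it positive.\<close>
    have "X \<le> ((E + 1) / e * D + E / ((E + 1) / e)) / 2"
      using that assms(4) by (intro assms(1) divide_pos_pos) auto
    also have "\<dots> = e * (E / (E + 1)) / 2" using True that by simp
    also have "\<dots> \<le> e * 1 / 2" using assms(4) that by (intro divide_right_mono mult_left_mono) auto
    finally show ?thesis using that by simp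
  next
    case False
    then have "E = 0" "D > 0" using \<open>D = 0 \<or> E = 0\<close> assms(3) by auto
    then show ?thesis using assms(1)[of "e / D"] that by simp
  qed
  then have "X \<le> 0" by (rule field_le_epsilon[of X 0, simplified])
  then have "X = 0" using assms(2) by simp
  then show ?thesis using assms by simp
next
  case False
  then have p: "D > 0" "E > 0" using assms by auto
  define t where "t = sqrt E / sqrt D"
  have t: "t > 0" using p by (simp add: t_def)
  have "t * D = sqrt E * (D / sqrt D)" by (simp add: t_def)
  then have "t * D = sqrt E * sqrt D" using p by (simp add: real_div_sqrt)
  moreover have "E / t = (E / sqrt E) * sqrt D" by (simp add: t_def)
  then have "E / t = sqrt E * sqrt D" using p by (simp add: real_div_sqrt)
  ultimately have "X \<le> sqrt E * sqrt D" using assms(1)[OF t] by (simp add: mult.commute)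
  then have "X\<^sup>2 \<le> (sqrt E * sqrt D)\<^sup>2" using assms(2) by (intro power_mono) auto
  then show ?thesis using p by (simp add: power_mult_distrib mult.commute)
qed

text \<open>The metric \<rho> |dz|^2 in the finite chart, with cone points of order
  \<open>b c\<close> at the points c of \<open>Z\<close> and of order \<beta> at infinity. With w =
  1 / z the form |w|^(2 \<beta>) |dw|^2 is |z|^(-2 (2 + \<beta>)) |dz|^2, whence the coefficient 2 +
  \<beta>. The curvature bound is written multiplied by \<rho>.\<close>

locale conic_plane =
  fixes \<rho> :: "complex \<Rightarrow> real" and Z :: "complex set" and b :: "complex \<Rightarrow> real" and \<beta> :: real
  assumes finZ: "finite Z"
    and b_le: "\<And>c. c \<in> Z \<Longrightarrow> b c \<le> 0"
    and Ck_rho: "Ck_on 2 (- Z) \<rho>"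
    and rho_pos: "\<And>z. z \<notin> Z \<Longrightarrow> \<rho> z > 0"
    and curv: "\<And>z. z \<notin> Z \<Longrightarrow> \<bar>laplacian (\<lambda>w. ln (\<rho> w) / 2) z\<bar> \<le> \<rho> z"
    and near: "\<And>c. c \<in> Z \<Longrightarrow> \<exists>C \<delta>. \<delta> > 0 \<and> (\<forall>z. 0 < cmod (z - c) \<and> cmod (z - c) < \<delta> \<longrightarrow>
        \<bar>ln (\<rho> z) / 2 - b c * ln (cmod (z - c))\<bar> \<le> C)"
    and infty: "\<exists>C R. \<forall>z. cmod z > R \<longrightarrow> \<bar>ln (\<rho> z) / 2 + (2 + \<beta>) * ln (cmod z)\<bar> \<le> C"
    and beta: "\<beta> > - 1"
    and rho_int: "integrable lborel \<rho>"
begin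

definition u where "u z = ln (\<rho> z) / 2"
text \<open>The curvature form, that is Gaussian curvature times area density; its integral is the
  total curvature.\<close>

definition \<kappa> where "\<kappa> z = (if z \<in> Z then 0 else - laplacian u z)"
definition total_b where "total_b = (\<Sum>c\<in>Z. b c)"

lemma openZ: "open (- Z)"
  using finZ by (simp add: finite_imp_closed open_Compl)

lemma AE_off_Z: "AE z in lborel. z \<notin> Z"
  using finite_imp_null_set_lborel[OF finZ] by (rule AE_not_in)

lemma measurable_off_Z:
  assumes "continuous_on (- Z) g"
  shows "(\<lambda>z. if z \<in> Z then 0 else g z :: real) \<in> borel_measurable borel"
proof -
  have "(\<lambda>z. indicator (- Z) z *\<^sub>R g z) \<in> borel_measurable borel"
    by (rule borel_measurable_continuous_on_indicator) (use assms openZ in auto)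
  moreover have "(\<lambda>z. indicator (- Z) z *\<^sub>R g z) = (\<lambda>z. if z \<in> Z then 0 else g z)"
    by (auto simp: indicator_def)
  ultimately show ?thesis by simp
qed

lemma Ck_u: "Ck_on 2 (- Z) u"
proof -
  have "Ck_on 2 (- Z) (\<lambda>z. ln (\<rho> z) * (1/2))"
    by (intro Ck_on_mult Ck_on_ln' Ck_on_const openZ Ck_rho) (use rho_pos in auto)
  then show ?thesis by (simp add: u_def[abs_def])
qed

lemma u_measurable [measurable]: "u \<in> borel_measurable borel"
  unfolding u_def[abs_def] using rho_int by simp

lemma exp_u: "z \<notin> Z \<Longrightarrow> exp (2 * u z) = \<rho> z"
  using rho_pos[of z] by (simp add: u_def)

lemma kappa_le: "z \<notin> Z \<Longrightarrow> \<bar>\<kappa> z\<bar> \<le> \<rho> z"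
  using curv[of z] by (simp add: \<kappa>_def u_def[abs_def])

lemma kappa_measurable [measurable]: "\<kappa> \<in> borel_measurable borel"
proof -
  have "continuous_on (- Z) (laplacian u)"
    unfolding laplacian_def[abs_def] using Ck_u
    by (intro continuous_on_sum) (auto simp: numeral_2_eq_2)
  from measurable_off_Z[OF continuous_on_minus[OF this]] show ?thesis
    unfolding \<kappa>_def[abs_def] .
qed

lemma kappa_int: "integrable lborel \<kappa>"
proof (rule Bochner_Integration.integrable_bound[OF rho_int])
  show "AE z in lborel. norm (\<kappa> z) \<le> norm (\<rho> z)"
    using AE_off_Z by eventually_elim (use kappa_le in force)
qed simp

section \<open>Disjoint neighbourhoods of the cone points and their cutoffs\<close>

definition separated where
  "separated r \<longleftrightarrow> (\<forall>c\<in>Z. \<forall>c'\<in>Z. c \<noteq> c' \<longrightarrow> 2 * r < cmod (c - c'))"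

definition log_near where
  "log_near r w C \<longleftrightarrow> (\<forall>c\<in>Z. \<forall>z. 0 < cmod (z - c) \<longrightarrow> cmod (z - c) \<le> r \<longrightarrow>
     \<bar>w z - b c * ln (cmod (z - c))\<bar> \<le> C)"

lemma radius:
  obtains r C where "0 < r" "r \<le> 1" "0 \<le> C" "log_near r u C" "separated r"
proof -
  define P where "P c C \<delta> \<longleftrightarrow> \<delta> > 0 \<and> (\<forall>z. 0 < cmod (z - c) \<and> cmod (z - c) < \<delta> \<longrightarrow>
        \<bar>u z - b c * ln (cmod (z - c))\<bar> \<le> C)" for c C \<delta>
  have "\<forall>c\<in>Z. \<exists>C \<delta>. P c C \<delta>" using near unfolding u_def P_def by blast
  from bchoice[OF this] obtain C where "\<forall>c\<in>Z. \<exists>\<delta>. P c (C c) \<delta>" by blast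
  from bchoice[OF this] obtain \<delta> where "\<forall>c\<in>Z. P c (C c) (\<delta> c)" by blast
  then have C: "\<And>c. c \<in> Z \<Longrightarrow> \<delta> c > 0"
    "\<And>c z. c \<in> Z \<Longrightarrow> 0 < cmod (z - c) \<Longrightarrow> cmod (z - c) < \<delta> c \<Longrightarrow> \<bar>u z - b c * ln (cmod (z - c))\<bar> \<le> C c"
    unfolding P_def by blast+
  \<comment> \<open>A quarter of each mutual distance keeps the discs apart, half of each \<delta>
    stays inside the region of the asymptotics, and the entry 1 gives r \<le> 1, so that ln |z - c|
    \<le> 0 on the discs.\<close>
  define S where "S = insert 1 ((\<lambda>c. \<delta> c / 2) ` Z \<union> (\<lambda>(c, c'). cmod (c - c') / 4) ` {p \<in> Z \<times> Z. fst p \<noteq> snd p})"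
  have fS: "finite S" "S \<noteq> {}" using finZ by (auto simp: S_def)
  define r where "r = Min S"
  have r: "r > 0" "\<And>x. x \<in> S \<Longrightarrow> r \<le> x"
  proof -
    have "\<forall>x\<in>S. x > 0" using C(1) by (auto simp: S_def)
    then show "r > 0" using fS by (simp add: r_def)
    show "r \<le> x" if "x \<in> S" for x using fS that by (simp add: r_def)
  qed
  show ?thesis
  proof (rule that[of r "\<Sum>c\<in>Z. \<bar>C c\<bar>"])
    show "r \<le> 1" using r(2)[of 1] by (simp add: S_def)
    have "\<bar>u z - b c * ln (cmod (z - c))\<bar> \<le> (\<Sum>c\<in>Z. \<bar>C c\<bar>)"
      if "c \<in> Z" "0 < cmod (z - c)" "cmod (z - c) \<le> r" for c z
    proof -
      have "\<delta> c / 2 \<in> S" using that by (simp add: S_def)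
      then have "r \<le> \<delta> c / 2" by (rule r(2))
      then have "cmod (z - c) < \<delta> c" using that C(1)[OF that(1)] by linarith
      then have "\<bar>u z - b c * ln (cmod (z - c))\<bar> \<le> \<bar>C c\<bar>" using C(2)[OF that(1,2)] by linarith
      also have "\<dots> \<le> (\<Sum>c\<in>Z. \<bar>C c\<bar>)" using that finZ by (intro member_le_sum) auto
      finally show ?thesis .
    qed
    then show "log_near r u (\<Sum>c\<in>Z. \<bar>C c\<bar>)" unfolding log_near_def by blast
    have "2 * r < cmod (c - c')" if "c \<in> Z" "c' \<in> Z" "c \<noteq> c'" for c c'
    proof -
      have "cmod (c - c') / 4 \<in> S" using that by (force simp: S_def)
      then have "r \<le> cmod (c - c') / 4" by (rule r(2))
      moreover have "cmod (c - c') > 0" using that by simp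
      ultimately show ?thesis by linarith
    qed
    then show "separated r" unfolding separated_def by blast
    show "0 < r" by (rule r(1))
    show "0 \<le> (\<Sum>c\<in>Z. \<bar>C c\<bar>)" by (rule sum_nonneg) simp
  qed
qed

text \<open>For separated cone points the functions 1 - \<open>cut c r n\<close> live on disjoint
  discs, so this agrees with the product of the cutoffs; the additive form makes its derivatives
  plain sums over \<open>Z\<close>.\<close>

definition chi where "chi r n z = 1 - (\<Sum>c\<in>Z. 1 - cut c r n z)"

context
  fixes r n :: real
  assumes r: "r > 0" and n: "n > 0"
    and sep: "separated r"
begin

lemma chi_eq_cut:
  assumes "c \<in> Z" "cmod (z - c) \<le> r"
  shows "chi r n z = cut c r n z"
proof -
  have "1 - cut c' r n z = 0" if "c' \<in> Z - {c}" for c'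
  proof -
    have "2 * r < cmod (c - c')" using sep that assms by (auto simp: separated_def)
    also have "\<dots> \<le> cmod (z - c') + cmod (z - c)" using norm_triangle_ineq4[of "z - c'" "z - c"] by simp
    finally have "r \<le> cmod (z - c')" using assms by linarith
    then show ?thesis using cut_eq(2)[OF n r] by simp
  qed
  then have "(\<Sum>c\<in>Z. 1 - cut c r n z) = 1 - cut c r n z"
    using sum.remove[OF finZ assms(1), of "\<lambda>c. 1 - cut c r n z"] by simp
  then show ?thesis by (simp add: chi_def)
qed

lemma chi_bounds: "0 \<le> chi r n z" "chi r n z \<le> 1"
proof -
  have "0 \<le> chi r n z \<and> chi r n z \<le> 1"
  proof (cases "\<exists>c\<in>Z. cmod (z - c) \<le> r")
    case True
    then show ?thesis using chi_eq_cut cut_bounds by metis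
  next
    case False
    then have "cut c r n z = 1" if "c \<in> Z" for c using cut_eq(2)[OF n r, of z c] that by force
    then show ?thesis by (simp add: chi_def)
  qed
  then show "0 \<le> chi r n z" "chi r n z \<le> 1" by auto
qed

lemma chi_eq_0:
  assumes "z \<in> (\<Union>c\<in>Z. ball c (r * exp (- 3 * n)))"
  shows "chi r n z = 0"
proof -
  obtain c where c: "c \<in> Z" "cmod (z - c) < r * exp (- 3 * n)"
    using assms by (auto simp: dist_norm norm_minus_commute)
  moreover have "r * exp (- 3 * n) \<le> r" using r n by (simp add: mult_left_le)
  ultimately show ?thesis using chi_eq_cut[of c z] cut_eq(1)[OF n r, of z c] by simp
qed

lemma Ck_chi: "Ck_on 2 UNIV (chi r n)"
proof -
  have "Ck_on 2 UNIV (\<lambda>z. 1 - (\<Sum>c\<in>Z. 1 - cut c r n z))"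
    by (rule Ck_on_diff[OF open_UNIV Ck_on_const Ck_on_sum[OF open_UNIV Ck_on_diff[OF open_UNIV Ck_on_const Ck_on_cut[OF n r]]]])
  then show ?thesis by (simp add: chi_def[abs_def])
qed

lemma chi_derivative:
  "frechet_derivative (chi r n) (at z) = (\<lambda>h. \<Sum>c\<in>Z. frechet_derivative (cut c r n) (at z) h)"
proof -
  have d: "(cut c r n has_derivative frechet_derivative (cut c r n) (at z)) (at z)" for c
    using Ck_on_cut[OF n r, of c] by (simp add: numeral_2_eq_2 frechet_derivative_works[symmetric])
  have "((\<lambda>z. 1 - (\<Sum>c\<in>Z. 1 - cut c r n z)) has_derivative
     (\<lambda>h. 0 - (\<Sum>c\<in>Z. 0 - frechet_derivative (cut c r n) (at z) h))) (at z)"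
    by (intro has_derivative_diff has_derivative_const has_derivative_sum d)
  then have "(chi r n has_derivative (\<lambda>h. \<Sum>c\<in>Z. frechet_derivative (cut c r n) (at z) h)) (at z)"
    by (simp add: chi_def[abs_def] sum_negf)
  from frechet_derivative_at[OF this] show ?thesis by simp
qed

lemma laplacian_chi: "laplacian (chi r n) z = (\<Sum>c\<in>Z. laplacian (cut c r n) z)"
proof -
  have "laplacian (chi r n) z = (\<Sum>b\<in>Basis. \<Sum>c\<in>Z. frechet_derivative (\<lambda>y. frechet_derivative (cut c r n) (at y) b) (at z) b)"
    unfolding laplacian_def chi_derivative
  proof (rule sum.cong)
    fix b :: complex assume b: "b \<in> Basis"
    have d: "((\<lambda>y. frechet_derivative (cut c r n) (at y) b) has_derivative
        frechet_derivative (\<lambda>y. frechet_derivative (cut c r n) (at y) b) (at z)) (at z)" for c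
      using Ck_on_cut[OF n r, of c] b by (simp add: numeral_2_eq_2 frechet_derivative_works[symmetric])
    show "frechet_derivative (\<lambda>y. \<Sum>c\<in>Z. frechet_derivative (cut c r n) (at y) b) (at z) b =
        (\<Sum>c\<in>Z. frechet_derivative (\<lambda>y. frechet_derivative (cut c r n) (at y) b) (at z) b)"
      unfolding frechet_derivative_at[OF has_derivative_sum[where I=Z, OF d], symmetric] ..
  qed simp
  also have "\<dots> = (\<Sum>c\<in>Z. laplacian (cut c r n) z)"
    unfolding laplacian_def by (rule sum.swap)
  finally show ?thesis .
qed

text \<open>The gradient of one cutoff has length at most 1 / (n |z - c|) and vanishes for |z - c| >
  r; that bound integrates to 2\<pi> r / n over the disc.\<close>

lemma gradient_chi_integral:
  "(\<integral>z. sqrt ((frechet_derivative (chi r n) (at z) 1)\<^sup>2 + (frechet_derivative (chi r n) (at z) \<i>)\<^sup>2) \<partial>lborel)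
     \<le> 2 * pi * r * card Z / n"
  "integrable lborel (\<lambda>z. sqrt ((frechet_derivative (chi r n) (at z) 1)\<^sup>2 + (frechet_derivative (chi r n) (at z) \<i>)\<^sup>2))"
proof -
  define g where "g f z = sqrt ((frechet_derivative f (at z) 1)\<^sup>2 + (frechet_derivative f (at z) \<i>)\<^sup>2)" for f :: "complex \<Rightarrow> real" and z
  \<comment> \<open>|z - c|^2 times the gradient bound, as a function of l = ln |z - c|; the factor
    compensates the Jacobian of logarithmic polar coordinates.\<close>
  define H where "H l = (exp l / n) * indicator {..ln r} l" for l :: real
  have iH: "has_bochner_integral lborel H (r / n)"
  proof -
    have "(\<integral>\<^sup>+x. ennreal (exp (- x)) * indicator {- ln r..} x \<partial>lborel) = ennreal (0 - (- exp (- (- ln r))))"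
    proof (rule nn_integral_FTC_atLeast)
      show "((\<lambda>x::real. - exp (- x)) \<longlongrightarrow> 0) at_top" by real_asymp
    qed (auto intro!: derivative_eq_intros)
    also have "\<dots> = ennreal r" using r by simp
    finally have *: "(\<integral>\<^sup>+x. ennreal (exp (- x)) * indicator {- ln r..} x \<partial>lborel) = ennreal r" .
    have "(\<integral>\<^sup>+x. ennreal (exp x) * indicator {..ln r} x \<partial>lborel) = (\<integral>\<^sup>+x. ennreal (exp (- x)) * indicator {- ln r..} x \<partial>lborel)"
      by (subst nn_integral_real_affine[where c="-1" and t=0]) (auto intro!: nn_integral_cong simp: indicator_def)
    with * have **: "(\<integral>\<^sup>+x. ennreal (exp x) * indicator {..ln r} x \<partial>lborel) = ennreal r" by simp
    have "has_bochner_integral lborel (\<lambda>l. exp l * indicator {..ln r} l) r"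
      by (rule has_bochner_integral_nn_integral) (use r ** in \<open>auto simp: ennreal_mult ennreal_indicator\<close>)
    from has_bochner_integral_mult_right[where c="1 / n", OF this] show ?thesis
      by (simp add: H_def[abs_def] has_bochner_integral_iff)
  qed
  have [measurable]: "H \<in> borel_measurable borel" unfolding H_def by measurable
  have iHc: "integrable lborel (\<lambda>z. H (ln (cmod (z - c))) / (cmod (z - c))\<^sup>2)"
    "(\<integral>z. H (ln (cmod (z - c))) / (cmod (z - c))\<^sup>2 \<partial>lborel) = 2 * pi * (r / n)" for c
    using integral_ln_cmod[of H c] iH by (auto simp: has_bochner_integral_iff)
  have gc: "g (cut c r n) z \<le> H (ln (cmod (z - c))) / (cmod (z - c))\<^sup>2" if "z \<noteq> c" for c z
  proof -
    have "g (cut c r n) z = sqrt (\<Sum>b\<in>Basis. (frechet_derivative (cut c r n) (at z) b)\<^sup>2)"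
      by (simp add: g_def Basis_complex_def)
    also have "\<dots> = step1 ((ln (cmod (z - c)) - (ln r - 3 * n)) / n) / (n * cmod (z - c))"
      unfolding cut_derivatives(2)[OF n that] using n step1_bounds(1) by (simp add: abs_of_nonneg divide_nonneg_nonneg)
    also have "\<dots> \<le> H (ln (cmod (z - c))) / (cmod (z - c))\<^sup>2"
    proof (cases "ln (cmod (z - c)) \<le> ln r")
      case True
      then show ?thesis using n that step1_bounds(2) by (simp add: H_def divide_simps power2_eq_square)
    next
      case False
      then have "(ln (cmod (z - c)) - (ln r - 3 * n)) / n \<ge> 3" using n by (simp add: field_simps)
      then show ?thesis using False by (simp add: H_def step_ge_3)
    qed
    finally show ?thesis .
  qed
  have tri: "g (chi r n) z \<le> (\<Sum>c\<in>Z. g (cut c r n) z)" for z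
  proof -
    have "g (chi r n) z = norm (\<Sum>c\<in>Z. Complex (frechet_derivative (cut c r n) (at z) 1) (frechet_derivative (cut c r n) (at z) \<i>))"
      unfolding g_def chi_derivative cmod_def by simp
    also have "\<dots> \<le> (\<Sum>c\<in>Z. norm (Complex (frechet_derivative (cut c r n) (at z) 1) (frechet_derivative (cut c r n) (at z) \<i>)))"
      by (rule norm_sum)
    finally show ?thesis by (simp add: g_def cmod_def)
  qed
  have ae: "AE z in lborel. g (chi r n) z \<le> (\<Sum>c\<in>Z. H (ln (cmod (z - c))) / (cmod (z - c))\<^sup>2)"
    using AE_off_Z
  proof eventually_elim
    case (elim z)
    have "(\<Sum>c\<in>Z. g (cut c r n) z) \<le> (\<Sum>c\<in>Z. H (ln (cmod (z - c))) / (cmod (z - c))\<^sup>2)"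
    proof (rule sum_mono, rule gc)
      show "z \<noteq> c" if "c \<in> Z" for c using that elim by auto
    qed
    with tri[of z] show ?case by linarith
  qed
  have iS: "integrable lborel (\<lambda>z. \<Sum>c\<in>Z. H (ln (cmod (z - c))) / (cmod (z - c))\<^sup>2)"
    by (intro Bochner_Integration.integrable_sum iHc)
  have "continuous_on UNIV (g (chi r n))"
    unfolding g_def using Ck_chi
    by (intro continuous_intros; simp add: numeral_2_eq_2 Basis_complex_def Ck_on_imp_continuous_on differentiable_imp_continuous_on differentiable_on_def)
  then have m: "g (chi r n) \<in> borel_measurable borel" by (rule borel_measurable_continuous_onI)
  have i: "integrable lborel (g (chi r n))"
    by (rule Bochner_Integration.integrable_bound[OF iS])
       (use m ae in \<open>auto elim!: eventually_mono simp: g_def\<close>)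
  have "(\<integral>z. g (chi r n) z \<partial>lborel) \<le> (\<integral>z. (\<Sum>c\<in>Z. H (ln (cmod (z - c))) / (cmod (z - c))\<^sup>2) \<partial>lborel)"
    by (rule integral_mono_AE[OF i iS ae])
  also have "\<dots> = 2 * pi * r * card Z / n"
    by (subst Bochner_Integration.integral_sum) (auto simp: iHc)
  finally show "(\<integral>z. sqrt ((frechet_derivative (chi r n) (at z) 1)\<^sup>2 + (frechet_derivative (chi r n) (at z) \<i>)\<^sup>2) \<partial>lborel)
     \<le> 2 * pi * r * card Z / n" by (simp add: g_def)
  show "integrable lborel (\<lambda>z. sqrt ((frechet_derivative (chi r n) (at z) 1)\<^sup>2 + (frechet_derivative (chi r n) (at z) \<i>)\<^sup>2))"
    using i by (simp add: g_def[abs_def])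
qed

lemma laplacian_chi_integral:
  assumes [measurable]: "w \<in> borel_measurable borel"
    and w: "log_near r w C"
    and C: "C \<ge> 0"
  shows "integrable lborel (\<lambda>z. w z * laplacian (chi r n) z)"
    and "\<bar>(\<integral>z. w z * laplacian (chi r n) z \<partial>lborel) + 2 * pi * total_b\<bar> \<le> card Z * (36 * pi * C / n)"
proof -
  have pos: "0 < r * exp (- 3 * n)" using r by simp
  have w': "\<bar>w z - b c * ln (cmod (z - c))\<bar> \<le> C" if "c \<in> Z" "r * exp (- 3 * n) \<le> cmod (z - c)" "cmod (z - c) \<le> r" for c z
    using w that less_le_trans[OF pos that(2)] by (simp add: log_near_def)
  note cl = cut_laplacian_integral[OF n r assms(1) w' C]
  have eq: "w z * laplacian (chi r n) z = (\<Sum>c\<in>Z. w z * laplacian (cut c r n) z)" for z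
    by (simp add: laplacian_chi sum_distrib_left)
  show "integrable lborel (\<lambda>z. w z * laplacian (chi r n) z)"
    unfolding eq by (rule Bochner_Integration.integrable_sum) (rule cl(1))
  have "(\<integral>z. w z * laplacian (chi r n) z \<partial>lborel) = (\<Sum>c\<in>Z. \<integral>z. w z * laplacian (cut c r n) z \<partial>lborel)"
    unfolding eq by (rule Bochner_Integration.integral_sum) (rule cl(1))
  then have "(\<integral>z. w z * laplacian (chi r n) z \<partial>lborel) + 2 * pi * total_b =
     (\<Sum>c\<in>Z. (\<integral>z. w z * laplacian (cut c r n) z \<partial>lborel) + 2 * pi * b c)"
    by (simp add: total_b_def sum.distrib sum_distrib_left)
  also have "\<bar>\<dots>\<bar> \<le> (\<Sum>c\<in>Z. 36 * pi * C / n)"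
    by (rule order_trans[OF sum_abs sum_mono]) (rule cl(2))
  finally show "\<bar>(\<integral>z. w z * laplacian (chi r n) z \<partial>lborel) + 2 * pi * total_b\<bar> \<le> card Z * (36 * pi * C / n)"
    by simp
qed

end

text \<open>For fixed z the argument of \<open>step\<close> tends to 3, the point where
  \<open>step\<close> reaches 1.\<close>

lemma chi_tendsto_1:
  assumes "r > 0" "z \<notin> Z"
  shows "(\<lambda>k. chi r (real (Suc k)) z) \<longlonglongrightarrow> 1"
proof -
  have "(\<lambda>k. cut c r (real (Suc k)) z) \<longlonglongrightarrow> 1" if "c \<in> Z" for c
  proof -
    have zc: "z \<noteq> c" using that assms by auto
    have "(\<lambda>k. (ln (cmod (z - c)) - ln r) * inverse (real (Suc k)) + 3) \<longlonglongrightarrow> (ln (cmod (z - c)) - ln r) * 0 + 3"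
      by (intro tendsto_intros LIMSEQ_inverse_real_of_nat)
    moreover have "(ln (cmod (z - c)) - ln r) * inverse (real (Suc k)) + 3 = (ln (cmod (z - c)) - (ln r - 3 * real (Suc k))) / real (Suc k)" for k
      by (simp add: field_simps del: of_nat_Suc)
    ultimately have "(\<lambda>k. (ln (cmod (z - c)) - (ln r - 3 * real (Suc k))) / real (Suc k)) \<longlonglongrightarrow> 3" by simp
    moreover have "isCont step 3" using continuous_step(3)[of UNIV] by (simp add: continuous_on_eq_continuous_at)
    ultimately have "(\<lambda>k. step ((ln (cmod (z - c)) - (ln r - 3 * real (Suc k))) / real (Suc k))) \<longlonglongrightarrow> step 3"
      by (rule isCont_tendsto_compose[rotated])
    then show ?thesis using zc by (simp add: cut_def step_ge_3)
  qed
  then have "(\<lambda>k. 1 - (\<Sum>c\<in>Z. 1 - cut c r (real (Suc k)) z)) \<longlonglongrightarrow> 1 - (\<Sum>c\<in>Z. 1 - 1)"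
    by (intro tendsto_intros)
  then show ?thesis by (simp add: chi_def)
qed

end

section \<open>Smoothed superlevel sets and Gauss-Bonnet\<close>

context conic_plane
begin

text \<open>Near infinity u is -(2 + \<beta>) ln |z| up to a bounded term, and 2 + \<beta> > 0; so
  superlevel sets are bounded.\<close>

lemma escape: "\<exists>R\<ge>0. \<forall>z. R < cmod z \<longrightarrow> z \<notin> Z \<and> u z < s"
proof -
  obtain C R0 where CR: "\<And>z. cmod z > R0 \<Longrightarrow> \<bar>u z + (2 + \<beta>) * ln (cmod z)\<bar> \<le> C"
    using infty unfolding u_def by blast
  define R where "R = max (max 1 R0) (max (exp ((C - s) / (2 + \<beta>))) (\<Sum>c\<in>Z. cmod c))"
  show ?thesis
  proof (intro exI[of _ R] conjI allI impI)
    show "R \<ge> 0" by (simp add: R_def)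
    show "z \<notin> Z" if "R < cmod z" for z
    proof
      assume "z \<in> Z"
      then have "cmod z \<le> (\<Sum>c\<in>Z. cmod c)" using finZ by (intro member_le_sum) auto
      then show False using that by (simp add: R_def)
    qed
    show "u z < s" if "R < cmod z" for z
    proof -
      have z: "cmod z > 1" "cmod z > R0" "exp ((C - s) / (2 + \<beta>)) < cmod z" using that by (auto simp: R_def)
      then have "(C - s) / (2 + \<beta>) < ln (cmod z)" by (subst ln_exp[symmetric], subst ln_less_cancel_iff) auto
      then have "C - s < (2 + \<beta>) * ln (cmod z)" using beta by (simp add: field_simps)
      with CR[OF z(2)] show ?thesis by linarith
    qed
  qed
qed

text \<open>A C2 stand-in for the indicator of u > s, rising as u runs from s to s + 3 e.
  \<open>slope\<close> is its derivative with respect to u; by coarea its integral approximates that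
  of 1 / |grad u| over the level set.\<close>

definition level where "level s e z = (if z \<in> Z then 0 else step ((u z - s) / e))"
definition slope where "slope s e z = (if z \<in> Z then 0 else step1 ((u z - s) / e) / e)"

lemma level_bounds: "0 \<le> level s e z" "level s e z \<le> 1"
  using step_bounds by (auto simp: level_def)

lemma slope_nonneg: "e > 0 \<Longrightarrow> 0 \<le> slope s e z"
  using step1_bounds by (auto simp: slope_def)

lemma level_slope_measurable [measurable]:
  "level s e \<in> borel_measurable borel" "slope s e \<in> borel_measurable borel"
proof -
  have c: "continuous_on (- Z) (\<lambda>z. (u z - s) * (1 / e))"
    by (intro continuous_intros Ck_on_imp_continuous_on[OF Ck_u])
  have "continuous_on (- Z) (\<lambda>z. step ((u z - s) * (1 / e)))"
    "continuous_on (- Z) (\<lambda>z. step1 ((u z - s) * (1 / e)) * (1 / e))"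
    by (intro continuous_on_mult continuous_on_const continuous_on_compose2[OF continuous_step(3)[of UNIV] c]
        continuous_on_compose2[OF continuous_step(2)[of UNIV] c] subset_UNIV)+
  note m = measurable_off_Z[OF this(1)] measurable_off_Z[OF this(2)]
  have eq: "level s e = (\<lambda>z. if z \<in> Z then 0 else step ((u z - s) * (1 / e)))"
    "slope s e = (\<lambda>z. if z \<in> Z then 0 else step1 ((u z - s) * (1 / e)) * (1 / e))"
    by (auto simp: level_def slope_def)
  show "level s e \<in> borel_measurable borel" unfolding eq by (rule m)
  show "slope s e \<in> borel_measurable borel" unfolding eq by (rule m)
qed

lemma slope_integrable:
  assumes "e > 0"
  shows "integrable lborel (slope s e)"
proof -
  obtain R where R: "\<And>z. R < cmod z \<Longrightarrow> z \<notin> Z" "\<And>z. R < cmod z \<Longrightarrow> u z < s" using escape[of s] by auto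
  have i: "integrable lborel (\<lambda>z::complex. 1 / e * indicator (cball 0 R) z :: real)"
    by (rule integrable_mult_right, rule integrable_real_indicator)
       (use emeasure_bounded_finite[OF bounded_cball, of "0::complex" R] in \<open>simp_all add: less_top\<close>)
  show ?thesis
  proof (rule Bochner_Integration.integrable_bound[OF i])
    show "AE z in lborel. norm (slope s e z) \<le> norm (1 / e * indicator (cball 0 R) z :: real)"
    proof (rule AE_I2)
      fix z :: complex
      show "norm (slope s e z) \<le> norm (1 / e * indicator (cball 0 R) z :: real)"
      proof (cases "cmod z \<le> R")
        case True
        then show ?thesis using step1_bounds assms by (simp add: slope_def divide_simps abs_of_nonneg)
      next
        case False
        then have "(u z - s) / e \<le> 0" using R(2)[of z] assms by (simp add: divide_nonpos_pos)
        then show ?thesis using assms by (simp add: slope_def step_le_0)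
      qed
    qed
  qed simp
qed

lemma level_kappa_integrable: "integrable lborel (\<lambda>z. level s e z * \<kappa> z)"
  by (rule Bochner_Integration.integrable_bound[OF kappa_int])
     (use level_bounds in \<open>auto intro!: AE_I2 mult_left_le_one_le simp: abs_mult abs_of_nonneg\<close>)

text \<open>Write f for \<open>level\<close> and \<psi> for \<open>slope\<close>. Since grad f =
  \<psi> grad u, the Sobolev inequality and Cauchy-Schwarz bound 4\<pi> \<integral> f^2 by the
  product of \<integral> \<psi> and \<integral> \<psi> |grad u|^2. Testing -\<kappa> = laplacian u
  with f identifies the second factor as \<integral> f \<kappa> - 2\<pi> \<open>total_b\<close>. The
  cutoffs \<open>X k\<close> keep each step away from the cone points.\<close>

lemma level_inequality:
  assumes e: "e > 0"
  shows "0 \<le> (\<integral>z. level s e z * \<kappa> z \<partial>lborel) - 2 * pi * total_b"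
    and "4 * pi * (\<integral>z. (level s e z)\<^sup>2 \<partial>lborel) \<le>
       (\<integral>z. slope s e z \<partial>lborel) * ((\<integral>z. level s e z * \<kappa> z \<partial>lborel) - 2 * pi * total_b)"
proof -
  define f \<psi> where "f = level s e" and "\<psi> = slope s e"
  have [measurable]: "f \<in> borel_measurable borel" "\<psi> \<in> borel_measurable borel" by (simp_all add: f_def \<psi>_def)
  have f01: "0 \<le> f z" "f z \<le> 1" for z using level_bounds by (auto simp: f_def)
  have psi0: "0 \<le> \<psi> z" for z using slope_nonneg[OF e] by (simp add: \<psi>_def)
  obtain R where R: "R \<ge> 0" "\<And>z. R < cmod z \<Longrightarrow> z \<notin> Z" "\<And>z. R < cmod z \<Longrightarrow> u z < s"
    using escape[of s] by auto
  obtain r C where r: "0 < r" "r \<le> 1" "0 \<le> C" "log_near r u C" "separated r"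
    by (rule radius)
  define n where "n k = real (Suc k)" for k
  have n: "n k > 0" for k by (simp add: n_def)
  define X where "X k = chi r (n k)" for k
  note X01 = chi_bounds[OF r(1) n r(5), folded X_def]
  note CkX = Ck_chi[OF r(1) n r(5), folded X_def]
  define U where "U k = (\<Union>c\<in>Z. ball c (r * exp (- 3 * n k)))" for k
  have oU: "open (U k)" and ZU: "Z \<subseteq> U k" for k using r(1) by (auto simp: U_def)
  have XU: "X k z = 0" if "z \<in> U k" for k z
    using chi_eq_0[OF r(1) n r(5), of z k] that by (simp add: X_def U_def)
  have XZ: "X k z = 0" if "z \<in> Z" for k z using XU ZU that by blast
  have neg: "(u z - s) / e \<le> 0" if "R < cmod z" for z
    using R(3)[OF that] e by (simp add: divide_nonpos_pos)
  have fR: "f z = 0" if "R < cmod z" for z using neg[OF that] by (simp add: f_def level_def step_le_0)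
  have psiR: "\<psi> z = 0" if "R < cmod z" for z using neg[OF that] by (simp add: \<psi>_def slope_def step_le_0)
  let ?fd = "\<lambda>g z b. frechet_derivative g (at z) b"
  define G where "G z = (?fd u z 1)\<^sup>2 + (?fd u z \<i>)\<^sup>2" for z
  have B: "(1::complex) \<in> Basis" "\<i> \<in> Basis" by (auto simp: Basis_complex_def)
  have du: "(u has_derivative ?fd u z) (at z)" if "z \<notin> Z" for z
    using Ck_u that by (simp add: numeral_2_eq_2 frechet_derivative_works[symmetric])
  have cu: "continuous_on (- Z) (\<lambda>z. ?fd u z b)" if "b \<in> Basis" for b
    using Ck_u that by (intro Ck_on_imp_continuous_on[of 1]) (simp add: numeral_2_eq_2)
  have cua: "continuous_on (- Z) (\<lambda>z. (u z - s) / e)"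
    using e by (intro continuous_intros Ck_on_imp_continuous_on[OF Ck_u]) auto
  have cG: "continuous_on (- Z) G" unfolding G_def by (intro continuous_intros cu B)
  have cpsi: "continuous_on (- Z) \<psi>"
  proof (rule continuous_on_eq)
    show "continuous_on (- Z) (\<lambda>z. step1 ((u z - s) / e) / e)"
      using e by (intro continuous_on_divide continuous_on_const continuous_on_compose2[OF continuous_step(2)[of UNIV] cua]) auto
  qed (auto simp: \<psi>_def slope_def)
  \<comment> \<open>The smoothed positive part of u - s; its Laplacian \<psi> |grad u|^2 - f
    \<kappa> contains the energy sought, with the same f and \<psi>.\<close>
  define w where "w z = (if z \<in> Z then 0 else e * ramp ((u z - s) / e))" for z
  have d: "((\<lambda>t. (t - s) / e) has_real_derivative 1 / e) (at t)" for t
    using e by (auto intro!: derivative_eq_intros)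
  have Ckua: "Ck_on 2 (- Z) (\<lambda>z. (u z - s) / e)"
    using Ck_on_mult[OF openZ Ck_on_diff[OF openZ Ck_u Ck_on_const[of 2 "- Z" s]] Ck_on_const[of 2 "- Z" "1 / e"]] by simp
  have Ckw: "Ck_on 2 (- Z) w"
    by (rule Ck_on_cong[OF openZ _ Ck_on_mult[OF openZ Ck_on_const[of 2 "- Z" e] Ck_on_compose[OF openZ Ckua Ck_on_step(2)]]])
       (auto simp: w_def)
  have Ckf: "Ck_on 2 (- Z) f"
    by (rule Ck_on_cong[OF openZ _ Ck_on_compose[OF openZ Ckua Ck_on_step(1)]]) (auto simp: f_def level_def)
  have [measurable]: "w \<in> borel_measurable borel"
    using measurable_off_Z[OF Ck_on_imp_continuous_on[OF Ckw]] by (simp add: w_def[abs_def] cong: if_cong)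
  have lapw: "laplacian w z = \<psi> z * G z - f z * \<kappa> z" if z: "z \<notin> Z" for z
  proof -
    have F1: "((\<lambda>t. e * ramp ((t - s) / e)) has_real_derivative step ((t - s) / e)) (at t)" for t
      using DERIV_cmult[OF DERIV_chain2[OF DERIV_ramp d], of e t] e by simp
    have F2: "((\<lambda>t. step ((t - s) / e)) has_real_derivative step1 ((t - s) / e) / e) (at t)" for t
      using DERIV_chain2[OF DERIV_step d, of t] by simp
    have "laplacian w z = laplacian (\<lambda>z. e * ramp ((u z - s) / e)) z"
      by (rule laplacian_cong[OF openZ]) (use z in \<open>auto simp: w_def\<close>)
    also have "\<dots> = step1 ((u z - s) / e) / e * (\<Sum>b\<in>Basis. (?fd u z b)\<^sup>2) + step ((u z - s) / e) * laplacian u z"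
      by (rule laplacian_compose[OF openZ _ Ck_u open_UNIV subset_UNIV F1 F2]) (use z in auto)
    also have "\<dots> = \<psi> z * G z - f z * \<kappa> z"
      using z by (simp add: \<psi>_def slope_def f_def level_def \<kappa>_def G_def Basis_complex_def)
    finally show ?thesis .
  qed
  \<comment> \<open>If u \<ge> s, then w differs from u by at most |s| + 3 e. If u < s, then w = 0,
    while 0 \<le> b ln |z - c| \<le> s + C because b and the logarithm are nonpositive. So w has the
    logarithmic coefficient of u at every cone point.\<close>
  define C2 where "C2 = C + \<bar>s\<bar> + 3 * e"
  have C2: "C2 \<ge> 0" using r(3) e by (simp add: C2_def)
  have wnear': "\<bar>w z - b c * ln (cmod (z - c))\<bar> \<le> C2" if c: "c \<in> Z" "0 < cmod (z - c)" "cmod (z - c) \<le> r" for c z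
  proof -
    have "z \<notin> Z"
    proof
      assume "z \<in> Z"
      with r(5) c(1) have "c \<noteq> z \<longrightarrow> 2 * r < cmod (c - z)" by (simp add: separated_def)
      with c r(1) show False by (auto simp: norm_minus_commute)
    qed
    then have wz: "w z = e * ramp ((u z - s) / e)" by (simp add: w_def)
    have L: "ln (cmod (z - c)) \<le> 0" using c r(2) by simp
    have bL: "b c * ln (cmod (z - c)) \<ge> 0" by (rule mult_nonpos_nonpos[OF b_le[OF c(1)] L])
    have uC: "\<bar>u z - b c * ln (cmod (z - c))\<bar> \<le> C" using r(4) c by (simp add: log_near_def)
    show ?thesis
    proof (cases "u z \<ge> s")
      case True
      then have "\<bar>ramp ((u z - s) / e) - (u z - s) / e\<bar> \<le> 3" using e by (intro ramp_bound) simp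
      then have "e * \<bar>ramp ((u z - s) / e) - (u z - s) / e\<bar> \<le> e * 3" using e by (intro mult_left_mono) auto
      moreover have "e * \<bar>ramp ((u z - s) / e) - (u z - s) / e\<bar> = \<bar>w z - (u z - s)\<bar>"
      proof -
        have "e * \<bar>x\<bar> = \<bar>e * x\<bar>" for x using e by (simp add: abs_mult)
        moreover have "e * (ramp ((u z - s) / e) - (u z - s) / e) = w z - (u z - s)"
        proof -
          have "e * ((u z - s) / e) = u z - s" using e by simp
          then show ?thesis by (simp only: wz right_diff_distrib)
        qed
        ultimately show ?thesis by simp
      qed
      ultimately have "\<bar>w z - (u z - s)\<bar> \<le> 3 * e" by simp
      with uC show ?thesis unfolding C2_def by linarith
    next
      case False
      then have "w z = 0" unfolding wz using e by (simp add: step_le_0 divide_nonpos_pos)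
      then show ?thesis using bL uC False e r(3) unfolding C2_def by linarith
    qed
  qed
  have wnear: "log_near r w C2" using wnear' by (simp add: log_near_def)
  note lc = laplacian_chi_integral[OF r(1) n r(5) \<open>w \<in> borel_measurable borel\<close> wnear C2, folded X_def]
  \<comment> \<open>The energy density cut off near the cone points. Integrability of \<psi> |grad
    u|^2 itself is not known here; \<open>E\<close> below is the curvature expression, obtained as
    the limit of the truncated energies.\<close>
  define P where "P k z = X k z * (\<psi> z * G z)" for k z
  have P0: "0 \<le> P k z" for k z using X01 psi0 by (simp add: P_def G_def)
  have cP: "continuous_on UNIV (P k)" for k
  proof -
    have "continuous_on (U k) (P k)" by (rule continuous_on_eq[of _ "\<lambda>_. 0"]) (auto simp: P_def XU)
    moreover have "continuous_on (- Z) (P k)"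
      unfolding P_def by (intro continuous_on_mult cpsi cG continuous_on_subset[OF Ck_on_imp_continuous_on[OF CkX]] subset_UNIV)
    moreover have "U k \<union> - Z = UNIV" using ZU by auto
    ultimately show ?thesis using continuous_on_open_Un[OF oU openZ] by metis
  qed
  have iP: "integrable lborel (P k)" for k
    by (rule integrable_compact_support[OF cP, of R]) (simp add: P_def psiR)
  note ik = level_kappa_integrable[of s e, folded f_def]
  have iXk: "integrable lborel (\<lambda>z. X k z * (f z * \<kappa> z))" for k
  proof (rule Bochner_Integration.integrable_bound[OF ik])
    show "(\<lambda>z. X k z * (f z * \<kappa> z)) \<in> borel_measurable lborel"
      using borel_measurable_continuous_onI[OF Ck_on_imp_continuous_on[OF CkX]] by simp
    show "AE z in lborel. norm (X k z * (f z * \<kappa> z)) \<le> norm (f z * \<kappa> z)"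
      using X01 by (auto intro!: AE_I2 mult_left_le_one_le simp: abs_mult abs_of_nonneg)
  qed
  define I where "I k = (\<integral>z. w z * laplacian (X k) z \<partial>lborel)" for k
  have EP: "(\<integral>z. P k z \<partial>lborel) = (\<integral>z. X k z * (f z * \<kappa> z) \<partial>lborel) + I k" for k
  proof -
    have "(\<integral>z. X k z * laplacian w z - w z * laplacian (X k) z \<partial>lborel) = 0"
      by (rule green_identity[OF _ Ckw CkX oU ZU XU, where R=R])
         (use finZ fR neg in \<open>auto simp: finite_imp_closed w_def step_le_0\<close>)
    moreover have "X k z * laplacian w z = P k z - X k z * (f z * \<kappa> z)" for z
      by (cases "z \<in> Z") (auto simp: XZ P_def lapw algebra_simps)
    ultimately have "(\<integral>z. P k z - X k z * (f z * \<kappa> z) - w z * laplacian (X k) z \<partial>lborel) = 0" by simp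
    then show ?thesis using iP iXk lc(1) by (simp add: I_def)
  qed
  have limI: "I \<longlonglongrightarrow> - 2 * pi * total_b"
  proof (rule LIM_zero_cancel, rule Lim_null_comparison)
    show "\<forall>\<^sub>F k in sequentially. norm (I k - - 2 * pi * total_b) \<le> card Z * (36 * pi * C2) * inverse (real (Suc k))"
      using lc(2) by (auto simp: I_def n_def field_simps)
    have "(\<lambda>k. card Z * (36 * pi * C2) * inverse (real (Suc k))) \<longlonglongrightarrow> card Z * (36 * pi * C2) * 0"
      by (intro tendsto_mult tendsto_const LIMSEQ_inverse_real_of_nat)
    then show "(\<lambda>k. card Z * (36 * pi * C2) * inverse (real (Suc k))) \<longlonglongrightarrow> 0" by simp
  qed
  have X1: "(\<lambda>k. X k z) \<longlonglongrightarrow> 1" if "z \<notin> Z" for z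
    using chi_tendsto_1[OF r(1) that] by (simp add: X_def n_def)
  have limk: "(\<lambda>k. \<integral>z. X k z * (f z * \<kappa> z) \<partial>lborel) \<longlonglongrightarrow> (\<integral>z. f z * \<kappa> z \<partial>lborel)"
  proof (rule integral_dominated_convergence)
    show "integrable lborel (\<lambda>z. norm (f z * \<kappa> z))" using ik by simp
    show "AE z in lborel. (\<lambda>k. X k z * (f z * \<kappa> z)) \<longlonglongrightarrow> f z * \<kappa> z"
      using AE_off_Z by eventually_elim (use tendsto_mult[OF X1 tendsto_const] in fastforce)
    show "AE z in lborel. norm (X k z * (f z * \<kappa> z)) \<le> norm (f z * \<kappa> z)" for k
      using X01 by (auto intro!: AE_I2 mult_left_le_one_le simp: abs_mult abs_of_nonneg)
  qed (use ik iXk in auto)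
  define E where "E = (\<integral>z. f z * \<kappa> z \<partial>lborel) - 2 * pi * total_b"
  have limE: "(\<lambda>k. \<integral>z. P k z \<partial>lborel) \<longlonglongrightarrow> E"
    unfolding EP E_def using tendsto_add[OF limk limI] by simp
  have E0: "0 \<le> E"
    by (rule LIMSEQ_le_const[OF limE]) (auto intro!: exI[of _ 0] Bochner_Integration.integral_nonneg P0)
  then show "0 \<le> (\<integral>z. level s e z * \<kappa> z \<partial>lborel) - 2 * pi * total_b" by (simp add: E_def f_def)
  define D where "D = (\<integral>z. \<psi> z \<partial>lborel)"
  have D0: "0 \<le> D" unfolding D_def using psi0 by simp
  note ipsi = slope_integrable[OF e, of s, folded \<psi>_def]
  define F where "F k z = X k z * f z" for k z
  have CkF: "Ck_on 2 UNIV (F k)" for k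
  proof (rule Ck_on_localI)
    fix z :: complex
    have "Ck_on 2 (U k) (F k)" by (rule Ck_on_cong[OF oU _ Ck_on_const[of 2 "U k" 0]]) (simp add: F_def XU)
    moreover have "Ck_on 2 (- Z) (F k)"
      unfolding F_def by (rule Ck_on_mult[OF openZ Ck_on_subset[OF CkX subset_UNIV] Ckf])
    moreover have "z \<in> U k \<or> z \<in> - Z" using ZU by auto
    ultimately show "\<exists>V. open V \<and> z \<in> V \<and> Ck_on 2 V (F k)" using oU openZ by blast
  qed
  have dF: "(F k has_derivative ?fd (F k) z) (at z)" for k z
    using CkF[of k] by (simp add: numeral_2_eq_2 frechet_derivative_works[symmetric])
  have cF: "continuous_on UNIV (\<lambda>z. ?fd (F k) z b)" if "b \<in> Basis" for k b
    using CkF[of k] that by (intro Ck_on_imp_continuous_on[of 1]) (simp add: numeral_2_eq_2)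
  have FR: "F k z = 0" if "R < cmod z" for k z using fR[OF that] by (simp add: F_def)
  have dX: "(X k has_derivative ?fd (X k) z) (at z)" for k z
    using CkX[of k] by (simp add: numeral_2_eq_2 frechet_derivative_works[symmetric])
  define gF where "gF k z = sqrt ((?fd (F k) z 1)\<^sup>2 + (?fd (F k) z \<i>)\<^sup>2)" for k z
  define gX where "gX k z = sqrt ((?fd (X k) z 1)\<^sup>2 + (?fd (X k) z \<i>)\<^sup>2)" for k z
  note gXi = gradient_chi_integral[OF r(1) n r(5), folded X_def, folded gX_def]
  have sob: "sqrt (4 * pi * (\<integral>z. (F k z)\<^sup>2 \<partial>lborel)) \<le> (\<integral>z. gF k z \<partial>lborel)" for k
  proof -
    have "4 * pi * (\<integral>z. (F k z)\<^sup>2 \<partial>lborel) \<le> (\<integral>z. gF k z \<partial>lborel)\<^sup>2"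
      unfolding gF_def by (rule planar_sobolev[OF dF cF FR])
    from real_sqrt_le_mono[OF this] show ?thesis by (simp add: gF_def Bochner_Integration.integral_nonneg abs_of_nonneg)
  qed
  \<comment> \<open>Product rule for X f, then Young's inequality with weight t; X^2 \<le> X turns
    the square into the truncated energy. The gradient of the cutoff is kept as a separate term
    whose integral is O(1 / n).\<close>
  have pt: "gF k z \<le> (t * \<psi> z + P k z / t) / 2 + gX k z" if z: "z \<notin> Z" and t: "t > 0" for k z t
  proof -
    have fdf: "?fd f z = (\<lambda>h. \<psi> z * ?fd u z h)"
    proof -
      have "((\<lambda>t. step ((t - s) / e)) has_real_derivative step1 ((u z - s) / e) / e) (at (u z))"
        using DERIV_chain2[OF DERIV_step d, of "u z"] by simp
      from frechet_derivative_compose_real(2)[OF du[OF z] this]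
      have "?fd (\<lambda>z. step ((u z - s) / e)) z = (\<lambda>h. \<psi> z * ?fd u z h)" using z by (simp add: \<psi>_def slope_def)
      moreover have "?fd f z = ?fd (\<lambda>z. step ((u z - s) / e)) z"
        by (rule frechet_derivative_cong[OF openZ]) (use z in \<open>auto simp: f_def level_def\<close>)
      ultimately show ?thesis by simp
    qed
    have df: "(f has_derivative ?fd f z) (at z)"
      using Ckf z by (simp add: numeral_2_eq_2 frechet_derivative_works[symmetric])
    have fdF: "?fd (F k) z = (\<lambda>h. X k z * (\<psi> z * ?fd u z h) + ?fd (X k) z h * f z)"
    proof -
      have "F k = (\<lambda>z. X k z * f z)" by (rule ext) (simp only: F_def)
      then show ?thesis
        using frechet_derivative_at[OF has_derivative_mult[OF dX[of k] df]] by (simp only: fdf)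
    qed
    have "gF k z \<le> sqrt ((X k z * (\<psi> z * ?fd u z 1))\<^sup>2 + (X k z * (\<psi> z * ?fd u z \<i>))\<^sup>2) +
        sqrt ((?fd (X k) z 1 * f z)\<^sup>2 + (?fd (X k) z \<i> * f z)\<^sup>2)"
      unfolding gF_def fdF by (rule real_sqrt_sum_squares_triangle_ineq)
    also have "sqrt ((X k z * (\<psi> z * ?fd u z 1))\<^sup>2 + (X k z * (\<psi> z * ?fd u z \<i>))\<^sup>2) = X k z * \<psi> z * sqrt (G z)"
    proof -
      have "(X k z * (\<psi> z * ?fd u z 1))\<^sup>2 + (X k z * (\<psi> z * ?fd u z \<i>))\<^sup>2 = (X k z * \<psi> z)\<^sup>2 * G z"
        by (simp add: G_def power_mult_distrib algebra_simps)
      then show ?thesis using X01 psi0 by (simp add: real_sqrt_mult)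
    qed
    also have "sqrt ((?fd (X k) z 1 * f z)\<^sup>2 + (?fd (X k) z \<i> * f z)\<^sup>2) = f z * gX k z"
    proof -
      have "(?fd (X k) z 1 * f z)\<^sup>2 + (?fd (X k) z \<i> * f z)\<^sup>2 = (f z)\<^sup>2 * ((?fd (X k) z 1)\<^sup>2 + (?fd (X k) z \<i>)\<^sup>2)"
        by (simp add: power_mult_distrib algebra_simps)
      then show ?thesis using f01 by (simp add: real_sqrt_mult gX_def)
    qed
    also have "f z * gX k z \<le> gX k z" using f01 by (intro mult_left_le_one_le) (auto simp: gX_def)
    also have "X k z * \<psi> z * sqrt (G z) \<le> (t * \<psi> z + P k z / t) / 2"
    proof -
      have g: "(sqrt (G z))\<^sup>2 = G z" by (simp add: G_def)
      have "2 * (X k z * sqrt (G z)) \<le> t + (X k z)\<^sup>2 * G z / t"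
      proof -
        have *: "2 * y \<le> t + y\<^sup>2 / t" for y
        proof -
          have "0 \<le> (t - y)\<^sup>2 / t" using t by simp
          also have "(t - y)\<^sup>2 / t = t - 2 * y + y\<^sup>2 / t"
            using t by (simp add: power2_eq_square field_simps)
          finally show ?thesis by simp
        qed
        show ?thesis using *[of "X k z * sqrt (G z)"] by (simp only: power_mult_distrib g)
      qed
      also have "\<dots> \<le> t + X k z * G z / t"
      proof -
        have "(X k z)\<^sup>2 \<le> X k z" using X01 by (simp add: power2_eq_square mult_left_le)
        then have "(X k z)\<^sup>2 * G z / t \<le> X k z * G z / t"
          using t by (intro divide_right_mono mult_right_mono) (auto simp: G_def)
        then show ?thesis by simp
      qed
      finally have "\<psi> z * (2 * (X k z * sqrt (G z))) \<le> \<psi> z * (t + X k z * G z / t)"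
        by (rule mult_left_mono[OF _ psi0])
      also have "\<psi> z * (2 * (X k z * sqrt (G z))) = 2 * (X k z * \<psi> z * sqrt (G z))" by simp
      also have "\<psi> z * (t + X k z * G z / t) = t * \<psi> z + P k z / t" by (simp add: P_def distrib_left)
      finally show ?thesis by simp
    qed
    finally show ?thesis by simp
  qed
  have bound: "sqrt (4 * pi * (\<integral>z. (F k z)\<^sup>2 \<partial>lborel)) \<le> (t * D + (\<integral>z. P k z \<partial>lborel) / t) / 2 + 2 * pi * r * card Z / n k"
    if t: "t > 0" for k t
  proof -
    have "(\<integral>z. gF k z \<partial>lborel) \<le> (\<integral>z. (t * \<psi> z + P k z / t) / 2 + gX k z \<partial>lborel)"
    proof (rule integral_mono_AE)
      show "integrable lborel (gF k)"
      proof (rule integrable_compact_support[of _ R])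
        show "continuous_on UNIV (gF k)" unfolding gF_def by (intro continuous_intros cF B)
        show "gF k z = 0" if "R < cmod z" for z
        proof -
          have "?fd (F k) z = ?fd (\<lambda>_. 0) z"
            by (rule frechet_derivative_cong[of "{z. R < cmod z}"]) (use that FR in \<open>auto intro!: open_Collect_less continuous_intros\<close>)
          then show ?thesis by (simp add: gF_def frechet_derivative_const)
        qed
      qed
      show "integrable lborel (\<lambda>z. (t * \<psi> z + P k z / t) / 2 + gX k z)" using ipsi iP gXi(2) by simp
      show "AE z in lborel. gF k z \<le> (t * \<psi> z + P k z / t) / 2 + gX k z"
        using AE_off_Z by eventually_elim (rule pt[OF _ t])
    qed
    also have "\<dots> = (t * D + (\<integral>z. P k z \<partial>lborel) / t) / 2 + (\<integral>z. gX k z \<partial>lborel)"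
      using ipsi iP gXi(2) by (simp add: D_def)
    finally show ?thesis using sob[of k] gXi(1)[of k] by linarith
  qed
  have limF: "(\<lambda>k. \<integral>z. (F k z)\<^sup>2 \<partial>lborel) \<longlonglongrightarrow> (\<integral>z. (f z)\<^sup>2 \<partial>lborel)"
  proof (rule integral_dominated_convergence)
    show "integrable lborel (\<lambda>z::complex. indicator (cball 0 R) z :: real)"
      by (rule integrable_real_indicator)
         (use emeasure_bounded_finite[OF bounded_cball, of "0::complex" R] in \<open>simp_all add: less_top\<close>)
    show "AE z in lborel. (\<lambda>k. (F k z)\<^sup>2) \<longlonglongrightarrow> (f z)\<^sup>2"
      using AE_off_Z
    proof eventually_elim
      case (elim z)
      have "(\<lambda>k. (X k z * f z)\<^sup>2) \<longlonglongrightarrow> (1 * f z)\<^sup>2" by (intro tendsto_intros X1 elim)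
      then show ?case by (simp add: F_def)
    qed
    show "AE z in lborel. norm ((F k z)\<^sup>2) \<le> indicator (cball 0 R) z" for k
    proof (rule AE_I2)
      fix z :: complex
      have "0 \<le> F k z" "F k z \<le> 1" using X01 f01 by (auto simp: F_def mult_le_one)
      then have "(F k z)\<^sup>2 \<le> 1" by (simp add: power_le_one)
      then show "norm ((F k z)\<^sup>2) \<le> indicator (cball 0 R) z" using FR[of z k] by (cases "cmod z \<le> R") auto
    qed
  next
    show "(\<lambda>z. (F k z)\<^sup>2) \<in> borel_measurable lborel" for k
      using borel_measurable_continuous_onI[OF Ck_on_imp_continuous_on[OF CkF]] by simp
  qed simp
  have "(sqrt (4 * pi * (\<integral>z. (f z)\<^sup>2 \<partial>lborel)))\<^sup>2 \<le> D * E"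
  proof (rule AM_GM_to_CS)
    fix t :: real assume t: "t > 0"
    show "sqrt (4 * pi * (\<integral>z. (f z)\<^sup>2 \<partial>lborel)) \<le> (t * D + E / t) / 2"
    proof (rule LIMSEQ_le)
      show "(\<lambda>k. sqrt (4 * pi * (\<integral>z. (F k z)\<^sup>2 \<partial>lborel))) \<longlonglongrightarrow> sqrt (4 * pi * (\<integral>z. (f z)\<^sup>2 \<partial>lborel))"
        by (rule tendsto_real_sqrt[OF tendsto_mult[OF tendsto_const limF]])
      define p where "p k = (\<integral>z. P k z \<partial>lborel)" for k
      define M where "M = 2 * pi * r * card Z"
      have a: "(\<lambda>k. p k / t) \<longlonglongrightarrow> E / t"
        unfolding p_def by (rule tendsto_divide[OF limE tendsto_const]) (use t in simp)
      have b: "(\<lambda>k. (t * D + p k / t) * (1 / 2)) \<longlonglongrightarrow> (t * D + E / t) * (1 / 2)"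
        by (rule tendsto_mult_right, rule tendsto_add[OF tendsto_const a])
      have c: "(\<lambda>k. M * inverse (real (Suc k))) \<longlonglongrightarrow> M * 0"
        by (rule tendsto_mult[OF tendsto_const LIMSEQ_inverse_real_of_nat])
      have "(\<lambda>k. (t * D + p k / t) / 2 + M / n k) \<longlonglongrightarrow> (t * D + E / t) / 2"
        using tendsto_add[OF b c] by (simp only: n_def divide_inverse mult_1_left mult_zero_right add_0_right)
      then show "(\<lambda>k. (t * D + (\<integral>z. P k z \<partial>lborel) / t) / 2 + 2 * pi * r * card Z / n k) \<longlonglongrightarrow> (t * D + E / t) / 2"
        unfolding p_def M_def .
      show "\<exists>N. \<forall>k\<ge>N. sqrt (4 * pi * (\<integral>z. (F k z)\<^sup>2 \<partial>lborel)) \<le> (t * D + (\<integral>z. P k z \<partial>lborel) / t) / 2 + 2 * pi * r * card Z / n k"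
        by (intro exI[of _ 0] allI impI bound[OF t])
    qed
  next
    show "0 \<le> sqrt (4 * pi * (\<integral>z. (f z)\<^sup>2 \<partial>lborel))" by simp
  qed (rule D0 E0)+
  moreover have "0 \<le> 4 * pi * (\<integral>z. (f z)\<^sup>2 \<partial>lborel)" by (simp add: Bochner_Integration.integral_nonneg)
  ultimately show "4 * pi * (\<integral>z. (level s e z)\<^sup>2 \<partial>lborel) \<le>
       (\<integral>z. slope s e z \<partial>lborel) * ((\<integral>z. level s e z * \<kappa> z \<partial>lborel) - 2 * pi * total_b)"
    by (simp add: D_def E_def f_def \<psi>_def)
qed

text \<open>Test \<kappa> with a function W that vanishes near the cone points and near infinity and
  tends to 1 elsewhere. Green's identity moves the Laplacian onto the cutoffs, and each end returns
  2\<pi> times its logarithmic coefficient: \<open>b c\<close> at the finite points and 2 + \<beta>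
  at infinity.\<close>

lemma gauss_bonnet: "(\<integral>z. \<kappa> z \<partial>lborel) = 2 * pi * (2 + total_b + \<beta>)"
proof -
  obtain R where R: "R \<ge> 0" "\<And>z. R < cmod z \<Longrightarrow> z \<notin> Z" "\<And>z. R < cmod z \<Longrightarrow> u z < 0"
    using escape[of 0] by auto
  obtain r C where r: "0 < r" "r \<le> 1" "0 \<le> C" "log_near r u C" "separated r"
    by (rule radius)
  obtain C' R0 where CR: "\<And>z. cmod z > R0 \<Longrightarrow> \<bar>u z + (2 + \<beta>) * ln (cmod z)\<bar> \<le> C'"
    using infty unfolding u_def by blast
  have C'0: "C' \<ge> 0"
  proof -
    have "R0 < cmod (of_real (\<bar>R0\<bar> + 1))" by (simp only: norm_of_real)
    from CR[OF this] show ?thesis by linarith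
  qed
  \<comment> \<open>As r \<le> 1, adding 1 encloses the discs of radius r about the points of
    \<open>Z\<close>.\<close>
  define R1 where "R1 = max R R0 + 1"
  have R1: "R1 > 0" "R + r \<le> R1" "R0 < R1" using R r(2) by (auto simp: R1_def)
  define n where "n k = real (Suc k)" for k
  have n: "n k > 0" for k by (simp add: n_def)
  define X where "X k = chi r (n k)" for k
  \<comment> \<open>The cutoff at infinity has fixed inner radius R1 and growing outer radius, so
    \<open>Y k\<close> tends to 0 at every point.\<close>
  define r2 where "r2 k = R1 * exp (3 * n k)" for k
  have r2: "r2 k > 0" "r2 k * exp (- 3 * n k) = R1" "ln (r2 k) - 3 * n k = ln R1" "R1 \<le> r2 k" for k
    using R1 n[of k] by (auto simp: r2_def exp_minus ln_mult)
  define Y where "Y k = cut 0 (r2 k) (n k)" for k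
  define W where "W k z = X k z + - 1 * Y k z" for k z
  note X01 = chi_bounds[OF r(1) n r(5), folded X_def]
  note CkX = Ck_chi[OF r(1) n r(5), folded X_def]
  have CkY: "Ck_on 2 UNIV (Y k)" for k unfolding Y_def by (rule Ck_on_cut[OF n r2(1)])
  have CkmY: "Ck_on 2 UNIV (\<lambda>z. - 1 * Y k z)" for k
    by (rule Ck_on_mult[OF open_UNIV Ck_on_const CkY])
  have CkW: "Ck_on 2 UNIV (W k)" for k
    unfolding W_def by (rule Ck_on_add[OF open_UNIV CkX CkmY])
  have lapW: "laplacian (W k) z = laplacian (X k) z - laplacian (Y k) z" for k z
    unfolding W_def laplacian_add[OF open_UNIV UNIV_I CkX CkmY] laplacian_cmult[OF open_UNIV UNIV_I CkY] by simp
  have Wb: "\<bar>W k z\<bar> \<le> 1" for k z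
    using X01[of k z] cut_bounds[of 0 "r2 k" "n k" z] by (auto simp: W_def Y_def)
  define U where "U k = (\<Union>c\<in>Z. ball c (r * exp (- 3 * n k)))" for k
  have oU: "open (U k)" and ZU: "Z \<subseteq> U k" for k using r(1) by (auto simp: U_def)
  have WU: "W k z = 0" if zU: "z \<in> U k" for k z
  proof -
    have X0: "X k z = 0" using chi_eq_0[OF r(1) n r(5), of z k] that by (simp add: X_def U_def)
    obtain c where "c \<in> Z" "z \<in> ball c (r * exp (- 3 * n k))" using zU unfolding U_def by blast
    then have c: "c \<in> Z" "cmod (z - c) < r * exp (- 3 * n k)" by (simp_all add: dist_norm norm_minus_commute)
    have "r * exp (- 3 * n k) \<le> r" using r(1) n[of k] by (simp add: mult_left_le)
    moreover have "cmod c \<le> R" using R(2) c(1) by (meson not_le)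
    ultimately have "cmod z \<le> R1" using c(2) R1(2) norm_triangle_ineq2[of z c] by linarith
    then have "Y k z = 0" unfolding Y_def by (intro cut_eq(1)[OF n r2(1)]) (simp add: r2(2)[simplified])
    with X0 show ?thesis by (simp add: W_def)
  qed
  have WR: "W k z = 0" if "r2 k < cmod z" for k z
  proof -
    have "cut c r (n k) z = 1" if "c \<in> Z" for c
    proof -
      have "cmod c \<le> R" using R(2) that by (meson not_le)
      then have "r \<le> cmod (z - c)" using \<open>r2 k < cmod z\<close> r2(4)[of k] R1(2) norm_triangle_ineq2[of z c] by linarith
      then show ?thesis by (rule cut_eq(2)[OF n r(1)])
    qed
    then have "X k z = 1" by (simp add: X_def chi_def)
    moreover have "Y k z = 1" unfolding Y_def by (rule cut_eq(2)[OF n r2(1)]) (use that in simp)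
    ultimately show ?thesis by (simp add: W_def)
  qed
  note lc = laplacian_chi_integral[OF r(1) n r(5) u_measurable r(4) r(3), folded X_def]
  have li: "integrable lborel (\<lambda>z. u z * laplacian (Y k) z)"
    "\<bar>(\<integral>z. u z * laplacian (Y k) z \<partial>lborel) + 2 * pi * - (2 + \<beta>)\<bar> \<le> 36 * pi * C' / n k" for k
  proof -
    have "\<bar>u z - - (2 + \<beta>) * ln (cmod (z - 0))\<bar> \<le> C'" if "r2 k * exp (- 3 * n k) \<le> cmod (z - 0)" for z
      using CR[of z] that R1(3) unfolding r2(2) by (simp add: algebra_simps)
    note bnd = this
    show "integrable lborel (\<lambda>z. u z * laplacian (Y k) z)"
      unfolding Y_def
      by (rule cut_laplacian_integral(1)[where w=u and a="- (2 + \<beta>)" and c=0, OF n r2(1) u_measurable _ C'0]) (rule bnd)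
    show "\<bar>(\<integral>z. u z * laplacian (Y k) z \<partial>lborel) + 2 * pi * - (2 + \<beta>)\<bar> \<le> 36 * pi * C' / n k"
      unfolding Y_def
      by (rule cut_laplacian_integral(2)[where w=u and a="- (2 + \<beta>)" and c=0, OF n r2(1) u_measurable _ C'0]) (rule bnd)
  qed
  have lim0: "J \<longlonglongrightarrow> a" if "\<And>k. \<bar>J k - a\<bar> \<le> M / n k" for J a M
  proof (rule LIM_zero_cancel, rule Lim_null_comparison)
    show "\<forall>\<^sub>F k in sequentially. norm (J k - a) \<le> M * inverse (real (Suc k))"
      using that by (auto simp: n_def divide_inverse)
    show "(\<lambda>k. M * inverse (real (Suc k))) \<longlonglongrightarrow> 0"
      using tendsto_mult[OF tendsto_const LIMSEQ_inverse_real_of_nat, of M] by simp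
  qed
  have l1: "(\<lambda>k. \<integral>z. u z * laplacian (X k) z \<partial>lborel) \<longlonglongrightarrow> - (2 * pi * total_b)"
    by (rule lim0[of _ _ "card Z * (36 * pi * C)"]) (use lc(2) in simp)
  have l2: "(\<lambda>k. \<integral>z. u z * laplacian (Y k) z \<partial>lborel) \<longlonglongrightarrow> - (2 * pi * - (2 + \<beta>))"
    by (rule lim0[of _ _ "36 * pi * C'"]) (use li(2) in simp)
  have mW[measurable]: "W k \<in> borel_measurable borel" for k
    by (rule borel_measurable_continuous_onI[OF Ck_on_imp_continuous_on[OF CkW]])
  have iW: "integrable lborel (\<lambda>z. W k z * \<kappa> z)" for k
    by (rule Bochner_Integration.integrable_bound[OF kappa_int])
       (use Wb in \<open>auto intro!: AE_I2 mult_left_le_one_le simp: abs_mult\<close>)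
  have id: "(\<integral>z. W k z * \<kappa> z \<partial>lborel) = (\<integral>z. u z * laplacian (Y k) z \<partial>lborel) - (\<integral>z. u z * laplacian (X k) z \<partial>lborel)" for k
  proof -
    have "(\<integral>z. W k z * laplacian u z - u z * laplacian (W k) z \<partial>lborel) = 0"
      by (rule green_identity[OF _ Ck_u CkW oU ZU WU, where R="r2 k"])
         (use finZ WR in \<open>auto simp: finite_imp_closed\<close>)
    moreover have "W k z * laplacian u z = - (W k z * \<kappa> z)" for z
      using WU ZU by (cases "z \<in> Z") (auto simp: \<kappa>_def)
    ultimately have "(\<integral>z. - (W k z * \<kappa> z) - (u z * laplacian (X k) z - u z * laplacian (Y k) z) \<partial>lborel) = 0"
      by (simp add: lapW right_diff_distrib)
    then show ?thesis using iW[of k] lc(1)[of k] li(1)[of k] by simp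
  qed
  have W1: "(\<lambda>k. W k z) \<longlonglongrightarrow> 1" if "z \<notin> Z" for z
  proof -
    have "(\<lambda>k. Y k z) \<longlonglongrightarrow> 0"
    proof (cases "z = 0")
      case True
      then show ?thesis by (simp add: Y_def cut_def)
    next
      case False
      have "(\<lambda>k. (ln (cmod z) - ln R1) * inverse (real (Suc k))) \<longlonglongrightarrow> (ln (cmod z) - ln R1) * 0"
        by (intro tendsto_intros LIMSEQ_inverse_real_of_nat)
      then have "(\<lambda>k. (ln (cmod z) - ln R1) / n k) \<longlonglongrightarrow> 0" by (simp add: n_def divide_inverse)
      moreover have "isCont step 0" using continuous_step(3)[of UNIV] by (simp add: continuous_on_eq_continuous_at)
      ultimately have "(\<lambda>k. step ((ln (cmod z) - ln R1) / n k)) \<longlonglongrightarrow> step 0"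
        by (rule isCont_tendsto_compose[rotated])
      then show ?thesis using False by (simp add: Y_def cut_def r2(3) step_le_0)
    qed
    moreover have "(\<lambda>k. X k z) \<longlonglongrightarrow> 1" using chi_tendsto_1[OF r(1) that] by (simp add: X_def n_def)
    ultimately have "(\<lambda>k. X k z + - 1 * Y k z) \<longlonglongrightarrow> 1 + - 1 * 0" by (intro tendsto_intros)
    then show ?thesis by (simp add: W_def)
  qed
  have "(\<lambda>k. \<integral>z. W k z * \<kappa> z \<partial>lborel) \<longlonglongrightarrow> (\<integral>z. \<kappa> z \<partial>lborel)"
  proof (rule integral_dominated_convergence)
    show "integrable lborel (\<lambda>z. norm (\<kappa> z))" using kappa_int by simp
    show "AE z in lborel. (\<lambda>k. W k z * \<kappa> z) \<longlonglongrightarrow> \<kappa> z"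
      using AE_off_Z by eventually_elim (use tendsto_mult[OF W1 tendsto_const] in fastforce)
    show "AE z in lborel. norm (W k z * \<kappa> z) \<le> norm (\<kappa> z)" for k
      using Wb by (auto intro!: AE_I2 mult_left_le_one_le simp: abs_mult)
  qed auto
  moreover have "(\<lambda>k. \<integral>z. W k z * \<kappa> z \<partial>lborel) \<longlonglongrightarrow> - (2 * pi * - (2 + \<beta>)) - (- (2 * pi * total_b))"
    unfolding id by (rule tendsto_diff[OF l2 l1])
  ultimately have "(\<integral>z. \<kappa> z \<partial>lborel) = - (2 * pi * - (2 + \<beta>)) - (- (2 * pi * total_b))"
    by (rule LIMSEQ_unique)
  then show ?thesis by (simp add: algebra_simps)
qed

end

section \<open>The area profile and the lower bound\<close>

lemma parametric_integral_derivative: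
  fixes \<phi> :: "real \<Rightarrow> real" and u \<rho> :: "'a::euclidean_space \<Rightarrow> real"
  assumes \<phi>: "\<And>t. (\<phi> has_real_derivative \<phi>' t) (at t)" "\<And>t. \<bar>\<phi>' t\<bar> \<le> M" "continuous_on UNIV \<phi>'"
    and i: "\<And>s. integrable lborel (\<lambda>z. \<phi> (u z - s) * \<rho> z)"
    and u[measurable]: "u \<in> borel_measurable borel" and \<rho>: "integrable lborel \<rho>"
  shows "((\<lambda>s. \<integral>z. \<phi> (u z - s) * \<rho> z \<partial>lborel) has_real_derivative - (\<integral>z. \<phi>' (u z - s) * \<rho> z \<partial>lborel)) (at s)"
    and "isCont (\<lambda>s. \<integral>z. \<phi>' (u z - s) * \<rho> z \<partial>lborel) s"
proof -
  have [measurable]: "\<rho> \<in> borel_measurable borel" using \<rho> by simp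
  have c: "continuous_on UNIV \<phi>" by (intro continuous_at_imp_continuous_on ballI DERIV_isCont[OF \<phi>(1)])
  have [measurable]: "\<phi> \<in> borel_measurable borel" "\<phi>' \<in> borel_measurable borel"
    by (rule borel_measurable_continuous_onI c \<phi>(3))+
  have iM: "integrable lborel (\<lambda>z. M * norm (\<rho> z))" using \<rho> by simp
  show "isCont (\<lambda>s. \<integral>z. \<phi>' (u z - s) * \<rho> z \<partial>lborel) s"
    unfolding continuous_at_sequentially
  proof (intro allI impI)
    fix X :: "nat \<Rightarrow> real" assume X: "X \<longlonglongrightarrow> s"
    have "(\<lambda>n. \<integral>z. \<phi>' (u z - X n) * \<rho> z \<partial>lborel) \<longlonglongrightarrow> (\<integral>z. \<phi>' (u z - s) * \<rho> z \<partial>lborel)"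
    proof (rule integral_dominated_convergence[OF _ _ iM])
      show "AE z in lborel. (\<lambda>n. \<phi>' (u z - X n) * \<rho> z) \<longlonglongrightarrow> \<phi>' (u z - s) * \<rho> z"
      proof (rule AE_I2)
        fix z
        have "isCont \<phi>' (u z - s)" using \<phi>(3) by (simp add: continuous_on_eq_continuous_at)
        moreover have "(\<lambda>n. u z - X n) \<longlonglongrightarrow> u z - s" by (intro tendsto_intros X)
        ultimately have "(\<lambda>n. \<phi>' (u z - X n)) \<longlonglongrightarrow> \<phi>' (u z - s)" by (rule isCont_tendsto_compose)
        then show "(\<lambda>n. \<phi>' (u z - X n) * \<rho> z) \<longlonglongrightarrow> \<phi>' (u z - s) * \<rho> z" by (intro tendsto_intros)
      qed
      show "AE z in lborel. norm (\<phi>' (u z - X n) * \<rho> z) \<le> M * norm (\<rho> z)" for n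
        by (rule AE_I2) (use \<phi>(2) in \<open>simp add: abs_mult mult_right_mono\<close>)
    qed auto
    then show "((\<lambda>s. \<integral>z. \<phi>' (u z - s) * \<rho> z \<partial>lborel) \<circ> X) \<longlonglongrightarrow> (\<integral>z. \<phi>' (u z - s) * \<rho> z \<partial>lborel)"
      by (simp add: comp_def)
  qed
  show "((\<lambda>s. \<integral>z. \<phi> (u z - s) * \<rho> z \<partial>lborel) has_real_derivative - (\<integral>z. \<phi>' (u z - s) * \<rho> z \<partial>lborel)) (at s)"
    unfolding DERIV_def tendsto_at_iff_sequentially
  proof (intro allI impI)
    fix X :: "nat \<Rightarrow> real" assume X0: "\<forall>i. X i \<in> UNIV - {0}" and X: "X \<longlonglongrightarrow> 0"
    let ?q = "\<lambda>n z. (\<phi> (u z - (s + X n)) * \<rho> z - \<phi> (u z - s) * \<rho> z) / X n"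
    have lip: "\<bar>\<phi> x - \<phi> y\<bar> \<le> M * \<bar>x - y\<bar>" for x y
      using field_differentiable_bound[of UNIV \<phi> \<phi>' M x y] \<phi>(1,2)
      by (auto simp: has_field_derivative_at_within)
    have "(\<lambda>n. \<integral>z. ?q n z \<partial>lborel) \<longlonglongrightarrow> (\<integral>z. - \<phi>' (u z - s) * \<rho> z \<partial>lborel)"
    proof (rule integral_dominated_convergence[OF _ _ iM])
      show "AE z in lborel. (\<lambda>n. ?q n z) \<longlonglongrightarrow> - \<phi>' (u z - s) * \<rho> z"
      proof (rule AE_I2)
        fix z
        have "((\<lambda>s. \<phi> (u z - s) * \<rho> z) has_real_derivative (\<phi>' (u z - s) * (0 - 1)) * \<rho> z) (at s)"
          by (rule DERIV_cmult_right, rule DERIV_chain2[OF \<phi>(1)], rule DERIV_diff) (rule DERIV_const DERIV_ident)+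
        then have "((\<lambda>h. (\<phi> (u z - (s + h)) * \<rho> z - \<phi> (u z - s) * \<rho> z) / h) \<longlongrightarrow> - \<phi>' (u z - s) * \<rho> z) (at 0)"
          by (simp add: DERIV_def)
        with X0 X show "(\<lambda>n. ?q n z) \<longlonglongrightarrow> - \<phi>' (u z - s) * \<rho> z"
          unfolding tendsto_at_iff_sequentially comp_def by blast
      qed
      show "AE z in lborel. norm (?q n z) \<le> M * norm (\<rho> z)" for n
      proof (rule AE_I2)
        fix z
        have "\<bar>\<phi> (u z - (s + X n)) - \<phi> (u z - s)\<bar> \<le> M * \<bar>X n\<bar>"
          using lip[of "u z - (s + X n)" "u z - s"] by simp
        then have "\<bar>\<phi> (u z - (s + X n)) - \<phi> (u z - s)\<bar> * \<bar>\<rho> z\<bar> \<le> M * \<bar>X n\<bar> * \<bar>\<rho> z\<bar>" by (rule mult_right_mono) simp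
        moreover have "X n \<noteq> 0" using X0 by auto
        moreover have "?q n z = (\<phi> (u z - (s + X n)) - \<phi> (u z - s)) * \<rho> z / X n" by (simp only: left_diff_distrib)
        ultimately show "norm (?q n z) \<le> M * norm (\<rho> z)"
          by (simp only: real_norm_def abs_mult abs_divide) (simp add: divide_le_eq mult_ac)
      qed
    qed auto
    moreover have "(\<integral>z. ?q n z \<partial>lborel) = ((\<integral>z. \<phi> (u z - (s + X n)) * \<rho> z \<partial>lborel) - (\<integral>z. \<phi> (u z - s) * \<rho> z \<partial>lborel)) / X n" for n
      using i by simp
    moreover have "(\<integral>z. - \<phi>' (u z - s) * \<rho> z \<partial>lborel) = - (\<integral>z. \<phi>' (u z - s) * \<rho> z \<partial>lborel)" by simp
    ultimately show "((\<lambda>h. ((\<integral>z. \<phi> (u z - (s + h)) * \<rho> z \<partial>lborel) - (\<integral>z. \<phi> (u z - s) * \<rho> z \<partial>lborel)) / h) \<circ> X)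
      \<longlonglongrightarrow> - (\<integral>z. \<phi>' (u z - s) * \<rho> z \<partial>lborel)" unfolding comp_def by (simp only:)
  qed
qed

lemma nn_integral_FTC_real_line:
  fixes f F :: "real \<Rightarrow> real"
  assumes "\<And>x. (F has_real_derivative f x) (at x)" "\<And>x. isCont f x" "\<And>x. 0 \<le> f x"
    and "(F \<longlongrightarrow> A) at_bot" "(F \<longlongrightarrow> B) at_top"
  shows "(\<integral>\<^sup>+x. ennreal (f x) \<partial>lborel) = ennreal (B - A)"
proof -
  have c: "continuous_on UNIV f" using assms(2) by (simp add: continuous_on_eq_continuous_at)
  have [measurable]: "f \<in> borel_measurable borel" by (rule borel_measurable_continuous_onI[OF c])
  have l: "((F \<circ> real_of_ereal) \<longlongrightarrow> A) (at_right (-\<infinity>))" "((F \<circ> real_of_ereal) \<longlongrightarrow> B) (at_left \<infinity>)"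
    using assms(4,5) by (simp_all add: ereal_tendsto_simps)
  note I = interval_integral_FTC_nonneg[of "-\<infinity>" "\<infinity>" F f A B, OF _ assms(1,2) _ l]
  have "set_integrable lborel (einterval (-\<infinity>) \<infinity>) f" "(LBINT x=-\<infinity>..\<infinity>. f x) = B - A"
    using I assms(3) by auto
  then have "integrable lborel f" "(\<integral>x. f x \<partial>lborel) = B - A"
    by (auto simp: set_integrable_def interval_lebesgue_integral_def set_lebesgue_integral_def einterval_eq_UNIV)
  then show ?thesis using assms(3) by (simp add: nn_integral_eq_integral)
qed

context conic_plane
begin

text \<open>Let a(s) be the smoothed area above level s and d = -a'. Since d \<ge> exp (2 s)
  \<integral> \<open>slope\<close>, the level inequality and the curvature bound give 4\<pi> exp (2
  s) \<integral> level^2 \<le> d (\<tau> - |a - \<tau>| - 2\<pi> total_b), whose right-hand side is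
  an exact derivative in s. After integration in s and Fubini the left-hand side dominates 2\<pi>
  exp (-6 e) A.\<close>

lemma profile_inequality:
  assumes e: "e > 0"
  defines "A \<equiv> \<integral>z. \<rho> z \<partial>lborel" and "k \<equiv> \<integral>z. \<kappa> z \<partial>lborel"
  shows "2 * pi * exp (- 6 * e) * A \<le> A\<^sup>2 / 4 + k * A / 2 - k\<^sup>2 / 4 - 2 * pi * total_b * A"
proof -
  \<comment> \<open>\<tau> - |a - \<tau>| is the minimum of a and A + k - a, the two bounds for the
    curvature above a level: the area there, and the total curvature plus the area below.\<close>
  define \<tau> where "\<tau> = (A + k) / 2"
  \<comment> \<open>The antiderivative of \<tau> - |a - \<tau>|, in one formula for both sides of
    \<tau>; the constant makes Q 0 = 0, as \<tau> \<ge> 0.\<close>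
  define Q where "Q a = \<tau> * a - (a - \<tau>) * \<bar>a - \<tau>\<bar> / 2 - \<tau>\<^sup>2 / 2" for a
  have rho_ae: "AE z in lborel. 0 < \<rho> z" using AE_off_Z by eventually_elim (rule rho_pos)
  have kA: "\<bar>k\<bar> \<le> A"
  proof -
    have "\<bar>k\<bar> \<le> (\<integral>z. \<bar>\<kappa> z\<bar> \<partial>lborel)" unfolding k_def by (rule integral_abs_bound)
    also have "\<dots> \<le> A" unfolding A_def
      by (rule integral_mono_AE[OF _ rho_int]) (use kappa_int AE_off_Z kappa_le in \<open>auto elim: eventually_mono\<close>)
    finally show ?thesis .
  qed
  have dQ: "(Q has_real_derivative \<tau> - \<bar>a - \<tau>\<bar>) (at a)" for a
  proof -
    have absd: "((\<lambda>x::real. x * \<bar>x\<bar>) has_real_derivative 2 * \<bar>x\<bar>) (at x)" for x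
    proof -
      consider "x < 0" | "x > 0" | "x = 0" by linarith
      then show ?thesis
      proof cases
        case 1
        have "((\<lambda>x::real. - (x * x)) has_real_derivative 2 * \<bar>x\<bar>) (at x)" using 1 by (auto intro!: derivative_eq_intros)
        then show ?thesis by (rule has_field_derivative_transform_within_open[where S="{..<0}"]) (use 1 in auto)
      next
        case 2
        have "((\<lambda>x::real. x * x) has_real_derivative 2 * \<bar>x\<bar>) (at x)" using 2 by (auto intro!: derivative_eq_intros)
        then show ?thesis by (rule has_field_derivative_transform_within_open[where S="{0<..}"]) (use 2 in auto)
      next
        case 3
        have "((\<lambda>h::real. \<bar>h\<bar>) \<longlongrightarrow> \<bar>0\<bar>) (at 0)" by (intro tendsto_intros)
        moreover have "\<forall>\<^sub>F h::real in at 0. \<bar>h\<bar> = (h * \<bar>h\<bar>) / h" by (auto simp: eventually_at_filter)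
        ultimately have "((\<lambda>h::real. (h * \<bar>h\<bar>) / h) \<longlongrightarrow> \<bar>0\<bar>) (at 0)" by (rule Lim_transform_eventually)
        then show ?thesis unfolding 3 DERIV_def by simp
      qed
    qed
    have "((\<lambda>a. a - \<tau>) has_real_derivative 1) (at a)" by (auto intro!: derivative_eq_intros)
    from DERIV_chain2[OF absd this]
    have d1: "((\<lambda>a. (a - \<tau>) * \<bar>a - \<tau>\<bar>) has_real_derivative 2 * \<bar>a - \<tau>\<bar>) (at a)" by simp
    have "((\<lambda>a. \<tau> * a - (a - \<tau>) * \<bar>a - \<tau>\<bar> / 2 - \<tau>\<^sup>2 / 2) has_real_derivative \<tau> * 1 - 2 * \<bar>a - \<tau>\<bar> / 2 - 0) (at a)"
      by (rule DERIV_diff[OF DERIV_diff[OF DERIV_cmult[OF DERIV_ident] DERIV_cdivide[OF d1]] DERIV_const])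
    then show ?thesis unfolding Q_def[abs_def] by simp
  qed
  have Q0: "Q 0 = 0" using kA by (simp add: Q_def \<tau>_def power2_eq_square)
  have QA: "Q A = A\<^sup>2 / 4 + k * A / 2 - k\<^sup>2 / 4"
  proof -
    have "\<tau> \<le> A" using kA by (simp add: \<tau>_def)
    then show ?thesis by (simp add: Q_def \<tau>_def power2_eq_square field_simps)
  qed
  define \<phi> \<phi>' where "\<phi> t = step (t / e)" and "\<phi>' t = step1 (t / e) / e" for t
  have p1: "(\<phi> has_real_derivative \<phi>' t) (at t)" for t
  proof -
    have "((\<lambda>t. t / e) has_real_derivative 1 / e) (at t)" using e by (auto intro!: derivative_eq_intros)
    from DERIV_chain2[OF DERIV_step this] show ?thesis by (simp add: \<phi>_def[abs_def] \<phi>'_def)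
  qed
  have p2: "\<bar>\<phi>' t\<bar> \<le> 1 / e" for t using step1_bounds[of "t / e"] e by (simp add: \<phi>'_def divide_right_mono)
  have p3: "continuous_on UNIV \<phi>'"
    unfolding \<phi>'_def using e by (intro continuous_on_divide continuous_on_const continuous_on_compose2[OF continuous_step(2)[of UNIV]] continuous_on_id) auto
  have p4: "\<bar>\<phi> t\<bar> \<le> 1" for t using step_bounds[of "t / e"] by (simp add: \<phi>_def)
  define a d where "a s = (\<integral>z. \<phi> (u z - s) * \<rho> z \<partial>lborel)" and "d s = (\<integral>z. \<phi>' (u z - s) * \<rho> z \<partial>lborel)" for s
  have [measurable]: "\<phi> \<in> borel_measurable borel" "\<phi>' \<in> borel_measurable borel" "\<rho> \<in> borel_measurable borel"
    using borel_measurable_continuous_onI[OF continuous_at_imp_continuous_on[of UNIV \<phi>]] DERIV_isCont[OF p1]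
      borel_measurable_continuous_onI[OF p3] rho_int by auto
  have ia: "integrable lborel (\<lambda>z. \<phi> (u z - s) * \<rho> z)" for s
    by (rule Bochner_Integration.integrable_bound[OF rho_int])
       (use p4 in \<open>auto intro!: AE_I2 mult_left_le_one_le simp: abs_mult\<close>)
  note pd = parametric_integral_derivative[OF p1 p2 p3 ia u_measurable rho_int]
  have da: "(a has_real_derivative - d s) (at s)" for s
    unfolding a_def[abs_def] d_def by (rule pd(1))
  have cd: "isCont d s" for s unfolding d_def[abs_def] by (rule pd(2))
  have idd: "integrable lborel (\<lambda>z. \<phi>' (u z - s) * \<rho> z)" for s
  proof (rule Bochner_Integration.integrable_bound)
    show "integrable lborel (\<lambda>z. 1 / e * \<bar>\<rho> z\<bar>)" using rho_int by simp
    show "AE z in lborel. norm (\<phi>' (u z - s) * \<rho> z) \<le> norm (1 / e * \<bar>\<rho> z\<bar>)"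
      by (rule AE_I2) (use p2 e in \<open>simp only: abs_mult real_norm_def abs_abs abs_of_pos divide_pos_pos zero_less_one mult_right_mono abs_ge_zero\<close>)
  qed simp
  define E where "E s = (\<integral>z. level s e z * \<kappa> z \<partial>lborel) - 2 * pi * total_b" for s
  have lev: "AE z in lborel. level s e z = \<phi> (u z - s)" "AE z in lborel. slope s e z = \<phi>' (u z - s)" for s
    using AE_off_Z by (auto elim!: eventually_mono simp: level_def slope_def \<phi>_def \<phi>'_def)
  have E_le: "E s \<le> \<tau> - \<bar>a s - \<tau>\<bar> - 2 * pi * total_b" for s
  proof -
    have "(\<integral>z. level s e z * \<kappa> z \<partial>lborel) \<le> a s" unfolding a_def
    proof (rule integral_mono_AE[OF level_kappa_integrable ia])
      show "AE z in lborel. level s e z * \<kappa> z \<le> \<phi> (u z - s) * \<rho> z"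
        using lev(1)[of s] AE_off_Z
      proof eventually_elim
        case (elim z)
        have "\<kappa> z \<le> \<rho> z" using kappa_le[OF elim(2)] by simp
        then show ?case using mult_left_mono[OF _ level_bounds(1)[of s e z]] elim(1) by metis
      qed
    qed
    moreover have "k - (\<integral>z. level s e z * \<kappa> z \<partial>lborel) \<ge> - (A - a s)"
    proof -
      have "(\<integral>z. - ((1 - \<phi> (u z - s)) * \<rho> z) \<partial>lborel) \<le> (\<integral>z. (1 - level s e z) * \<kappa> z \<partial>lborel)"
      proof (rule integral_mono_AE)
        show "integrable lborel (\<lambda>z. - ((1 - \<phi> (u z - s)) * \<rho> z))" "integrable lborel (\<lambda>z. (1 - level s e z) * \<kappa> z)"
          using ia[of s] rho_int kappa_int level_kappa_integrable[of s e] by (simp_all add: left_diff_distrib)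
        show "AE z in lborel. - ((1 - \<phi> (u z - s)) * \<rho> z) \<le> (1 - level s e z) * \<kappa> z"
          using lev(1)[of s] AE_off_Z
        proof eventually_elim
          case (elim z)
          have "- \<rho> z \<le> \<kappa> z" using kappa_le[OF elim(2)] by simp
          then have "(1 - level s e z) * - \<rho> z \<le> (1 - level s e z) * \<kappa> z"
            using level_bounds(2)[of s e z] by (intro mult_left_mono) auto
          then show ?case using elim(1) by simp
        qed
      qed
      moreover have "(\<integral>z. - ((1 - \<phi> (u z - s)) * \<rho> z) \<partial>lborel) = - (A - a s)"
        using ia[of s] rho_int by (simp add: left_diff_distrib A_def a_def)
      moreover have "(\<integral>z. (1 - level s e z) * \<kappa> z \<partial>lborel) = k - (\<integral>z. level s e z * \<kappa> z \<partial>lborel)"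
        using kappa_int level_kappa_integrable[of s e] by (simp add: left_diff_distrib k_def)
      ultimately show ?thesis by linarith
    qed
    ultimately have "(\<integral>z. level s e z * \<kappa> z \<partial>lborel) \<le> \<tau> - \<bar>a s - \<tau>\<bar>"
      unfolding \<tau>_def by (auto simp: abs_if field_simps)
    then show ?thesis by (simp add: E_def)
  qed
  have E0: "0 \<le> E s" for s using level_inequality(1)[OF e] by (simp add: E_def)
  define D where "D s = (\<integral>z. slope s e z \<partial>lborel)" for s
  \<comment> \<open>\<open>slope\<close> lives where u \<ge> s, hence where \<rho> \<ge> exp (2
    s).\<close>
  have Dd: "exp (2 * s) * D s \<le> d s" for s
  proof -
    have "exp (2 * s) * D s = (\<integral>z. exp (2 * s) * slope s e z \<partial>lborel)" by (simp add: D_def)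
    also have "\<dots> \<le> d s" unfolding d_def
    proof (rule integral_mono_AE[OF _ idd])
      show "integrable lborel (\<lambda>z. exp (2 * s) * slope s e z)" using slope_integrable[OF e] by simp
      show "AE z in lborel. exp (2 * s) * slope s e z \<le> \<phi>' (u z - s) * \<rho> z"
        using lev(2)[of s] AE_off_Z
      proof eventually_elim
        case (elim z)
        show ?case
        proof (cases "u z \<ge> s")
          case True
          then have "exp (2 * s) \<le> \<rho> z" using exp_u[OF elim(2)] by (metis exp_le_cancel_iff mult_le_cancel_left_pos zero_less_numeral)
          then have "exp (2 * s) * slope s e z \<le> \<rho> z * slope s e z" using slope_nonneg[OF e] by (intro mult_right_mono) auto
          then show ?thesis using elim(1) by (simp add: mult.commute)
        next
          case False
          then have "\<phi>' (u z - s) = 0" using e by (simp add: \<phi>'_def step_le_0 divide_nonpos_pos)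
          then show ?thesis using elim by simp
        qed
      qed
    qed
    finally show ?thesis .
  qed
  define h where "h s = d s * (\<tau> - \<bar>a s - \<tau>\<bar> - 2 * pi * total_b)" for s
  have main: "4 * pi * exp (2 * s) * (\<integral>z. (level s e z)\<^sup>2 \<partial>lborel) \<le> h s" for s
  proof -
    have "exp (2 * s) * (4 * pi * (\<integral>z. (level s e z)\<^sup>2 \<partial>lborel)) \<le> exp (2 * s) * (D s * E s)"
      using level_inequality(2)[OF e, of s] by (intro mult_left_mono) (auto simp: D_def E_def)
    also have "\<dots> = (exp (2 * s) * D s) * E s" by simp
    also have "\<dots> \<le> d s * E s" by (rule mult_right_mono[OF Dd E0])
    also have "\<dots> \<le> h s" unfolding h_def
    proof (rule mult_left_mono[OF E_le])
      have "0 \<le> exp (2 * s) * D s" using slope_nonneg[OF e] by (simp add: D_def)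
      with Dd[of s] show "0 \<le> d s" by linarith
    qed
    finally show ?thesis by (simp add: mult_ac)
  qed
  have h0: "0 \<le> h s" for s
  proof -
    have "0 \<le> 4 * pi * exp (2 * s) * (\<integral>z. (level s e z)\<^sup>2 \<partial>lborel)" by simp
    with main[of s] show ?thesis by linarith
  qed
  \<comment> \<open>The minus sign compensates that a decreases in s; \<Phi> increases to 0.\<close>
  define \<Phi> where "\<Phi> s = - (Q (a s) - 2 * pi * total_b * a s)" for s
  have dPhi: "(\<Phi> has_real_derivative h s) (at s)" for s
    unfolding \<Phi>_def[abs_def] h_def using DERIV_chain2[OF dQ da]
    by (auto intro!: derivative_eq_intros da simp: algebra_simps)
  have ch: "isCont h s" for s
    unfolding h_def[abs_def] using DERIV_isCont[OF da] cd by (intro continuous_intros) auto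
  have a_top: "(a \<longlongrightarrow> 0) at_top"
  proof -
    have "((\<lambda>s. \<integral>z. \<phi> (u z - s) * \<rho> z \<partial>lborel) \<longlongrightarrow> (\<integral>z. 0 \<partial>(lborel::complex measure))) at_top"
    proof (rule integral_dominated_convergence_at_top)
      show "integrable lborel (\<lambda>z. norm (\<rho> z))" using rho_int by simp
      show "AE z in lborel. ((\<lambda>s. \<phi> (u z - s) * \<rho> z) \<longlongrightarrow> 0) at_top"
      proof (rule AE_I2, rule tendsto_eventually)
        fix z show "\<forall>\<^sub>F s in at_top. \<phi> (u z - s) * \<rho> z = 0"
          using eventually_ge_at_top[of "u z"] by eventually_elim (use e in \<open>simp add: \<phi>_def step_le_0 divide_nonpos_pos\<close>)
      qed
      show "\<forall>\<^sub>F s in at_top. AE z in lborel. norm (\<phi> (u z - s) * \<rho> z) \<le> norm (\<rho> z)"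
        by (intro always_eventually allI AE_I2) (use p4 in \<open>auto intro!: mult_left_le_one_le simp: abs_mult\<close>)
    qed auto
    then show ?thesis by (simp add: a_def[abs_def])
  qed
  have a_bot: "(a \<longlongrightarrow> A) at_bot"
  proof -
    have "((\<lambda>s. \<integral>z. \<phi> (u z - (- s)) * \<rho> z \<partial>lborel) \<longlongrightarrow> (\<integral>z. \<rho> z \<partial>lborel)) at_top"
    proof (rule integral_dominated_convergence_at_top)
      show "integrable lborel (\<lambda>z. norm (\<rho> z))" using rho_int by simp
      show "AE z in lborel. ((\<lambda>s. \<phi> (u z - (- s)) * \<rho> z) \<longlongrightarrow> \<rho> z) at_top"
      proof (rule AE_I2, rule tendsto_eventually)
        fix z show "\<forall>\<^sub>F s in at_top. \<phi> (u z - (- s)) * \<rho> z = \<rho> z"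
          using eventually_ge_at_top[of "3 * e - u z"] by eventually_elim (use e in \<open>simp add: \<phi>_def step_ge_3 field_simps\<close>)
      qed
      show "\<forall>\<^sub>F s in at_top. AE z in lborel. norm (\<phi> (u z - (- s)) * \<rho> z) \<le> norm (\<rho> z)"
        by (intro always_eventually allI AE_I2) (use p4 in \<open>auto intro!: mult_left_le_one_le simp: abs_mult\<close>)
    qed auto
    then have "((\<lambda>s. a (- s)) \<longlongrightarrow> A) at_top" by (simp add: a_def[abs_def] A_def)
    then show ?thesis unfolding filterlim_at_bot_mirror .
  qed
  have cQ: "isCont Q x" for x by (rule DERIV_isCont[OF dQ])
  have Phi_top: "(\<Phi> \<longlongrightarrow> 0) at_top"
  proof -
    have "(\<Phi> \<longlongrightarrow> - (Q 0 - 2 * pi * total_b * 0)) at_top"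
      unfolding \<Phi>_def[abs_def] by (intro tendsto_intros isCont_tendsto_compose[OF cQ a_top] a_top)
    then show ?thesis by (simp add: Q0)
  qed
  have Phi_bot: "(\<Phi> \<longlongrightarrow> - (Q A - 2 * pi * total_b * A)) at_bot"
    unfolding \<Phi>_def[abs_def] by (intro tendsto_intros isCont_tendsto_compose[OF cQ a_bot] a_bot)
  have up: "(\<integral>\<^sup>+s. ennreal (h s) \<partial>lborel) = ennreal (Q A - 2 * pi * total_b * A)"
    using nn_integral_FTC_real_line[OF dPhi ch h0 Phi_bot Phi_top] by simp
  have ennlev: "ennreal (4 * pi * exp (2 * s) * (\<integral>z. (level s e z)\<^sup>2 \<partial>lborel)) =
      (\<integral>\<^sup>+z. ennreal (4 * pi * exp (2 * s) * (level s e z)\<^sup>2) \<partial>lborel)" for s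
  proof -
    obtain R where R: "R \<ge> 0" "\<And>z. R < cmod z \<Longrightarrow> z \<notin> Z" "\<And>z. R < cmod z \<Longrightarrow> u z < s"
      using escape[of s] by auto
    have "integrable lborel (\<lambda>z. (level s e z)\<^sup>2)"
    proof (rule Bochner_Integration.integrable_bound)
      show "integrable lborel (\<lambda>z::complex. indicator (cball 0 R) z :: real)"
        by (rule integrable_real_indicator)
           (use emeasure_bounded_finite[OF bounded_cball, of "0::complex" R] in \<open>simp_all add: less_top\<close>)
      show "AE z in lborel. norm ((level s e z)\<^sup>2) \<le> norm (indicator (cball 0 R) z :: real)"
      proof (rule AE_I2)
        fix z :: complex
        show "norm ((level s e z)\<^sup>2) \<le> norm (indicator (cball 0 R) z :: real)"
        proof (cases "cmod z \<le> R")
          case True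
          then show ?thesis using level_bounds[of s e z] by (simp add: power_le_one)
        next
          case False
          then have "(u z - s) / e \<le> 0" using R(3)[of z] e by (simp add: divide_nonpos_pos)
          then show ?thesis by (simp add: level_def step_le_0)
        qed
      qed
    qed simp
    then have "(\<integral>\<^sup>+z. ennreal (4 * pi * exp (2 * s) * (level s e z)\<^sup>2) \<partial>lborel) = 
        ennreal (\<integral>z. 4 * pi * exp (2 * s) * (level s e z)\<^sup>2 \<partial>lborel)"
      by (intro nn_integral_eq_integral) auto
    then show ?thesis by simp
  qed
  \<comment> \<open>\<open>level\<close> has reached 1 once s \<le> u - 3 e, and 4\<pi> exp (2 s)
    integrates to 2\<pi> exp (2 u - 6 e) over that half line. This is the origin of the factor exp
    (-6 e).\<close>
  have inner: "ennreal (2 * pi * exp (- 6 * e) * \<rho> z) \<le> (\<integral>\<^sup>+s. ennreal (4 * pi * exp (2 * s) * (level s e z)\<^sup>2) \<partial>lborel)"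
    if z: "z \<notin> Z" for z
  proof -
    define t where "t = u z - 3 * e"
    have "(\<integral>\<^sup>+x. ennreal (4 * pi * exp (- 2 * x)) * indicator {- t..} x \<partial>lborel) = ennreal (0 - (- 2 * pi * exp (- 2 * (- t))))"
    proof (rule nn_integral_FTC_atLeast)
      show "((\<lambda>x. - 2 * pi * exp (- 2 * x)) \<longlongrightarrow> 0) at_top" by real_asymp
    qed (auto intro!: derivative_eq_intros)
    moreover have "(\<integral>\<^sup>+x. ennreal (4 * pi * exp (2 * x)) * indicator {..t} x \<partial>lborel) =
       (\<integral>\<^sup>+x. ennreal (4 * pi * exp (- 2 * x)) * indicator {- t..} x \<partial>lborel)"
      by (subst nn_integral_real_affine[where c="-1" and t=0]) (auto intro!: nn_integral_cong simp: indicator_def)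
    moreover have "2 * pi * exp (2 * t) = 2 * pi * exp (- 6 * e) * \<rho> z"
      using exp_u[OF z, symmetric] by (simp add: t_def exp_add[symmetric] algebra_simps)
    ultimately have "ennreal (2 * pi * exp (- 6 * e) * \<rho> z) = (\<integral>\<^sup>+x. ennreal (4 * pi * exp (2 * x)) * indicator {..t} x \<partial>lborel)" by simp
    also have "\<dots> \<le> (\<integral>\<^sup>+s. ennreal (4 * pi * exp (2 * s) * (level s e z)\<^sup>2) \<partial>lborel)"
    proof (rule nn_integral_mono)
      fix x
      show "ennreal (4 * pi * exp (2 * x)) * indicator {..t} x \<le> ennreal (4 * pi * exp (2 * x) * (level x e z)\<^sup>2)"
      proof (cases "x \<le> t")
        case True
        then have "(u z - x) / e \<ge> 3" using e by (simp add: t_def field_simps)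
        then show ?thesis using z True by (simp add: level_def step_ge_3)
      qed simp
    qed
    finally show ?thesis .
  qed
  have meas: "(\<lambda>(s, z). ennreal (4 * pi * exp (2 * s) * (level s e z)\<^sup>2)) \<in> borel_measurable (lborel \<Otimes>\<^sub>M lborel)"
  proof -
    have *: "level s e z = (if z \<in> Z then 0 else \<phi> (u z - s))" for s z by (simp add: level_def \<phi>_def)
    have "Z \<in> sets borel" using finZ by (simp add: finite_imp_closed)
    then show ?thesis unfolding * by measurable
  qed
  have intr: "integrable lborel (\<lambda>z. 2 * pi * exp (- 6 * e) * \<rho> z)" using rho_int by simp
  have "ennreal (2 * pi * exp (- 6 * e) * A) = (\<integral>\<^sup>+z. ennreal (2 * pi * exp (- 6 * e) * \<rho> z) \<partial>lborel)"
  proof -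
    have "AE z in lborel. 0 \<le> 2 * pi * exp (- 6 * e) * \<rho> z" using rho_ae by eventually_elim simp
    from nn_integral_eq_integral[OF intr this] show ?thesis by (simp add: A_def)
  qed
  also have "\<dots> \<le> (\<integral>\<^sup>+z. (\<integral>\<^sup>+s. ennreal (4 * pi * exp (2 * s) * (level s e z)\<^sup>2) \<partial>lborel) \<partial>lborel)"
  proof (rule nn_integral_mono_AE)
    show "AE z in lborel. ennreal (2 * pi * exp (- 6 * e) * \<rho> z) \<le>
        (\<integral>\<^sup>+s. ennreal (4 * pi * exp (2 * s) * (level s e z)\<^sup>2) \<partial>lborel)"
      using AE_off_Z by eventually_elim (rule inner)
  qed
  also have "\<dots> = (\<integral>\<^sup>+s. (\<integral>\<^sup>+z. ennreal (4 * pi * exp (2 * s) * (level s e z)\<^sup>2) \<partial>lborel) \<partial>lborel)"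
    by (rule lborel_pair.Fubini'[OF meas])
  also have "\<dots> \<le> (\<integral>\<^sup>+s. ennreal (h s) \<partial>lborel)"
    unfolding ennlev[symmetric] by (intro nn_integral_mono ennreal_leI main)
  also have "\<dots> = ennreal (Q A - 2 * pi * total_b * A)" by (rule up)
  finally have "ennreal (2 * pi * exp (- 6 * e) * A) \<le> ennreal (Q A - 2 * pi * total_b * A)" .
  \<comment> \<open>\<open>ennreal\<close> sends negative numbers to 0, so the inequality returns to
    the reals only with a nonnegative right-hand side; monotonicity of \<Phi> provides it.\<close>
  moreover have "0 \<le> Q A - 2 * pi * total_b * A"
  proof -
    have "0 \<le> 0 - (- (Q A - 2 * pi * total_b * A))"
    proof -
      have "mono \<Phi>" by (rule monoI, rule DERIV_nonneg_imp_nondecreasing) (use dPhi h0 in blast)+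
      then have "\<Phi> 0 \<le> 0" by (intro tendsto_lowerbound[OF Phi_top]) (auto intro!: eventually_mono[OF eventually_ge_at_top[of 0]] simp: mono_def)
      moreover have "- (Q A - 2 * pi * total_b * A) \<le> \<Phi> 0" using \<open>mono \<Phi>\<close>
        by (intro tendsto_upperbound[OF Phi_bot]) (auto intro!: eventually_mono[OF eventually_le_at_bot[of 0]] simp: mono_def)
      ultimately show ?thesis by linarith
    qed
    then show ?thesis by simp
  qed
  ultimately have "2 * pi * exp (- 6 * e) * A \<le> Q A - 2 * pi * total_b * A" by (simp add: ennreal_le_iff)
  then show ?thesis by (simp add: QA)
qed

text \<open>With e tending to 0, Gauss-Bonnet inserted and the area measured in units of 2\<pi>, the
  profile inequality becomes a lower bound for the square of x - (total_b - \<beta>).\<close>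

theorem area_lower_bound:
  "2 * pi * (total_b - \<beta> + sqrt (2 * (1 + total_b)\<^sup>2 + 2 * (1 + \<beta>)\<^sup>2)) \<le> (\<integral>z. \<rho> z \<partial>lborel)"
proof -
  define A k where "A = (\<integral>z. \<rho> z \<partial>lborel)" and "k = (\<integral>z. \<kappa> z \<partial>lborel)"
  have "(\<lambda>n. 2 * pi * exp (- 6 * inverse (real (Suc n))) * A) \<longlonglongrightarrow> 2 * pi * exp (- 6 * 0) * A"
    by (intro tendsto_intros LIMSEQ_inverse_real_of_nat)
  moreover have "2 * pi * exp (- 6 * inverse (real (Suc n))) * A \<le> A\<^sup>2 / 4 + k * A / 2 - k\<^sup>2 / 4 - 2 * pi * total_b * A" for n
    unfolding A_def k_def by (rule profile_inequality) simp
  ultimately have ineq: "2 * pi * A \<le> A\<^sup>2 / 4 + k * A / 2 - k\<^sup>2 / 4 - 2 * pi * total_b * A"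
    by (intro LIMSEQ_le_const2[where X="\<lambda>n. 2 * pi * exp (- 6 * inverse (real (Suc n))) * A"]) auto
  have rho_ae: "AE z in lborel. 0 < \<rho> z" using AE_off_Z by eventually_elim (rule rho_pos)
  have "A > 0"
  proof -
    have "A \<ge> 0" unfolding A_def by (rule integral_nonneg_AE) (use rho_ae in \<open>auto elim: eventually_mono\<close>)
    moreover have "A \<noteq> 0"
    proof
      assume "A = 0"
      moreover have "AE z in lborel. 0 \<le> \<rho> z" using rho_ae by eventually_elim simp
      ultimately have "AE z in lborel. \<rho> z = 0"
        using integral_nonneg_eq_0_iff_AE[OF rho_int] by (simp add: A_def)
      with rho_ae have "AE z in (lborel :: complex measure). False" by eventually_elim simp
      then have "emeasure lborel (UNIV :: complex set) = 0"
        using AE_iff_measurable[of UNIV "lborel :: complex measure" "\<lambda>_. False"] by simp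
      then show False by simp
    qed
    ultimately show ?thesis by simp
  qed
  define x p where "x = A / (2 * pi)" and "p = 2 + total_b + \<beta>"
  have x: "x > 0" using \<open>A > 0\<close> by (simp add: x_def)
  have Ax: "A = 2 * pi * x" by (simp add: x_def)
  have kp: "k = 2 * pi * p" using gauss_bonnet by (simp add: k_def p_def)
  have "(2 * pi)\<^sup>2 * (x + total_b * x) \<le> (2 * pi)\<^sup>2 * (x\<^sup>2 / 4 + p * x / 2 - p\<^sup>2 / 4)"
    using ineq unfolding Ax kp by (simp add: power2_eq_square algebra_simps)
  then have "x + total_b * x \<le> x\<^sup>2 / 4 + p * x / 2 - p\<^sup>2 / 4" by simp
  then have sq: "(x - (total_b - \<beta>))\<^sup>2 \<ge> 2 * (1 + total_b)\<^sup>2 + 2 * (1 + \<beta>)\<^sup>2"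
  proof -
    have "(x - (total_b - \<beta>))\<^sup>2 - (2 * (1 + total_b)\<^sup>2 + 2 * (1 + \<beta>)\<^sup>2) =
        4 * ((x\<^sup>2 / 4 + p * x / 2 - p\<^sup>2 / 4) - (x + total_b * x))"
      by (simp add: p_def power2_eq_square field_simps)
    moreover have "0 \<le> 4 * ((x\<^sup>2 / 4 + p * x / 2 - p\<^sup>2 / 4) - (x + total_b * x))"
      using \<open>x + total_b * x \<le> x\<^sup>2 / 4 + p * x / 2 - p\<^sup>2 / 4\<close> by simp
    ultimately have "0 \<le> (x - (total_b - \<beta>))\<^sup>2 - (2 * (1 + total_b)\<^sup>2 + 2 * (1 + \<beta>)\<^sup>2)" by (simp only:)
    then show ?thesis by (simp only: diff_ge_0_iff_ge)
  qed
  define S where "S = sqrt (2 * (1 + total_b)\<^sup>2 + 2 * (1 + \<beta>)\<^sup>2)"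
  have "S \<le> \<bar>x - (total_b - \<beta>)\<bar>" using real_sqrt_le_mono[OF sq] by (simp add: S_def)
  \<comment> \<open>The difference of the squares is (2 + total_b + \<beta>)^2. So total_b - \<beta>
    - S \<le> 0, and x > 0 excludes the lower branch.\<close>
  moreover have "\<bar>total_b - \<beta>\<bar> \<le> S"
  proof -
    have "(total_b - \<beta>)\<^sup>2 \<le> 2 * (1 + total_b)\<^sup>2 + 2 * (1 + \<beta>)\<^sup>2"
      using zero_le_power2[of "2 + total_b + \<beta>"] by (simp add: power2_eq_square algebra_simps)
    from real_sqrt_le_mono[OF this] show ?thesis by (simp add: S_def)
  qed
  ultimately have "total_b - \<beta> + S \<le> x" using x by linarith
  then have "2 * pi * (total_b - \<beta> + S) \<le> 2 * pi * x" by (intro mult_left_mono) auto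
  then show ?thesis unfolding S_def by (simp add: Ax[symmetric] A_def[symmetric])
qed

end

section \<open>Smooth rotationally symmetric profiles\<close>

text \<open>For m = 0 the classical function that vanishes to infinite order at 0; the powers in the
  denominator close the family, up to linear combinations, under differentiation.\<close>

definition flat :: "nat \<Rightarrow> real \<Rightarrow> real" where
  "flat m x = (if x \<le> 0 then 0 else exp (- (1 / x)) / x ^ m)"

lemma flat_tendsto_0: "(flat m \<longlongrightarrow> 0) (at 0)"
proof -
  have "((\<lambda>x::real. inverse x ^ m / exp (inverse x)) \<longlongrightarrow> 0) (at_right 0)"
    by (rule filterlim_compose[OF tendsto_power_div_exp_0 filterlim_inverse_at_top_right])
  moreover have "\<forall>\<^sub>F x::real in at_right 0. inverse x ^ m / exp (inverse x) = flat m x"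
    using eventually_at_right_less[of "0::real"] 
    by eventually_elim (simp add: flat_def exp_minus divide_simps power_one_over)
  ultimately have r: "(flat m \<longlongrightarrow> 0) (at_right 0)" by (rule Lim_transform_eventually)
  have "\<forall>\<^sub>F x::real in at_left 0. flat m x = 0"
    by (simp add: eventually_at_filter flat_def)
  then have l: "(flat m \<longlongrightarrow> 0) (at_left 0)" by (rule tendsto_eventually)
  show ?thesis using l r by (simp add: filterlim_at_split)
qed

lemma DERIV_flat: "(flat m has_real_derivative flat (m + 2) x - real m * flat (m + 1) x) (at x)"
proof -
  consider "x < 0" | "x > 0" | "x = 0" by linarith
  then show ?thesis
  proof cases
    case 1
    have "((\<lambda>_. 0) has_real_derivative 0) (at x)" by simp
    then have "(flat m has_real_derivative 0) (at x)"
      by (rule has_field_derivative_transform_within_open[where S="{..<0}"]) (use 1 in \<open>auto simp: flat_def\<close>)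
    then show ?thesis using 1 by (simp add: flat_def)
  next
    case 2
    have dI: "(inverse has_real_derivative - (1 / x\<^sup>2)) (at x)"
      using 2 by (auto intro!: derivative_eq_intros simp: power2_eq_square divide_simps)
    have dE: "((\<lambda>x. exp (- (1 / x))) has_real_derivative exp (- (1 / x)) * (1 / x\<^sup>2)) (at x)"
      using 2 by (auto intro!: derivative_eq_intros simp: power2_eq_square)
    have "((\<lambda>x. exp (- (1 / x)) * inverse x ^ m) has_real_derivative
        exp (- (1 / x)) * (1 / x\<^sup>2) * inverse x ^ m + real m * (- (1 / x\<^sup>2) * inverse x ^ (m - Suc 0)) * exp (- (1 / x))) (at x)"
      by (rule DERIV_mult[OF dE DERIV_power[OF dI]])
    moreover have "exp (- (1 / x)) * (1 / x\<^sup>2) * inverse x ^ m + real m * (- (1 / x\<^sup>2) * inverse x ^ (m - Suc 0)) * exp (- (1 / x))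
        = flat (m + 2) x - real m * flat (m + 1) x"
      using 2 by (cases m) (simp_all add: flat_def field_simps power2_eq_square)
    ultimately have "((\<lambda>x. exp (- (1 / x)) * inverse x ^ m) has_real_derivative flat (m + 2) x - real m * flat (m + 1) x) (at x)" by simp
    then show ?thesis
      by (rule has_field_derivative_transform_within_open[where S="{0<..}"]) (use 2 in \<open>auto simp: flat_def divide_simps power_one_over\<close>)
  next
    \<comment> \<open>At 0 the difference quotient of \<open>flat m\<close> is
      \<open>flat (m + 1)\<close>, which tends to 0.\<close>
    case 3
    have "\<forall>\<^sub>F h in at 0. flat (m + 1) h = (flat m (0 + h) - flat m 0) / h"
      by (auto simp: eventually_at_filter flat_def)
    from Lim_transform_eventually[OF flat_tendsto_0 this] show ?thesis
      unfolding 3 DERIV_def by (simp add: flat_def)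
  qed
qed

lemma Ck_on_flat: "Ck_on k UNIV (flat m)"
proof (induction k arbitrary: m)
  case 0
  show ?case by (auto intro!: continuous_at_imp_continuous_on DERIV_isCont[OF DERIV_flat])
next
  case (Suc k)
  show ?case
    by (rule Ck_on_real_SucI[OF open_UNIV DERIV_flat])
       (rule Ck_on_diff[OF open_UNIV Suc.IH Ck_on_mult[OF open_UNIV Ck_on_const Suc.IH]])
qed

lemma Ck_on_affine: "Ck_on k UNIV (\<lambda>t::real. a + c * t)"
  by (rule Ck_on_add[OF open_UNIV Ck_on_const Ck_on_mult[OF open_UNIV Ck_on_const Ck_on_id]])

lemma mollifier_exists:
  assumes "\<sigma> > 0"
  obtains \<phi> :: "real \<Rightarrow> real" where "\<And>k. Ck_on k UNIV \<phi>" "\<And>x. 0 \<le> \<phi> x" "\<And>x. \<sigma> < \<bar>x\<bar> \<Longrightarrow> \<phi> x = 0"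
    "integrable lborel \<phi>" "(\<integral>x. \<phi> x \<partial>lborel) = 1"
proof -
  define f where "f x = flat 0 (\<sigma> + 1 * x) * flat 0 (\<sigma> + (- 1) * x)" for x
  have Ckf: "Ck_on k UNIV f" for k
    unfolding f_def by (rule Ck_on_mult[OF open_UNIV]; rule Ck_on_compose[OF open_UNIV Ck_on_affine Ck_on_flat]) auto
  have cf: "continuous_on UNIV f" by (rule Ck_on_imp_continuous_on[OF Ckf])
  have f0: "0 \<le> f x" for x by (simp add: f_def flat_def)
  have fs: "f x = 0" if "\<sigma> < norm x" for x using that by (auto simp: f_def flat_def)
  have fi: "integrable lborel f" by (rule integrable_compact_support[OF cf fs])
  define c where "c = (\<integral>x. f x \<partial>lborel)"
  have c: "c > 0"
  proof -
    have "c \<ge> 0" unfolding c_def by (rule Bochner_Integration.integral_nonneg) (rule f0)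
    moreover have "c \<noteq> 0"
    proof
      assume "c = 0"
      then have "AE x in lborel. f x = 0" using integral_nonneg_eq_0_iff_AE[OF fi] f0 by (simp add: c_def)
      then have "AE x in lborel. x \<notin> {- \<sigma><..<\<sigma>}"
        by eventually_elim (use assms in \<open>auto simp: f_def flat_def\<close>)
      then have "{- \<sigma><..<\<sigma>} \<in> null_sets lborel" by (subst AE_iff_null_sets) auto
      then show False using assms by (auto simp: null_sets_def emeasure_lborel_Ioo)
    qed
    ultimately show ?thesis by simp
  qed
  show ?thesis
  proof (rule that[of "\<lambda>x. f x * (1 / c)"])
    show "Ck_on k UNIV (\<lambda>x. f x * (1 / c))" for k by (rule Ck_on_mult[OF open_UNIV Ckf Ck_on_const])
    show "(\<integral>x. f x * (1 / c) \<partial>lborel) = 1" using c unfolding integral_mult_left_zero c_def[symmetric] by simp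
  qed (use f0 c fs fi in auto)
qed

text \<open>All derivatives fall on the kernel and keep its compact support, so the induction runs
  over K and asks only continuity of g.\<close>

lemma Ck_on_convolution:
  fixes g K :: "real \<Rightarrow> real"
  assumes g: "continuous_on UNIV g" and K: "\<And>k. Ck_on k UNIV K" "\<And>x. r < \<bar>x\<bar> \<Longrightarrow> K x = 0"
  shows "Ck_on k UNIV (\<lambda>t. \<integral>y. K (t - y) * g y \<partial>lborel)"
proof -
  have deriv: "\<exists>K'. (\<forall>k. Ck_on k UNIV K') \<and> (\<forall>x. r < \<bar>x\<bar> \<longrightarrow> K' x = 0) \<and>
    (\<forall>t. ((\<lambda>t. \<integral>y. K (t - y) * g y \<partial>lborel) has_real_derivative (\<integral>y. K' (t - y) * g y \<partial>lborel)) (at t))"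
    if K: "\<And>k. Ck_on k UNIV K" "\<And>x. r < \<bar>x\<bar> \<Longrightarrow> K x = 0" for K :: "real \<Rightarrow> real"
  proof -
    define K' where "K' x = frechet_derivative K (at x) 1" for x
    have CkK': "Ck_on k UNIV K'" for k using K(1)[of "Suc k"] by (simp add: K'_def[abs_def])
    have dK: "(K has_real_derivative K' x) (at x)" for x
    proof -
      have D: "(K has_derivative frechet_derivative K (at x)) (at x)"
        using K(1)[of 1] by (simp add: frechet_derivative_works[symmetric])
      have "frechet_derivative K (at x) h = K' x * h" for h
        using linear_scale[OF has_derivative_linear[OF D], of h 1] by (simp add: K'_def)
      then have "frechet_derivative K (at x) = (\<lambda>h. K' x * h)" by (rule ext)
      with D show ?thesis by (simp add: has_field_derivative_def)
    qed
    have sK': "K' x = 0" if "r < \<bar>x\<bar>" for x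
    proof -
      have op: "open {x::real. r < \<bar>x\<bar>}" by (intro open_Collect_less continuous_intros)
      have "((\<lambda>_. 0) has_real_derivative K' x) (at x)"
        by (rule has_field_derivative_transform_within_open[OF dK op]) (use that K(2) in auto)
      then show ?thesis using DERIV_unique[OF _ DERIV_const] by blast
    qed
    have cK': "continuous_on UNIV K'" by (rule Ck_on_imp_continuous_on[OF CkK'[of 0]])
    have cK: "continuous_on UNIV K" by (rule Ck_on_imp_continuous_on[OF K(1)[of 0]])
    have sn: "\<And>x. r < norm x \<Longrightarrow> K' x = 0" "\<And>x. r < norm x \<Longrightarrow> K x = 0" using sK' K(2) by auto
    obtain M where M: "\<And>x. \<bar>K' x\<bar> \<le> M" using bounded_compact_support[OF cK' sn(1)] by blast
    have "((\<lambda>t. \<integral>y. K (t - y) * g y \<partial>lborel) has_real_derivative (\<integral>y. K' (t - y) * g y \<partial>lborel)) (at t)" for t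
    proof -
      \<comment> \<open>For parameters within 1 of t the kernel sees only |y| \<le> S. Truncating g
        there gives an integrable function although g may be unbounded.\<close>
      define S where "S = \<bar>t\<bar> + 1 + \<bar>r\<bar>"
      define G where "G y = indicator (cball 0 S) y *\<^sub>R g y" for y :: real
      have iG: "integrable lborel G" unfolding G_def
        by (rule borel_integrable_compact) (auto intro: continuous_on_subset[OF g])
      have mG[measurable]: "G \<in> borel_measurable borel" using iG by simp
      have mK[measurable]: "K \<in> borel_measurable borel" by (rule borel_measurable_continuous_onI[OF cK])
      obtain B where B: "\<And>x. \<bar>K x\<bar> \<le> B" using bounded_compact_support[OF cK sn(2)] by blast
      have B0: "0 \<le> B" using B[of 0] by linarith
      have i: "integrable lborel (\<lambda>y. K (- y - s) * G y)" for s
      proof (rule Bochner_Integration.integrable_bound[OF integrable_mult_right[of B]])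
        show "integrable lborel (\<lambda>y. \<bar>G y\<bar>)" using iG by simp
        show "AE y in lborel. norm (K (- y - s) * G y) \<le> norm (B * \<bar>G y\<bar>)"
          by (rule AE_I2) (use B B0 in \<open>simp add: abs_mult mult_right_mono\<close>)
      qed simp
      \<comment> \<open>The parameter enters as u - s with u = -y, so K (t - y) corresponds to s =
        -t, and the mirror rule undoes the sign.\<close>
      have "((\<lambda>s. \<integral>y. K (- y - s) * G y \<partial>lborel) has_real_derivative - (\<integral>y. K' (- y - - t) * G y \<partial>lborel)) (at (- t))"
        by (rule parametric_integral_derivative(1)[where u="\<lambda>y. - y", OF dK M cK' i _ iG]) simp
      then have "((\<lambda>t. \<integral>y. K (- y - - t) * G y \<partial>lborel) has_real_derivative - (- (\<integral>y. K' (- y - - t) * G y \<partial>lborel))) (at t)"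
        using DERIV_mirror[of "\<lambda>s. \<integral>y. K (- y - s) * G y \<partial>lborel" "- (\<integral>y. K' (- y - - t) * G y \<partial>lborel)" t] by simp
      then have D: "((\<lambda>t. \<integral>y. K (t - y) * G y \<partial>lborel) has_real_derivative (\<integral>y. K' (t - y) * G y \<partial>lborel)) (at t)"
        by simp
      have eq: "L (s - y) * G y = L (s - y) * g y" if "\<bar>s - t\<bar> < 1" "\<And>x. r < \<bar>x\<bar> \<Longrightarrow> L x = 0" for s y and L :: "real \<Rightarrow> real"
      proof (cases "\<bar>y\<bar> \<le> S")
        case False
        then have "r < \<bar>s - y\<bar>" using that(1) by (simp add: S_def)
        then show ?thesis using that(2) by simp
      qed (simp add: G_def)
      have "((\<lambda>t. \<integral>y. K (t - y) * g y \<partial>lborel) has_real_derivative (\<integral>y. K' (t - y) * G y \<partial>lborel)) (at t)"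
        by (rule has_field_derivative_transform_within_open[OF D, where S="ball t 1"])
           (auto intro!: Bochner_Integration.integral_cong eq K(2) simp: dist_real_def)
      moreover have "(\<integral>y. K' (t - y) * G y \<partial>lborel) = (\<integral>y. K' (t - y) * g y \<partial>lborel)"
        by (intro Bochner_Integration.integral_cong refl eq sK') auto
      ultimately show ?thesis by simp
    qed
    then show ?thesis using CkK' sK' by blast
  qed
  show ?thesis
    using K
  proof (induction k arbitrary: K)
  case 0
  from deriv[OF 0] obtain K' where "\<forall>t. ((\<lambda>t. \<integral>y. K (t - y) * g y \<partial>lborel) has_real_derivative (\<integral>y. K' (t - y) * g y \<partial>lborel)) (at t)"
    by blast
  then show ?case by (auto intro!: continuous_at_imp_continuous_on DERIV_isCont)
next
  case (Suc k)
  have deriv': "\<exists>K'. (\<forall>k. Ck_on k UNIV K') \<and> (\<forall>x. r < \<bar>x\<bar> \<longrightarrow> K' x = 0) \<and>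
    (\<forall>t. ((\<lambda>t. \<integral>y. K (t - y) * g y \<partial>lborel) has_real_derivative (\<integral>y. K' (t - y) * g y \<partial>lborel)) (at t))"
    by (rule deriv[OF Suc.prems])
  then obtain K' where K': "\<forall>k. Ck_on k UNIV K'" "\<forall>x. r < \<bar>x\<bar> \<longrightarrow> K' x = 0"
    "\<forall>t. ((\<lambda>t. \<integral>y. K (t - y) * g y \<partial>lborel) has_real_derivative (\<integral>y. K' (t - y) * g y \<partial>lborel)) (at t)" by blast
  show ?case
    by (rule Ck_on_real_SucI[OF open_UNIV]) (use K'(3) Suc.IH[of K'] K'(1,2) in auto)
  qed
qed

section \<open>The football profile and its smoothing\<close>

lemma DERIV_glue:
  fixes f g :: "real \<Rightarrow> real"
  assumes "t \<le> a \<Longrightarrow> (f has_real_derivative f' t) (at t)" "a \<le> t \<Longrightarrow> (g has_real_derivative g' t) (at t)"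
    and "f a = g a" "f' a = g' a"
  shows "((\<lambda>t. if t \<le> a then f t else g t) has_real_derivative (if t \<le> a then f' t else g' t)) (at t)"
proof -
  consider "t < a" | "t > a" | "t = a" by linarith
  then show ?thesis
  proof cases
    case 1
    have "(f has_real_derivative f' t) (at t)" using assms(1) 1 by simp
    then have "((\<lambda>t. if t \<le> a then f t else g t) has_real_derivative f' t) (at t)"
      by (rule has_field_derivative_transform_within_open[where S="{..<a}"]) (use 1 in auto)
    then show ?thesis using 1 by simp
  next
    case 2
    have "(g has_real_derivative g' t) (at t)" using assms(2) 2 by simp
    then have "((\<lambda>t. if t \<le> a then f t else g t) has_real_derivative g' t) (at t)"
      by (rule has_field_derivative_transform_within_open[where S="{a<..}"]) (use 2 in auto)
    then show ?thesis using 2 by simp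
  next
    case 3
    let ?h = "\<lambda>t. if t \<le> a then f t else g t"
    have f: "((\<lambda>y. (f y - f a) / (y - a)) \<longlongrightarrow> f' a) (at a)" and g: "((\<lambda>y. (g y - g a) / (y - a)) \<longlongrightarrow> g' a) (at a)"
      using assms(1,2) 3 by (auto simp: has_field_derivative_iff)
    have l: "((\<lambda>y. (?h y - ?h a) / (y - a)) \<longlongrightarrow> f' a) (at_left a)"
      by (rule Lim_transform_eventually[OF filterlim_mono[OF f order_refl at_le]])
         (auto simp: eventually_at_filter)
    have r: "((\<lambda>y. (?h y - ?h a) / (y - a)) \<longlongrightarrow> f' a) (at_right a)"
      unfolding assms(4)
      by (rule Lim_transform_eventually[OF filterlim_mono[OF g order_refl at_le]])
         (auto simp: eventually_at_filter assms(3))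
    show ?thesis unfolding 3 has_field_derivative_iff using l r by (simp add: filterlim_at_split)
  qed
qed

lemma tanh_surj:
  assumes "\<bar>q\<bar> < 1"
  obtains x :: real where "tanh x = q"
proof (rule that[of "- ln ((1 - q) / (1 + q)) / 2"])
  have q: "1 - q > 0" "1 + q > 0" using assms by auto
  then show "tanh (- ln ((1 - q) / (1 + q)) / 2) = q"
    by (simp add: tanh_real_altdef field_simps)
qed

text \<open>
  On the cylinder with metric \<open>e\<^sup>2\<^sup>w (dt\<^sup>2 + d\<theta>\<^sup>2)\<close> the curvature is \<open>- w'' e\<^sup>-\<^sup>2\<^sup>w\<close>. The profile below has
  curvature \<open>0, 1, -1, 0\<close> on four consecutive intervals; \<open>w'\<^sup>2 + e\<^sup>2\<^sup>w\<close>, respectively \<open>w'\<^sup>2 - e\<^sup>2\<^sup>w\<close>, is constant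
  where the curvature is \<open>1\<close>, respectively \<open>-1\<close>, and this determines the slope \<open>- p\<close> at the interface.
  The function \<open>S\<close> is an antiderivative of \<open>e\<^sup>2\<^sup>w\<close>.
\<close>

lemma model_profile:
  fixes \<gamma> \<kappa> d :: real
  assumes k: "0 < \<kappa>" "\<kappa> \<le> \<gamma>" and d: "0 < d" "d < \<kappa>\<^sup>2"
  defines "p \<equiv> sqrt ((\<gamma>\<^sup>2 + \<kappa>\<^sup>2) / 2)"
  obtains w D S t1 where "\<And>t. (w has_real_derivative D t) (at t)" "continuous_on UNIV D" "t1 \<ge> 0"
    "\<And>t. t \<le> 0 \<Longrightarrow> D t = \<gamma>" "\<And>t. t1 \<le> t \<Longrightarrow> D t = - \<kappa>"
    "\<And>t. (S has_real_derivative exp (2 * w t)) (at t)"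
    "\<And>x y. x \<le> y \<Longrightarrow> \<bar>D y - D x\<bar> \<le> S y - S x"
    "\<And>t. 0 \<le> S t" "\<And>t. S t \<le> \<gamma> - \<kappa> + 2 * p + d / (2 * \<gamma>) + d / (2 * \<kappa>)"
proof -
  have g: "\<gamma> > 0" using k by linarith
  have sq: "\<kappa>\<^sup>2 \<le> \<gamma>\<^sup>2" by (rule power_mono) (use k in auto)
  \<comment> \<open>c^2 and c'^2 are the values of w'^2 + e^(2w) and w'^2 - e^(2w) forced by the
    slopes \<gamma> and -\<kappa> at the flat ends, where e^(2w) = d. Matching e^(2w) at the
    interface, c^2 - p^2 = p^2 - c'^2, gives p^2 = (\<gamma>^2 + \<kappa>^2) / 2 whatever d
    is.\<close>
  define c c' where "c = sqrt (\<gamma>\<^sup>2 + d)" and "c' = sqrt (\<kappa>\<^sup>2 - d)"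
  have c2: "c\<^sup>2 = \<gamma>\<^sup>2 + d" "c'\<^sup>2 = \<kappa>\<^sup>2 - d" using d by (auto simp: c_def c'_def)
  have cpos: "c > 0" "c' > 0" using d g by (auto simp: c_def c'_def add_pos_pos)
  have p2: "p\<^sup>2 = (\<gamma>\<^sup>2 + \<kappa>\<^sup>2) / 2" by (simp add: p_def)
  have p0: "0 < p" using g k by (simp add: p_def add_pos_pos)
  have kp: "\<kappa> \<le> p"
    by (rule power2_le_imp_le) (use sq p2 p0 in auto)
  have gc: "\<gamma> < c"
    by (rule power2_less_imp_less) (use c2 d cpos in auto)
  have pc: "p < c"
    by (rule power2_less_imp_less) (use c2 p2 sq d cpos in auto)
  have ck: "c' < \<kappa>"
    by (rule power2_less_imp_less) (use c2 d k in auto)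
  have q: "\<bar>u / v\<bar> < 1" "0 < u / v" if "0 < u" "u < v" for u v :: real using that by simp_all
  have xtanh: "0 < v" if "tanh v = u / u'" "0 < u / u'" for u u' v :: real
    using that tanh_real_pos_iff[of v] by simp
  obtain x where x: "tanh x = \<gamma> / c" by (rule tanh_surj[OF q(1)[OF g gc]])
  obtain x' where x': "tanh x' = p / c" by (rule tanh_surj[OF q(1)[OF p0 pc]])
  obtain y where y: "tanh y = c' / p" by (rule tanh_surj[OF q(1)[OF cpos(2) less_le_trans[OF ck kp]]])
  obtain y' where y': "tanh y' = c' / \<kappa>" by (rule tanh_surj[OF q(1)[OF cpos(2) ck]])
  have xpos: "x > 0" "x' > 0" "y > 0"
    by (rule xtanh[OF x q(2)[OF g gc]] xtanh[OF x' q(2)[OF p0 pc]] xtanh[OF y q(2)[OF cpos(2) less_le_trans[OF ck kp]]])+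
  have yy: "y \<le> y'"
  proof -
    have "tanh y \<le> tanh y'" unfolding y y' using kp k cpos by (intro divide_left_mono) auto
    then show ?thesis by simp
  qed
  \<comment> \<open>The times at which the slope reaches -p, where the curvature changes sign, and
    then -\<kappa>. They are ordered because y \<le> y', a consequence of \<kappa> \<le> p.\<close>
  define ti t1 where "ti = (x + x') / c" and "t1 = ti + (y' - y) / c'"
  have ti: "0 \<le> ti" "ti \<le> t1" using xpos cpos yy by (auto simp: ti_def t1_def)
  \<comment> \<open>Solutions of w'' = -e^(2w) and of w'' = e^(2w): on the spherical piece e^w is c
    / cosh, on the hyperbolic piece c' / sinh.\<close>
  define f1 D1 where "f1 t = ln c - ln (cosh (c * t - x))" and "D1 t = - c * tanh (c * t - x)" for t
  define f2 D2 where "f2 t = ln c' - ln (sinh (c' * (t - ti) + y))" and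
    "D2 t = - c' * (cosh (c' * (t - ti) + y) / sinh (c' * (t - ti) + y))" for t
  have d1: "(f1 has_real_derivative D1 t) (at t)" for t
    unfolding f1_def[abs_def] D1_def by (auto intro!: derivative_eq_intros simp: tanh_def divide_simps)
  have e1: "exp (2 * f1 t) = c\<^sup>2 - (D1 t)\<^sup>2" for t
  proof -
    let ?z = "c * t - x"
    have "exp (2 * f1 t) = (exp (f1 t))\<^sup>2" by (simp add: exp_double[symmetric] power2_eq_square exp_add[symmetric])
    also have "exp (f1 t) = c / cosh ?z" using cpos by (simp add: f1_def exp_diff)
    also have "(c / cosh ?z)\<^sup>2 = c\<^sup>2 * ((cosh ?z)\<^sup>2 - (sinh ?z)\<^sup>2) / (cosh ?z)\<^sup>2" by (simp add: hyperbolic_pythagoras power_divide)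
    also have "\<dots> = c\<^sup>2 - (D1 t)\<^sup>2" by (simp add: D1_def tanh_def power_mult_distrib power_divide diff_divide_distrib right_diff_distrib)
    finally show ?thesis .
  qed
  have d1': "(D1 has_real_derivative - exp (2 * f1 t)) (at t)" for t
  proof -
    have "(D1 has_real_derivative - c * ((1 - (tanh (c * t - x))\<^sup>2) * c)) (at t)"
      unfolding D1_def[abs_def] by (auto intro!: derivative_eq_intros)
    also have "- c * ((1 - (tanh (c * t - x))\<^sup>2) * c) = - exp (2 * f1 t)"
      unfolding e1 by (simp add: D1_def power2_eq_square algebra_simps)
    finally show ?thesis .
  qed
  have sp: "0 < sinh (c' * (t - ti) + y)" if "ti \<le> t" for t
    using that cpos xpos by (simp add: add_nonneg_pos)
  have d2: "(f2 has_real_derivative D2 t) (at t)" if "ti \<le> t" for t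
    unfolding f2_def[abs_def] D2_def using sp[OF that] by (auto intro!: derivative_eq_intros simp: divide_simps)
  have e2: "exp (2 * f2 t) = (D2 t)\<^sup>2 - c'\<^sup>2" if "ti \<le> t" for t
  proof -
    let ?z = "c' * (t - ti) + y"
    have "exp (2 * f2 t) = (exp (f2 t))\<^sup>2" by (simp add: exp_double[symmetric] power2_eq_square exp_add[symmetric])
    also have "exp (f2 t) = c' / sinh ?z" using cpos sp[OF that] by (simp add: f2_def exp_diff)
    also have "(c' / sinh ?z)\<^sup>2 = c'\<^sup>2 * ((cosh ?z)\<^sup>2 - (sinh ?z)\<^sup>2) / (sinh ?z)\<^sup>2" by (simp add: hyperbolic_pythagoras power_divide)
    also have "\<dots> = (D2 t)\<^sup>2 - c'\<^sup>2" using sp[OF that] by (simp add: D2_def power_mult_distrib power_divide diff_divide_distrib right_diff_distrib)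
    finally show ?thesis .
  qed
  have d2': "(D2 has_real_derivative exp (2 * f2 t)) (at t)" if "ti \<le> t" for t
  proof -
    let ?z = "c' * (t - ti) + y"
    have "(D2 has_real_derivative - c' * ((sinh ?z * c' * sinh ?z - cosh ?z * (cosh ?z * c')) / (sinh ?z * sinh ?z))) (at t)"
      unfolding D2_def[abs_def] using sp[OF that] by (auto intro!: derivative_eq_intros) (simp add: algebra_simps)
    also have "- c' * ((sinh ?z * c' * sinh ?z - cosh ?z * (cosh ?z * c')) / (sinh ?z * sinh ?z)) = exp (2 * f2 t)"
      unfolding e2[OF that] using sp[OF that] by (simp add: D2_def power2_eq_square field_simps)
    finally show ?thesis .
  qed
  have v0: "D1 0 = \<gamma>" using x cpos by (simp add: D1_def)
  have vi: "D1 ti = - p" using x' cpos by (simp add: D1_def ti_def)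
  have vi2: "D2 ti = - p" using y p0 cpos xpos by (simp add: D2_def tanh_def field_simps)
  have v1: "D2 t1 = - \<kappa>"
  proof -
    have "c' * (t1 - ti) + y = y'" using cpos by (simp add: t1_def)
    moreover have "y' > 0" using xpos yy by linarith
    ultimately show ?thesis using y' k cpos by (simp add: D2_def tanh_def field_simps)
  qed
  have f12: "f1 ti = f2 ti"
  proof -
    have "exp (2 * f1 ti) = exp (2 * f2 ti)" unfolding e1 e2[OF order_refl] vi vi2 using c2 p2 by (simp add: field_simps)
    then show ?thesis by simp
  qed
  have ed: "exp (2 * f1 0) = d" "exp (2 * f2 t1) = d" unfolding e1 e2[OF ti(2)] v0 v1 using c2 by auto
  \<comment> \<open>Flat conical ends of constant slope. They contribute d / (2 \<gamma>) and d / (2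
    \<kappa>) to the integral of e^(2w), as small as d.\<close>
  define A0 :: "real \<Rightarrow> real" where "A0 t = f1 0 + \<gamma> * t" for t
  define B0 :: "real \<Rightarrow> real" where "B0 t = f2 t1 - \<kappa> * (t - t1)" for t
  have dA: "(A0 has_real_derivative \<gamma>) (at t)" and dB: "(B0 has_real_derivative - \<kappa>) (at t)" for t
    unfolding A0_def[abs_def] B0_def[abs_def] by (auto intro!: derivative_eq_intros)
  have eA: "exp (2 * A0 t) = d * exp (2 * \<gamma> * t)" for t
    by (simp add: A0_def distrib_left exp_add ed(1) mult.assoc)
  have eB: "exp (2 * B0 t) = d * exp (- 2 * \<kappa> * (t - t1))" for t
    by (simp add: B0_def right_diff_distrib exp_diff ed(2) exp_minus divide_inverse mult.assoc)
  define w where "w t = (if t \<le> 0 then A0 t else if t \<le> ti then f1 t else if t \<le> t1 then f2 t else B0 t)" for t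
  define D where "D t = (if t \<le> 0 then \<gamma> else if t \<le> ti then D1 t else if t \<le> t1 then D2 t else - \<kappa>)" for t
  define a where "a = d / (2 * \<gamma>)"
  \<comment> \<open>On the two curved pieces the slope has derivative -e^(2w), then e^(2w), so S is
    a constant minus, then plus, the slope; the constants make neighbouring pieces match.\<close>
  define S where "S t = (if t \<le> 0 then d * exp (2 * \<gamma> * t) / (2 * \<gamma>) else if t \<le> ti then a + \<gamma> - D1 t
     else if t \<le> t1 then a + \<gamma> + 2 * p + D2 t else a + \<gamma> + 2 * p - \<kappa> + d / (2 * \<kappa>) - d * exp (- 2 * \<kappa> * (t - t1)) / (2 * \<kappa>))" for t
  have dw: "(w has_real_derivative D t) (at t)" for t
  proof -
    have 1: "((\<lambda>t. if t \<le> t1 then f2 t else B0 t) has_real_derivative (if t \<le> t1 then D2 t else - \<kappa>)) (at t)" if "ti \<le> t" for t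
      by (rule DERIV_glue[where f=f2 and g=B0 and f'=D2 and g'="\<lambda>_. - \<kappa>"]) (simp_all add: d2[OF that] dB v1, simp add: B0_def)
    have 2: "((\<lambda>t. if t \<le> ti then f1 t else if t \<le> t1 then f2 t else B0 t) has_real_derivative
        (if t \<le> ti then D1 t else if t \<le> t1 then D2 t else - \<kappa>)) (at t)" for t
      by (rule DERIV_glue[where f=f1 and g="\<lambda>t. if t \<le> t1 then f2 t else B0 t" and f'=D1 and g'="\<lambda>t. if t \<le> t1 then D2 t else - \<kappa>"])
        (use d1 1 f12 vi vi2 ti in auto)
    show ?thesis unfolding w_def[abs_def] D_def
      by (rule DERIV_glue[where f=A0 and f'="\<lambda>_. \<gamma>" and g="\<lambda>t. if t \<le> ti then f1 t else if t \<le> t1 then f2 t else B0 t"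
            and g'="\<lambda>t. if t \<le> ti then D1 t else if t \<le> t1 then D2 t else - \<kappa>"])
        (rule dA, rule 2, use v0 ti in \<open>simp add: A0_def\<close>, use v0 ti in simp)
  qed
  have dS: "(S has_real_derivative exp (2 * w t)) (at t)" for t
  proof -
    have 1: "((\<lambda>t. if t \<le> t1 then a + \<gamma> + 2 * p + D2 t else a + \<gamma> + 2 * p - \<kappa> + d / (2 * \<kappa>) - d * exp (- 2 * \<kappa> * (t - t1)) / (2 * \<kappa>))
        has_real_derivative (if t \<le> t1 then exp (2 * f2 t) else exp (2 * B0 t))) (at t)" if "ti \<le> t" for t
    proof (rule DERIV_glue[where f'="\<lambda>t. exp (2 * f2 t)" and g'="\<lambda>t. exp (2 * B0 t)"])
      show "((\<lambda>t. a + \<gamma> + 2 * p + D2 t) has_real_derivative exp (2 * f2 t)) (at t)"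
        using DERIV_add[OF DERIV_const d2'[OF that]] by simp
      show "((\<lambda>t. a + \<gamma> + 2 * p - \<kappa> + d / (2 * \<kappa>) - d * exp (- 2 * \<kappa> * (t - t1)) / (2 * \<kappa>)) has_real_derivative exp (2 * B0 t)) (at t)"
        unfolding eB using k by (auto intro!: derivative_eq_intros)
    qed (use v1 ed eB in auto)
    have 2: "((\<lambda>t. if t \<le> ti then a + \<gamma> - D1 t else if t \<le> t1 then a + \<gamma> + 2 * p + D2 t
         else a + \<gamma> + 2 * p - \<kappa> + d / (2 * \<kappa>) - d * exp (- 2 * \<kappa> * (t - t1)) / (2 * \<kappa>))
        has_real_derivative (if t \<le> ti then exp (2 * f1 t) else if t \<le> t1 then exp (2 * f2 t) else exp (2 * B0 t))) (at t)" for t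
    proof (rule DERIV_glue[where f'="\<lambda>t. exp (2 * f1 t)" and g'="\<lambda>t. if t \<le> t1 then exp (2 * f2 t) else exp (2 * B0 t)"])
      show "((\<lambda>t. a + \<gamma> - D1 t) has_real_derivative exp (2 * f1 t)) (at t)"
        using DERIV_diff[OF DERIV_const d1'] by simp
    qed (use 1 vi vi2 f12 ti in auto)
    have eq: "exp (2 * w t) = (if t \<le> 0 then exp (2 * A0 t) else if t \<le> ti then exp (2 * f1 t) else if t \<le> t1 then exp (2 * f2 t) else exp (2 * B0 t))"
      by (simp add: w_def)
    show ?thesis unfolding S_def[abs_def] eq
    proof (rule DERIV_glue[where f'="\<lambda>t. exp (2 * A0 t)" and g'="\<lambda>t. if t \<le> ti then exp (2 * f1 t) else if t \<le> t1 then exp (2 * f2 t) else exp (2 * B0 t)"])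
      show "((\<lambda>t. d * exp (2 * \<gamma> * t) / (2 * \<gamma>)) has_real_derivative exp (2 * A0 t)) (at t)"
        unfolding eA using g by (auto intro!: derivative_eq_intros)
    qed (use 2 v0 ed eA ti a_def in auto)
  qed
  have mS: "S x \<le> S y" if "x \<le> y" for x y
  proof (rule DERIV_nonneg_imp_nondecreasing[OF that])
    show "\<exists>y. (S has_real_derivative y) (at x) \<and> 0 \<le> y" for x
      by (rule exI[of _ "exp (2 * w x)"]) (simp add: dS)
  qed
  have tip: "0 < ti" using xpos cpos by (simp add: ti_def add_pos_pos)
  have Dt1: "D t = - \<kappa>" if "t1 \<le> t" for t
  proof (cases "t = t1")
    case True
    then show ?thesis using tip ti vi vi2 v1 by (cases "t1 = ti") (simp_all add: D_def)
  next
    case False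
    then have "\<not> t \<le> 0" "\<not> t \<le> ti" "\<not> t \<le> t1" using that tip ti by linarith+
    then show ?thesis by (simp add: D_def)
  qed
  \<comment> \<open>The bound |w''| \<le> e^(2w) in integrated form, since the slope has corners at
    the joints. It holds on each piece and adds up across them.\<close>
  have e1: "\<bar>D y - D x\<bar> \<le> S y - S x" if "x \<le> y" "y \<le> 0" for x y
  proof -
    have "D x = D y" using that by (simp add: D_def)
    then show ?thesis using mS[OF that(1)] by simp
  qed
  have e2: "\<bar>D y - D x\<bar> \<le> S y - S x" if "0 \<le> x" "x \<le> y" "y \<le> ti" for x y
  proof -
    have z: "S z = a + \<gamma> - D z" if "0 \<le> z" "z \<le> ti" for z
    proof (cases "z = 0")
      case True
      then show ?thesis by (simp add: D_def S_def a_def)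
    next
      case False
      then show ?thesis using that by (simp add: D_def S_def)
    qed
    have "S y - S x = - (D y - D x)" using z[of x] z[of y] that by linarith
    then show ?thesis using mS[OF that(2)] by linarith
  qed
  have e3: "\<bar>D y - D x\<bar> \<le> S y - S x" if "ti \<le> x" "x \<le> y" "y \<le> t1" for x y
  proof -
    have z: "S z = a + \<gamma> + 2 * p + D z" if "ti \<le> z" "z \<le> t1" for z
    proof (cases "z = ti")
      case True
      then show ?thesis using tip vi by (simp add: D_def S_def)
    next
      case False
      then have "\<not> z \<le> 0" "\<not> z \<le> ti" using that tip by linarith+
      then show ?thesis using that by (simp add: D_def S_def)
    qed
    have "S y - S x = D y - D x" using z[of x] z[of y] that by linarith
    then show ?thesis using mS[OF that(2)] by linarith
  qed
  have e4: "\<bar>D y - D x\<bar> \<le> S y - S x" if "t1 \<le> x" "x \<le> y" for x y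
    using Dt1[of x] Dt1[of y] that mS[OF that(2)] by simp
  have e34: "\<bar>D y - D x\<bar> \<le> S y - S x" if "ti \<le> x" "x \<le> y" for x y
  proof -
    consider "y \<le> t1" | "t1 \<le> x" | "x \<le> t1" "t1 \<le> y" by linarith
    then show ?thesis
    proof cases
      case 3 then show ?thesis using e3[of x t1] e4[of t1 y] that by linarith
    next
      case 1 then show ?thesis using e3[of x y] that by linarith
    next
      case 2 then show ?thesis using e4[of x y] that by linarith
    qed
  qed
  have e234: "\<bar>D y - D x\<bar> \<le> S y - S x" if "0 \<le> x" "x \<le> y" for x y
  proof -
    consider "y \<le> ti" | "ti \<le> x" | "x \<le> ti" "ti \<le> y" by linarith
    then show ?thesis
    proof cases
      case 3 then show ?thesis using e2[of x ti] e34[of ti y] that by linarith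
    next
      case 1 then show ?thesis using e2[of x y] that by linarith
    next
      case 2 then show ?thesis using e34[of x y] that by linarith
    qed
  qed
  have incr: "\<bar>D y - D x\<bar> \<le> S y - S x" if "x \<le> y" for x y
  proof -
    consider "y \<le> 0" | "0 \<le> x" | "x \<le> 0" "0 \<le> y" by linarith
    then show ?thesis
    proof cases
      case 3 then show ?thesis using e1[of x 0] e234[of 0 y] that by linarith
    next
      case 1 then show ?thesis using e1[of x y] that by linarith
    next
      case 2 then show ?thesis using e234[of x y] that by linarith
    qed
  qed
  have cD: "continuous_on UNIV D"
  proof (intro continuous_at_imp_continuous_on ballI)
    fix t
    have "(S \<longlongrightarrow> S t) (at t)" using DERIV_isCont[OF dS] by (simp add: isCont_def)
    then have l: "((\<lambda>s. \<bar>S s - S t\<bar>) \<longlongrightarrow> 0) (at t)"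
      using tendsto_rabs_zero LIM_zero by fast
    have b: "norm (D s - D t) \<le> \<bar>S s - S t\<bar>" for s
      using incr[of s t] incr[of t s] unfolding real_norm_def by linarith
    have "((\<lambda>s. D s - D t) \<longlongrightarrow> 0) (at t)"
      by (rule Lim_null_comparison[OF always_eventually l]) (rule allI, rule b)
    then show "isCont D t" unfolding isCont_def by (rule LIM_zero_cancel)
  qed
  show ?thesis
  proof (rule that[of w D t1 S])
    show "0 \<le> S t" for t
    proof -
      have "S (min t 0) \<le> S t" by (rule mS) simp
      moreover have "0 \<le> S (min t 0)" using d g by (simp add: S_def)
      ultimately show ?thesis by linarith
    qed
    show "S t \<le> \<gamma> - \<kappa> + 2 * p + d / (2 * \<gamma>) + d / (2 * \<kappa>)" for t
    proof -
      have "S t \<le> S (max t (t1 + 1))" by (rule mS) simp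
      also have "S (max t (t1 + 1)) = a + \<gamma> + 2 * p - \<kappa> + d / (2 * \<kappa>) - d * exp (- 2 * \<kappa> * (max t (t1 + 1) - t1)) / (2 * \<kappa>)"
      proof -
        have "\<not> max t (t1 + 1) \<le> 0" "\<not> max t (t1 + 1) \<le> ti" "\<not> max t (t1 + 1) \<le> t1" using tip ti by linarith+
        then show ?thesis unfolding S_def by (simp only: if_False)
      qed
      also have "\<dots> \<le> a + \<gamma> + 2 * p - \<kappa> + d / (2 * \<kappa>)" using d k by simp
      finally show ?thesis by (simp add: a_def)
    qed
    show "D t = \<gamma>" if "t \<le> 0" for t using that by (simp add: D_def)
    show "0 \<le> t1" using ti by linarith
    show "(w has_real_derivative D t) (at t)" for t by (rule dw)
    show "continuous_on UNIV D" by (rule cD)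
    show "D t = - \<kappa>" if "t1 \<le> t" for t by (rule Dt1[OF that])
    show "(S has_real_derivative exp (2 * w t)) (at t)" for t by (rule dS)
    show "\<bar>D y - D x\<bar> \<le> S y - S x" if "x \<le> y" for x y by (rule incr[OF that])
  qed
qed

text \<open>Convolution of the model with a bump of radius \<sigma>. As w has Lipschitz constant L,
  the smoothed W stays within L \<sigma> of w, and the bounds for curvature and area lose only
  factors exp (4 L \<sigma>) and exp (2 L \<sigma>). Linear ends stay exactly linear beyond distance
  \<sigma> from the joints.\<close>

theorem smooth_profile:
  fixes \<gamma> \<kappa> \<eta> :: real
  assumes k: "0 < \<kappa>" "\<kappa> \<le> \<gamma>" and \<eta>: "\<eta> > 0"
  obtains W W1 W2 a b L where "\<And>k. Ck_on k UNIV W" "\<And>t. (W has_real_derivative W1 t) (at t)"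
    "\<And>t. (W1 has_real_derivative W2 t) (at t)" "\<And>t. \<bar>W2 t\<bar> \<le> (1 + \<eta>) * exp (2 * W t)"
    "\<And>t. t \<le> a \<Longrightarrow> W1 t = \<gamma>" "\<And>t. b \<le> t \<Longrightarrow> W1 t = - \<kappa>" "\<And>t. \<bar>W1 t\<bar> \<le> L"
    "(\<integral>\<^sup>+t. ennreal (exp (2 * W t)) \<partial>lborel) \<le> ennreal (\<gamma> - \<kappa> + 2 * sqrt ((\<gamma>\<^sup>2 + \<kappa>\<^sup>2) / 2) + \<eta>)"
proof -
  define p where "p = sqrt ((\<gamma>\<^sup>2 + \<kappa>\<^sup>2) / 2)"
  \<comment> \<open>The entry \<eta> \<kappa> / 2 makes each flat end cost at most \<eta> / 4, as
    \<kappa> \<le> \<gamma>; the entry \<kappa>^2 / 2 keeps d below \<kappa>^2. The other \<eta> / 2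
    pays for the smoothing.\<close>
  define d where "d = min (\<kappa>\<^sup>2 / 2) (\<eta> * \<kappa> / 2)"
  have d: "0 < d" "d < \<kappa>\<^sup>2"
  proof -
    have kk: "\<kappa>\<^sup>2 > 0" using k by simp
    then show "0 < d" using k \<eta> by (simp add: d_def)
    have "d \<le> \<kappa>\<^sup>2 / 2" by (simp add: d_def)
    then show "d < \<kappa>\<^sup>2" using kk by linarith
  qed
  have g: "\<gamma> > 0" using k by linarith
  define X where "X = \<gamma> - \<kappa> + 2 * p + \<eta> / 2"
  have X: "X > 0" using k \<eta> by (simp add: X_def p_def add_nonneg_pos)
  obtain w D S t1 where w: "\<And>t. (w has_real_derivative D t) (at t)" and cD: "continuous_on UNIV D" and t1: "t1 \<ge> 0"
    and D0: "\<And>t. t \<le> 0 \<Longrightarrow> D t = \<gamma>" and D1: "\<And>t. t1 \<le> t \<Longrightarrow> D t = - \<kappa>"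
    and S: "\<And>t. (S has_real_derivative exp (2 * w t)) (at t)"
    and DS: "\<And>x y. x \<le> y \<Longrightarrow> \<bar>D y - D x\<bar> \<le> S y - S x"
    and S0: "\<And>t. 0 \<le> S t" and S1: "\<And>t. S t \<le> \<gamma> - \<kappa> + 2 * p + d / (2 * \<gamma>) + d / (2 * \<kappa>)"
    using model_profile[OF k d] unfolding p_def by metis
  have SX: "S t \<le> X" for t
  proof -
    have "d / (2 * \<gamma>) \<le> d / (2 * \<kappa>)" using d k by (intro divide_left_mono) auto
    moreover have "d / (2 * \<kappa>) \<le> \<eta> / 4"
    proof -
      have "d \<le> \<eta> * \<kappa> / 2" by (simp add: d_def)
      then show ?thesis using k by (simp add: field_simps)
    qed
    ultimately show ?thesis using S1[of t] by (simp add: X_def)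
  qed
  obtain L where L: "L > 0" "\<And>t. \<bar>D t\<bar> \<le> L"
  proof -
    have "compact (D ` {0..t1})" by (rule compact_continuous_image[OF continuous_on_subset[OF cD]]) auto
    then obtain B where B: "\<And>t. t \<in> {0..t1} \<Longrightarrow> norm (D t) \<le> B"
      using compact_imp_bounded bounded_iff by (metis imageI)
    have "\<bar>D t\<bar> \<le> \<bar>B\<bar> + \<gamma> + \<kappa>" for t
    proof -
      consider "t \<le> 0" | "t \<in> {0..t1}" | "t1 \<le> t" by fastforce
      then show ?thesis
      proof cases
        case 2
        then show ?thesis using B[OF 2] g k by simp
      qed (use D0[of t] D1[of t] g k in auto)
    qed
    then show ?thesis using that[of "\<bar>B\<bar> + \<gamma> + \<kappa>"] g k by simp
  qed
  have lip: "\<bar>w x - w y\<bar> \<le> L * \<bar>x - y\<bar>" for x y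
    using field_differentiable_bound[of UNIV w D L x y] w L(2) by (auto simp: has_field_derivative_at_within)
  \<comment> \<open>The first entry yields exp (4 L \<sigma>) \<le> 1 + \<eta> for the curvature,
    the second exp (2 L \<sigma>) X \<le> X + \<eta> / 2 for the area.\<close>
  define \<sigma> where "\<sigma> = min (ln (1 + \<eta>) / (4 * L)) (ln (1 + \<eta> / (2 * X)) / (2 * L))"
  have "ln (1 + \<eta> / (2 * X)) > 0" "ln (1 + \<eta>) > 0" by (rule ln_gt_zero, use \<eta> X in simp)+
  then have \<sigma>: "\<sigma> > 0" using L by (simp add: \<sigma>_def)
  have s1: "exp (4 * L * \<sigma>) \<le> 1 + \<eta>"
  proof -
    have "4 * L * \<sigma> \<le> 4 * L * (ln (1 + \<eta>) / (4 * L))" using L by (intro mult_left_mono) (auto simp: \<sigma>_def)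
    then have "4 * L * \<sigma> \<le> ln (1 + \<eta>)" using L by simp
    then have "exp (4 * L * \<sigma>) \<le> exp (ln (1 + \<eta>))" by simp
    then show ?thesis using \<eta> by simp
  qed
  have s2: "exp (2 * L * \<sigma>) * X \<le> X + \<eta> / 2"
  proof -
    have pos: "1 + \<eta> / (2 * X) > 0" using \<eta> X by (simp add: add_pos_pos)
    have "2 * L * \<sigma> \<le> 2 * L * (ln (1 + \<eta> / (2 * X)) / (2 * L))" using L by (intro mult_left_mono) (auto simp: \<sigma>_def)
    then have "2 * L * \<sigma> \<le> ln (1 + \<eta> / (2 * X))" using L by simp
    then have "exp (2 * L * \<sigma>) \<le> exp (ln (1 + \<eta> / (2 * X)))" by simp
    then have "exp (2 * L * \<sigma>) \<le> 1 + \<eta> / (2 * X)" using pos by simp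
    then have "exp (2 * L * \<sigma>) * X \<le> (1 + \<eta> / (2 * X)) * X" using X by (intro mult_right_mono) auto
    moreover have "(1 + \<eta> / (2 * X)) * X = X + \<eta> / 2" using X by (simp add: distrib_right)
    ultimately show ?thesis by linarith
  qed
  obtain \<phi> where Ck\<phi>: "\<And>k. Ck_on k UNIV \<phi>" and \<phi>0: "\<And>x. 0 \<le> \<phi> x" and \<phi>s: "\<And>x. \<sigma> < \<bar>x\<bar> \<Longrightarrow> \<phi> x = 0"
    and \<phi>i: "integrable lborel \<phi>" and \<phi>1: "(\<integral>x. \<phi> x \<partial>lborel) = 1"
    using mollifier_exists[OF \<sigma>] by metis
  have c\<phi>: "continuous_on UNIV \<phi>" by (rule Ck_on_imp_continuous_on[OF Ck\<phi>[of 0]])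
  have cw: "continuous_on UNIV w" by (intro continuous_at_imp_continuous_on ballI DERIV_isCont[OF w])
  have ic: "integrable lborel (\<lambda>x. f (t - x) * \<phi> x)" if "continuous_on UNIV f" for f :: "real \<Rightarrow> real" and t
    by (rule integrable_compact_support[of _ \<sigma>])
       (auto intro!: continuous_on_mult c\<phi> continuous_on_compose2[OF that] continuous_intros simp: \<phi>s)
  have avg: "\<bar>(\<integral>x. f (t - x) * \<phi> x \<partial>lborel) - y\<bar> \<le> B" if f: "continuous_on UNIV f" and B: "\<And>x. \<bar>x\<bar> \<le> \<sigma> \<Longrightarrow> \<bar>f (t - x) - y\<bar> \<le> B" for f t y B
  proof -
    have "(\<integral>x. f (t - x) * \<phi> x \<partial>lborel) - y = (\<integral>x. f (t - x) * \<phi> x - y * \<phi> x \<partial>lborel)"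
      using ic[OF f] \<phi>i \<phi>1 by simp
    also have "\<bar>\<dots>\<bar> \<le> (\<integral>x. \<bar>f (t - x) * \<phi> x - y * \<phi> x\<bar> \<partial>lborel)" by (rule integral_abs_bound)
    also have "\<dots> \<le> (\<integral>x. B * \<phi> x \<partial>lborel)"
    proof (rule integral_mono)
      fix x
      show "\<bar>f (t - x) * \<phi> x - y * \<phi> x\<bar> \<le> B * \<phi> x"
      proof (cases "\<bar>x\<bar> \<le> \<sigma>")
        case True
        have "\<bar>f (t - x) * \<phi> x - y * \<phi> x\<bar> = \<bar>f (t - x) - y\<bar> * \<phi> x"
          using \<phi>0[of x] by (simp add: left_diff_distrib[symmetric] abs_mult)
        then show ?thesis using mult_right_mono[OF B[OF True] \<phi>0[of x]] by simp
      qed (simp add: \<phi>s)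
    qed (use ic[OF f] \<phi>i in auto)
    also have "\<dots> = B" using \<phi>1 by simp
    finally show ?thesis .
  qed
  define W where "W t = (\<integral>y. \<phi> (t - y) * w y \<partial>lborel)" for t
  define W1 where "W1 t = (\<integral>x. D (t - x) * \<phi> x \<partial>lborel)" for t
  have CkW: "Ck_on k UNIV W" for k unfolding W_def[abs_def] by (rule Ck_on_convolution[OF cw Ck\<phi> \<phi>s])
  have Weq: "W t = (\<integral>x. w (t - x) * \<phi> x \<partial>lborel)" for t
    unfolding W_def using lborel_integral_real_affine[of "-1" "\<lambda>y. \<phi> (t - y) * w y" t] by (simp add: mult.commute)
  have dW: "(W has_real_derivative W1 t) (at t)" for t
  proof -
    have i: "integrable lborel (\<lambda>x. w (- x - s) * \<phi> x)" for s
      using ic[OF cw, of "- s"] by (simp only: diff_conv_add_uminus add.commute)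
    have "((\<lambda>s. \<integral>x. w (- x - s) * \<phi> x \<partial>lborel) has_real_derivative - (\<integral>x. D (- x - - t) * \<phi> x \<partial>lborel)) (at (- t))"
      by (rule parametric_integral_derivative(1)[where u="\<lambda>x. - x", OF w L(2) cD i _ \<phi>i]) simp
    then have "((\<lambda>t. \<integral>x. w (- x - - t) * \<phi> x \<partial>lborel) has_real_derivative - (- (\<integral>x. D (- x - - t) * \<phi> x \<partial>lborel))) (at t)"
      using DERIV_mirror[of "\<lambda>s. \<integral>x. w (- x - s) * \<phi> x \<partial>lborel" "- (\<integral>x. D (- x - - t) * \<phi> x \<partial>lborel)" t] by simp
    then show ?thesis unfolding Weq[abs_def] W1_def by simp
  qed
  define W2 where "W2 t = frechet_derivative W1 (at t) 1" for t
  have fdW: "frechet_derivative W (at t) 1 = W1 t" for t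
    using frechet_derivative_at[OF dW[of t, unfolded has_field_derivative_def]] by (metis mult.right_neutral)
  have dW1: "(W1 has_real_derivative W2 t) (at t)" for t
  proof -
    have "Ck_on (Suc 0) UNIV W1" using CkW[of 2] by (simp add: numeral_2_eq_2 fdW)
    then have D: "(W1 has_derivative frechet_derivative W1 (at t)) (at t)"
      by (simp add: frechet_derivative_works[symmetric])
    have "frechet_derivative W1 (at t) h = W2 t * h" for h
      using linear_scale[OF has_derivative_linear[OF D], of h 1] by (simp add: W2_def)
    then have "frechet_derivative W1 (at t) = (\<lambda>h. W2 t * h)" by (rule ext)
    with D show ?thesis by (simp add: has_field_derivative_def)
  qed
  have Ww: "\<bar>W t - w t\<bar> \<le> L * \<sigma>" for t
    unfolding Weq
  proof (rule avg[OF cw])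
    fix x :: real assume "\<bar>x\<bar> \<le> \<sigma>"
    then have "L * \<bar>x\<bar> \<le> L * \<sigma>" using L by (intro mult_left_mono) auto
    then show "\<bar>w (t - x) - w t\<bar> \<le> L * \<sigma>" using lip[of "t - x" t] by simp
  qed
  have SD: "\<bar>D u - D v\<bar> \<le> \<bar>u - v\<bar> * exp (2 * w t + 2 * L * r)" if "\<bar>u - t\<bar> \<le> r" "\<bar>v - t\<bar> \<le> r" for u v t r
  proof -
    have *: "\<bar>D v - D u\<bar> \<le> (v - u) * exp (2 * w t + 2 * L * r)" if uv: "u < v" "\<bar>u - t\<bar> \<le> r" "\<bar>v - t\<bar> \<le> r" for u v
    proof -
      obtain z where z: "u < z" "z < v" "S v - S u = (v - u) * exp (2 * w z)"
        using MVT2[OF uv(1), of S "\<lambda>t. exp (2 * w t)"] S by auto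
      have "\<bar>z - t\<bar> \<le> r" using z uv by linarith
      then have "L * \<bar>z - t\<bar> \<le> L * r" using L by (intro mult_left_mono) auto
      then have "2 * w z \<le> 2 * w t + 2 * L * r" using lip[of z t] by linarith
      then have "(v - u) * exp (2 * w z) \<le> (v - u) * exp (2 * w t + 2 * L * r)" using uv by (intro mult_left_mono) auto
      then show ?thesis using DS[of u v] z uv by linarith
    qed
    consider "u < v" | "v < u" | "u = v" by linarith
    then show ?thesis using *[of u v] *[of v u] that by cases (auto simp: abs_minus_commute)
  qed
  \<comment> \<open>D need not be differentiable at the joints, so W2 is bounded as a limit of
    difference quotients of W1, each an average of increments of D.\<close>
  have W2b: "\<bar>W2 t\<bar> \<le> exp (2 * w t + 2 * L * \<sigma>)" for t
  proof -
    have q: "\<bar>(W1 (t + h) - W1 t) / h\<bar> \<le> exp (2 * w t + 2 * L * (\<sigma> + \<bar>h\<bar>))" if "h \<noteq> 0" for h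
    proof -
      have cdf: "continuous_on UNIV (\<lambda>x. D (x + h) - D x)"
        by (intro continuous_on_diff cD continuous_on_compose2[OF cD] continuous_intros) auto
      have "W1 (t + h) - W1 t = (\<integral>x. (D (t - x + h) - D (t - x)) * \<phi> x \<partial>lborel)"
        unfolding W1_def using ic[OF cD, of t] ic[OF cD, of "t + h"] by (simp add: left_diff_distrib algebra_simps)
      also have "\<bar>\<dots> - 0\<bar> \<le> \<bar>h\<bar> * exp (2 * w t + 2 * L * (\<sigma> + \<bar>h\<bar>))"
      proof (rule avg[OF cdf])
        fix x :: real assume "\<bar>x\<bar> \<le> \<sigma>"
        then show "\<bar>D (t - x + h) - D (t - x) - 0\<bar> \<le> \<bar>h\<bar> * exp (2 * w t + 2 * L * (\<sigma> + \<bar>h\<bar>))"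
          using SD[of "t - x + h" t "\<sigma> + \<bar>h\<bar>" "t - x"] by simp
      qed
      finally have "\<bar>W1 (t + h) - W1 t\<bar> \<le> \<bar>h\<bar> * exp (2 * w t + 2 * L * (\<sigma> + \<bar>h\<bar>))" by simp
      then show ?thesis using that by (simp add: abs_divide divide_le_eq mult.commute)
    qed
    have l1: "((\<lambda>h. \<bar>(W1 (t + h) - W1 t) / h\<bar>) \<longlongrightarrow> \<bar>W2 t\<bar>) (at 0)"
      using dW1[of t] unfolding DERIV_def by (rule tendsto_rabs)
    have l2: "((\<lambda>h. exp (2 * w t + 2 * L * (\<sigma> + \<bar>h\<bar>))) \<longlongrightarrow> exp (2 * w t + 2 * L * (\<sigma> + \<bar>0\<bar>))) (at (0::real))"
      by (intro tendsto_intros)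
    have "\<bar>W2 t\<bar> \<le> exp (2 * w t + 2 * L * (\<sigma> + \<bar>0\<bar>))"
      by (rule tendsto_le[OF _ l2 l1]) (use q in \<open>auto simp: eventually_at_filter\<close>)
    then show ?thesis by simp
  qed
  show ?thesis
  proof (rule that[of W W1 W2 "- \<sigma>" "t1 + \<sigma>" L])
    show "\<bar>W2 t\<bar> \<le> (1 + \<eta>) * exp (2 * W t)" for t
    proof -
      have "2 * w t + 2 * L * \<sigma> \<le> 4 * L * \<sigma> + 2 * W t" using Ww[of t] by linarith
      then have "exp (2 * w t + 2 * L * \<sigma>) \<le> exp (4 * L * \<sigma> + 2 * W t)" by simp
      also have "\<dots> = exp (4 * L * \<sigma>) * exp (2 * W t)" by (rule exp_add)
      also have "\<dots> \<le> (1 + \<eta>) * exp (2 * W t)" by (rule mult_right_mono[OF s1]) simp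
      finally show ?thesis using W2b[of t] by linarith
    qed
    \<comment> \<open>The averaging estimate with error 0: D is constant on the whole window of
      radius \<sigma>.\<close>
    show "W1 t = \<gamma>" if "t \<le> - \<sigma>" for t
      using avg[OF cD, of t \<gamma> 0] D0 that unfolding W1_def by force
    show "W1 t = - \<kappa>" if "t1 + \<sigma> \<le> t" for t
      using avg[OF cD, of t "- \<kappa>" 0] D1 that unfolding W1_def by force
    show "\<bar>W1 t\<bar> \<le> L" for t
      using avg[OF cD, of t 0 L] L(2) unfolding W1_def by simp
    show "(\<integral>\<^sup>+t. ennreal (exp (2 * W t)) \<partial>lborel) \<le> ennreal (\<gamma> - \<kappa> + 2 * sqrt ((\<gamma>\<^sup>2 + \<kappa>\<^sup>2) / 2) + \<eta>)"
    proof -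
      have [measurable]: "w \<in> borel_measurable borel" by (rule borel_measurable_continuous_onI[OF cw])
      have part: "(\<integral>\<^sup>+t. ennreal (exp (2 * w t)) * indicator {- real n..real n} t \<partial>lborel) \<le> ennreal X" for n
      proof -
        have "(\<integral>\<^sup>+t. ennreal (exp (2 * w t)) * indicator {- real n..real n} t \<partial>lborel) = ennreal (S (real n) - S (- real n))"
          by (rule nn_integral_FTC_Icc) (auto intro: S)
        also have "\<dots> \<le> ennreal X" using S0[of "- real n"] SX[of "real n"] by (intro ennreal_leI) linarith
        finally show ?thesis .
      qed
      have "(\<lambda>n. \<integral>\<^sup>+t. ennreal (exp (2 * w t)) * indicator {- real n..real n} t \<partial>lborel) \<longlonglongrightarrow> (\<integral>\<^sup>+t. ennreal (exp (2 * w t)) \<partial>lborel)"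
      proof (rule nn_integral_LIMSEQ)
        show "incseq (\<lambda>n t. ennreal (exp (2 * w t)) * indicator {- real n..real n} t)"
          by (auto simp: incseq_def le_fun_def indicator_def)
        show "(\<lambda>n. ennreal (exp (2 * w t)) * indicator {- real n..real n} t) \<longlonglongrightarrow> ennreal (exp (2 * w t))" for t
        proof (rule tendsto_eventually)
          obtain N where "\<bar>t\<bar> \<le> real N" using real_arch_simple by blast
          then show "\<forall>\<^sub>F n in sequentially. ennreal (exp (2 * w t)) * indicator {- real n..real n} t = ennreal (exp (2 * w t))"
            by (intro eventually_sequentiallyI[of N]) (auto simp: indicator_def)
        qed
      qed simp
      then have iw: "(\<integral>\<^sup>+t. ennreal (exp (2 * w t)) \<partial>lborel) \<le> ennreal X"
        by (rule LIMSEQ_le_const2) (use part in auto)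
      have "(\<integral>\<^sup>+t. ennreal (exp (2 * W t)) \<partial>lborel) \<le> (\<integral>\<^sup>+t. ennreal (exp (2 * L * \<sigma>)) * ennreal (exp (2 * w t)) \<partial>lborel)"
      proof (rule nn_integral_mono)
        fix t
        have "2 * W t \<le> 2 * L * \<sigma> + 2 * w t" using Ww[of t] by linarith
        then have "exp (2 * W t) \<le> exp (2 * L * \<sigma>) * exp (2 * w t)" by (simp add: exp_add[symmetric])
        then show "ennreal (exp (2 * W t)) \<le> ennreal (exp (2 * L * \<sigma>)) * ennreal (exp (2 * w t))"
          by (simp add: ennreal_mult[symmetric] ennreal_leI)
      qed
      also have "\<dots> = ennreal (exp (2 * L * \<sigma>)) * (\<integral>\<^sup>+t. ennreal (exp (2 * w t)) \<partial>lborel)" by (simp add: nn_integral_cmult)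
      also have "\<dots> \<le> ennreal (exp (2 * L * \<sigma>)) * ennreal X" by (rule mult_left_mono[OF iw]) simp
      also have "\<dots> = ennreal (exp (2 * L * \<sigma>) * X)" using X by (simp add: ennreal_mult)
      also have "\<dots> \<le> ennreal (X + \<eta> / 2)" by (rule ennreal_leI[OF s2])
      also have "X + \<eta> / 2 = \<gamma> - \<kappa> + 2 * sqrt ((\<gamma>\<^sup>2 + \<kappa>\<^sup>2) / 2) + \<eta>" by (simp add: X_def p_def)
      finally show ?thesis .
    qed
  qed (use CkW dW dW1 in auto)
qed

section \<open>Moebius invariance of the minimal volume\<close>

text \<open>Carries the change of variables formula with determinants from \<open>real^2\<close> to
  the complex plane.\<close>

lemma lborel_complex_cart:
  "lborel = distr (lborel :: (real^2) measure) borel (\<lambda>x. Complex (x$1) (x$2))"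
proof (rule lborel_eqI)
  fix l u :: complex assume "\<And>b. b \<in> Basis \<Longrightarrow> l \<bullet> b \<le> u \<bullet> b"
  from this[of 1] this[of \<i>] have lu: "Re l \<le> Re u" "Im l \<le> Im u" by (auto simp: Basis_complex_def inner_complex_def)
  have [measurable]: "(\<lambda>x::real^2. Complex (x$1) (x$2)) \<in> borel_measurable borel"
    unfolding Complex_eq by (intro borel_measurable_continuous_onI continuous_intros)
  have B: "(Basis :: (real^2) set) = {axis 1 1, axis 2 1}" by (auto simp: Basis_vec_def UNIV_2)
  have n: "axis 1 1 \<noteq> (axis 2 1 :: real^2)" by (simp add: axis_eq_axis)
  have "(\<lambda>x::real^2. Complex (x$1) (x$2)) -` box l u = box (vector [Re l, Im l]) (vector [Re u, Im u])"
    by (auto simp: mem_box_cart forall_2 in_box_complex_iff)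
  then have "emeasure (distr (lborel :: (real^2) measure) borel (\<lambda>x. Complex (x$1) (x$2))) (box l u)
      = emeasure lborel (box (vector [Re l, Im l]) (vector [Re u, Im u]) :: (real^2) set)"
    by (subst emeasure_distr) auto
  also have "\<dots> = (\<Prod>b\<in>Basis. (vector [Re u, Im u] - vector [Re l, Im l] :: real^2) \<bullet> b)"
    by (rule emeasure_lborel_box) (use lu in \<open>auto simp: B inner_axis\<close>)
  also have "(\<Prod>b\<in>Basis. (vector [Re u, Im u] - vector [Re l, Im l] :: real^2) \<bullet> b) = (\<Prod>b\<in>Basis. (u - l) \<bullet> b)"
    using n by (simp add: B inner_axis Basis_complex_def inner_complex_def)
  finally show "emeasure (distr (lborel :: (real^2) measure) borel (\<lambda>x. Complex (x$1) (x$2))) (box l u) = ennreal (\<Prod>b\<in>Basis. (u - l) \<bullet> b)" .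
qed simp

text \<open>The real Jacobian of w -> 1 / w is |1 / w^2|^2. Values on boxes determine
  \<open>lborel\<close>, so it suffices to compute the weighted area of preimages of boxes.\<close>

lemma nn_integral_inversion:
  fixes H :: "complex \<Rightarrow> ennreal"
  assumes [measurable]: "H \<in> borel_measurable borel"
  shows "(\<integral>\<^sup>+w. H (1 / w) * ennreal (1 / cmod w ^ 4) \<partial>lborel) = (\<integral>\<^sup>+z. H z \<partial>lborel)"
proof -
  define J :: "real^2 \<Rightarrow> complex" where "J x = Complex (x$1) (x$2)" for x
  define K :: "complex \<Rightarrow> real^2" where "K z = vector [Re z, Im z]" for z
  have KJ: "K (J x) = x" for x by (simp add: J_def K_def vec_eq_iff forall_2)
  have JK: "J (K z) = z" for z by (simp add: J_def K_def complex_eq_iff)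
  have J0: "J x = 0 \<longleftrightarrow> x = 0" for x by (simp add: J_def complex_eq_iff vec_eq_iff forall_2)
  have K0: "K z = 0 \<longleftrightarrow> z = 0" for z by (metis J0 JK)
  have lJ: "bounded_linear J"
    by (intro linear_conv_bounded_linear[THEN iffD1] linearI) (auto simp: J_def complex_eq_iff)
  have lK: "bounded_linear K"
    by (intro linear_conv_bounded_linear[THEN iffD1] linearI) (auto simp: K_def vec_eq_iff forall_2)
  have [measurable]: "J \<in> borel_measurable borel"
    by (intro borel_measurable_continuous_onI linear_continuous_on lJ)
  have lb: "lborel = distr lborel borel J" unfolding J_def[abs_def] by (rule lborel_complex_cart)
  let ?M = "distr (density lborel (\<lambda>w. ennreal (1 / cmod w ^ 4))) borel (\<lambda>w::complex. 1 / w)"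
  have "lborel = ?M"
  proof (rule lborel_eqI)
    fix l u :: complex assume lu: "\<And>b. b \<in> Basis \<Longrightarrow> l \<bullet> b \<le> u \<bullet> b"
    let ?B = "box l u"
    let ?g = "\<lambda>x. K (1 / J x)"
    let ?g' = "\<lambda>x h. K (- (1 / (J x)\<^sup>2) * J h)"
    let ?S = "{x. x \<noteq> 0 \<and> 1 / J x \<in> ?B}"
    have Sb: "?S \<in> sets borel" by measurable
    then have S: "?S \<in> sets lebesgue" by (intro sets_completionI_sets) simp
    have der: "(?g has_derivative ?g' x) (at x within ?S)" if "x \<in> ?S" for x
    proof -
      have "((\<lambda>w. 1 / w) has_derivative (*) (- (1 / (J x)\<^sup>2))) (at (J x))"
        unfolding has_field_derivative_def[symmetric] using that J0[of x]
        by (auto intro!: derivative_eq_intros simp: power2_eq_square)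
      from has_derivative_compose[OF bounded_linear_imp_has_derivative[OF lJ] this]
      have "((\<lambda>x. 1 / J x) has_derivative (\<lambda>h. - (1 / (J x)\<^sup>2) * J h)) (at x within ?S)" .
      then show ?thesis by (rule bounded_linear.has_derivative[OF lK])
    qed
    have inj: "inj_on ?g ?S"
    proof (rule inj_onI)
      fix x y assume "x \<in> ?S" "y \<in> ?S" "?g x = ?g y"
      then have "J x = J y" using JK[of "1 / J x"] JK[of "1 / J y"] by (metis div_by_1 divide_divide_eq_right mult_1)
      then show "x = y" by (metis KJ)
    qed
    have det: "\<bar>det (matrix (?g' x))\<bar> = 1 / cmod (J x) ^ 4" for x
    proof -
      \<comment> \<open>Multiplication by c is a rotation followed by a dilation by |c|.\<close>
      have c: "det (matrix (\<lambda>h. K (c * J h))) = (cmod c)\<^sup>2" for c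
        unfolding cmod_power2 by (simp add: det_2 matrix_def J_def K_def axis_def power2_eq_square)
      show ?thesis unfolding c by (simp add: norm_divide norm_power power_divide power_mult[symmetric])
    qed
    have im: "?g ` ?S = J -` (?B - {0})"
    proof (intro equalityI subsetI)
      fix y assume "y \<in> J -` (?B - {0})"
      then have "1 / (1 / J y) \<in> ?B" "J y \<noteq> 0" by auto
      then show "y \<in> ?g ` ?S" by (intro image_eqI[of _ _ "K (1 / J y)"]) (auto simp: JK KJ J0[symmetric])
    qed (auto simp: JK J0 K0)
    have [measurable]: "J -` (?B - {0}) \<in> sets borel" using measurable_sets_borel[of J borel "?B - {0}"] by simp
    have e: "emeasure lborel (J -` (?B - {0})) = emeasure lborel ?B"
    proof -
      have "emeasure lborel ?B = emeasure lborel (?B - {0})" by (rule emeasure_Diff_null_set[symmetric]) auto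
      also have "\<dots> = emeasure (distr lborel borel J) (?B - {0})" using lb by simp
      also have "\<dots> = emeasure lborel (J -` (?B - {0}))" by (subst emeasure_distr) auto
      finally show ?thesis by simp
    qed
    have fin: "emeasure lborel ?B < \<infinity>" by (simp add: emeasure_lborel_box_eq)
    have lm: "J -` (?B - {0}) \<in> lmeasurable"
      by (rule fmeasurableI) (use e fin in \<open>auto simp: emeasure_completion\<close>)
    define m where "m = measure lebesgue (J -` (?B - {0}))"
    have "((\<lambda>x. \<bar>det (matrix (?g' x))\<bar>) has_integral m) ?S"
      using has_measure_differentiable_image[OF S der inj, of m] lm by (simp only: im m_def simp_thms)
    then have hi: "((\<lambda>x. 1 / cmod (J x) ^ 4) has_integral m) ?S" by (simp only: det)
    have nn: "(\<integral>\<^sup>+x. ennreal (1 / cmod (J x) ^ 4) * indicator ?S x \<partial>lborel) = ennreal m"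
      by (rule nn_integral_has_integral_lebesgue'[OF _ hi]) simp
    have "emeasure ?M ?B = (\<integral>\<^sup>+w. ennreal (1 / cmod w ^ 4) * indicator ((\<lambda>w. 1 / w) -` ?B) w \<partial>lborel)"
      using measurable_sets_borel[of "\<lambda>w::complex. 1 / w" borel ?B]
      by (subst emeasure_distr) (auto intro!: emeasure_density)
    also have "\<dots> = (\<integral>\<^sup>+w. ennreal (1 / cmod w ^ 4) * indicator ((\<lambda>w. 1 / w) -` ?B) w \<partial>distr lborel borel J)"
      using lb by simp
    also have "\<dots> = (\<integral>\<^sup>+x. ennreal (1 / cmod (J x) ^ 4) * indicator ((\<lambda>w. 1 / w) -` ?B) (J x) \<partial>lborel)"
      using measurable_sets_borel[of "\<lambda>w::complex. 1 / w" borel ?B] by (subst nn_integral_distr) auto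
    also have "\<dots> = (\<integral>\<^sup>+x. ennreal (1 / cmod (J x) ^ 4) * indicator ?S x \<partial>lborel)"
      by (rule nn_integral_cong) (auto simp: indicator_def J0)
    also have "\<dots> = emeasure lebesgue (J -` (?B - {0}))"
      unfolding nn m_def by (rule emeasure_eq_measure2[symmetric]) (rule lm)
    also have "\<dots> = emeasure lborel ?B" using e by (simp add: emeasure_completion)
    also have "\<dots> = ennreal (\<Prod>b\<in>Basis. (u - l) \<bullet> b)" by (rule emeasure_lborel_box[OF lu])
    finally show "emeasure ?M ?B = ennreal (\<Prod>b\<in>Basis. (u - l) \<bullet> b)" .
  qed simp
  then have "(\<integral>\<^sup>+z. H z \<partial>lborel) = (\<integral>\<^sup>+z. H z \<partial>?M)" by simp
  also have "\<dots> = (\<integral>\<^sup>+w. ennreal (1 / cmod w ^ 4) * H (1 / w) \<partial>lborel)"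
    by (subst nn_integral_distr) (auto intro!: nn_integral_density)
  finally show ?thesis by (simp add: mult.commute)
qed

section \<open>Charts, curvature and conformal pullback\<close>

lemma inj_affine_chart: "\<phi> \<in> affine_charts \<Longrightarrow> inj \<phi>"
  by (auto simp: affine_charts_def inj_def chart_infty_def split: if_splits)

lemma open_affine_chart_vimage:
  assumes "\<phi> \<in> affine_charts" "finite P"
  shows "open {z. \<phi> z \<notin> P}"
proof -
  have "finite (\<phi> -` P)" by (rule finite_vimageI[OF assms(2) inj_affine_chart[OF assms(1)]])
  then have "open (- (\<phi> -` P))" by (intro open_Compl finite_imp_closed)
  also have "- (\<phi> -` P) = {z. \<phi> z \<notin> P}" by auto
  finally show ?thesis .
qed

lemma affine_chart_surj:
  obtains \<phi> z where "\<phi> \<in> affine_charts" "q = \<phi> z"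
proof (cases q)
  case (Fin z) then show ?thesis using that[of Fin z] by (simp add: affine_charts_def)
next
  case Infty then show ?thesis using that[of chart_infty 0] by (simp add: affine_charts_def chart_infty_def)
qed

lemma deriv_inversion: "w \<noteq> 0 \<Longrightarrow> deriv (\<lambda>w::complex. 1 / w + a) w = - (1 / w\<^sup>2)"
  by (rule DERIV_imp_deriv) (auto intro!: derivative_eq_intros simp: power2_eq_square)

lemma one_plus_cmod2: "0 < (1 + (cmod z)\<^sup>2)\<^sup>2" "(1 + (cmod z)\<^sup>2)\<^sup>2 \<noteq> 0"
proof -
  have "1 + (cmod z)\<^sup>2 > 0" by (rule add_pos_nonneg) simp_all
  then show "0 < (1 + (cmod z)\<^sup>2)\<^sup>2" by (rule zero_less_power)
  then show "(1 + (cmod z)\<^sup>2)\<^sup>2 \<noteq> 0" by simp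
qed

lemma metric_coeff_chart_infty:
  assumes "w \<noteq> 0"
  shows "metric_coeff G chart_infty w = metric_coeff G Fin (1 / w) / cmod w ^ 4"
proof -
  have "(1 + (cmod w)\<^sup>2)\<^sup>2 = (1 + (cmod (1 / w))\<^sup>2)\<^sup>2 * cmod w ^ 4"
  proof -
    have "1 + (cmod w)\<^sup>2 = (1 + (cmod (1 / w))\<^sup>2) * (cmod w)\<^sup>2"
      using assms by (simp add: norm_divide power_divide distrib_right)
    then show ?thesis by (simp add: power_mult_distrib power_mult[symmetric])
  qed
  note e = this
  have "metric_coeff G chart_infty w = G (Fin (1 / w)) * 4 / (1 + (cmod w)\<^sup>2)\<^sup>2"
    using assms unfolding metric_coeff_def chart_infty_def by (simp only: if_False)
  also have "\<dots> = metric_coeff G Fin (1 / w) / cmod w ^ 4"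
    unfolding e metric_coeff_def divide_divide_eq_left by (rule refl)
  finally show ?thesis .
qed

text \<open>\<open>gauss_curvature\<close> is computed in the chart \<open>Fin\<close> except at
  \<open>Infty\<close>; on the overlap the charts give the same value by the pullback formula for w
  -> 1 / w.\<close>

lemma gauss_curvature_affine_chart:
  assumes "\<psi> \<in> affine_charts" "smooth_metric_off P G" "finite P" "\<psi> w \<notin> P"
  shows "gauss_curvature G (\<psi> w) = planar_curvature (metric_coeff G \<psi>) w"
proof (cases "\<psi> = Fin \<or> w = 0")
  case True
  then consider "\<psi> = Fin" | "\<psi> = chart_infty" "w = 0" using assms(1) by (auto simp: affine_charts_def)
  then show ?thesis
  proof cases
    case 1
    show ?thesis unfolding 1 by (rule gauss_curvature.simps)
  next
    case 2
    have "chart_infty 0 = Infty" by (simp add: chart_infty_def)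
    then show ?thesis unfolding 2 by (simp only: gauss_curvature.simps)
  qed
next
  case False
  then have psi: "\<psi> = chart_infty" "w \<noteq> 0" using assms(1) by (auto simp: affine_charts_def)
  let ?U = "{w. chart_infty w \<notin> P} - {0}" and ?S = "{z. Fin z \<notin> P}"
  have oU: "open ?U" by (rule open_delete, rule open_affine_chart_vimage[OF _ assms(3)]) (simp add: affine_charts_def)
  have oS: "open ?S" by (rule open_affine_chart_vimage[OF _ assms(3)]) (simp add: affine_charts_def)
  have wU: "w \<in> ?U" using assms psi by simp
  \<comment> \<open>The summand 0 fits the inversion to \<open>deriv_inversion\<close>, which is
    stated for 1 / w + a.\<close>
  have "planar_curvature (metric_coeff G chart_infty) w =
      planar_curvature (\<lambda>w. metric_coeff G Fin (1 / w + 0) * (cmod (deriv (\<lambda>w. 1 / w + 0) w))\<^sup>2) w"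
  proof (rule planar_curvature_cong[OF oU wU])
    fix y assume "y \<in> ?U"
    then have y: "y \<noteq> 0" by simp
    have "(cmod (deriv (\<lambda>w. 1 / w + 0) y))\<^sup>2 = 1 / cmod y ^ 4"
      unfolding deriv_inversion[OF y] by (simp add: norm_divide norm_power power_divide power_mult[symmetric])
    then show "metric_coeff G chart_infty y = metric_coeff G Fin (1 / y + 0) * (cmod (deriv (\<lambda>w. 1 / w + 0) y))\<^sup>2"
      unfolding metric_coeff_chart_infty[OF y] by simp
  qed
  also have "\<dots> = planar_curvature (metric_coeff G Fin) (1 / w + 0)"
  proof (rule planar_curvature_pullback[where h="\<lambda>w. 1 / w + 0" and \<rho>="metric_coeff G Fin", OF oU wU _ _ oS])
    show "(\<lambda>w. 1 / w + 0) holomorphic_on ?U" by (intro holomorphic_intros) auto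
    show "deriv (\<lambda>w. 1 / w + 0) z \<noteq> 0" if "z \<in> ?U" for z
    proof -
      have "z \<noteq> 0" using that by simp
      then show ?thesis unfolding deriv_inversion[OF \<open>z \<noteq> 0\<close>] by simp
    qed
    show "(\<lambda>w. 1 / w + 0) ` ?U \<subseteq> ?S" by (auto simp: chart_infty_def)
    show "Ck_on 2 ?S (metric_coeff G Fin)" using assms(2) by (simp add: smooth_metric_off_def smooth_on_def affine_charts_def)
    show "0 < metric_coeff G Fin z" if "z \<in> ?S" for z
    proof -
      have "G (Fin z) > 0" using assms(2) that by (auto simp: smooth_metric_off_def)
      then show ?thesis unfolding metric_coeff_def using one_plus_cmod2(1)[of z] by (intro divide_pos_pos) auto
    qed
  qed
  finally show ?thesis using psi by (simp add: chart_infty_def)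
qed

text \<open>G' is the pullback of G by M. The local form, where M is read in suitable charts as an
  injective holomorphic \<tau>, treats finite points and infinity alike and leaves the target chart
  free.\<close>

definition conformal_pull :: "(rsphere \<Rightarrow> rsphere) \<Rightarrow> conformal_metric \<Rightarrow> conformal_metric \<Rightarrow> bool" where
  "conformal_pull M G' G \<longleftrightarrow> (\<forall>\<phi>\<in>affine_charts. \<forall>z. \<exists>\<psi>\<in>affine_charts. \<exists>U \<tau>. open U \<and> z \<in> U \<and>
     \<tau> holomorphic_on U \<and> inj_on \<tau> U \<and> (\<forall>\<zeta>\<in>U. \<psi> (\<tau> \<zeta>) = M (\<phi> \<zeta>) \<and>
       metric_coeff G' \<phi> \<zeta> = metric_coeff G \<psi> (\<tau> \<zeta>) * (cmod (deriv \<tau> \<zeta>))\<^sup>2))"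

lemma conformal_pullE:
  assumes "conformal_pull M G' G" "\<phi> \<in> affine_charts"
  obtains \<psi> U \<tau> where "\<psi> \<in> affine_charts" "open U" "z \<in> U" "\<tau> holomorphic_on U" "inj_on \<tau> U"
    "\<And>\<zeta>. \<zeta> \<in> U \<Longrightarrow> \<psi> (\<tau> \<zeta>) = M (\<phi> \<zeta>)"
    "\<And>\<zeta>. \<zeta> \<in> U \<Longrightarrow> metric_coeff G' \<phi> \<zeta> = metric_coeff G \<psi> (\<tau> \<zeta>) * (cmod (deriv \<tau> \<zeta>))\<^sup>2"
  using assms unfolding conformal_pull_def by metis

lemma smooth_metric_off_pos:
  assumes "smooth_metric_off P G" "\<psi> z \<notin> P"
  shows "0 < metric_coeff G \<psi> z"
proof -
  have "G (\<psi> z) > 0" using assms by (auto simp: smooth_metric_off_def)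
  then show ?thesis unfolding metric_coeff_def using one_plus_cmod2(1)[of z] by (intro divide_pos_pos) auto
qed

lemma smooth_metric_off_Ck:
  "smooth_metric_off P G \<Longrightarrow> \<psi> \<in> affine_charts \<Longrightarrow> Ck_on k {z. \<psi> z \<notin> P} (metric_coeff G \<psi>)"
  by (simp add: smooth_metric_off_def smooth_on_def)

lemma smooth_metric_off_pull:
  assumes pull: "conformal_pull M G' G" and G: "smooth_metric_off P G" and P: "finite P" "finite P'"
    and MP: "\<And>q. q \<notin> P' \<Longrightarrow> M q \<notin> P"
  shows "smooth_metric_off P' G'"
  unfolding smooth_metric_off_def smooth_on_def
proof (intro conjI allI impI ballI)
  fix q assume q: "q \<notin> P'"
  obtain \<phi> z where \<phi>: "\<phi> \<in> affine_charts" "q = \<phi> z" by (rule affine_chart_surj)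
  obtain \<psi> U \<tau> where t: "\<psi> \<in> affine_charts" "open U" "z \<in> U" "\<tau> holomorphic_on U" "inj_on \<tau> U"
    "\<And>\<zeta>. \<zeta> \<in> U \<Longrightarrow> \<psi> (\<tau> \<zeta>) = M (\<phi> \<zeta>)"
    "\<And>\<zeta>. \<zeta> \<in> U \<Longrightarrow> metric_coeff G' \<phi> \<zeta> = metric_coeff G \<psi> (\<tau> \<zeta>) * (cmod (deriv \<tau> \<zeta>))\<^sup>2"
    using conformal_pullE[OF pull \<phi>(1), of z] by metis
  have "deriv \<tau> z \<noteq> 0" by (rule holomorphic_injective_imp_regular[OF t(4,2,5,3)])
  moreover have "0 < metric_coeff G \<psi> (\<tau> z)"
    by (rule smooth_metric_off_pos[OF G]) (use t(3,6) MP[OF q] \<phi> in simp)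
  ultimately have "0 < metric_coeff G' \<phi> z" using t(7)[OF t(3)] by simp
  then have "0 < G' q * 4 / (1 + (cmod z)\<^sup>2)\<^sup>2" by (simp add: metric_coeff_def \<phi>)
  then show "0 < G' q" using one_plus_cmod2(1)[of z] by (simp add: zero_less_divide_iff del: zero_less_power_eq zero_less_power2)
next
  fix \<phi> k assume \<phi>: "\<phi> \<in> affine_charts"
  show "Ck_on k {z. \<phi> z \<notin> P'} (metric_coeff G' \<phi>)"
  proof (rule Ck_on_localI)
    fix z assume z: "z \<in> {z. \<phi> z \<notin> P'}"
    obtain \<psi> U \<tau> where t: "\<psi> \<in> affine_charts" "open U" "z \<in> U" "\<tau> holomorphic_on U" "inj_on \<tau> U"
      "\<And>\<zeta>. \<zeta> \<in> U \<Longrightarrow> \<psi> (\<tau> \<zeta>) = M (\<phi> \<zeta>)"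
      "\<And>\<zeta>. \<zeta> \<in> U \<Longrightarrow> metric_coeff G' \<phi> \<zeta> = metric_coeff G \<psi> (\<tau> \<zeta>) * (cmod (deriv \<tau> \<zeta>))\<^sup>2"
      using conformal_pullE[OF pull \<phi>(1), of z] by metis
    define V where "V = U \<inter> {z. \<phi> z \<notin> P'}"
    have V: "open V" "z \<in> V" "V \<subseteq> U" using t z open_affine_chart_vimage[OF \<phi> P(2)] by (auto simp: V_def)
    have hV: "\<tau> holomorphic_on V" by (rule holomorphic_on_subset[OF t(4) V(3)])
    have im: "\<tau> ` V \<subseteq> {w. \<psi> w \<notin> P}" using t(6) MP by (auto simp: V_def)
    have "Ck_on k V (\<lambda>\<zeta>. metric_coeff G \<psi> (\<tau> \<zeta>) * (cmod (deriv \<tau> \<zeta>))\<^sup>2)"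
    proof (rule Ck_on_mult[OF V(1)])
      show "Ck_on k V (\<lambda>\<zeta>. metric_coeff G \<psi> (\<tau> \<zeta>))"
        by (rule Ck_on_compose_holomorphic[OF V(1) hV smooth_metric_off_Ck[OF G t(1)] im])
      show "Ck_on k V (\<lambda>\<zeta>. (cmod (deriv \<tau> \<zeta>))\<^sup>2)"
        by (rule Ck_on_cmod_power2[OF V(1) holomorphic_deriv[OF hV V(1)]])
    qed
    then have "Ck_on k V (metric_coeff G' \<phi>)"
      by (rule Ck_on_cong[OF V(1), rotated]) (use t(7) V(3) in auto)
    then show "\<exists>U. open U \<and> z \<in> U \<and> Ck_on k U (metric_coeff G' \<phi>)" using V by metis
  qed
qed

lemma gauss_curvature_pull:
  assumes pull: "conformal_pull M G' G" and G: "smooth_metric_off P G" and P: "finite P" "finite P'"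
    and MP: "\<And>q. q \<notin> P' \<Longrightarrow> M q \<notin> P" and q: "q \<notin> P'"
  shows "gauss_curvature G' q = gauss_curvature G (M q)"
proof -
  have G': "smooth_metric_off P' G'" by (rule smooth_metric_off_pull[OF pull G P MP])
  obtain \<phi> z where \<phi>: "\<phi> \<in> affine_charts" "q = \<phi> z" by (rule affine_chart_surj)
  obtain \<psi> U \<tau> where t: "\<psi> \<in> affine_charts" "open U" "z \<in> U" "\<tau> holomorphic_on U" "inj_on \<tau> U"
    "\<And>\<zeta>. \<zeta> \<in> U \<Longrightarrow> \<psi> (\<tau> \<zeta>) = M (\<phi> \<zeta>)"
    "\<And>\<zeta>. \<zeta> \<in> U \<Longrightarrow> metric_coeff G' \<phi> \<zeta> = metric_coeff G \<psi> (\<tau> \<zeta>) * (cmod (deriv \<tau> \<zeta>))\<^sup>2"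
    using conformal_pullE[OF pull \<phi>(1), of z] by metis
  define V where "V = U \<inter> {z. \<phi> z \<notin> P'}"
  have V: "open V" "z \<in> V" "V \<subseteq> U" using t q \<phi> open_affine_chart_vimage[OF \<phi>(1) P(2)] by (auto simp: V_def)
  have "gauss_curvature G' q = planar_curvature (metric_coeff G' \<phi>) z"
    unfolding \<phi>(2) by (rule gauss_curvature_affine_chart[OF \<phi>(1) G' P(2)]) (use q \<phi> in simp)
  also have "\<dots> = planar_curvature (\<lambda>\<zeta>. metric_coeff G \<psi> (\<tau> \<zeta>) * (cmod (deriv \<tau> \<zeta>))\<^sup>2) z"
    by (rule planar_curvature_cong[OF V(1,2)]) (use t(7) V(3) in auto)
  also have "\<dots> = planar_curvature (metric_coeff G \<psi>) (\<tau> z)"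
  proof (rule planar_curvature_pullback[OF V(1,2) holomorphic_on_subset[OF t(4) V(3)]])
    show "deriv \<tau> z \<noteq> 0" if "z \<in> V" for z
      by (rule holomorphic_injective_imp_regular[OF t(4,2,5)]) (use that V in auto)
    show "open {w. \<psi> w \<notin> P}" by (rule open_affine_chart_vimage[OF t(1) P(1)])
    show "\<tau> ` V \<subseteq> {w. \<psi> w \<notin> P}" using t(6) MP by (auto simp: V_def)
    show "Ck_on 2 {w. \<psi> w \<notin> P} (metric_coeff G \<psi>)" by (rule smooth_metric_off_Ck[OF G t(1)])
    show "0 < metric_coeff G \<psi> z" if "z \<in> {w. \<psi> w \<notin> P}" for z
      by (rule smooth_metric_off_pos[OF G]) (use that in simp)
  qed
  also have "\<dots> = gauss_curvature G (\<psi> (\<tau> z))"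
    by (rule gauss_curvature_affine_chart[OF t(1) G P(1), symmetric]) (use t(3,6) MP[OF q] \<phi> in simp)
  finally show ?thesis using t(3,6) \<phi> by simp
qed

text \<open>G is the pullback of G' by N, so a coordinate h at q is carried to \<tau> o h at N q; by
  the chain rule the coefficient in it, and hence u, are unchanged.\<close>

lemma conic_singularity_pull:
  assumes pull: "conformal_pull N G G'" and G: "conic_singularity G q b"
  shows "conic_singularity G' (N q) b"
proof -
  from G obtain \<phi> h r u where b: "b > -1" and \<phi>: "\<phi> \<in> affine_charts" and r: "r > 0"
    and h: "h holomorphic_on ball 0 r" "inj_on h (ball 0 r)" "\<phi> (h 0) = q"
    and u: "continuous_on (ball 0 r) u" "Ck_on 2 (ball 0 r - {0}) u"
    and eq: "\<And>z. z \<in> ball 0 r - {0} \<Longrightarrow> metric_coeff G \<phi> (h z) * (cmod (deriv h z))\<^sup>2 = exp (2 * u z) * cmod z powr (2 * b)"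
    unfolding conic_singularity_def by metis
  obtain \<psi> U \<tau> where t: "\<psi> \<in> affine_charts" "open U" "h 0 \<in> U" "\<tau> holomorphic_on U" "inj_on \<tau> U"
    "\<And>\<zeta>. \<zeta> \<in> U \<Longrightarrow> \<psi> (\<tau> \<zeta>) = N (\<phi> \<zeta>)"
    "\<And>\<zeta>. \<zeta> \<in> U \<Longrightarrow> metric_coeff G \<phi> \<zeta> = metric_coeff G' \<psi> (\<tau> \<zeta>) * (cmod (deriv \<tau> \<zeta>))\<^sup>2"
    using conformal_pullE[OF pull \<phi>(1), of "h 0"] by metis
  have "open (h -` U \<inter> ball 0 r)"
    by (subst Int_commute, rule continuous_open_preimage[OF holomorphic_on_imp_continuous_on[OF h(1)] open_ball t(2)])
  moreover have "0 \<in> h -` U \<inter> ball 0 r" using t r by simp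
  ultimately obtain s where s: "s > 0" "ball 0 s \<subseteq> h -` U \<inter> ball 0 r" by (meson open_contains_ball)
  have sr: "ball (0::complex) s \<subseteq> ball 0 r" using s(2) by blast
  have hU: "h ` ball 0 s \<subseteq> U" using s(2) by blast
  show ?thesis unfolding conic_singularity_def
  proof (intro conjI b bexI[OF _ t(1)] exI[of _ "\<tau> \<circ> h"] exI[of _ s] exI[of _ u] s(1) ballI)
    show "\<tau> \<circ> h holomorphic_on ball 0 s"
      by (rule holomorphic_on_compose_gen[OF holomorphic_on_subset[OF h(1) sr] t(4) hU])
    show "inj_on (\<tau> \<circ> h) (ball 0 s)"
      by (rule comp_inj_on[OF inj_on_subset[OF h(2) sr] inj_on_subset[OF t(5) hU]])
    show "\<psi> ((\<tau> \<circ> h) 0) = N q" using t(3,6) h(3) by simp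
    show "continuous_on (ball 0 s) u" by (rule continuous_on_subset[OF u(1) sr])
    show "Ck_on 2 (ball 0 s - {0}) u" by (rule Ck_on_subset[OF u(2)]) (use sr in auto)
    fix z assume z: "z \<in> ball 0 s - {0::complex}"
    have zr: "z \<in> ball 0 r - {0}" and hz: "h z \<in> U" using z sr hU by auto
    have "(h has_field_derivative deriv h z) (at z)"
      by (rule holomorphic_derivI[OF h(1) open_ball]) (use zr in auto)
    moreover have "(\<tau> has_field_derivative deriv \<tau> (h z)) (at (h z))"
      by (rule holomorphic_derivI[OF t(4,2) hz])
    ultimately have "deriv (\<tau> \<circ> h) z = deriv \<tau> (h z) * deriv h z" by (intro DERIV_imp_deriv DERIV_chain)
    then show "metric_coeff G' \<psi> ((\<tau> \<circ> h) z) * (cmod (deriv (\<tau> \<circ> h) z))\<^sup>2 = exp (2 * u z) * cmod z powr (2 * b)"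
      using eq[OF zr] t(7)[OF hz] by (simp add: norm_mult power_mult_distrib mult.assoc)
  qed
qed

lemma metric_coeff_borel_measurable:
  assumes "smooth_metric_off P G" "finite P" "\<phi> \<in> affine_charts"
  shows "metric_coeff G \<phi> \<in> borel_measurable borel"
proof (rule borel_measurable_continuous_countable_exceptions)
  show "countable (\<phi> -` P)" by (rule countable_finite[OF finite_vimageI[OF assms(2) inj_affine_chart[OF assms(3)]]])
  have "- (\<phi> -` P) = {z. \<phi> z \<notin> P}" by auto
  then show "continuous_on (- (\<phi> -` P)) (metric_coeff G \<phi>)"
    using Ck_on_imp_continuous_on[OF smooth_metric_off_Ck[OF assms(1,3), of 0]] by simp
qed

text \<open>A competitor for p becomes one of equal area for the transported points. Of the two
  pullback relations the one along M carries smoothness and curvature, the one along its inverse N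
  the cone points.\<close>

lemma MinVol_pull_le:
  assumes NM: "\<And>q. N (M q) = q" and MN: "\<And>q. M (N q) = q"
    and ex: "\<And>G. smooth_metric_off (p ` {1..n}) G \<Longrightarrow>
      \<exists>G'. conformal_pull M G' G \<and> conformal_pull N G G' \<and> metric_area G' = metric_area G"
  shows "MinVol n (N \<circ> p) b \<le> MinVol n p b"
  unfolding MinVol_def
proof (rule Inf_mono)
  fix a assume "a \<in> {metric_area G |G. represents G n p b \<and> (\<forall>q. q \<notin> p ` {1..n} \<longrightarrow> \<bar>gauss_curvature G q\<bar> \<le> 1)}"
  then obtain G where G: "a = metric_area G" "represents G n p b" "\<And>q. q \<notin> p ` {1..n} \<Longrightarrow> \<bar>gauss_curvature G q\<bar> \<le> 1" by auto
  have sm: "smooth_metric_off (p ` {1..n}) G" using G(2) by (simp add: represents_def)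
  obtain G' where G': "conformal_pull M G' G" "conformal_pull N G G'" "metric_area G' = metric_area G"
    using ex[OF sm] by auto
  let ?P' = "(N \<circ> p) ` {1..n}"
  have MP: "M q \<notin> p ` {1..n}" if "q \<notin> ?P'" for q
  proof
    assume "M q \<in> p ` {1..n}"
    then obtain i where i: "i \<in> {1..n}" "M q = p i" by auto
    then have "q = (N \<circ> p) i" using NM[of q] by simp
    then show False using that i(1) by blast
  qed
  have "represents G' n (N \<circ> p) b"
    unfolding represents_def
  proof (intro conjI ballI)
    show "smooth_metric_off ?P' G'" by (rule smooth_metric_off_pull[OF G'(1) sm]) (use MP in auto)
    show "conic_singularity G' ((N \<circ> p) i) (b i)" if "i \<in> {1..n}" for i
    proof -
      have "conic_singularity G (p i) (b i)" using G(2) that unfolding represents_def by simp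
      then show ?thesis using conic_singularity_pull[OF G'(2), of "p i" "b i"] by simp
    qed
  qed
  moreover have "\<bar>gauss_curvature G' q\<bar> \<le> 1" if "q \<notin> ?P'" for q
  proof -
    have "gauss_curvature G' q = gauss_curvature G (M q)"
      by (rule gauss_curvature_pull[OF G'(1) sm _ _ _ that]) (use MP in auto)
    then show ?thesis using G(3)[OF MP[OF that]] by simp
  qed
  ultimately show "\<exists>a'\<in>{metric_area G |G. represents G n (N \<circ> p) b \<and> (\<forall>q. q \<notin> ?P' \<longrightarrow> \<bar>gauss_curvature G q\<bar> \<le> 1)}. a' \<le> a"
    using G'(3) G(1) by (intro bexI[of _ "metric_area G'"] CollectI exI[of _ G'] conjI) simp_all
qed

section \<open>Inversion and translations of the sphere\<close>

definition sphere_inv :: "rsphere \<Rightarrow> rsphere" where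
  "sphere_inv q = (case q of Infty \<Rightarrow> Fin 0 | Fin z \<Rightarrow> chart_infty z)"

definition sphere_shift :: "complex \<Rightarrow> rsphere \<Rightarrow> rsphere" where
  "sphere_shift a q = (case q of Infty \<Rightarrow> Infty | Fin z \<Rightarrow> Fin (z + a))"

text \<open>The fraction is the quotient of the round coefficients at z + a and at z, so that the
  planar coefficient is simply translated. It tends to 1 at infinity, whence the value
  there.\<close>

definition shift_metric :: "complex \<Rightarrow> conformal_metric \<Rightarrow> conformal_metric" where
  "shift_metric a G q = (case q of Infty \<Rightarrow> G Infty
     | Fin z \<Rightarrow> G (Fin (z + a)) * (1 + (cmod z)\<^sup>2)\<^sup>2 / (1 + (cmod (z + a))\<^sup>2)\<^sup>2)"

lemma sphere_inv_sphere_inv: "sphere_inv (sphere_inv q) = q"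
  by (auto simp: sphere_inv_def chart_infty_def split: rsphere.split)

lemma sphere_shift_sphere_shift: "sphere_shift a (sphere_shift (- a) q) = q" "sphere_shift (- a) (sphere_shift a q) = q"
  by (auto simp: sphere_shift_def split: rsphere.split)

lemma metric_coeff_shift_metric: "metric_coeff (shift_metric a G) Fin z = metric_coeff G Fin (z + a)"
  using one_plus_cmod2[of z] by (simp add: metric_coeff_def shift_metric_def)

lemma shift_metric_shift_metric: "shift_metric (- a) (shift_metric a G) = G"
proof
  fix q show "shift_metric (- a) (shift_metric a G) q = G q"
    using one_plus_cmod2 by (cases q) (simp_all add: shift_metric_def)
qed

text \<open>Inversion is an isometry of the round metric and exchanges the two charts, so \<tau> is
  the identity in both cases.\<close>

lemma conformal_pull_inv: "conformal_pull sphere_inv (G \<circ> sphere_inv) G"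
  unfolding conformal_pull_def
proof (intro ballI allI)
  fix \<phi> z assume "\<phi> \<in> affine_charts"
  then consider "\<phi> = Fin" | "\<phi> = chart_infty" by (auto simp: affine_charts_def)
  then obtain \<psi> where "\<psi> \<in> affine_charts" "\<And>\<zeta>. \<psi> \<zeta> = sphere_inv (\<phi> \<zeta>)"
  proof cases
    case 1 then show ?thesis using that[of chart_infty] by (simp add: affine_charts_def sphere_inv_def)
  next
    case 2 then show ?thesis using that[of Fin] by (simp add: affine_charts_def sphere_inv_def chart_infty_def)
  qed
  then show "\<exists>\<psi>\<in>affine_charts. \<exists>U \<tau>. open U \<and> z \<in> U \<and> \<tau> holomorphic_on U \<and> inj_on \<tau> U \<and> (\<forall>\<zeta>\<in>U. \<psi> (\<tau> \<zeta>) = sphere_inv (\<phi> \<zeta>) \<and>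
       metric_coeff (G \<circ> sphere_inv) \<phi> \<zeta> = metric_coeff G \<psi> (\<tau> \<zeta>) * (cmod (deriv \<tau> \<zeta>))\<^sup>2)"
    by (intro bexI[of _ \<psi>] exI[of _ UNIV] exI[of _ "\<lambda>z. z"]) (auto simp: metric_coeff_def)
qed

lemma conformal_pull_shift: "conformal_pull (sphere_shift a) (shift_metric a G) G"
  unfolding conformal_pull_def
proof (intro ballI allI)
  fix \<phi> and z :: complex assume "\<phi> \<in> affine_charts"
  then consider "\<phi> = Fin" | "\<phi> = chart_infty" "z \<noteq> 0" | "\<phi> = chart_infty" "z = 0" by (auto simp: affine_charts_def)
  then show "\<exists>\<psi>\<in>affine_charts. \<exists>U \<tau>. open U \<and> z \<in> U \<and> \<tau> holomorphic_on U \<and> inj_on \<tau> U \<and> (\<forall>\<zeta>\<in>U. \<psi> (\<tau> \<zeta>) = sphere_shift a (\<phi> \<zeta>) \<and>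
       metric_coeff (shift_metric a G) \<phi> \<zeta> = metric_coeff G \<psi> (\<tau> \<zeta>) * (cmod (deriv \<tau> \<zeta>))\<^sup>2)"
  proof cases
    case 1
    have "deriv (\<lambda>z. z + a) \<zeta> = 1" for \<zeta> by (rule DERIV_imp_deriv) (auto intro!: derivative_eq_intros)
    then show ?thesis using 1
      by (intro bexI[of _ Fin] exI[of _ UNIV] exI[of _ "\<lambda>z. z + a"])
         (auto simp: affine_charts_def metric_coeff_shift_metric sphere_shift_def inj_on_def intro!: holomorphic_intros)
  next
    case 2
    have "metric_coeff (shift_metric a G) chart_infty \<zeta> = metric_coeff G Fin (1 / \<zeta> + a) * (cmod (deriv (\<lambda>w. 1 / w + a) \<zeta>))\<^sup>2"
      if "\<zeta> \<noteq> 0" for \<zeta>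
      using that by (simp add: metric_coeff_chart_infty metric_coeff_shift_metric deriv_inversion norm_divide norm_power power_divide power_mult[symmetric])
    then show ?thesis using 2
      by (intro bexI[of _ Fin] exI[of _ "- {0}"] exI[of _ "\<lambda>w. 1 / w + a"])
         (auto simp: affine_charts_def sphere_shift_def chart_infty_def inj_on_def intro!: holomorphic_intros)
  next
    case 3
    \<comment> \<open>Near infinity, in w = 1 / z, the translation z + a reads w / (1 + a
      w).\<close>
    let ?U = "{w. 1 + a * w \<noteq> 0}" and ?t = "\<lambda>w. w / (1 + a * w)"
    have oU: "open ?U" by (intro open_Collect_neq continuous_intros)
    have d: "deriv ?t w = 1 / (1 + a * w)\<^sup>2" if "w \<in> ?U" for w
      by (rule DERIV_imp_deriv) (use that in \<open>auto intro!: derivative_eq_intros simp: power2_eq_square algebra_simps\<close>)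
    have inj: "inj_on ?t ?U"
    proof (rule inj_onI)
      fix v w assume "v \<in> ?U" "w \<in> ?U" "?t v = ?t w"
      then have "v * (1 + a * w) = w * (1 + a * v)" by (simp add: frac_eq_eq)
      then show "v = w" by (simp add: algebra_simps)
    qed
    have c: "chart_infty (?t w) = sphere_shift a (chart_infty w)" if "w \<in> ?U" for w
      using that by (auto simp: chart_infty_def sphere_shift_def add_divide_distrib)
    have m: "metric_coeff (shift_metric a G) chart_infty w = metric_coeff G chart_infty (?t w) * (cmod (deriv ?t w))\<^sup>2" if "w \<in> ?U" for w
    proof (cases "w = 0")
      case True
      then show ?thesis using d[OF that] by (simp add: metric_coeff_def chart_infty_def shift_metric_def)
    next
      case False
      then have n: "?t w \<noteq> 0" "1 + a * w \<noteq> 0" using that by auto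
      have e: "1 / ?t w = 1 / w + a" using False n by (simp add: add_divide_distrib)
      have e2: "cmod (?t w) ^ 4 = cmod w ^ 4 * (cmod (deriv ?t w))\<^sup>2"
        using d[OF that] by (simp add: norm_divide norm_power power_divide power_mult[symmetric])
      have e3: "(cmod (deriv ?t w))\<^sup>2 \<noteq> 0" using d[OF that] n by simp
      show ?thesis unfolding metric_coeff_chart_infty[OF False] metric_coeff_chart_infty[OF n(1)] e metric_coeff_shift_metric e2
        using e3 by simp
    qed
    show ?thesis unfolding 3
      by (intro bexI[of _ chart_infty] exI[of _ ?U] exI[of _ ?t] conjI ballI oU inj c m)
         (auto simp: affine_charts_def intro!: holomorphic_intros)
  qed
qed

lemma metric_area_inv:
  assumes "smooth_metric_off P G" "finite P"
  shows "metric_area (G \<circ> sphere_inv) = metric_area G"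
proof -
  have [measurable]: "metric_coeff G Fin \<in> borel_measurable borel"
    by (rule metric_coeff_borel_measurable[OF assms]) (simp add: affine_charts_def)
  have eq: "metric_coeff (G \<circ> sphere_inv) Fin z = metric_coeff G Fin (1 / z) * (1 / cmod z ^ 4)" if "z \<noteq> 0" for z
  proof -
    have "metric_coeff (G \<circ> sphere_inv) Fin z = metric_coeff G chart_infty z"
      by (simp add: metric_coeff_def sphere_inv_def)
    then show ?thesis using metric_coeff_chart_infty[OF that, of G] by simp
  qed
  have "metric_area (G \<circ> sphere_inv) = (\<integral>\<^sup>+z. ennreal (metric_coeff G Fin (1 / z)) * ennreal (1 / cmod z ^ 4) \<partial>lborel)"
    unfolding metric_area_def
  proof (rule nn_integral_cong_AE)
    show "AE z in lborel. ennreal (metric_coeff (G \<circ> sphere_inv) Fin z) = ennreal (metric_coeff G Fin (1 / z)) * ennreal (1 / cmod z ^ 4)"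
      using AE_lborel_singleton[of 0]
    proof eventually_elim
      case (elim z)
      show ?case unfolding eq[OF elim] by (rule ennreal_mult'') simp
    qed
  qed
  also have "\<dots> = metric_area G" unfolding metric_area_def by (rule nn_integral_inversion) measurable
  finally show ?thesis .
qed

lemma metric_area_shift:
  assumes "smooth_metric_off P G" "finite P"
  shows "metric_area (shift_metric a G) = metric_area G"
proof -
  have [measurable]: "metric_coeff G Fin \<in> borel_measurable borel"
    by (rule metric_coeff_borel_measurable[OF assms]) (simp add: affine_charts_def)
  have "metric_area G = (\<integral>\<^sup>+z. ennreal (metric_coeff G Fin z) \<partial>distr lborel borel ((+) a))"
    unfolding metric_area_def by (simp add: lborel_distr_plus)
  also have "\<dots> = (\<integral>\<^sup>+z. ennreal (metric_coeff G Fin (a + z)) \<partial>lborel)" by (subst nn_integral_distr) auto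
  finally show ?thesis by (simp add: metric_area_def metric_coeff_shift_metric add.commute)
qed

lemma MinVol_inv: "MinVol n (sphere_inv \<circ> p) b = MinVol n p b"
proof -
  have le: "MinVol n (sphere_inv \<circ> p) b \<le> MinVol n p b" for p
  proof (rule MinVol_pull_le[where M=sphere_inv])
    fix G assume G: "smooth_metric_off (p ` {1..n}) G"
    have "G \<circ> sphere_inv \<circ> sphere_inv = G" by (simp add: fun_eq_iff sphere_inv_sphere_inv)
    then have "conformal_pull sphere_inv G (G \<circ> sphere_inv)" using conformal_pull_inv[of "G \<circ> sphere_inv"] by simp
    then show "\<exists>G'. conformal_pull sphere_inv G' G \<and> conformal_pull sphere_inv G G' \<and> metric_area G' = metric_area G"
      using conformal_pull_inv[of G] metric_area_inv[OF G] by auto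
  qed (simp_all add: sphere_inv_sphere_inv)
  have "sphere_inv \<circ> (sphere_inv \<circ> p) = p" by (simp add: fun_eq_iff sphere_inv_sphere_inv)
  then show ?thesis using le[of p] le[of "sphere_inv \<circ> p"] by (metis order_antisym)
qed

lemma MinVol_shift: "MinVol n (sphere_shift a \<circ> p) b = MinVol n p b"
proof -
  have le: "MinVol n (sphere_shift a \<circ> p) b \<le> MinVol n p b" for p a
  proof (rule MinVol_pull_le[where M="sphere_shift (- a)"])
    fix G assume G: "smooth_metric_off (p ` {1..n}) G"
    have "conformal_pull (sphere_shift a) G (shift_metric (- a) G)"
      using conformal_pull_shift[of a "shift_metric (- a) G"] shift_metric_shift_metric[of "- a" G] by simp
    then show "\<exists>G'. conformal_pull (sphere_shift (- a)) G' G \<and> conformal_pull (sphere_shift a) G G' \<and> metric_area G' = metric_area G"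
      using conformal_pull_shift[of "- a" G] metric_area_shift[OF G] by auto
  qed (simp_all add: sphere_shift_sphere_shift)
  have "sphere_shift (- a) \<circ> (sphere_shift a \<circ> p) = p" by (simp add: fun_eq_iff sphere_shift_sphere_shift)
  then show ?thesis using le[of a p] le[of "- a" "sphere_shift a \<circ> p"] by (metis order_antisym)
qed

section \<open>Conic singularities in the affine charts\<close>

text \<open>|h z - h 0| and |z| differ by the factor |q z|, bounded above and away from 0; so the
  logarithmic singularity keeps its coefficient when the coordinate z is replaced by the chart
  variable.\<close>

lemma conic_log_bound:
  assumes r: "r > 0" and h: "h holomorphic_on ball 0 r" "inj_on h (ball 0 r)"
    and u: "continuous_on (ball 0 r) u"
    and eq: "\<And>z. z \<in> ball 0 r - {0} \<Longrightarrow> f (h z) * (cmod (deriv h z))\<^sup>2 = exp (2 * u z) * cmod z powr (2 * b)"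
  obtains C \<delta> where "\<delta> > 0"
    "\<And>\<zeta>. 0 < cmod (\<zeta> - h 0) \<Longrightarrow> cmod (\<zeta> - h 0) < \<delta> \<Longrightarrow> f \<zeta> > 0"
    "\<And>\<zeta>. 0 < cmod (\<zeta> - h 0) \<Longrightarrow> cmod (\<zeta> - h 0) < \<delta> \<Longrightarrow> \<bar>ln (f \<zeta>) / 2 - b * ln (cmod (\<zeta> - h 0))\<bar> \<le> C"
proof -
  let ?B = "ball (0::complex) r"
  have d: "deriv h z \<noteq> 0" if "z \<in> ?B" for z by (rule holomorphic_injective_imp_regular[OF h(1) open_ball h(2) that])
  \<comment> \<open>The difference quotient completed by the derivative at 0; injectivity of h keeps
    it from vanishing.\<close>
  define q where "q z = (if z = 0 then deriv h 0 else (h z - h 0) / z)" for z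
  have q0: "q z \<noteq> 0" if "z \<in> ?B" for z
  proof (cases "z = 0")
    case True
    then show ?thesis using d[OF that] by (simp add: q_def)
  next
    case False
    then have "h z \<noteq> h 0" using inj_onD[OF h(2), of z 0] that r by auto
    then show ?thesis using False by (simp add: q_def)
  qed
  have ch: "continuous_on ?B h" by (rule holomorphic_on_imp_continuous_on[OF h(1)])
  have cq: "continuous_on ?B q"
    unfolding continuous_on_eq_continuous_at[OF open_ball]
  proof
    fix z assume z: "z \<in> ?B"
    show "isCont q z"
    proof (cases "z = 0")
      case True
      have "(h has_field_derivative deriv h 0) (at 0)" by (rule holomorphic_derivI[OF h(1) open_ball]) (use r in simp)
      then have "((\<lambda>k. (h (0 + k) - h 0) / k) \<longlongrightarrow> deriv h 0) (at 0)" unfolding DERIV_def .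
      moreover have "(q \<longlongrightarrow> deriv h 0) (at 0) \<longleftrightarrow> ((\<lambda>k. (h (0 + k) - h 0) / k) \<longlongrightarrow> deriv h 0) (at 0)"
        by (rule LIM_equal) (simp add: q_def)
      ultimately show ?thesis unfolding True isCont_def by (simp add: q_def)
    next
      case False
      have o: "open (?B - {0})" by (rule open_delete[OF open_ball])
      have "continuous_on (?B - {0}) (\<lambda>z. (h z - h 0) / z)"
        by (intro continuous_intros continuous_on_subset[OF ch]) auto
      then have "continuous_on (?B - {0}) q" by (rule continuous_on_eq) (simp add: q_def)
      then show ?thesis using z False by (simp add: continuous_on_eq_continuous_at[OF o])
    qed
  qed
  \<comment> \<open>The remainder in closed form. It is continuous across 0, hence bounded on the
    closed disc of half the radius.\<close>
  define v where "v z = u z - ln (cmod (deriv h z)) - b * ln (cmod (q z))" for z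
  have cv: "continuous_on ?B v"
    unfolding v_def
    by (intro continuous_intros u cq holomorphic_on_imp_continuous_on[OF holomorphic_deriv[OF h(1) open_ball]])
       (use d q0 in auto)
  have sub: "cball 0 (r / 2) \<subseteq> ?B" using r by auto
  have "compact (v ` cball 0 (r / 2))" by (intro compact_continuous_image continuous_on_subset[OF cv sub]) simp
  then obtain C where C: "\<And>z. z \<in> cball 0 (r / 2) \<Longrightarrow> norm (v z) \<le> C"
    by (meson bounded_iff compact_imp_bounded imageI)
  have bs: "ball 0 (r / 2) \<subseteq> ?B" using r by auto
  have "open (h ` ball 0 (r / 2))"
    by (rule open_mapping_thm3[OF holomorphic_on_subset[OF h(1) bs] open_ball inj_on_subset[OF h(2) bs]])
  moreover have "h 0 \<in> h ` ball 0 (r / 2)" using r by simp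
  ultimately obtain \<delta> where dl: "\<delta> > 0" "ball (h 0) \<delta> \<subseteq> h ` ball 0 (r / 2)" by (meson open_contains_ball)
  have main: "f \<zeta> > 0 \<and> \<bar>ln (f \<zeta>) / 2 - b * ln (cmod (\<zeta> - h 0))\<bar> \<le> C" if z: "0 < cmod (\<zeta> - h 0)" "cmod (\<zeta> - h 0) < \<delta>" for \<zeta>
  proof -
    have "\<zeta> \<in> ball (h 0) \<delta>" using z by (simp add: dist_norm norm_minus_commute)
    then obtain w where w: "w \<in> ball 0 (r / 2)" "\<zeta> = h w" using dl by blast
    have w0: "w \<noteq> 0" using z w by auto
    have wB: "w \<in> ?B" using w bs by blast
    have dw: "deriv h w \<noteq> 0" by (rule d[OF wB])
    have e: "f \<zeta> * (cmod (deriv h w))\<^sup>2 = exp (2 * u w) * cmod w powr (2 * b)" using eq[of w] w w0 wB by simp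
    have pos: "f \<zeta> > 0"
    proof (rule ccontr)
      assume "\<not> f \<zeta> > 0"
      then have "f \<zeta> * (cmod (deriv h w))\<^sup>2 \<le> 0" by (intro mult_nonpos_nonneg) auto
      moreover have "exp (2 * u w) * cmod w powr (2 * b) > 0" using w0 by simp
      ultimately show False using e by linarith
    qed
    have "ln (f \<zeta> * (cmod (deriv h w))\<^sup>2) = ln (f \<zeta>) + 2 * ln (cmod (deriv h w))"
      using pos dw by (simp add: ln_mult ln_realpow)
    moreover have "ln (exp (2 * u w) * cmod w powr (2 * b)) = 2 * u w + 2 * b * ln (cmod w)"
      using w0 by (simp add: ln_mult ln_powr)
    ultimately have l: "ln (f \<zeta>) = 2 * u w + 2 * b * ln (cmod w) - 2 * ln (cmod (deriv h w))" using e by simp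
    have "cmod (\<zeta> - h 0) = cmod (q w) * cmod w" using w0 w(2) by (simp add: q_def norm_divide)
    then have "ln (cmod (\<zeta> - h 0)) = ln (cmod (q w)) + ln (cmod w)" using q0[OF wB] w0 by (simp add: ln_mult)
    then have "ln (f \<zeta>) / 2 - b * ln (cmod (\<zeta> - h 0)) = v w" unfolding l v_def by (simp add: algebra_simps add_divide_distrib diff_divide_distrib)
    then show ?thesis using pos C[of w] w(1) by simp
  qed
  show ?thesis by (rule that[OF dl(1), of C]) (use main in auto)
qed

text \<open>A coordinate at a finite point may be given through the chart at infinity; then h avoids
  0 near the centre, and 1 / h is a coordinate through the finite chart.\<close>

lemma conic_singularity_Fin_bound:
  assumes "conic_singularity G (Fin c) b"
  obtains C \<delta> where "\<delta> > 0"
    "\<And>z. 0 < cmod (z - c) \<Longrightarrow> cmod (z - c) < \<delta> \<Longrightarrow> \<bar>ln (metric_coeff G Fin z) / 2 - b * ln (cmod (z - c))\<bar> \<le> C"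
proof -
  from assms obtain \<phi> h r u where b: "b > -1" and \<phi>: "\<phi> \<in> affine_charts" and r: "r > 0"
    and h: "h holomorphic_on ball 0 r" "inj_on h (ball 0 r)" "\<phi> (h 0) = Fin c"
    and u: "continuous_on (ball 0 r) u"
    and eq: "\<And>z. z \<in> ball 0 r - {0} \<Longrightarrow> metric_coeff G \<phi> (h z) * (cmod (deriv h z))\<^sup>2 = exp (2 * u z) * cmod z powr (2 * b)"
    unfolding conic_singularity_def by metis
  consider "\<phi> = Fin" | "\<phi> = chart_infty" using \<phi> by (auto simp: affine_charts_def)
  then show ?thesis
  proof cases
    case 1
    then have "h 0 = c" using h(3) by simp
    then show ?thesis using conic_log_bound[OF r h(1,2) u eq] 1 that by metis
  next
    case 2
    then have h0: "h 0 \<noteq> 0" "1 / h 0 = c" using h(3) by (auto simp: chart_infty_def split: if_splits)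
    have "open (ball 0 r \<inter> h -` (- {0}))"
      by (rule continuous_open_preimage[OF holomorphic_on_imp_continuous_on[OF h(1)] open_ball]) auto
    moreover have "0 \<in> ball 0 r \<inter> h -` (- {0})" using r h0 by simp
    ultimately obtain s where s: "s > 0" "ball 0 s \<subseteq> ball 0 r \<inter> h -` (- {0})" by (meson open_contains_ball)
    have sr: "ball (0::complex) s \<subseteq> ball 0 r" using s(2) by blast
    have hn: "h z \<noteq> 0" if "z \<in> ball 0 s" for z using s(2) that by blast
    let ?k = "\<lambda>z. 1 / h z"
    have k1: "?k holomorphic_on ball 0 s" by (intro holomorphic_intros holomorphic_on_subset[OF h(1) sr]) (rule hn)
    have k2: "inj_on ?k (ball 0 s)"
    proof (rule inj_onI)
      fix x y assume xy: "x \<in> ball 0 s" "y \<in> ball 0 s" "?k x = ?k y"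
      then have "h x = h y" using hn[of x] hn[of y] by (simp add: frac_eq_eq)
      then show "x = y" using inj_onD[OF h(2)] xy sr by blast
    qed
    have k3: "metric_coeff G Fin (?k z) * (cmod (deriv ?k z))\<^sup>2 = exp (2 * u z) * cmod z powr (2 * b)" if z: "z \<in> ball 0 s - {0}" for z
    proof -
      have zr: "z \<in> ball 0 r - {0}" using z sr by blast
      have hz: "h z \<noteq> 0" using hn z by simp
      have "(h has_field_derivative deriv h z) (at z)" by (rule holomorphic_derivI[OF h(1) open_ball]) (use zr in simp)
      then have "deriv ?k z = - (deriv h z / (h z)\<^sup>2)" using hz
        by (intro DERIV_imp_deriv) (auto intro!: derivative_eq_intros simp: power2_eq_square)
      then have "(cmod (deriv ?k z))\<^sup>2 = (cmod (deriv h z))\<^sup>2 / cmod (h z) ^ 4"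
        by (simp add: norm_divide norm_power power_divide power_mult[symmetric])
      then show ?thesis using eq[OF zr] unfolding 2 metric_coeff_chart_infty[OF hz] by simp
    qed
    obtain C \<delta> where "\<delta> > 0"
      "\<And>\<zeta>. 0 < cmod (\<zeta> - ?k 0) \<Longrightarrow> cmod (\<zeta> - ?k 0) < \<delta> \<Longrightarrow> \<bar>ln (metric_coeff G Fin \<zeta>) / 2 - b * ln (cmod (\<zeta> - ?k 0))\<bar> \<le> C"
      using conic_log_bound[OF s(1) k1 k2 continuous_on_subset[OF u sr] k3] by metis
    then show ?thesis using that h0(2) by metis
  qed
qed

text \<open>In w = 1 / z the coefficient is |z|^4 times the finite one, which turns b ln |w| into
  -(2 + b) ln |z|.\<close>

lemma conic_singularity_Infty_bound:
  assumes "conic_singularity G Infty b"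
  obtains C R where "\<And>z. cmod z > R \<Longrightarrow> \<bar>ln (metric_coeff G Fin z) / 2 + (2 + b) * ln (cmod z)\<bar> \<le> C"
proof -
  from assms obtain \<phi> h r u where b: "b > -1" and \<phi>: "\<phi> \<in> affine_charts" and r: "r > 0"
    and h: "h holomorphic_on ball 0 r" "inj_on h (ball 0 r)" "\<phi> (h 0) = Infty"
    and u: "continuous_on (ball 0 r) u"
    and eq: "\<And>z. z \<in> ball 0 r - {0} \<Longrightarrow> metric_coeff G \<phi> (h z) * (cmod (deriv h z))\<^sup>2 = exp (2 * u z) * cmod z powr (2 * b)"
    unfolding conic_singularity_def by metis
  have phi: "\<phi> = chart_infty" and h0: "h 0 = 0" using \<phi> h(3) by (auto simp: affine_charts_def chart_infty_def split: if_splits)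
  obtain C \<delta> where dl: "\<delta> > 0"
    "\<And>\<zeta>. 0 < cmod (\<zeta> - h 0) \<Longrightarrow> cmod (\<zeta> - h 0) < \<delta> \<Longrightarrow> metric_coeff G \<phi> \<zeta> > 0"
    "\<And>\<zeta>. 0 < cmod (\<zeta> - h 0) \<Longrightarrow> cmod (\<zeta> - h 0) < \<delta> \<Longrightarrow> \<bar>ln (metric_coeff G \<phi> \<zeta>) / 2 - b * ln (cmod (\<zeta> - h 0))\<bar> \<le> C"
    using conic_log_bound[OF r h(1,2) u eq] by metis
  show ?thesis
  proof (rule that[of "1 / \<delta>" C])
    fix z assume z: "cmod z > 1 / \<delta>"
    have zp: "cmod z > 0" using z dl(1) by (meson less_trans zero_less_divide_1_iff)
    then have z0: "z \<noteq> 0" by simp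
    let ?w = "1 / z"
    have w0: "?w \<noteq> 0" using z0 by simp
    have cw: "cmod ?w = 1 / cmod z" by (simp add: norm_divide)
    have w: "0 < cmod (?w - h 0)" "cmod (?w - h 0) < \<delta>" using z zp dl(1) by (simp_all add: h0 cw field_simps)
    have e: "metric_coeff G \<phi> ?w = metric_coeff G Fin z * cmod z ^ 4"
      unfolding phi metric_coeff_chart_infty[OF w0] by (simp add: norm_divide power_divide)
    have "metric_coeff G Fin z > 0" using dl(2)[OF w] zp unfolding e by (simp add: zero_less_mult_iff)
    then have "ln (metric_coeff G \<phi> ?w) = ln (metric_coeff G Fin z) + 4 * ln (cmod z)"
      unfolding e using zp by (simp add: ln_mult ln_realpow)
    moreover have "ln (cmod (?w - h 0)) = - ln (cmod z)" using zp by (simp add: h0 cw ln_div)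
    ultimately have "ln (metric_coeff G \<phi> ?w) / 2 - b * ln (cmod (?w - h 0)) = ln (metric_coeff G Fin z) / 2 + (2 + b) * ln (cmod z)"
      by (simp add: algebra_simps)
    then show "\<bar>ln (metric_coeff G Fin z) / 2 + (2 + b) * ln (cmod z)\<bar> \<le> C" using dl(3)[OF w] by simp
  qed
qed

section \<open>Lower bound for a divisor with a point at infinity\<close>

lemma MinVol_lower_bound_Infty:
  fixes n :: nat and b :: "nat \<Rightarrow> real"
  assumes inj: "inj_on p {1..n}" and bb: "\<And>i. i \<in> {1..n} \<Longrightarrow> -1 < b i \<and> b i \<le> 0"
    and j: "j \<in> {1..n}" "p j = Infty"
  defines "s \<equiv> (\<Sum>i\<in>{1..n} - {j}. b i)"
  shows "ennreal (2 * pi * (s - b j + sqrt (2 * (1 + s)\<^sup>2 + 2 * (1 + b j)\<^sup>2))) \<le> MinVol n p b"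
  unfolding MinVol_def
proof (rule Inf_greatest)
  fix a assume "a \<in> {metric_area G |G. represents G n p b \<and> (\<forall>q. q \<notin> p ` {1..n} \<longrightarrow> \<bar>gauss_curvature G q\<bar> \<le> 1)}"
  then obtain G where a: "a = metric_area G" and G: "represents G n p b"
    and K: "\<And>q. q \<notin> p ` {1..n} \<Longrightarrow> \<bar>gauss_curvature G q\<bar> \<le> 1" by blast
  let ?P = "p ` {1..n}"
  define \<rho> where "\<rho> = metric_coeff G Fin"
  define Z where "Z = {z. Fin z \<in> ?P}"
  \<comment> \<open>The orders are indexed by numbers, while \<open>conic_plane\<close> wants them
    attached to points; injectivity of p makes the translation well defined.\<close>
  define c where "c z = b (the_inv_into {1..n} p (Fin z))" for z
  have sm: "smooth_metric_off ?P G" and con: "\<And>i. i \<in> {1..n} \<Longrightarrow> conic_singularity G (p i) (b i)"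
    using G by (auto simp: represents_def)
  have inv: "the_inv_into {1..n} p (p i) = i" if "i \<in> {1..n}" for i by (rule the_inv_into_f_f[OF inj that])
  have ch: "Fin \<in> affine_charts" by (simp add: affine_charts_def)
  have fZ: "finite Z"
  proof -
    have "finite (Fin -` ?P)" by (rule finite_vimageI) (auto simp: inj_def)
    moreover have "Fin -` ?P = Z" by (auto simp: Z_def)
    ultimately show ?thesis by simp
  qed
  have compl: "- Z = {z. Fin z \<notin> ?P}" by (auto simp: Z_def)
  have Zi: "\<exists>i\<in>{1..n}. p i = Fin z \<and> c z = b i" if "z \<in> Z" for z
  proof -
    from that obtain i where i: "i \<in> {1..n}" "Fin z = p i" by (auto simp: Z_def)
    then show ?thesis using inv[of i] by (auto simp: c_def)
  qed
  have rpos: "\<rho> z > 0" if "z \<notin> Z" for z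
    unfolding \<rho>_def by (rule smooth_metric_off_pos[OF sm]) (use that in \<open>simp add: Z_def\<close>)
  have tot: "(\<Sum>z\<in>Z. c z) = s"
  proof -
    define k where "k i = (case p i of Fin z \<Rightarrow> z | Infty \<Rightarrow> 0)" for i
    have pk: "p i = Fin (k i)" if "i \<in> {1..n} - {j}" for i
    proof (cases "p i")
      case Infty
      then have "i = j" using inj_onD[OF inj, of i j] j that by simp
      then show ?thesis using that by simp
    qed (simp add: k_def)
    have bij: "bij_betw k ({1..n} - {j}) Z"
    proof (rule bij_betw_imageI)
      show "inj_on k ({1..n} - {j})"
      proof (rule inj_onI)
        fix x y assume xy: "x \<in> {1..n} - {j}" "y \<in> {1..n} - {j}" "k x = k y"
        then have "p x = p y" using pk by simp
        then show "x = y" using inj_onD[OF inj, of x y] xy by simp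
      qed
      show "k ` ({1..n} - {j}) = Z"
      proof (intro equalityI subsetI)
        fix z assume "z \<in> k ` ({1..n} - {j})"
        then obtain i where i: "i \<in> {1..n} - {j}" "z = k i" by blast
        then have "p i = Fin z" using pk by simp
        then show "z \<in> Z" unfolding Z_def using i by (metis (mono_tags, lifting) DiffD1 imageI mem_Collect_eq)
      next
        fix z assume "z \<in> Z"
        then obtain i where i: "i \<in> {1..n}" "p i = Fin z" using Zi by blast
        then have "i \<in> {1..n} - {j}" using j by auto
        moreover from this have "z = k i" using pk i by simp
        ultimately show "z \<in> k ` ({1..n} - {j})" by blast
      qed
    qed
    have "(\<Sum>z\<in>Z. c z) = (\<Sum>i\<in>{1..n} - {j}. c (k i))" by (rule sum.reindex_bij_betw[OF bij, symmetric])
    also have "\<dots> = s" unfolding s_def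
    proof (rule sum.cong[OF refl])
      fix i assume i: "i \<in> {1..n} - {j}"
      then show "c (k i) = b i" unfolding c_def pk[OF i, symmetric] using inv[of i] by simp
    qed
    finally show ?thesis .
  qed
  show "ennreal (2 * pi * (s - b j + sqrt (2 * (1 + s)\<^sup>2 + 2 * (1 + b j)\<^sup>2))) \<le> a"
  proof (cases "metric_area G = \<infinity>")
    \<comment> \<open>Infinite area satisfies every lower bound; in the other case \<rho> is
      integrable, as \<open>conic_plane\<close> requires.\<close>
    case True
    then show ?thesis using a by simp
  next
    case False
    have m: "\<rho> \<in> borel_measurable borel" unfolding \<rho>_def by (rule metric_coeff_borel_measurable[OF sm _ ch]) simp
    have AE: "AE z in lborel. 0 \<le> \<rho> z"
      using AE_not_in[OF finite_imp_null_set_lborel[OF fZ]] by eventually_elim (use rpos less_imp_le in blast)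
    have fin: "(\<integral>\<^sup>+z. ennreal (\<rho> z) \<partial>lborel) < \<infinity>" using False by (simp add: metric_area_def \<rho>_def less_top)
    have int: "integrable lborel \<rho>" by (rule integrableI_nonneg[OF _ AE fin]) (use m in simp)
    have cp: "conic_plane \<rho> Z c (b j)"
    proof (unfold_locales, goal_cases)
      case 1 then show ?case by (rule fZ)
    next
      case (2 z) then show ?case using Zi[of z] bb by auto
    next
      case 3 then show ?case unfolding compl \<rho>_def by (rule smooth_metric_off_Ck[OF sm ch])
    next
      case (4 z) then show ?case by (rule rpos)
    next
      case (5 z)
      have "\<bar>planar_curvature \<rho> z\<bar> \<le> 1" using K[of "Fin z"] 5 by (simp add: \<rho>_def Z_def)
      then have "\<bar>laplacian (\<lambda>w. ln (\<rho> w) / 2) z\<bar> / \<rho> z \<le> 1"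
        using rpos[OF 5] by (simp add: planar_curvature_def abs_divide)
      then show ?case using rpos[OF 5] by (simp add: divide_le_eq)
    next
      case (6 z)
      then obtain i where i: "i \<in> {1..n}" "p i = Fin z" "c z = b i" using Zi by blast
      then have "conic_singularity G (Fin z) (c z)" using con[OF i(1)] by simp
      then obtain C \<delta> where "\<delta> > 0"
        "\<And>y. 0 < cmod (y - z) \<Longrightarrow> cmod (y - z) < \<delta> \<Longrightarrow> \<bar>ln (metric_coeff G Fin y) / 2 - c z * ln (cmod (y - z))\<bar> \<le> C"
        using conic_singularity_Fin_bound by metis
      then show ?case unfolding \<rho>_def by blast
    next
      case 7
      have "conic_singularity G Infty (b j)" using con[OF j(1)] j(2) by simp
      then obtain C R where "\<And>z. cmod z > R \<Longrightarrow> \<bar>ln (metric_coeff G Fin z) / 2 + (2 + b j) * ln (cmod z)\<bar> \<le> C"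
        using conic_singularity_Infty_bound by metis
      then show ?case unfolding \<rho>_def by blast
    next
      case 8 then show ?case using bb[OF j(1)] by simp
    next
      case 9 then show ?case by (rule int)
    qed
    have "2 * pi * (s - b j + sqrt (2 * (1 + s)\<^sup>2 + 2 * (1 + b j)\<^sup>2)) \<le> (\<integral>z. \<rho> z \<partial>lborel)"
      using conic_plane.area_lower_bound[OF cp] unfolding conic_plane.total_b_def[OF cp] tot .
    moreover have "metric_area G = ennreal (\<integral>z. \<rho> z \<partial>lborel)"
      unfolding metric_area_def \<rho>_def[symmetric] by (rule nn_integral_eq_integral[OF int AE])
    ultimately show ?thesis unfolding a by (simp add: ennreal_leI)
  qed
qed

section \<open>Metrics of nearly minimal area\<close>

text \<open>F is the football profile in t = ln |z|, with slope 1 + s up to ln R and slope -(1 +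
  \<beta>) from B on. \<open>R1\<close> makes the points k i small against R, so that |z - k i|
  \<le> (1 + \<eta>) |z| for |z| \<ge> R. \<open>R2\<close> says that moving the centre by at most
  the sum of the |k i| changes 2 V by at most ln (1 + \<eta>).\<close>

locale conic_model =
  fixes I :: "nat set" and b :: "nat \<Rightarrow> real" and k :: "nat \<Rightarrow> complex" and s \<beta> \<eta> R B L :: real
    and F F1 F2 :: "real \<Rightarrow> real"
  assumes finI: "finite I" and b_le: "\<And>i. i \<in> I \<Longrightarrow> b i \<le> 0" and b_gt: "\<And>i. i \<in> I \<Longrightarrow> b i > - 1"
    and s_eq: "s = (\<Sum>i\<in>I. b i)" and s_gt: "s > - 1" and beta: "\<beta> > - 1" and inj: "inj_on k I"
    and eta: "\<eta> > 0" and R: "R > 0"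
    and CkF: "\<And>m. Ck_on m UNIV F" and dF: "\<And>t. (F has_real_derivative F1 t) (at t)"
    and dF1: "\<And>t. (F1 has_real_derivative F2 t) (at t)" and F2: "\<And>t. \<bar>F2 t\<bar> \<le> (1 + \<eta>) * exp (2 * F t)"
    and Fa: "\<And>t. t \<le> ln R \<Longrightarrow> F1 t = 1 + s" and Fb: "\<And>t. B \<le> t \<Longrightarrow> F1 t = - (1 + \<beta>)"
    and L: "\<And>t. \<bar>F1 t\<bar> \<le> L"
    and R1: "(\<Sum>i\<in>I. cmod (k i)) / R \<le> \<eta>"
    and R2: "2 * ((L + (1 + s)) * (\<Sum>i\<in>I. cmod (k i)) / R) \<le> ln (1 + \<eta>)"
begin

definition "C = (\<Sum>i\<in>I. cmod (k i))"
text \<open>The football e^(2F) |z|^(-2) |dz|^2 is e^(2H) |z|^(2s) |dz|^2, with one finite cone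
  point of order s. H is constant for t \<le> ln R, so it extends smoothly over z = 0 as V, and only
  the power of |z| has to be split among the points k i.\<close>

definition "H t = F t - (1 + s) * t"
definition "V z = H (ln (max R (cmod z)))"
text \<open>Half the logarithm of the density. The constant multiplies the metric by (1 + \<eta>)^3:
  one factor for the curvature excess of the profile, two for the gap between split and merged
  logarithms.\<close>

definition "pot z = 3 * ln (1 + \<eta>) / 2 + V z + (\<Sum>i\<in>I. b i * ln (cmod (z - k i)))"
definition "\<rho> z = exp (2 * pot z)"

lemma C_ge: "i \<in> I \<Longrightarrow> cmod (k i) \<le> C"
  unfolding C_def by (rule member_le_sum[OF _ _ finI]) auto

lemma C_nonneg: "0 \<le> C"
  unfolding C_def by (rule sum_nonneg) simp

lemma s_le: "s \<le> 0"
  unfolding s_eq by (rule sum_nonpos) (rule b_le)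

lemma dH: "(H has_real_derivative F1 t - (1 + s)) (at t)"
  unfolding H_def[abs_def] using DERIV_diff[OF dF[of t] DERIV_cmult[OF DERIV_ident, of "1 + s"]] by simp

lemma H_left:
  assumes "t \<le> ln R" shows "H t = H (ln R)"
proof (cases "t = ln R")
  case False
  then have "t < ln R" using assms by simp
  then obtain z where z: "t < z" "z < ln R" "H (ln R) - H t = (ln R - t) * (F1 z - (1 + s))"
    using MVT2[OF \<open>t < ln R\<close>, of H "\<lambda>t. F1 t - (1 + s)"] dH by blast
  then show ?thesis using Fa[of z] by simp
qed simp

lemma V_nonzero: "z \<noteq> 0 \<Longrightarrow> V z = H (ln (cmod z))"
proof (cases "R \<le> cmod z")
  case True
  then show ?thesis by (simp add: V_def max_def)
next
  case False
  moreover assume "z \<noteq> 0"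
  ultimately have "ln (cmod z) \<le> ln R" using R by simp
  from H_left[OF this] show ?thesis using False by (simp add: V_def max_def)
qed

lemma V_small: "cmod z < R \<Longrightarrow> V z = H (ln R)"
  by (simp add: V_def max_def)

lemma Ck_H: "Ck_on m UNIV H"
  unfolding H_def[abs_def]
  by (rule Ck_on_diff[OF open_UNIV CkF Ck_on_mult[OF open_UNIV Ck_on_const Ck_on_id]])

lemma Ck_V: "Ck_on m UNIV V"
proof (rule Ck_on_localI)
  fix z :: complex
  show "\<exists>U. open U \<and> z \<in> U \<and> Ck_on m U V"
  proof (cases "z = 0")
    case True
    have "Ck_on m (ball 0 R) V" by (rule Ck_on_cong[OF open_ball _ Ck_on_const[of _ _ "H (ln R)"]]) (simp add: V_small)
    then show ?thesis using True R by (intro exI[of _ "ball 0 R"]) simp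
  next
    case False
    have o: "open (- {0::complex})" by auto
    have "Ck_on m (- {0}) (\<lambda>z::complex. ln (cmod z))" by (rule Ck_on_ln_cmod[OF o]) (auto intro: holomorphic_on_ident)
    then have "Ck_on m (- {0}) (\<lambda>z::complex. H (ln (cmod z)))" by (rule Ck_on_compose[OF o _ Ck_H]) simp
    then have "Ck_on m (- {0}) V" by (rule Ck_on_cong[OF o, rotated]) (simp add: V_nonzero)
    then show ?thesis using False o by (intro exI[of _ "- {0}"]) simp
  qed
qed

lemma laplacian_V:
  "laplacian V z = (if cmod z < R then 0 else F2 (ln (cmod z)) / (cmod z)\<^sup>2)"
proof (cases "cmod z < R")
  case True
  have "laplacian V z = laplacian (\<lambda>_. H (ln R)) z"
    by (rule laplacian_cong[OF open_ball[of 0 R]]) (use True V_small in auto)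
  then show ?thesis using True by simp
next
  case False
  then have z: "z \<noteq> 0" using R by auto
  have "laplacian V z = laplacian (\<lambda>z. H (ln (cmod (z - 0)))) z"
    by (rule laplacian_cong[of "- {0}"]) (use z V_nonzero in auto)
  also have "\<dots> = F2 (ln (cmod (z - 0))) / (cmod (z - 0))\<^sup>2"
  proof (rule laplacian_radial[OF z dH])
    show "((\<lambda>t. F1 t - (1 + s)) has_real_derivative F2 (ln (cmod (z - 0)))) (at (ln (cmod (z - 0))))"
      using DERIV_diff[OF dF1 DERIV_const] by simp
  qed
  finally show ?thesis using False by simp
qed

text \<open>V depends only on the maximum of R and |z|, and ln has Lipschitz constant 1 / R from R
  on; a large R thus makes V nearly translation invariant.\<close>

lemma V_Lipschitz: "\<bar>V z - V w\<bar> \<le> (L + (1 + s)) / R * cmod (z - w)"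
proof -
  have b: "norm (F1 t - (1 + s)) \<le> L + (1 + s)" for t using L[of t] s_gt by simp
  have l: "\<bar>ln x - ln y\<bar> \<le> \<bar>x - y\<bar> / R" if "R \<le> x" "R \<le> y" for x y
  proof -
    have *: "ln x - ln y \<le> \<bar>x - y\<bar> / R" if "R \<le> x" "R \<le> y" for x y
    proof -
      have "ln x - ln y \<le> (x - y) / y" by (rule ln_diff_le) (use that R in auto)
      also have "\<dots> \<le> \<bar>x - y\<bar> / y" using that R by (intro divide_right_mono) auto
      also have "\<dots> \<le> \<bar>x - y\<bar> / R" using that R by (intro divide_left_mono) auto
      finally show ?thesis .
    qed
    show ?thesis using *[OF that] *[OF that(2,1)] abs_minus_commute[of x y] by (intro abs_leI) simp_all
  qed
  let ?x = "max R (cmod z)" and ?y = "max R (cmod w)"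
  have Lp: "0 \<le> L + (1 + s)" using L[of 0] s_gt by linarith
  have "norm (H (ln ?x) - H (ln ?y)) \<le> (L + (1 + s)) * norm (ln ?x - ln ?y)"
  proof (rule field_differentiable_bound[of UNIV H "\<lambda>t. F1 t - (1 + s)"])
    show "(H has_field_derivative F1 z - (1 + s)) (at z within UNIV)" for z using dH[of z] by simp
    show "norm (F1 z - (1 + s)) \<le> L + (1 + s)" for z by (rule b)
  qed simp_all
  also have "\<dots> \<le> (L + (1 + s)) * (cmod (z - w) / R)"
  proof (rule mult_left_mono[OF _ Lp])
    have "\<bar>?x - ?y\<bar> \<le> \<bar>cmod z - cmod w\<bar>" by linarith
    also have "\<dots> \<le> cmod (z - w)" by (rule norm_triangle_ineq3)
    finally have "\<bar>?x - ?y\<bar> / R \<le> cmod (z - w) / R" using R by (intro divide_right_mono) auto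
    then show "norm (ln ?x - ln ?y) \<le> cmod (z - w) / R" using l[of ?x ?y] by simp
  qed
  finally show ?thesis by (simp add: V_def)
qed

lemma open_off: "open (- (k ` I))"
  using finI by (intro open_Compl finite_imp_closed finite_imageI)

lemma Ck_ln_term: "i \<in> I \<Longrightarrow> Ck_on m (- (k ` I)) (\<lambda>z. b i * ln (cmod (z - k i)))"
  by (rule Ck_on_mult[OF open_off Ck_on_const Ck_on_ln_cmod[OF open_off]]) (auto intro!: holomorphic_intros)

lemma Ck_V_const: "Ck_on m (- (k ` I)) (\<lambda>z. 3 * ln (1 + \<eta>) / 2 + V z)"
  by (rule Ck_on_add[OF open_off Ck_on_const Ck_on_subset[OF Ck_V]]) simp

lemma Ck_pot: "Ck_on m (- (k ` I)) pot"
  unfolding pot_def[abs_def] by (rule Ck_on_add[OF open_off Ck_V_const Ck_on_sum[OF open_off Ck_ln_term]])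

lemma Ck_rho: "Ck_on m (- (k ` I)) \<rho>"
  unfolding \<rho>_def[abs_def]
  by (rule Ck_on_exp'[OF open_off Ck_on_mult[OF open_off Ck_on_const Ck_pot]])

lemma laplacian_pot:
  assumes z: "z \<notin> k ` I" shows "laplacian pot z = laplacian V z"
proof -
  have zS: "z \<in> - (k ` I)" using z by simp
  have "laplacian pot z = laplacian (\<lambda>z. 3 * ln (1 + \<eta>) / 2 + V z) z + laplacian (\<lambda>z. \<Sum>i\<in>I. b i * ln (cmod (z - k i))) z"
    unfolding pot_def[abs_def]
    by (rule laplacian_add[OF open_off zS Ck_V_const Ck_on_sum[OF open_off Ck_ln_term]])
  also have "laplacian (\<lambda>z. 3 * ln (1 + \<eta>) / 2 + V z) z = laplacian (\<lambda>_. 3 * ln (1 + \<eta>) / 2) z + laplacian V z"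
    by (rule laplacian_add[OF open_UNIV UNIV_I Ck_on_const Ck_V])
  also have "laplacian (\<lambda>z. \<Sum>i\<in>I. b i * ln (cmod (z - k i))) z = (\<Sum>i\<in>I. laplacian (\<lambda>z. b i * ln (cmod (z - k i))) z)"
    by (rule laplacian_sum[OF open_off zS Ck_ln_term])
  also have "\<dots> = (\<Sum>i\<in>I. 0)"
  proof (rule sum.cong[OF refl])
    fix i assume i: "i \<in> I"
    have h: "(\<lambda>z. z - k i) holomorphic_on - (k ` I)" by (intro holomorphic_intros)
    have n: "z - k i \<noteq> 0" if "z \<in> - (k ` I)" for z using that i by auto
    have "laplacian (\<lambda>z. b i * ln (cmod (z - k i))) z = b i * laplacian (\<lambda>z. ln (cmod (z - k i))) z"
      by (rule laplacian_cmult[OF open_off zS Ck_on_ln_cmod[OF open_off h n]])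
    then show "laplacian (\<lambda>z. b i * ln (cmod (z - k i))) z = 0" using laplacian_ln_cmod(1)[OF open_off h n zS] by simp
  qed
  finally show ?thesis by simp
qed

text \<open>For |z| < R the potential is a constant plus harmonic logarithms, and the metric is
  flat. For |z| \<ge> R each |z - k i| is at most (1 + \<eta>) |z|, so by b i \<le> 0 the density is
  at least the football's up to powers of 1 + \<eta>, which the constant in \<open>pot\<close>
  restores.\<close>

lemma curvature_bound:
  assumes z: "z \<notin> k ` I" shows "\<bar>planar_curvature \<rho> z\<bar> \<le> 1"
proof -
  have "\<bar>laplacian V z\<bar> \<le> \<rho> z"
  proof (cases "cmod z < R")
    case True
    then show ?thesis by (simp add: laplacian_V \<rho>_def)
  next
    case False
    then have zR: "R \<le> cmod z" by simp
    then have zp: "0 < cmod z" using R by linarith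
    then have z0: "z \<noteq> 0" by auto
    define l where "l = ln (1 + \<eta>)"
    have l0: "0 \<le> l" using eta by (simp add: l_def)
    have el: "exp l = 1 + \<eta>" using eta by (simp add: l_def)
    have t: "b i * (ln (cmod z) + l) \<le> b i * ln (cmod (z - k i))" if i: "i \<in> I" for i
    proof (rule mult_left_mono_neg[OF _ b_le[OF i]])
      have "C / cmod z \<le> C / R" using zR R C_nonneg by (intro divide_left_mono C_nonneg mult_pos_pos zp)
      then have "C / cmod z \<le> \<eta>" using R1 unfolding C_def by linarith
      then have "C \<le> \<eta> * cmod z" using zp by (simp add: divide_le_eq)
      then have "cmod (z - k i) \<le> cmod z * (1 + \<eta>)"
        using norm_triangle_ineq4[of z "k i"] C_ge[OF i] by (simp add: algebra_simps)
      moreover have "0 < cmod (z - k i)" using z i by auto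
      moreover have "0 < cmod z * (1 + \<eta>)" using zp eta by (intro mult_pos_pos) simp_all
      ultimately have "ln (cmod (z - k i)) \<le> ln (cmod z * (1 + \<eta>))" by (simp only: ln_le_cancel_iff)
      then show "ln (cmod (z - k i)) \<le> ln (cmod z) + l" using zp eta by (simp add: ln_mult l_def)
    qed
    have "s * (ln (cmod z) + l) \<le> (\<Sum>i\<in>I. b i * ln (cmod (z - k i)))"
      unfolding s_eq sum_distrib_right by (rule sum_mono) (rule t)
    \<comment> \<open>s > -1 bounds the accumulated loss by a single ln (1 + \<eta>).\<close>
    moreover have "- l \<le> s * l" using mult_right_mono[of "-1" s l] s_gt l0 by simp
    ultimately have A: "s * ln (cmod z) - l \<le> (\<Sum>i\<in>I. b i * ln (cmod (z - k i)))" by (simp add: distrib_left)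
    have "\<bar>laplacian V z\<bar> = \<bar>F2 (ln (cmod z))\<bar> / (cmod z)\<^sup>2" using False by (simp add: laplacian_V abs_divide)
    also have "\<dots> \<le> ((1 + \<eta>) * exp (2 * F (ln (cmod z)))) / (cmod z)\<^sup>2" by (intro divide_right_mono F2) simp
    also have "\<dots> = exp (l + 2 * F (ln (cmod z)) - 2 * ln (cmod z))"
    proof -
      have "exp (2 * ln (cmod z)) = (cmod z)\<^sup>2" using zp by (simp add: exp_double)
      then show ?thesis by (simp add: exp_diff exp_add el)
    qed
    also have "\<dots> \<le> exp (2 * pot z)"
    proof -
      have gen: "m + 2 * f - 2 * x \<le> 2 * Q" if "Q = 3 * m / 2 + (f - y) + S" "y = x + q" "q - m \<le> S" for m f x y q S Q :: real
        using that by linarith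
      have "pot z = 3 * l / 2 + (F (ln (cmod z)) - (1 + s) * ln (cmod z)) + (\<Sum>i\<in>I. b i * ln (cmod (z - k i)))"
        by (simp only: pot_def V_nonzero[OF z0] H_def l_def)
      moreover have "(1 + s) * ln (cmod z) = ln (cmod z) + s * ln (cmod z)" by (simp add: distrib_right)
      ultimately have "l + 2 * F (ln (cmod z)) - 2 * ln (cmod z) \<le> 2 * pot z" by (rule gen[OF _ _ A])
      then show ?thesis by simp
    qed
    finally show ?thesis by (simp add: \<rho>_def)
  qed
  moreover have "laplacian (\<lambda>w. ln (\<rho> w) / 2) z = laplacian V z"
    using laplacian_pot[OF z] by (simp add: \<rho>_def)
  moreover have "\<rho> z > 0" by (simp add: \<rho>_def)
  ultimately show ?thesis by (simp add: planar_curvature_def abs_divide divide_le_eq)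
qed

text \<open>Convexity of exp with weights b i / s compares the product of the |z - k i|^(2 b i) with
  a weighted mean of the |z - k i|^(2 s).\<close>

lemma rho_AM_GM:
  obtains J :: "nat set" and w c where "finite J" "\<And>i. i \<in> J \<Longrightarrow> 0 \<le> w i" "(\<Sum>i\<in>J. w i) = 1"
    "\<And>i. i \<in> J \<Longrightarrow> cmod (c i) \<le> C"
    "\<And>z. z \<notin> k ` I \<Longrightarrow> exp (2 * (\<Sum>i\<in>I. b i * ln (cmod (z - k i)))) \<le> (\<Sum>i\<in>J. w i * exp (2 * s * ln (cmod (z - c i))))"
proof (cases "s = 0")
  case True
  have "(\<Sum>i\<in>I. - b i) = 0" unfolding sum_negf using True s_eq by linarith
  then have "\<forall>i\<in>I. - b i = 0" by (subst (asm) sum_nonneg_eq_0_iff[OF finI]) (use b_le in auto)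
  then have b0: "b i = 0" if "i \<in> I" for i using that by simp
  \<comment> \<open>For s = 0 all orders vanish and the weights b i / s make no sense; a single
    dummy centre 0 of weight 1 serves instead.\<close>
  show ?thesis
  proof (rule that[of "{0}" "\<lambda>_. 1" "\<lambda>_. 0"])
    fix z
    have "(\<Sum>i\<in>I. b i * ln (cmod (z - k i))) = 0" by (rule sum.neutral) (simp add: b0)
    then show "exp (2 * (\<Sum>i\<in>I. b i * ln (cmod (z - k i)))) \<le> (\<Sum>i\<in>{0::nat}. 1 * exp (2 * s * ln (cmod (z - 0))))"
      by (simp add: True)
  qed (simp_all add: C_nonneg)
next
  case False
  then have sn: "s < 0" using s_le by simp
  show ?thesis
  proof (rule that[of I "\<lambda>i. b i / s" k])
    show "0 \<le> b i / s" if "i \<in> I" for i using b_le[OF that] sn by (simp add: zero_le_divide_iff)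
    show w1: "(\<Sum>i\<in>I. b i / s) = 1" using sn by (simp add: sum_divide_distrib[symmetric] s_eq[symmetric])
    fix z assume "z \<notin> k ` I"
    have ne: "I \<noteq> {}" using sn s_eq by auto
    have "exp (\<Sum>i\<in>I. (b i / s) *\<^sub>R (2 * s * ln (cmod (z - k i)))) \<le> (\<Sum>i\<in>I. b i / s * exp (2 * s * ln (cmod (z - k i))))"
      by (rule convex_on_sum[OF finI ne exp_convex w1]) (use b_le sn in \<open>auto simp: zero_le_divide_iff\<close>)
    moreover have "(\<Sum>i\<in>I. (b i / s) *\<^sub>R (2 * s * ln (cmod (z - k i)))) = 2 * (\<Sum>i\<in>I. b i * ln (cmod (z - k i)))"
      unfolding sum_distrib_left by (rule sum.cong[OF refl]) (use sn in simp)
    ultimately show "exp (2 * (\<Sum>i\<in>I. b i * ln (cmod (z - k i)))) \<le> (\<Sum>i\<in>I. b i / s * exp (2 * s * ln (cmod (z - k i))))" by simp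
  qed (use finI C_ge in auto)
qed

text \<open>After \<open>rho_AM_GM\<close> each term is close to a football centred at c i:
  replacing V z by V (z - c i) costs the fourth factor 1 + \<eta>, and logarithmic polar coordinates
  about c i give 2\<pi> times the integral of the profile. The weights sum to 1.\<close>

lemma area_bound: "(\<integral>\<^sup>+z. ennreal (\<rho> z) \<partial>lborel) \<le> ennreal ((1 + \<eta>) ^ 4 * (2 * pi)) * (\<integral>\<^sup>+t. ennreal (exp (2 * F t)) \<partial>lborel)"
proof -
  obtain J :: "nat set" and w c where J: "finite J" "\<And>i. i \<in> J \<Longrightarrow> 0 \<le> w i" "(\<Sum>i\<in>J. w i) = 1"
    "\<And>i. i \<in> J \<Longrightarrow> cmod (c i) \<le> C"
    "\<And>z. z \<notin> k ` I \<Longrightarrow> exp (2 * (\<Sum>i\<in>I. b i * ln (cmod (z - k i)))) \<le> (\<Sum>i\<in>J. w i * exp (2 * s * ln (cmod (z - c i))))"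
    by (rule rho_AM_GM) (rule that; assumption)
  let ?E = "\<lambda>t. exp (2 * F t)"
  have mF [measurable]: "F \<in> borel_measurable borel"
    by (rule borel_measurable_continuous_onI) (rule Ck_on_imp_continuous_on[OF CkF[of 0]])
  have e3: "exp (3 * ln (1 + \<eta>)) = (1 + \<eta>) ^ 3"
    using exp_of_nat_mult[of 3 "ln (1 + \<eta>)"] eta by simp
  have pt: "\<rho> z \<le> (\<Sum>i\<in>J. (1 + \<eta>) ^ 4 * w i * (?E (ln (cmod (z - c i))) * (1 / (cmod (z - c i))\<^sup>2)))"
    if z: "z \<notin> k ` I \<union> c ` J" for z
  proof -
    have "\<rho> z = (1 + \<eta>) ^ 3 * exp (2 * V z) * exp (2 * (\<Sum>i\<in>I. b i * ln (cmod (z - k i))))"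
    proof -
      have "2 * pot z = 3 * ln (1 + \<eta>) + 2 * V z + 2 * (\<Sum>i\<in>I. b i * ln (cmod (z - k i)))" by (simp add: pot_def)
      then show ?thesis by (simp only: \<rho>_def exp_add e3)
    qed
    also have "\<dots> \<le> (1 + \<eta>) ^ 3 * exp (2 * V z) * (\<Sum>i\<in>J. w i * exp (2 * s * ln (cmod (z - c i))))"
      by (intro mult_left_mono J(5)) (use z eta in auto)
    also have "\<dots> = (\<Sum>i\<in>J. ((1 + \<eta>) ^ 3 * w i) * exp (2 * V z + 2 * s * ln (cmod (z - c i))))"
      unfolding sum_distrib_left by (rule sum.cong[OF refl]) (simp only: exp_add mult_ac)
    also have "\<dots> \<le> (\<Sum>i\<in>J. ((1 + \<eta>) ^ 3 * w i) * ((1 + \<eta>) * (?E (ln (cmod (z - c i))) * (1 / (cmod (z - c i))\<^sup>2))))"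
    proof (rule sum_mono)
      fix i assume i: "i \<in> J"
      have n: "z - c i \<noteq> 0" using z i by auto
      then have np: "cmod (z - c i) > 0" by simp
      have Lp: "0 \<le> L + (1 + s)" using L[of 0] s_gt by linarith
      have "\<bar>V z - V (z - c i)\<bar> \<le> (L + (1 + s)) / R * cmod (c i)" using V_Lipschitz[of z "z - c i"] by simp
      also have "\<dots> \<le> (L + (1 + s)) / R * C" by (intro mult_left_mono J(4)[OF i]) (use Lp R in auto)
      also have "\<dots> = (L + (1 + s)) * C / R" by simp
      finally have A: "\<bar>V z - V (z - c i)\<bar> \<le> (L + (1 + s)) * C / R" .
      have gen: "2 * vz + 2 * q \<le> m + (2 * f - 2 * x)"
        if "\<bar>vz - (f - y)\<bar> \<le> P" "2 * P \<le> m" "y = x + q" for vz q m f x y P :: real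
        using that by linarith
      have "(1 + s) * ln (cmod (z - c i)) = ln (cmod (z - c i)) + s * ln (cmod (z - c i))" by (simp add: distrib_right)
      then have "2 * V z + 2 * (s * ln (cmod (z - c i))) \<le> ln (1 + \<eta>) + (2 * F (ln (cmod (z - c i))) - 2 * ln (cmod (z - c i)))"
        by (rule gen[OF A[unfolded V_nonzero[OF n] H_def] R2[folded C_def]])
      then have "exp (2 * V z + 2 * s * ln (cmod (z - c i))) \<le> exp (ln (1 + \<eta>) + (2 * F (ln (cmod (z - c i))) - 2 * ln (cmod (z - c i))))"
        by (simp only: exp_le_cancel_iff mult.assoc)
      also have "\<dots> = (1 + \<eta>) * (?E (ln (cmod (z - c i))) * (1 / (cmod (z - c i))\<^sup>2))"
      proof -
        have "exp (2 * ln (cmod (z - c i))) = (cmod (z - c i))\<^sup>2" using np by (simp add: exp_double)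
        then show ?thesis using eta by (simp add: exp_diff exp_add)
      qed
      finally show "((1 + \<eta>) ^ 3 * w i) * exp (2 * V z + 2 * s * ln (cmod (z - c i)))
          \<le> ((1 + \<eta>) ^ 3 * w i) * ((1 + \<eta>) * (?E (ln (cmod (z - c i))) * (1 / (cmod (z - c i))\<^sup>2)))"
        by (rule mult_left_mono) (use J(2)[OF i] eta in simp)
    qed
    also have "\<dots> = (\<Sum>i\<in>J. (1 + \<eta>) ^ 4 * w i * (?E (ln (cmod (z - c i))) * (1 / (cmod (z - c i))\<^sup>2)))"
    proof (rule sum.cong[OF refl])
      have "(1 + \<eta>) ^ 4 = (1 + \<eta>) ^ 3 * (1 + \<eta>)" using power_add[of "1 + \<eta>" 3 1] by simp
      then show "((1 + \<eta>) ^ 3 * w i) * ((1 + \<eta>) * (?E (ln (cmod (z - c i))) * (1 / (cmod (z - c i))\<^sup>2)))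
          = (1 + \<eta>) ^ 4 * w i * (?E (ln (cmod (z - c i))) * (1 / (cmod (z - c i))\<^sup>2))" for i
        by (simp only: mult_ac)
    qed
    finally show ?thesis .
  qed
  have fin: "finite (k ` I \<union> c ` J)" using finI J(1) by simp
  have "(\<integral>\<^sup>+z. ennreal (\<rho> z) \<partial>lborel)
      \<le> (\<integral>\<^sup>+z. (\<Sum>i\<in>J. ennreal ((1 + \<eta>) ^ 4 * w i) * (ennreal (?E (ln (cmod (z - c i)))) * ennreal (1 / (cmod (z - c i))\<^sup>2))) \<partial>lborel)"
  proof (rule nn_integral_mono_AE)
    show "AE z in lborel. ennreal (\<rho> z) \<le> (\<Sum>i\<in>J. ennreal ((1 + \<eta>) ^ 4 * w i) * (ennreal (?E (ln (cmod (z - c i)))) * ennreal (1 / (cmod (z - c i))\<^sup>2)))"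
      using AE_not_in[OF finite_imp_null_set_lborel[OF fin]]
    proof eventually_elim
      case (elim z)
      have "ennreal (\<rho> z) \<le> ennreal (\<Sum>i\<in>J. (1 + \<eta>) ^ 4 * w i * (?E (ln (cmod (z - c i))) * (1 / (cmod (z - c i))\<^sup>2)))"
        by (rule ennreal_leI[OF pt[OF elim]])
      also have "\<dots> = (\<Sum>i\<in>J. ennreal ((1 + \<eta>) ^ 4 * w i * (?E (ln (cmod (z - c i))) * (1 / (cmod (z - c i))\<^sup>2))))"
        by (rule sum_ennreal[symmetric]) (use J(2) eta in simp)
      also have "\<dots> = (\<Sum>i\<in>J. ennreal ((1 + \<eta>) ^ 4 * w i) * (ennreal (?E (ln (cmod (z - c i)))) * ennreal (1 / (cmod (z - c i))\<^sup>2)))"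
      proof (rule sum.cong[OF refl])
        fix i assume i: "i \<in> J"
        have "ennreal ((1 + \<eta>) ^ 4 * w i * (?E (ln (cmod (z - c i))) * (1 / (cmod (z - c i))\<^sup>2)))
           = ennreal ((1 + \<eta>) ^ 4 * w i) * ennreal (?E (ln (cmod (z - c i))) * (1 / (cmod (z - c i))\<^sup>2))"
          by (rule ennreal_mult'') simp
        also have "ennreal (?E (ln (cmod (z - c i))) * (1 / (cmod (z - c i))\<^sup>2)) = ennreal (?E (ln (cmod (z - c i)))) * ennreal (1 / (cmod (z - c i))\<^sup>2)"
          by (rule ennreal_mult'') simp
        finally show "ennreal ((1 + \<eta>) ^ 4 * w i * (?E (ln (cmod (z - c i))) * (1 / (cmod (z - c i))\<^sup>2)))
           = ennreal ((1 + \<eta>) ^ 4 * w i) * (ennreal (?E (ln (cmod (z - c i)))) * ennreal (1 / (cmod (z - c i))\<^sup>2))" .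
      qed
      finally show ?case .
    qed
  qed
  also have "\<dots> = (\<Sum>i\<in>J. ennreal ((1 + \<eta>) ^ 4 * w i) * (\<integral>\<^sup>+z. ennreal (?E (ln (cmod (z - c i)))) * ennreal (1 / (cmod (z - c i))\<^sup>2) \<partial>lborel))"
  proof (subst nn_integral_sum)
    show "(\<Sum>i\<in>J. \<integral>\<^sup>+z. ennreal ((1 + \<eta>) ^ 4 * w i) * (ennreal (?E (ln (cmod (z - c i)))) * ennreal (1 / (cmod (z - c i))\<^sup>2)) \<partial>lborel)
      = (\<Sum>i\<in>J. ennreal ((1 + \<eta>) ^ 4 * w i) * (\<integral>\<^sup>+z. ennreal (?E (ln (cmod (z - c i)))) * ennreal (1 / (cmod (z - c i))\<^sup>2) \<partial>lborel))"
      by (intro sum.cong[OF refl] nn_integral_cmult) measurable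
  qed measurable
  also have "\<dots> = (\<Sum>i\<in>J. ennreal ((1 + \<eta>) ^ 4 * w i) * (ennreal (2 * pi) * (\<integral>\<^sup>+t. ennreal (?E t) \<partial>lborel)))"
  proof (rule sum.cong[OF refl])
    fix i
    have "(\<integral>\<^sup>+z. ennreal (?E (ln (cmod (z - c i)))) * ennreal (1 / (cmod (z - c i))\<^sup>2) \<partial>lborel) = ennreal (2 * pi) * (\<integral>\<^sup>+t. ennreal (?E t) \<partial>lborel)"
      by (rule nn_integral_ln_cmod[of "\<lambda>t. ennreal (?E t)"]) measurable
    then show "ennreal ((1 + \<eta>) ^ 4 * w i) * (\<integral>\<^sup>+z. ennreal (?E (ln (cmod (z - c i)))) * ennreal (1 / (cmod (z - c i))\<^sup>2) \<partial>lborel)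
      = ennreal ((1 + \<eta>) ^ 4 * w i) * (ennreal (2 * pi) * (\<integral>\<^sup>+t. ennreal (?E t) \<partial>lborel))" by (rule arg_cong)
  qed
  also have "\<dots> = (\<Sum>i\<in>J. ennreal ((1 + \<eta>) ^ 4 * w i)) * (ennreal (2 * pi) * (\<integral>\<^sup>+t. ennreal (?E t) \<partial>lborel))"
    by (rule sum_distrib_right[symmetric])
  also have "(\<Sum>i\<in>J. ennreal ((1 + \<eta>) ^ 4 * w i)) = ennreal ((1 + \<eta>) ^ 4)"
  proof -
    have "(\<Sum>i\<in>J. ennreal ((1 + \<eta>) ^ 4 * w i)) = ennreal (\<Sum>i\<in>J. (1 + \<eta>) ^ 4 * w i)"
      by (rule sum_ennreal) (use J(2) eta in simp)
    also have "(\<Sum>i\<in>J. (1 + \<eta>) ^ 4 * w i) = (1 + \<eta>) ^ 4"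
      using sum_distrib_left[of "(1 + \<eta>) ^ 4" w J] J(3) by simp
    finally show ?thesis .
  qed
  also have "ennreal ((1 + \<eta>) ^ 4) * (ennreal (2 * pi) * (\<integral>\<^sup>+t. ennreal (?E t) \<partial>lborel)) =
      ennreal ((1 + \<eta>) ^ 4 * (2 * pi)) * (\<integral>\<^sup>+t. ennreal (?E t) \<partial>lborel)"
  proof -
    have "ennreal ((1 + \<eta>) ^ 4 * (2 * pi)) = ennreal ((1 + \<eta>) ^ 4) * ennreal (2 * pi)"
      by (rule ennreal_mult) (use eta in simp_all)
    then show ?thesis by (simp only: mult.assoc)
  qed
  finally show ?thesis .
qed

text \<open>\<rho> relative to the round metric. Infinity is a singular point, so the value there is
  arbitrary.\<close>

definition "G q = (case q of Infty \<Rightarrow> 1 | Fin z \<Rightarrow> \<rho> z * (1 + (cmod z)\<^sup>2)\<^sup>2 / 4)"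

lemma metric_coeff_G: "metric_coeff G Fin = \<rho>"
proof
  fix z show "metric_coeff G Fin z = \<rho> z"
    using one_plus_cmod2(2)[of z] by (simp add: metric_coeff_def G_def)
qed

lemma smooth_G:
  assumes P: "P = insert Infty (Fin ` k ` I)"
  shows "smooth_metric_off P G"
  unfolding smooth_metric_off_def smooth_on_def
proof (intro conjI allI impI ballI)
  fix q show "G q > 0"
  proof (cases q)
    case (Fin z)
    have "\<rho> z * (1 + (cmod z)\<^sup>2)\<^sup>2 > 0" by (rule mult_pos_pos[OF _ one_plus_cmod2(1)]) (simp add: \<rho>_def)
    then show ?thesis by (simp add: Fin G_def)
  qed (simp add: G_def)
next
  fix \<phi> m assume "\<phi> \<in> affine_charts"
  then consider "\<phi> = Fin" | "\<phi> = chart_infty" by (auto simp: affine_charts_def)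
  then show "Ck_on m {z. \<phi> z \<notin> P} (metric_coeff G \<phi>)"
  proof cases
    case 1
    have "{z. Fin z \<notin> P} = - (k ` I)" by (auto simp: P)
    then show ?thesis unfolding 1 metric_coeff_G using Ck_rho by simp
  next
    case 2
    let ?U = "{w. chart_infty w \<notin> P}"
    have oU: "open ?U" by (rule open_affine_chart_vimage) (use finI in \<open>auto simp: affine_charts_def P\<close>)
    have w0: "w \<noteq> 0" if "w \<in> ?U" for w using that by (auto simp: P chart_infty_def)
    have im: "(\<lambda>w. 1 / w) ` ?U \<subseteq> - (k ` I)" using w0 by (auto simp: P chart_infty_def)
    have h: "(\<lambda>w. 1 / w) holomorphic_on ?U" "(\<lambda>w. 1 / w\<^sup>2) holomorphic_on ?U"
      by (intro holomorphic_intros; use w0 in simp)+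
    have "Ck_on m ?U (\<lambda>w. \<rho> (1 / w) * (cmod (1 / w\<^sup>2))\<^sup>2)"
      by (rule Ck_on_mult[OF oU Ck_on_compose_holomorphic[OF oU h(1) Ck_rho im] Ck_on_cmod_power2[OF oU h(2)]])
    then have "Ck_on m ?U (metric_coeff G chart_infty)"
    proof (rule Ck_on_cong[OF oU, rotated])
      fix w assume w: "w \<in> ?U"
      show "\<rho> (1 / w) * (cmod (1 / w\<^sup>2))\<^sup>2 = metric_coeff G chart_infty w"
        unfolding metric_coeff_chart_infty[OF w0[OF w]] metric_coeff_G
        by (simp add: norm_divide norm_power power_divide power_mult[symmetric])
    qed
    then show ?thesis unfolding 2 .
  qed
qed

lemma conic_Fin:
  assumes i: "i \<in> I" shows "conic_singularity G (Fin (k i)) (b i)"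
proof -
  obtain r where r: "r > 0" "\<And>x. x \<in> k ` I \<Longrightarrow> x \<noteq> k i \<Longrightarrow> r \<le> dist (k i) x"
    using finite_set_avoid[of "k ` I" "k i"] finI by auto
  \<comment> \<open>Everything except the logarithm centred at k i; it is smooth because the disc of
    radius r avoids the other points.\<close>
  define u where "u z = 3 * ln (1 + \<eta>) / 2 + V (k i + z) + (\<Sum>l\<in>I - {i}. b l * ln (cmod (k i + z - k l)))" for z
  have n: "k i + z - k l \<noteq> 0" if "z \<in> ball 0 r" "l \<in> I - {i}" for z l
  proof
    assume "k i + z - k l = 0"
    then have "z = k l - k i" by (simp add: algebra_simps)
    moreover have "k l \<noteq> k i" using inj_onD[OF inj, of l i] that i by auto
    ultimately show False using r(2)[of "k l"] that by (auto simp: dist_norm norm_minus_commute)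
  qed
  have Cku: "Ck_on m (ball 0 r) u" for m
    unfolding u_def[abs_def]
  proof (intro Ck_on_add[OF open_ball] Ck_on_const Ck_on_sum[OF open_ball] Ck_on_mult[OF open_ball Ck_on_const])
    have h: "(\<lambda>z. k i + z) holomorphic_on ball 0 r" by (intro holomorphic_intros)
    show "Ck_on m (ball 0 r) (\<lambda>z. V (k i + z))" by (rule Ck_on_compose_holomorphic[OF open_ball h Ck_V]) simp
    fix l assume "l \<in> I - {i}"
    then show "Ck_on m (ball 0 r) (\<lambda>z. ln (cmod (k i + z - k l)))"
      by (intro Ck_on_ln_cmod[OF open_ball] holomorphic_intros n)
  qed
  have d: "deriv (\<lambda>z. k i + z) z = 1" for z by (rule DERIV_imp_deriv) (auto intro!: derivative_eq_intros)
  show ?thesis unfolding conic_singularity_def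
  proof (intro conjI b_gt[OF i] bexI[of _ Fin] exI[of _ "\<lambda>z. k i + z"] exI[of _ r] exI[of _ u] r(1) ballI)
    show "continuous_on (ball 0 r) u" by (rule Ck_on_imp_continuous_on[OF Cku])
    show "Ck_on 2 (ball 0 r - {0}) u" by (rule Ck_on_subset[OF Cku]) auto
    fix z assume z: "z \<in> ball 0 r - {0::complex}"
    have "(\<Sum>l\<in>I. b l * ln (cmod (k i + z - k l))) = b i * ln (cmod z) + (\<Sum>l\<in>I - {i}. b l * ln (cmod (k i + z - k l)))"
      by (subst sum.remove[OF finI i]) simp
    then have "2 * pot (k i + z) = 2 * u z + 2 * b i * ln (cmod z)" by (simp add: pot_def u_def)
    then have "\<rho> (k i + z) = exp (2 * u z) * exp (2 * b i * ln (cmod z))" by (simp add: \<rho>_def exp_add)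
    then show "metric_coeff G Fin (k i + z) * (cmod (deriv (\<lambda>z. k i + z) z))\<^sup>2 = exp (2 * u z) * cmod z powr (2 * b i)"
      using z by (simp add: metric_coeff_G d powr_def)
  qed (auto simp: affine_charts_def inj_on_def intro!: holomorphic_intros)
qed

lemma H_right:
  assumes "B \<le> t" shows "F t = F B - (1 + \<beta>) * (t - B)"
proof (cases "t = B")
  case False
  then have "B < t" using assms by simp
  then obtain z where z: "B < z" "z < t" "F t - F B = (t - B) * F1 z"
    using MVT2[of B t F F1] dF by auto
  then show ?thesis using Fb[of z] by (simp add: algebra_simps)
qed simp

lemma conic_Infty: "conic_singularity G Infty \<beta>"
proof -
  \<comment> \<open>|z| < exp (-B) puts 1 / z into the end where F is linear, and |z| < 1 / (C + 1)
    keeps 1 - z k l away from 0.\<close>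
  define r where "r = min (exp (- B)) (1 / (C + 1))"
  have r: "r > 0" using C_nonneg by (simp add: r_def)
  \<comment> \<open>Written with |1 / z - k l| = |1 - z k l| / |z|. The powers of |z| split off
    here, those from the linear end of F and the chart factor |z|^(-4) combine to |z|^(2
    \<beta>).\<close>
  define u where "u z = 3 * ln (1 + \<eta>) / 2 + (F B + (1 + \<beta>) * B) + (\<Sum>l\<in>I. b l * ln (cmod (1 - z * k l)))" for z
  have n: "1 - z * k l \<noteq> 0" if z: "z \<in> ball 0 r" "l \<in> I" for z l
  proof
    assume "1 - z * k l = 0"
    then have "cmod z * cmod (k l) = 1" by (metis eq_iff_diff_eq_0 norm_mult norm_one)
    moreover have "cmod z * cmod (k l) \<le> cmod z * (C + 1)" using C_ge[OF z(2)] by (intro mult_left_mono) auto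
    moreover have "cmod z < 1 / (C + 1)" using z(1) by (simp add: r_def)
    then have "cmod z * (C + 1) < 1" using C_nonneg by (simp add: less_divide_eq)
    ultimately show False by linarith
  qed
  have Cku: "Ck_on m (ball 0 r) u" for m
    unfolding u_def[abs_def]
  proof (intro Ck_on_add[OF open_ball] Ck_on_const Ck_on_sum[OF open_ball] Ck_on_mult[OF open_ball Ck_on_const])
    fix l assume "l \<in> I"
    then show "Ck_on m (ball 0 r) (\<lambda>z. ln (cmod (1 - z * k l)))"
      by (intro Ck_on_ln_cmod[OF open_ball] holomorphic_intros n)
  qed
  show ?thesis unfolding conic_singularity_def
  proof (intro conjI beta bexI[of _ chart_infty] exI[of _ "\<lambda>z. z"] exI[of _ r] exI[of _ u] r ballI)
    show "continuous_on (ball 0 r) u" by (rule Ck_on_imp_continuous_on[OF Cku])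
    show "Ck_on 2 (ball 0 r - {0}) u" by (rule Ck_on_subset[OF Cku]) auto
    fix z assume z: "z \<in> ball 0 r - {0::complex}"
    then have z0: "z \<noteq> 0" and zr: "cmod z < exp (- B)" and zB: "z \<in> ball 0 r" by (auto simp: r_def)
    define t where "t = ln (cmod z)"
    have "ln (cmod z) < ln (exp (- B))" using zr z0 by (subst ln_less_cancel_iff) simp_all
    then have "t < - B" by (simp add: t_def)
    moreover have lt: "ln (cmod (1 / z)) = - t" using z0 by (simp add: t_def norm_divide ln_div)
    ultimately have V: "V (1 / z) = F B + (1 + \<beta>) * B + (2 + \<beta> + s) * t"
      using V_nonzero[of "1 / z"] z0 H_right[of "- t"] by (simp add: H_def algebra_simps)
    have "(\<Sum>l\<in>I. b l * ln (cmod (1 / z - k l))) = (\<Sum>l\<in>I. b l * ln (cmod (1 - z * k l)) - b l * t)"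
    proof (rule sum.cong[OF refl])
      fix l assume l: "l \<in> I"
      have "1 / z - k l = (1 - z * k l) / z" using z0 by (simp add: field_simps)
      then have "ln (cmod (1 / z - k l)) = ln (cmod (1 - z * k l)) - t"
        using n[OF zB l] z0 by (simp add: norm_divide ln_div t_def)
      then show "b l * ln (cmod (1 / z - k l)) = b l * ln (cmod (1 - z * k l)) - b l * t" by (simp add: right_diff_distrib)
    qed
    also have "\<dots> = (\<Sum>l\<in>I. b l * ln (cmod (1 - z * k l))) - s * t"
      by (simp add: sum_subtractf s_eq sum_distrib_right)
    finally have S: "(\<Sum>l\<in>I. b l * ln (cmod (1 / z - k l))) = (\<Sum>l\<in>I. b l * ln (cmod (1 - z * k l))) - s * t" .
    have "2 * pot (1 / z) = 2 * u z + 2 * \<beta> * t + 4 * t" unfolding pot_def V S u_def by (simp add: algebra_simps)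
    then have "\<rho> (1 / z) = exp (2 * u z) * exp (2 * \<beta> * t) * exp (4 * t)" by (simp add: \<rho>_def exp_add)
    moreover have "exp (4 * t) = cmod z ^ 4" using exp_of_nat_mult[of 4 t] z0 by (simp add: t_def)
    ultimately show "metric_coeff G chart_infty z * (cmod (deriv (\<lambda>z. z) z))\<^sup>2 = exp (2 * u z) * cmod z powr (2 * \<beta>)"
      unfolding metric_coeff_chart_infty[OF z0] metric_coeff_G using z0 by (simp add: powr_def t_def)
  qed (auto simp: affine_charts_def chart_infty_def intro!: holomorphic_intros)
qed

end

section \<open>Upper bound for a divisor with a point at infinity, and the conclusion\<close>

lemma MinVol_upper_bound_Infty:
  fixes n :: nat and b :: "nat \<Rightarrow> real"
  assumes inj: "inj_on p {1..n}" and bb: "\<And>i. i \<in> {1..n} \<Longrightarrow> -1 < b i \<and> b i \<le> 0"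
    and j: "j \<in> {1..n}" "p j = Infty"
  defines "s \<equiv> (\<Sum>i\<in>{1..n} - {j}. b i)"
  assumes js: "b j \<le> s"
  shows "MinVol n p b \<le> ennreal (2 * pi * (s - b j + sqrt (2 * (1 + s)\<^sup>2 + 2 * (1 + b j)\<^sup>2)))"
proof -
  define I where "I = {1..n} - {j}"
  define k where "k i = (case p i of Fin z \<Rightarrow> z | Infty \<Rightarrow> 0)" for i
  have pk: "p i = Fin (k i)" if "i \<in> I" for i
  proof (cases "p i")
    case Infty
    then have "i = j" using inj_onD[OF inj, of i j] j that by (simp add: I_def)
    then show ?thesis using that by (simp add: I_def)
  qed (simp add: k_def)
  have injk: "inj_on k I"
  proof (rule inj_onI)
    fix x y assume xy: "x \<in> I" "y \<in> I" "k x = k y"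
    then have "p x = p y" using pk by simp
    then show "x = y" using inj_onD[OF inj, of x y] xy by (simp add: I_def)
  qed
  have ins: "{1..n} = insert j I" using j by (auto simp: I_def)
  have P: "p ` {1..n} = insert Infty (Fin ` k ` I)"
  proof -
    have "p ` I = Fin ` k ` I" unfolding image_image by (rule image_cong[OF refl pk])
    then show ?thesis unfolding ins image_insert j(2) by simp
  qed
  \<comment> \<open>Cone angles divided by 2\<pi>: of the merged finite cone and of the cone at
    infinity. \<open>js\<close> is the inequality \<kappa> \<le> \<gamma> that the profile
    requires.\<close>
  define \<gamma> \<kappa> where "\<gamma> = 1 + s" and "\<kappa> = 1 + b j"
  have \<kappa>: "0 < \<kappa>" "\<kappa> \<le> \<gamma>" using bb[OF j(1)] js by (auto simp: \<gamma>_def \<kappa>_def)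
  define v where "v = \<gamma> - \<kappa> + 2 * sqrt ((\<gamma>\<^sup>2 + \<kappa>\<^sup>2) / 2)"
  have v0: "0 \<le> v" using \<kappa> by (simp add: v_def)
  have veq: "s - b j + sqrt (2 * (1 + s)\<^sup>2 + 2 * (1 + b j)\<^sup>2) = v"
  proof -
    have "2 * (1 + s)\<^sup>2 + 2 * (1 + b j)\<^sup>2 = 4 * ((\<gamma>\<^sup>2 + \<kappa>\<^sup>2) / 2)" by (simp add: \<gamma>_def \<kappa>_def)
    then have "sqrt (2 * (1 + s)\<^sup>2 + 2 * (1 + b j)\<^sup>2) = 2 * sqrt ((\<gamma>\<^sup>2 + \<kappa>\<^sup>2) / 2)"
      by (simp only: real_sqrt_mult real_sqrt_four)
    then show ?thesis by (simp add: v_def \<gamma>_def \<kappa>_def)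
  qed
  have "MinVol n p b \<le> ennreal (2 * pi * v)"
  proof (rule ennreal_le_epsilon)
    fix e :: real assume e: "0 < e"
    have "((\<lambda>\<eta>. (1 + \<eta>) ^ 4 * (2 * pi) * (v + \<eta>)) \<longlongrightarrow> (1 + 0) ^ 4 * (2 * pi) * (v + 0)) (at_right 0)"
      by (intro tendsto_intros)
    then have "\<forall>\<^sub>F \<eta> in at_right 0. (1 + \<eta>) ^ 4 * (2 * pi) * (v + \<eta>) < 2 * pi * v + e"
      by (rule order_tendstoD(2)) (use e in simp)
    then have "\<forall>\<^sub>F \<eta> in at_right 0. (1 + \<eta>) ^ 4 * (2 * pi) * (v + \<eta>) < 2 * pi * v + e \<and> 0 < \<eta>"
      by (rule eventually_conj[OF _ eventually_at_right_less])
    from eventually_happens'[OF trivial_limit_at_right_real this]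
    obtain \<eta> where \<eta>: "(1 + \<eta>) ^ 4 * (2 * pi) * (v + \<eta>) < 2 * pi * v + e" "0 < \<eta>" by blast
    obtain W W1 W2 a B L where W: "\<And>k. Ck_on k UNIV W" "\<And>t. (W has_real_derivative W1 t) (at t)"
      "\<And>t. (W1 has_real_derivative W2 t) (at t)" "\<And>t. \<bar>W2 t\<bar> \<le> (1 + \<eta>) * exp (2 * W t)"
      "\<And>t. t \<le> a \<Longrightarrow> W1 t = \<gamma>" "\<And>t. B \<le> t \<Longrightarrow> W1 t = - \<kappa>" "\<And>t. \<bar>W1 t\<bar> \<le> L"
      "(\<integral>\<^sup>+t. ennreal (exp (2 * W t)) \<partial>lborel) \<le> ennreal (\<gamma> - \<kappa> + 2 * sqrt ((\<gamma>\<^sup>2 + \<kappa>\<^sup>2) / 2) + \<eta>)"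
      by (rule smooth_profile[OF \<kappa> \<eta>(2)]) (rule that; assumption)
    define C where "C = (\<Sum>i\<in>I. cmod (k i))"
    have C0: "0 \<le> C" unfolding C_def by (rule sum_nonneg) simp
    have L0: "0 \<le> L" using W(7)[of 0] by linarith
    have l0: "0 < ln (1 + \<eta>)" by (rule ln_gt_zero) (use \<eta> in simp)
    define M where "M = 2 * ((L + \<gamma>) * C)"
    have M0: "0 \<le> M" using L0 C0 \<kappa> by (simp add: M_def)
    \<comment> \<open>The last two summands serve the two smallness conditions of
      \<open>conic_model\<close>; the 1 keeps R positive.\<close>
    define R where "R = 1 + C / \<eta> + M / ln (1 + \<eta>)"
    have q: "0 \<le> C / \<eta>" "0 \<le> M / ln (1 + \<eta>)" using C0 M0 \<eta> l0 by simp_all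
    have R0: "R > 0" using q by (simp add: R_def)
    have "C / \<eta> \<le> R" "M / ln (1 + \<eta>) \<le> R" using q by (simp_all add: R_def)
    then have R1: "C / R \<le> \<eta>" and "M / R \<le> ln (1 + \<eta>)" using \<eta>(2) l0 R0 by (simp_all add: divide_le_eq mult.commute)
    then have R2: "2 * ((L + (1 + s)) * C / R) \<le> ln (1 + \<eta>)" by (simp add: M_def \<gamma>_def)
    \<comment> \<open>A shift in t = ln |z|, that is a dilation of the plane, moves the end a of the
      first linear piece to ln R and leaves the integral of the profile unchanged.\<close>
    define \<sigma> where "\<sigma> = ln R - a"
    have sh: "((\<lambda>t. t - \<sigma>) has_real_derivative 1) (at t)" for t by (auto intro!: derivative_eq_intros)
    interpret M: conic_model I b k s "b j" \<eta> R "B + \<sigma>" L "\<lambda>t. W (t - \<sigma>)" "\<lambda>t. W1 (t - \<sigma>)" "\<lambda>t. W2 (t - \<sigma>)"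
    proof
      show "finite I" "inj_on k I" "0 < \<eta>" "0 < R" "s = (\<Sum>i\<in>I. b i)" using injk \<eta> R0 by (auto simp: I_def s_def)
      show "b i \<le> 0" "- 1 < b i" if "i \<in> I" for i using bb[of i] that by (auto simp: I_def)
      show "- 1 < s" "- 1 < b j" using bb[OF j(1)] js by auto
      show "Ck_on m UNIV (\<lambda>t. W (t - \<sigma>))" for m
        by (rule Ck_on_compose[OF open_UNIV Ck_on_diff[OF open_UNIV Ck_on_id Ck_on_const] W(1)]) simp
      show "((\<lambda>t. W (t - \<sigma>)) has_real_derivative W1 (t - \<sigma>)) (at t)" for t
        using DERIV_chain2[OF W(2)[of "t - \<sigma>"] sh] by simp
      show "((\<lambda>t. W1 (t - \<sigma>)) has_real_derivative W2 (t - \<sigma>)) (at t)" for t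
        using DERIV_chain2[OF W(3)[of "t - \<sigma>"] sh] by simp
      show "\<bar>W2 (t - \<sigma>)\<bar> \<le> (1 + \<eta>) * exp (2 * W (t - \<sigma>))" for t by (rule W(4))
      show "W1 (t - \<sigma>) = 1 + s" if "t \<le> ln R" for t using W(5)[of "t - \<sigma>"] that by (simp add: \<sigma>_def \<gamma>_def)
      show "W1 (t - \<sigma>) = - (1 + b j)" if "B + \<sigma> \<le> t" for t using W(6)[of "t - \<sigma>"] that by (simp add: \<kappa>_def)
      show "\<bar>W1 (t - \<sigma>)\<bar> \<le> L" for t by (rule W(7))
      show "(\<Sum>i\<in>I. cmod (k i)) / R \<le> \<eta>" using R1 by (simp add: C_def)
      show "2 * ((L + (1 + s)) * (\<Sum>i\<in>I. cmod (k i)) / R) \<le> ln (1 + \<eta>)" using R2 by (simp add: C_def)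
    qed
    have rep: "represents M.G n p b"
      unfolding represents_def
    proof (intro conjI ballI)
      show "smooth_metric_off (p ` {1..n}) M.G" by (rule M.smooth_G[OF P])
      fix i assume i: "i \<in> {1..n}"
      show "conic_singularity M.G (p i) (b i)"
      proof (cases "i = j")
        case True
        then show ?thesis using M.conic_Infty j(2) by simp
      next
        case False
        then have "i \<in> I" using i by (simp add: I_def)
        then show ?thesis using M.conic_Fin pk by simp
      qed
    qed
    have K: "\<bar>gauss_curvature M.G q\<bar> \<le> 1" if "q \<notin> p ` {1..n}" for q
    proof (cases q)
      case (Fin z)
      then have "z \<notin> k ` I" using that unfolding P by auto
      then show ?thesis unfolding Fin gauss_curvature.simps M.metric_coeff_G by (rule M.curvature_bound)
    next
      case Infty
      then show ?thesis using that unfolding P by simp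
    qed
    have "MinVol n p b \<le> metric_area M.G"
      unfolding MinVol_def by (rule Inf_lower) (use rep K in blast)
    also have "\<dots> \<le> ennreal ((1 + \<eta>) ^ 4 * (2 * pi)) * (\<integral>\<^sup>+t. ennreal (exp (2 * W (t - \<sigma>))) \<partial>lborel)"
      unfolding metric_area_def M.metric_coeff_G by (rule M.area_bound)
    also have "(\<integral>\<^sup>+t. ennreal (exp (2 * W (t - \<sigma>))) \<partial>lborel) = (\<integral>\<^sup>+t. ennreal (exp (2 * W t)) \<partial>lborel)"
    proof -
      have [measurable]: "W \<in> borel_measurable borel"
        by (rule borel_measurable_continuous_onI) (rule Ck_on_imp_continuous_on[OF W(1)[of 0]])
      have "(\<integral>\<^sup>+t. ennreal (exp (2 * W t)) \<partial>lborel) = (\<integral>\<^sup>+t. ennreal (exp (2 * W t)) \<partial>distr lborel borel ((+) (- \<sigma>)))"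
        by (simp only: lborel_distr_plus)
      also have "\<dots> = (\<integral>\<^sup>+t. ennreal (exp (2 * W (- \<sigma> + t))) \<partial>lborel)" by (subst nn_integral_distr) auto
      finally show ?thesis by simp
    qed
    also have "ennreal ((1 + \<eta>) ^ 4 * (2 * pi)) * (\<integral>\<^sup>+t. ennreal (exp (2 * W t)) \<partial>lborel)
        \<le> ennreal ((1 + \<eta>) ^ 4 * (2 * pi)) * ennreal (v + \<eta>)"
      by (rule mult_left_mono) (use W(8) in \<open>simp_all add: v_def\<close>)
    also have "\<dots> = ennreal ((1 + \<eta>) ^ 4 * (2 * pi) * (v + \<eta>))"
      by (rule ennreal_mult[symmetric]) (use \<eta> v0 in simp_all)
    also have "\<dots> \<le> ennreal (2 * pi * v + e)" by (rule ennreal_leI) (use \<eta> in simp)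
    also have "\<dots> = ennreal (2 * pi * v) + ennreal e" by (rule ennreal_plus) (use e v0 in simp_all)
    finally show "MinVol n p b \<le> ennreal (2 * pi * v) + ennreal e" .
  qed
  then show ?thesis unfolding veq .
qed

theorem theorem1p5:
  fixes n :: nat and p :: "nat \<Rightarrow> rsphere" and b :: "nat \<Rightarrow> real" and \<alpha> \<beta> :: real
  assumes "n \<ge> 1"
    and "inj_on p {1..n}"
    and "\<And>i. i \<in> {1..n} \<Longrightarrow> -1 < b i \<and> b i \<le> 0"
    and "mono_on {1..n} b"
    and "(critical n b \<and> n \<ge> 3) \<or> supercritical n b"
    and "\<beta> = min_order n b"
    and "\<alpha> = div_degree n b - min_order n b"
  shows "MinVol n p b =
    ennreal (2 * pi * (\<alpha> - \<beta> + sqrt (2 * (1 + \<alpha>)\<^sup>2 + 2 * (1 + \<beta>)\<^sup>2)))"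
proof -
  have "min_order n b \<in> b ` {1..n}" unfolding min_order_def by (rule Min_in) (use assms(1) in auto)
  then obtain j where j: "j \<in> {1..n}" "\<beta> = b j" using assms(6) by auto
  have \<alpha>: "\<alpha> = (\<Sum>i\<in>{1..n} - {j}. b i)"
    unfolding assms(7) assms(6)[symmetric] j(2) div_degree_def using sum.remove[OF _ j(1), of b] by simp
  \<comment> \<open>Both alternatives give \<alpha> \<ge> \<beta>, with equality in the critical
    case.\<close>
  have le: "b j \<le> (\<Sum>i\<in>{1..n} - {j}. b i)"
    using assms(5,6,7) j(2) \<alpha> by (auto simp: critical_def supercritical_def)
  have Infty_case: "MinVol n p' b = ennreal (2 * pi * (\<alpha> - \<beta> + sqrt (2 * (1 + \<alpha>)\<^sup>2 + 2 * (1 + \<beta>)\<^sup>2)))"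
    if inj': "inj_on p' {1..n}" and pj: "p' j = Infty" for p'
    unfolding \<alpha> j(2)
    by (rule order_antisym[OF MinVol_upper_bound_Infty[OF inj' assms(3) j(1) pj le] MinVol_lower_bound_Infty[OF inj' assms(3) j(1) pj]])
  show ?thesis
  proof (cases "p j")
    case Infty
    then show ?thesis using Infty_case[OF assms(2)] by simp
  next
    case (Fin a)
    \<comment> \<open>Translate the point of least order to 0, then invert.\<close>
    define p' where "p' = sphere_inv \<circ> (sphere_shift (- a) \<circ> p)"
    have "inj sphere_inv" by (rule inj_on_inverseI[where g=sphere_inv]) (rule sphere_inv_sphere_inv)
    moreover have "inj (sphere_shift (- a))"
      by (rule inj_on_inverseI[where g="sphere_shift a"]) (rule sphere_shift_sphere_shift)
    ultimately have "inj_on p' {1..n}"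
      unfolding p'_def by (intro comp_inj_on assms(2)) (auto intro: inj_on_subset)
    moreover have "p' j = Infty" by (simp add: p'_def Fin sphere_shift_def sphere_inv_def chart_infty_def)
    ultimately have "MinVol n p' b = ennreal (2 * pi * (\<alpha> - \<beta> + sqrt (2 * (1 + \<alpha>)\<^sup>2 + 2 * (1 + \<beta>)\<^sup>2)))"
      by (rule Infty_case)
    then show ?thesis unfolding p'_def MinVol_inv MinVol_shift .
  qed
qed

end
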